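(* Let $(M,g)$ be a $C^{2,1}$ pseudo-Finsler manifold for which $g$ is $C^{1,1}$. Let $N$ be a normal neighborhood of $p\in M$. The function $D^2_p\colon N\to\mathbb{R}$ defined by $$D^2_p(q):=2L(p,\exp_p^{-1}(q))=g_{\exp_p^{-1}(q)}(\exp_p^{-1}(q),\exp_p^{-1}(q))$$ is $C^{1,1}$ in $q$ and $$d D^2_p(q)=2g_{P(p,q)}(P(p,q),\cdot),$$ where $P(p,q)=\gamma'_{\exp_p^{-1}q}(1)$ is the position vector of $q$ with respect to $p$. Thus the level sets of $D^2_p$ are orthogonal to the geodesics issued from $p$, and for $t,s>0$ the $(-t)$-time flow map of the vector field $P(p,\cdot)$ is a Lipeomorphism between $(D^2_p)^{-1}(s)$ and its image on $(D^2_p)^{-1}(s\,e^{-2t})$. Finally, the equality $$g_{(d\exp_p)_v v}\big((d\exp_p)_v v,(d\exp_p)_v w\big)=g_v(v,w),\qquad v\in\exp_p^{-1}N\backslash 0,\quad w\in T_pM\sim T_v(T_pM),$$ holds at every $v$ where $\exp_p\colon\exp_p^{-1}N\to N$ is differentiable, hence for almost every $v$. Thus the usual Gauss' Lemma (the previous equality for every $v\in\exp_p^{-1}N\backslash0$ and every $w\in T_pM$) holds if the metric $g$ is $C^2$.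
   Context: $C^{k,1}$ means $C^{k,1}_{loc}$. A pseudo-Finsler manifold $(M,g)$ is an $n$-dimensional paracompact connected $C^{2,1}$ manifold endowed with a $C^{1,1}$ map $g\colon TM\backslash 0\to T^*M\otimes_M T^*M$, $(x,v)\mapsto g_{(x,v)}$ (also written $g_v$), defined on the non-vanishing vectors, with $g_{(x,v)}$ a symmetric non-degenerate bilinear form on $T_xM$ satisfying in induced charts $\frac{\partial g_{(x,v)\mu\nu}}{\partial v^\alpha}v^\nu=0$ and $\frac{\partial g_{(x,v)\mu\nu}}{\partial v^\alpha}v^\alpha=0$. The pseudo-Riemannian case is that in which $g$ does not depend on $v$. Set $L(x,v):=\frac12 g_{(x,v)}(v,v)$ for $v\ne0$, $L(x,0):=0$. Expressions such as $g_v(v,\cdot)$ are set to zero at $v=0$. The spray is $H^\mu(x,v)=-\frac12 g_v^{\mu\nu}\big(\frac{\partial g_{v\,\nu\alpha}}{\partial x^\beta}+\frac{\partial g_{v\,\nu\beta}}{\partial x^\alpha}-\frac{\partial g_{v\,\alpha\beta}}{\partial x^\nu}\big)v^\alpha v^\beta$, $H^\mu(x,0)=0$; it is locally Lipschitz. Geodesics are the non-stationary solutions of $\dot x^\mu=v^\mu$, $\dot v^\mu=H^\mu(x,v)$; $\gamma_v$ is the unique solution with $\gamma_v(0)=\pi(v)$, $\gamma_v'(0)=v$ (with $\pi\colon TM\to M$), $\Omega_p\subset T_pM$ is the set of $v\in T_pM$ for which $\gamma_v$ is defined at least on $[0,1]$, and $\exp_pv:=\gamma_v(1)$ for $v\in\Omega_p$.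 A Lipeomorphism is a homeomorphism $f$ with $f$ and $f^{-1}$ locally Lipschitz. An open neighborhood $N$ of $p$ is normal if there is an open star-shaped ($v\in N_p$, $s\in[0,1]$ imply $sv\in N_p$) set $N_p\subset\Omega_p$ such that $\exp_p\colon N_p\to N$ is a Lipeomorphism; $\exp_p^{-1}$ denotes the inverse of this map and $\exp_p^{-1}N=N_p$. A vector $v$ is orthogonal to $w$ if $g_v(v,w)=0$. Note that $D_p^2$ may be negative. *)

theory Defs
  imports "HOL-Analysis.Analysis"
begin

section \<open>Regularity classes on open subsets of Euclidean spaces\<close>

definition locally_lipschitz_on ::
    "('a::metric_space \<Rightarrow> 'b::metric_space) \<Rightarrow> 'a set \<Rightarrow> bool" where
  "locally_lipschitz_on f S \<longleftrightarrow>
     (\<forall>x\<in>S. \<exists>e>0. \<exists>K. K-lipschitz_on (ball x e \<inter> S) f)"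

text \<open>As usual in this setting, $C^{k,1}$ stands for $C^{k,1}_{loc}$.\<close>

fun Ck1_on :: "nat \<Rightarrow> ('a::real_normed_vector \<Rightarrow> 'b::real_normed_vector) \<Rightarrow> 'a set \<Rightarrow> bool" where
  "Ck1_on 0 f S \<longleftrightarrow> locally_lipschitz_on f S"
| "Ck1_on (Suc k) f S \<longleftrightarrow>
     (\<forall>x\<in>S. f differentiable (at x)) \<and>
     (\<forall>w. Ck1_on k (\<lambda>x. frechet_derivative f (at x) w) S)"

fun Ck_on :: "nat \<Rightarrow> ('a::real_normed_vector \<Rightarrow> 'b::real_normed_vector) \<Rightarrow> 'a set \<Rightarrow> bool" where
  "Ck_on 0 f S \<longleftrightarrow> continuous_on S f"
| "Ck_on (Suc k) f S \<longleftrightarrow>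
     (\<forall>x\<in>S. f differentiable (at x)) \<and>
     (\<forall>w. Ck_on k (\<lambda>x. frechet_derivative f (at x) w) S)"


section \<open>Manifolds of class $C^{2,1}$\<close>

text \<open>A chart is a domain together with a coordinate map; the values of the map outside the
  domain are irrelevant.\<close>

type_synonym ('m, 'n) chart = "'m set \<times> ('m \<Rightarrow> real ^ 'n)"

definition chart_inv :: "('m, 'n) chart \<Rightarrow> real ^ 'n \<Rightarrow> 'm" where
  "chart_inv c = inv_into (fst c) (snd c)"

text \<open>The manifold is the whole type \<open>'m\<close>. The atlas need not be maximal: everything below is
  unchanged if it is enlarged by $C^{2,1}$-compatible charts.\<close>

definition C21_atlas :: "('m::topological_space, 'n::finite) chart set \<Rightarrow> bool" where
  "C21_atlas A \<longleftrightarrow>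
     (\<Union>c\<in>A. fst c) = UNIV \<and>
     (\<forall>c\<in>A. open (fst c) \<and> open (snd c ` fst c) \<and>
        homeomorphism (fst c) (snd c ` fst c) (snd c) (chart_inv c)) \<and>
     (\<forall>c\<in>A. \<forall>d\<in>A. Ck1_on 2 (snd d \<circ> chart_inv c) (snd c ` (fst c \<inter> fst d)))"

definition paracompact_space :: "'a topology \<Rightarrow> bool" where
  "paracompact_space X \<longleftrightarrow>
     (\<forall>\<U>. (\<forall>U\<in>\<U>. openin X U) \<and> \<Union>\<U> = topspace X \<longrightarrow>
        (\<exists>\<V>. (\<forall>V\<in>\<V>. openin X V \<and> (\<exists>U\<in>\<U>. V \<subseteq> U)) \<and> \<Union>\<V> = topspace X \<and>
             locally_finite_in X \<V>))"

definition C21_manifold :: "('m::t2_space, 'n::finite) chart set \<Rightarrow> bool" where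
  "C21_manifold A \<longleftrightarrow>
     C21_atlas A \<and> paracompact_space (euclidean :: 'm topology) \<and> connected (UNIV :: 'm set)"

text \<open>Maps between (arbitrary subsets of) manifolds with atlases \<open>A\<close> and \<open>B\<close>.\<close>

definition loc_lipschitz_map :: "('a::topological_space, 'n::finite) chart set \<Rightarrow>
    ('b::topological_space, 'k::finite) chart set \<Rightarrow> 'a set \<Rightarrow> ('a \<Rightarrow> 'b) \<Rightarrow> bool" where
  "loc_lipschitz_map A B S f \<longleftrightarrow>
     continuous_on S f \<and>
     (\<forall>c\<in>A. \<forall>d\<in>B. locally_lipschitz_on (snd d \<circ> f \<circ> chart_inv c)
        (snd c ` {x \<in> S \<inter> fst c. f x \<in> fst d}))"

definition lipeomorphism :: "('a::topological_space, 'n::finite) chart set \<Rightarrow>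
    ('b::topological_space, 'k::finite) chart set \<Rightarrow> 'a set \<Rightarrow> 'b set \<Rightarrow> ('a \<Rightarrow> 'b) \<Rightarrow> bool" where
  "lipeomorphism A B S T f \<longleftrightarrow>
     (\<exists>h. homeomorphism S T f h \<and> loc_lipschitz_map A B S f \<and> loc_lipschitz_map B A T h)"


section \<open>Tangent vectors\<close>

text \<open>A tangent vector at \<open>p\<close> assigns to every chart around \<open>p\<close> its components in that chart,
  subject to the contravariant transformation law; it is extended by zero to the other charts.
  Thus \<open>v c\<close> is the vector of components of \<open>v\<close> in the chart \<open>c\<close>. For each chart \<open>c\<close> around \<open>p\<close>
  the map \<open>v \<mapsto> v c\<close> is a linear isomorphism of the tangent space onto \<open>real ^ 'n\<close>, and a
  homeomorphism for the library topology (pointwise convergence) on the function type.\<close>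

type_synonym ('m, 'n) tvec = "('m, 'n) chart \<Rightarrow> real ^ 'n"

definition tangent_space ::
    "('m, 'n::finite) chart set \<Rightarrow> 'm \<Rightarrow> ('m, 'n) tvec set" where
  "tangent_space A p =
     {v. (\<forall>c\<in>A. \<forall>d\<in>A. p \<in> fst c \<longrightarrow> p \<in> fst d \<longrightarrow>
            v d = frechet_derivative (snd d \<circ> chart_inv c) (at (snd c p)) (v c)) \<and>
         (\<forall>c. c \<notin> A \<or> p \<notin> fst c \<longrightarrow> v c = 0)}"

definition tzero :: "('m, 'n::finite) tvec" where
  "tzero = (\<lambda>c. 0)"

definition tadd :: "('m, 'n::finite) tvec \<Rightarrow> ('m, 'n) tvec \<Rightarrow> ('m, 'n) tvec" where
  "tadd v w = (\<lambda>c. v c + w c)"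

definition tscale :: "real \<Rightarrow> ('m, 'n::finite) tvec \<Rightarrow> ('m, 'n) tvec" where
  "tscale s v = (\<lambda>c. s *\<^sub>R v c)"

text \<open>The tangent vector at \<open>p\<close> whose components in the chart \<open>c\<close> are \<open>w\<close>.\<close>

definition tvec_of :: "('m, 'n::finite) chart set \<Rightarrow> ('m, 'n) chart \<Rightarrow> 'm \<Rightarrow>
    real ^ 'n \<Rightarrow> ('m, 'n) tvec" where
  "tvec_of A c p w =
     (\<lambda>d. if d \<in> A \<and> p \<in> fst d
          then frechet_derivative (snd d \<circ> chart_inv c) (at (snd c p)) w else 0)"

text \<open>The linear charts of the tangent space, regarded as a manifold.\<close>

definition tangent_atlas :: "('m, 'n::finite) chart set \<Rightarrow> 'm \<Rightarrow>
    (('m, 'n) tvec, 'n) chart set" where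
  "tangent_atlas A p = {(tangent_space A p, \<lambda>v. v c) | c. c \<in> A \<and> p \<in> fst c}"

definition has_velocity :: "('m::topological_space, 'n::finite) chart set \<Rightarrow>
    (real \<Rightarrow> 'm) \<Rightarrow> real \<Rightarrow> ('m, 'n) tvec \<Rightarrow> bool" where
  "has_velocity A \<gamma> t v \<longleftrightarrow>
     isCont \<gamma> t \<and> v \<in> tangent_space A (\<gamma> t) \<and>
     (\<forall>c\<in>A. \<gamma> t \<in> fst c \<longrightarrow> ((snd c \<circ> \<gamma>) has_vector_derivative v c) (at t))"

definition C11_scalar_on ::
    "('m, 'n::finite) chart set \<Rightarrow> 'm set \<Rightarrow> ('m \<Rightarrow> real) \<Rightarrow> bool" where
  "C11_scalar_on A N f \<longleftrightarrow> (\<forall>c\<in>A. Ck1_on 1 (f \<circ> chart_inv c) (snd c ` (N \<inter> fst c)))"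

text \<open>The real function \<open>f\<close> is differentiable at \<open>q\<close> with differential \<open>\<omega>\<close>, a covector at \<open>q\<close>.\<close>

definition has_differential_scalar :: "('m, 'n::finite) chart set \<Rightarrow> ('m \<Rightarrow> real) \<Rightarrow> 'm \<Rightarrow>
    (('m, 'n) tvec \<Rightarrow> real) \<Rightarrow> bool" where
  "has_differential_scalar A f q \<omega> \<longleftrightarrow>
     (\<forall>c\<in>A. q \<in> fst c \<longrightarrow>
        ((f \<circ> chart_inv c) has_derivative (\<lambda>w. \<omega> (tvec_of A c q w))) (at (snd c q)))"

text \<open>A map \<open>F\<close> from the tangent space at \<open>p\<close> to the manifold is differentiable at \<open>v\<close> with
  differential \<open>\<Lambda>\<close>, a linear map from the tangent space at \<open>p\<close> (identified with its own tangent
  space at \<open>v\<close>) to the tangent space at \<open>F v\<close>.\<close>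

definition has_differential_from_tangent ::
    "('m::topological_space, 'n::finite) chart set \<Rightarrow> 'm \<Rightarrow>
     (('m, 'n) tvec \<Rightarrow> 'm) \<Rightarrow> ('m, 'n) tvec \<Rightarrow> (('m, 'n) tvec \<Rightarrow> ('m, 'n) tvec) \<Rightarrow> bool" where
  "has_differential_from_tangent A p F v \<Lambda> \<longleftrightarrow>
     (F \<longlongrightarrow> F v) (at v within tangent_space A p) \<and>
     (\<forall>w\<in>tangent_space A p. \<Lambda> w \<in> tangent_space A (F v)) \<and>
     (\<forall>c\<in>A. \<forall>d\<in>A. p \<in> fst c \<longrightarrow> F v \<in> fst d \<longrightarrow>
        ((\<lambda>y. snd d (F (tvec_of A c p y))) has_derivative (\<lambda>y. \<Lambda> (tvec_of A c p y) d))
          (at (v c)))"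


section \<open>Pseudo-Finsler metrics\<close>

text \<open>\<open>g p v u w\<close> is the value of the bilinear form at \<open>(p, v)\<close> on \<open>u\<close> and \<open>w\<close>. Its values for
  \<open>v = 0\<close> carry no information.\<close>

type_synonym ('m, 'n) metric =
  "'m \<Rightarrow> ('m, 'n) tvec \<Rightarrow> ('m, 'n) tvec \<Rightarrow> ('m, 'n) tvec \<Rightarrow> real"

definition gcoord :: "('m, 'n::finite) chart set \<Rightarrow> ('m, 'n) metric \<Rightarrow> ('m, 'n) chart \<Rightarrow>
    (real ^ 'n) \<times> (real ^ 'n) \<Rightarrow> real ^ 'n ^ 'n" where
  "gcoord A g c = (\<lambda>(x, v). let q = chart_inv c x in
     (\<chi> \<mu> \<nu>. g q (tvec_of A c q v) (tvec_of A c q (axis \<mu> 1)) (tvec_of A c q (axis \<nu> 1))))"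

definition slit_domain :: "('m, 'n::finite) chart \<Rightarrow> ((real ^ 'n) \<times> (real ^ 'n)) set" where
  "slit_domain c = (snd c ` fst c) \<times> (UNIV - {0})"

text \<open>Partial derivatives of the components \<open>g\<^sub>\<mu>\<^sub>\<nu>(x, v)\<close> with respect to \<open>x\<^sup>\<alpha>\<close> and \<open>v\<^sup>\<alpha>\<close>.\<close>

definition dg_dx :: "('m, 'n::finite) chart set \<Rightarrow> ('m, 'n) metric \<Rightarrow> ('m, 'n) chart \<Rightarrow>
    (real ^ 'n) \<times> (real ^ 'n) \<Rightarrow> 'n \<Rightarrow> 'n \<Rightarrow> 'n \<Rightarrow> real" where
  "dg_dx A g c z \<mu> \<nu> \<alpha> =
     frechet_derivative (gcoord A g c) (at z) (axis \<alpha> 1, 0) $ \<mu> $ \<nu>"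

definition dg_dv :: "('m, 'n::finite) chart set \<Rightarrow> ('m, 'n) metric \<Rightarrow> ('m, 'n) chart \<Rightarrow>
    (real ^ 'n) \<times> (real ^ 'n) \<Rightarrow> 'n \<Rightarrow> 'n \<Rightarrow> 'n \<Rightarrow> real" where
  "dg_dv A g c z \<mu> \<nu> \<alpha> =
     frechet_derivative (gcoord A g c) (at z) (0, axis \<alpha> 1) $ \<mu> $ \<nu>"

definition nondegenerate_symmetric_bilinear ::
    "('m, 'n::finite) tvec set \<Rightarrow> (('m, 'n) tvec \<Rightarrow> ('m, 'n) tvec \<Rightarrow> real) \<Rightarrow> bool" where
  "nondegenerate_symmetric_bilinear T b \<longleftrightarrow>
     (\<forall>u\<in>T. \<forall>w\<in>T. b u w = b w u) \<and>
     (\<forall>u\<in>T. \<forall>u'\<in>T. \<forall>w\<in>T. b (tadd u u') w = b u w + b u' w) \<and>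
     (\<forall>s. \<forall>u\<in>T. \<forall>w\<in>T. b (tscale s u) w = s * b u w) \<and>
     (\<forall>u\<in>T. (\<forall>w\<in>T. b u w = 0) \<longrightarrow> u = tzero)"

definition pseudo_finsler_metric ::
    "('m, 'n::finite) chart set \<Rightarrow> ('m, 'n) metric \<Rightarrow> bool" where
  "pseudo_finsler_metric A g \<longleftrightarrow>
     (\<forall>p. \<forall>v\<in>tangent_space A p - {tzero}.
        nondegenerate_symmetric_bilinear (tangent_space A p) (g p v)) \<and>
     (\<forall>c\<in>A. Ck1_on 1 (gcoord A g c) (slit_domain c) \<and>
        (\<forall>(x, v)\<in>slit_domain c.
           (\<forall>\<mu> \<alpha>. (\<Sum>\<nu>\<in>UNIV. dg_dv A g c (x, v) \<mu> \<nu> \<alpha> * v $ \<nu>) = 0) \<and>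
           (\<forall>\<mu> \<nu>. (\<Sum>\<alpha>\<in>UNIV. dg_dv A g c (x, v) \<mu> \<nu> \<alpha> * v $ \<alpha>) = 0)))"

definition pseudo_finsler_manifold ::
    "('m::t2_space, 'n::finite) chart set \<Rightarrow> ('m, 'n) metric \<Rightarrow> bool" where
  "pseudo_finsler_manifold A g \<longleftrightarrow> C21_manifold A \<and> pseudo_finsler_metric A g"

text \<open>$C^2$ regularity of the components is not preserved by $C^{2,1}$ coordinate changes, so it
  can only be demanded in some chart around each point, not in every chart of a possibly maximal
  $C^{2,1}$ atlas.\<close>

definition C2_metric :: "('m, 'n::finite) chart set \<Rightarrow> ('m, 'n) metric \<Rightarrow> bool" where
  "C2_metric A g \<longleftrightarrow>
     (\<forall>q. \<exists>c\<in>A. q \<in> fst c \<and> Ck_on 2 (gcoord A g c) (slit_domain c))"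

text \<open>\<open>g\<^sub>v(u, w)\<close>, set to zero at \<open>v = 0\<close>. It is only used for expressions \<open>g\<^sub>v(v, w)\<close>.\<close>

definition gform :: "('m, 'n::finite) metric \<Rightarrow> 'm \<Rightarrow> ('m, 'n) tvec \<Rightarrow> ('m, 'n) tvec \<Rightarrow>
    ('m, 'n) tvec \<Rightarrow> real" where
  "gform g p v u w = (if v = tzero then 0 else g p v u w)"

definition lagrangian :: "('m, 'n::finite) metric \<Rightarrow> 'm \<Rightarrow> ('m, 'n) tvec \<Rightarrow> real" where
  "lagrangian g p v = (if v = tzero then 0 else 1 / 2 * g p v v v)"

definition orthogonal_to :: "('m, 'n::finite) metric \<Rightarrow> 'm \<Rightarrow> ('m, 'n) tvec \<Rightarrow>
    ('m, 'n) tvec \<Rightarrow> bool" where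
  "orthogonal_to g p v w \<longleftrightarrow> gform g p v v w = 0"


section \<open>Geodesics and the exponential map\<close>

definition spray :: "('m, 'n::finite) chart set \<Rightarrow> ('m, 'n) metric \<Rightarrow> ('m, 'n) chart \<Rightarrow>
    (real ^ 'n) \<times> (real ^ 'n) \<Rightarrow> real ^ 'n" where
  "spray A g c = (\<lambda>(x, v). if v = 0 then 0 else
     (\<chi> \<mu>. - 1 / 2 * (\<Sum>\<nu>\<in>UNIV. \<Sum>\<alpha>\<in>UNIV. \<Sum>\<beta>\<in>UNIV.
        matrix_inv (gcoord A g c (x, v)) $ \<mu> $ \<nu> *
        (dg_dx A g c (x, v) \<nu> \<alpha> \<beta> + dg_dx A g c (x, v) \<nu> \<beta> \<alpha> - dg_dx A g c (x, v) \<alpha> \<beta> \<nu>) *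
        v $ \<alpha> * v $ \<beta>)))"

text \<open>\<open>(\<gamma>, V)\<close> is a (possibly stationary) solution, on the open interval \<open>I\<close>, of the first order
  system on the tangent bundle.\<close>

definition spray_solution :: "('m::topological_space, 'n::finite) chart set \<Rightarrow>
    ('m, 'n) metric \<Rightarrow> real set \<Rightarrow> (real \<Rightarrow> 'm) \<Rightarrow> (real \<Rightarrow> ('m, 'n) tvec) \<Rightarrow> bool" where
  "spray_solution A g I \<gamma> V \<longleftrightarrow>
     open I \<and> is_interval I \<and>
     (\<forall>t\<in>I. has_velocity A \<gamma> t (V t) \<and>
        (\<forall>c\<in>A. \<gamma> t \<in> fst c \<longrightarrow>
           ((\<lambda>s. V s c) has_vector_derivative spray A g c (snd c (\<gamma> t), V t c)) (at t)))"

definition geodesic_reaches :: "('m::topological_space, 'n::finite) chart set \<Rightarrow>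
    ('m, 'n) metric \<Rightarrow> 'm \<Rightarrow> ('m, 'n) tvec \<Rightarrow> real \<Rightarrow> 'm \<times> ('m, 'n) tvec \<Rightarrow> bool" where
  "geodesic_reaches A g p v t z \<longleftrightarrow>
     (\<exists>I \<gamma> V. spray_solution A g I \<gamma> V \<and> 0 \<in> I \<and> t \<in> I \<and> \<gamma> 0 = p \<and> V 0 = v \<and> z = (\<gamma> t, V t))"

definition geodesic_defined :: "('m::topological_space, 'n::finite) chart set \<Rightarrow>
    ('m, 'n) metric \<Rightarrow> 'm \<Rightarrow> ('m, 'n) tvec \<Rightarrow> real \<Rightarrow> bool" where
  "geodesic_defined A g p v t \<longleftrightarrow> (\<exists>z. geodesic_reaches A g p v t z)"

text \<open>Position and velocity at time \<open>t\<close> of the maximal solution starting at \<open>p\<close> with velocity \<open>v\<close>;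
  they are well defined because the spray is locally Lipschitz and the manifold is Hausdorff.\<close>

definition geodesic :: "('m::topological_space, 'n::finite) chart set \<Rightarrow>
    ('m, 'n) metric \<Rightarrow> 'm \<Rightarrow> ('m, 'n) tvec \<Rightarrow> real \<Rightarrow> 'm" where
  "geodesic A g p v t = fst (THE z. geodesic_reaches A g p v t z)"

definition geodesic_velocity :: "('m::topological_space, 'n::finite) chart set \<Rightarrow>
    ('m, 'n) metric \<Rightarrow> 'm \<Rightarrow> ('m, 'n) tvec \<Rightarrow> real \<Rightarrow> ('m, 'n) tvec" where
  "geodesic_velocity A g p v t = snd (THE z. geodesic_reaches A g p v t z)"

definition exp_domain :: "('m::topological_space, 'n::finite) chart set \<Rightarrow>
    ('m, 'n) metric \<Rightarrow> 'm \<Rightarrow> ('m, 'n) tvec set" where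
  "exp_domain A g p = {v \<in> tangent_space A p. \<forall>t\<in>{0..1}. geodesic_defined A g p v t}"

definition exp_map :: "('m::topological_space, 'n::finite) chart set \<Rightarrow>
    ('m, 'n) metric \<Rightarrow> 'm \<Rightarrow> ('m, 'n) tvec \<Rightarrow> 'm" where
  "exp_map A g p v = geodesic A g p v 1"

text \<open>\<open>N\<close> is a normal neighborhood of \<open>p\<close>, with \<open>Np\<close> the corresponding star-shaped set of tangent
  vectors.\<close>

definition normal_nbhd :: "('m::topological_space, 'n::finite) chart set \<Rightarrow>
    ('m, 'n) metric \<Rightarrow> 'm \<Rightarrow> 'm set \<Rightarrow> ('m, 'n) tvec set \<Rightarrow> bool" where
  "normal_nbhd A g p N Np \<longleftrightarrow>
     open N \<and> p \<in> N \<and>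
     Np \<subseteq> exp_domain A g p \<and>
     openin (top_of_set (tangent_space A p)) Np \<and>
     (\<forall>v\<in>Np. \<forall>s\<in>{0..1}. tscale s v \<in> Np) \<and>
     lipeomorphism (tangent_atlas A p) A Np N (exp_map A g p)"

definition exp_inv :: "('m::topological_space, 'n::finite) chart set \<Rightarrow>
    ('m, 'n) metric \<Rightarrow> 'm \<Rightarrow> ('m, 'n) tvec set \<Rightarrow> 'm \<Rightarrow> ('m, 'n) tvec" where
  "exp_inv A g p Np = inv_into Np (exp_map A g p)"

definition D2 :: "('m::topological_space, 'n::finite) chart set \<Rightarrow>
    ('m, 'n) metric \<Rightarrow> 'm \<Rightarrow> ('m, 'n) tvec set \<Rightarrow> 'm \<Rightarrow> real" where
  "D2 A g p Np q = 2 * lagrangian g p (exp_inv A g p Np q)"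

definition position_vector :: "('m::topological_space, 'n::finite) chart set \<Rightarrow>
    ('m, 'n) metric \<Rightarrow> 'm \<Rightarrow> ('m, 'n) tvec set \<Rightarrow> 'm \<Rightarrow> ('m, 'n) tvec" where
  "position_vector A g p Np q = geodesic_velocity A g p (exp_inv A g p Np q) 1"


section \<open>Level sets and flows\<close>

definition level_set :: "'m set \<Rightarrow> ('m \<Rightarrow> real) \<Rightarrow> real \<Rightarrow> 'm set" where
  "level_set N f r = {q \<in> N. f q = r}"

text \<open>\<open>w\<close> is the velocity at \<open>q\<close> of a curve contained in \<open>S\<close>.\<close>

definition tangent_to_at :: "('m::topological_space, 'n::finite) chart set \<Rightarrow>
    'm set \<Rightarrow> 'm \<Rightarrow> ('m, 'n) tvec \<Rightarrow> bool" where
  "tangent_to_at A S q w \<longleftrightarrow>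
     (\<exists>\<sigma>. \<sigma> 0 = q \<and> has_velocity A \<sigma> 0 w \<and> (\<forall>\<^sub>F \<tau> in nhds 0. \<sigma> \<tau> \<in> S))"

definition flow_reaches :: "('m::topological_space, 'n::finite) chart set \<Rightarrow> 'm set \<Rightarrow>
    ('m \<Rightarrow> ('m, 'n) tvec) \<Rightarrow> real \<Rightarrow> 'm \<Rightarrow> 'm \<Rightarrow> bool" where
  "flow_reaches A N X t q q' \<longleftrightarrow>
     (\<exists>I \<sigma>. open I \<and> is_interval I \<and> 0 \<in> I \<and> t \<in> I \<and> \<sigma> 0 = q \<and> \<sigma> t = q' \<and>
        (\<forall>\<tau>\<in>I. \<sigma> \<tau> \<in> N \<and> has_velocity A \<sigma> \<tau> (X (\<sigma> \<tau>))))"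

text \<open>The time-\<open>t\<close> flow map of the vector field \<open>X\<close> on \<open>N\<close>; meaningful at those \<open>q\<close> for which exactly
  one \<open>q'\<close> satisfies \<open>flow_reaches A N X t q q'\<close>.\<close>

definition flow_map :: "('m::topological_space, 'n::finite) chart set \<Rightarrow> 'm set \<Rightarrow>
    ('m \<Rightarrow> ('m, 'n) tvec) \<Rightarrow> real \<Rightarrow> 'm \<Rightarrow> 'm" where
  "flow_map A N X t q = (THE q'. flow_reaches A N X t q q')"


section \<open>The identity in Gauss' Lemma\<close>

definition gauss_identity :: "('m::topological_space, 'n::finite) chart set \<Rightarrow>
    ('m, 'n) metric \<Rightarrow> 'm \<Rightarrow> ('m, 'n) tvec \<Rightarrow> (('m, 'n) tvec \<Rightarrow> ('m, 'n) tvec) \<Rightarrow> bool" where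
  "gauss_identity A g p v \<Lambda> \<longleftrightarrow>
     (\<forall>w\<in>tangent_space A p. g (exp_map A g p v) (\<Lambda> v) (\<Lambda> v) (\<Lambda> w) = g p v v w)"

end

theory Submission
  imports Defs
begin

text \<open>Write \<open>x\<^sub>y\<close> for the geodesic from \<open>p\<close> with initial velocity \<open>y\<close>, \<open>z\<^sub>y = (x\<^sub>y, v\<^sub>y)\<close> for its
position and velocity in a chart, \<open>L\<close> for the Lagrangian and \<open>m = g\<^sub>v v = dL/dv\<close> for the momentum.
The geodesic equation is the Euler-Lagrange equation \<open>m' = dL/dx\<close>.  Hence, for a fixed \<open>y0\<close> and a
nearby \<open>y\<close>, the pairing of the momentum of \<open>x\<^sub>y\<^sub>0\<close> with the coordinate displacement satisfies

  \<open>d/dt (m \<bullet> (x\<^sub>y - x\<^sub>y\<^sub>0)) = dL(z\<^sub>y\<^sub>0) (z\<^sub>y - z\<^sub>y\<^sub>0) = L(y) - L(y0) + O(|y - y0|^2)\<close>.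

The last step uses that \<open>L\<close> has a locally Lipschitz differential off the zero section, that \<open>z\<^sub>y\<close>
depends in a Lipschitz way on \<open>y\<close>, and that \<open>L\<close> is constant along geodesics.  Both geodesics start
at \<open>p\<close>, so integration over \<open>[0,1]\<close> gives

  \<open>m(1) \<bullet> (x\<^sub>y(1) - x\<^sub>y\<^sub>0(1)) = L(y) - L(y0) + O(|y - y0|^2)\<close>   (lemma \<open>second_order\<close>).

A geodesic may leave every chart, so the estimate is propagated along the geodesic chart by chart;
it survives a change of chart because the transition maps are \<open>C\<^sup>1\<^sup>,\<^sup>1\<close> and the momentum is a covector
(\<open>pairing_chart_change\<close>).  Now insert \<open>y = exp\<^sub>p\<^sup>-\<^sup>1(q)\<close>, which is Lipschitz in \<open>q\<close>: the estimate says
that \<open>L \<circ> exp\<^sub>p\<^sup>-\<^sup>1\<close> is differentiable with differential \<open>g\<^sub>P(P, \<sqdot>)\<close> (\<open>D_der\<close>), and this differential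
is locally Lipschitz because the position vector \<open>P\<close> is (\<open>C11\<close>).  No derivative of the exponential map
enters.  At \<open>p\<close> itself the initial velocity is 0, where the metric is undefined; there the claim holds
because \<open>L\<close> is quadratically small.

The other claims follow.  Orthogonality of level sets and geodesics comes from differentiating \<open>D\<^sup>2\<close>
along a curve in the level set (\<open>orthogonal\<close>).  In the coordinates \<open>exp\<^sub>p\<^sup>-\<^sup>1\<close> the flow of \<open>P\<close> is the
dilation \<open>y \<mapsto> e\<^sup>s y\<close>, by homogeneity of geodesics, and \<open>L\<close> is homogeneous of degree two
(\<open>flow_reaches_iff\<close>, \<open>flow_lipeomorphism\<close>, \<open>flow_level\<close>).  The Gauss identity is the derivative of
\<open>D\<^sup>2 \<circ> exp\<^sub>p = 2 L\<close> at a point of differentiability, because \<open>(d exp\<^sub>p)\<^sub>v v = P\<close> (\<open>gauss\<close>).  The exponential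
map is locally Lipschitz, so Rademacher's theorem supplies almost every point (\<open>ae_gauss\<close>).  If the
metric is \<open>C\<^sup>2\<close>, the spray is \<open>C\<^sup>1\<close> off the zero section and solutions are differentiable in the
initial velocity at every non-zero vector (\<open>C2_differentiable\<close>).\<close>

section \<open>Rademacher's theorem\<close>

text \<open>Here \<open>h\<close> is the inverse of \<open>g\<close>, so the preimage under \<open>h\<close> is the image \<open>g(E)\<close>.  Around each point of
\<open>E\<close> there are arbitrarily short intervals that \<open>g\<close> stretches at most by the factor \<open>p\<close>; by Vitali's
theorem disjoint ones among them exhaust \<open>E\<close> up to a null set, and \<open>g\<close> maps null sets to null sets.\<close>

lemma emeasure_vimage_le_slope:
  fixes g h :: "real \<Rightarrow> real"
  assumes gh: "\<And>y. g (h y) = y" "\<And>x. h (g x) = x"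
    and mono: "strict_mono g"
    and lip: "C-lipschitz_on UNIV g" and lip': "C'-lipschitz_on UNIV h"
    and E: "E \<in> sets borel" and fin: "emeasure lborel E < \<infinity>"
    and p: "0 \<le> p"
    and small: "\<And>x d. x \<in> E \<Longrightarrow> 0 < d \<Longrightarrow>
       \<exists>a b. a \<le> x \<and> x \<le> b \<and> a < b \<and> b - a < d \<and> g b - g a \<le> p * (b - a)"
  shows "emeasure lborel (h -` E) \<le> ennreal p * emeasure lborel E"
proof (rule ennreal_le_epsilon)
  fix e :: real assume e: "0 < e"
  have hcont: "continuous_on UNIV h" using lipschitz_on_continuous_on[OF lip'] .
  have hmeas[measurable]: "h \<in> borel_measurable borel"
    using hcont by (rule borel_measurable_continuous_onI)
  have hle: "x \<le> h y \<longleftrightarrow> g x \<le> y" for x y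
    using strict_mono_less_eq[OF mono] gh by metis
  have hge: "h y \<le> x \<longleftrightarrow> y \<le> g x" for x y
    using strict_mono_less_eq[OF mono] gh by metis
  have vim: "h -` {a..b} = {g a..g b}" for a b by (auto simp: hle hge)
  define e' where "e' = e / (p + 1)"
  have e': "0 < e'" using e p by (auto simp: e'_def)
  obtain T where T: "open T" "E \<subseteq> T" "emeasure lborel (T - E) < e'"
    using outer_regular_lborel[OF E e'] .
  have emT: "emeasure lborel T \<le> emeasure lborel E + ennreal e'"
  proof -
    have "emeasure lborel T = emeasure lborel E + emeasure lborel (T - E)"
      using T E by (subst plus_emeasure) (auto simp: Un_absorb1 Un_Diff_cancel)
    also have "\<dots> \<le> emeasure lborel E + ennreal e'"
      using T(3) by (intro add_mono) auto
    finally show ?thesis .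
  qed
  define K where "K = {(a, b). a < b \<and> {a..b} \<subseteq> T \<and> g b - g a \<le> p * (b - a)}"
  define c where "c = (\<lambda>(a, b). (a + b) / 2 :: real)"
  define r where "r = (\<lambda>(a, b). (b - a) / 2 :: real)"
  have cb: "cball (c i) (r i) = {fst i..snd i}" for i
    by (cases i) (auto simp: c_def r_def dist_real_def abs_if field_simps split: if_splits)
  obtain I where I: "countable I" "I \<subseteq> K"
     "pairwise (\<lambda>i j. disjnt (cball (c i) (r i)) (cball (c j) (r j))) I"
     "negligible (E - (\<Union>i \<in> I. cball (c i) (r i)))"
  proof (rule Vitali_covering_theorem_cballs[of K r E c])
    show "0 < r i" if "i \<in> K" for i using that by (auto simp: K_def r_def)
    fix x d :: real assume x: "x \<in> E" and d: "0 < d"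
    obtain \<rho> where \<rho>: "0 < \<rho>" "ball x \<rho> \<subseteq> T" using T x by (meson open_contains_ball subsetD)
    obtain a b where ab: "a \<le> x" "x \<le> b" "a < b" "b - a < min \<rho> d" "g b - g a \<le> p * (b - a)"
      using small[OF x, of "min \<rho> d"] \<rho> d by auto
    have "{a..b} \<subseteq> ball x \<rho>" using ab by (auto simp: dist_real_def)
    then have "(a, b) \<in> K" using ab \<rho> by (auto simp: K_def)
    moreover have "r (a, b) < d" using ab by (auto simp: r_def)
    moreover have "x \<in> cball (c (a, b)) (r (a, b))" using ab by (auto simp: cb)
    ultimately show "\<exists>i. i \<in> K \<and> x \<in> cball (c i) (r i) \<and> r i < d" by blast
  qed
  define X where "X = (\<lambda>i::real\<times>real. {fst i..snd i})"
  have XU: "(\<Union>i \<in> I. cball (c i) (r i)) = \<Union> (X ` I)" by (simp add: cb X_def)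
  have dX: "disjoint_family_on X I"
    using I(3) by (auto simp: disjoint_family_on_def pairwise_def disjnt_def cb X_def)
  have Xs: "X i \<in> sets lborel" for i by (auto simp: X_def)
  define Z where "Z = E - \<Union> (X ` I)"
  have Zs[measurable]: "Z \<in> sets borel"
    unfolding Z_def using E I(1) Xs by (auto intro!: sets.Diff sets.countable_UN')
  have nZ: "negligible Z" using I(4) by (simp add: XU Z_def)
  have "h -` Z = g ` Z" using gh by (auto simp: image_iff) metis
  moreover have "negligible (g ` Z)"
  proof (rule negligible_locally_Lipschitz_image[OF order_refl nZ])
    fix x assume "x \<in> Z"
    show "\<exists>T B. open T \<and> x \<in> T \<and> (\<forall>y\<in>Z \<inter> T. norm (g y - g x) \<le> B * norm (y - x))"
      using lipschitz_on_normD[OF lip] by (intro exI[of _ UNIV] exI[of _ C]) auto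
  qed
  ultimately have nhZ: "negligible (h -` Z)" by simp
  have hs: "h -` S \<in> sets lborel" if "S \<in> sets borel" for S
    using measurable_sets[OF hmeas that] by simp
  have hZ0: "emeasure lborel (h -` Z) = 0"
    using nhZ hs[OF Zs] by (simp add: negligible_iff_null_sets null_sets_def)
  have sub: "h -` E \<subseteq> h -` Z \<union> (\<Union>i\<in>I. h -` X i)" by (auto simp: Z_def)
  have "emeasure lborel (h -` E) \<le> emeasure lborel (h -` Z \<union> (\<Union>i\<in>I. h -` X i))"
    using hs[OF Zs] I(1) hs Xs
    by (intro emeasure_mono[OF sub] sets.Un sets.countable_UN') auto
  also have "\<dots> \<le> emeasure lborel (h -` Z) + emeasure lborel (\<Union>i\<in>I. h -` X i)"
    using hs[OF Zs] I(1) hs Xs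
    by (intro emeasure_subadditive sets.countable_UN') auto
  also have "\<dots> = emeasure lborel (\<Union>i\<in>I. h -` X i)" by (simp add: hZ0)
  also have "\<dots> = (\<integral>\<^sup>+i. emeasure lborel (h -` X i) \<partial>count_space I)"
  proof (intro emeasure_UN_countable)
    show "disjoint_family_on (\<lambda>i. h -` X i) I"
      using dX unfolding disjoint_family_on_def by blast
  qed (use hs Xs I(1) in auto)
  also have "\<dots> \<le> (\<integral>\<^sup>+i. ennreal p * emeasure lborel (X i) \<partial>count_space I)"
  proof (rule nn_integral_mono)
    fix i assume "i \<in> space (count_space I)"
    then have "i \<in> K" using I(2) by auto
    then obtain a b where i: "i = (a, b)" "a < b" "g b - g a \<le> p * (b - a)" by (auto simp: K_def)
    have "g a \<le> g b" using strict_mono_less_eq[OF mono] i by simp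
    then have "emeasure lborel (h -` X i) = ennreal (g b - g a)"
      using i by (simp add: X_def vim)
    also have "\<dots> \<le> ennreal (p * (b - a))" using i by (intro ennreal_leI) auto
    also have "\<dots> = ennreal p * emeasure lborel (X i)"
      using i p by (simp add: X_def ennreal_mult)
    finally show "emeasure lborel (h -` X i) \<le> ennreal p * emeasure lborel (X i)" .
  qed
  also have "\<dots> = ennreal p * (\<integral>\<^sup>+i. emeasure lborel (X i) \<partial>count_space I)"
    by (rule nn_integral_cmult) auto
  also have "(\<integral>\<^sup>+i. emeasure lborel (X i) \<partial>count_space I) = emeasure lborel (\<Union> (X ` I))"
    using dX Xs I(1) by (intro emeasure_UN_countable[symmetric]) auto
  also have "ennreal p * \<dots> \<le> ennreal p * (emeasure lborel E + ennreal e')"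
  proof (intro mult_left_mono order_trans[OF _ emT] emeasure_mono)
    have "X i \<subseteq> T" if i: "i \<in> I" for i
    proof -
      obtain a b where "i = (a, b)" "{a..b} \<subseteq> T" using I(2) i by (auto simp: K_def)
      then show ?thesis by (simp add: X_def)
    qed
    then show "\<Union> (X ` I) \<subseteq> T" by blast
  qed (use T in auto)
  also have "\<dots> = ennreal p * emeasure lborel E + ennreal (p * e')"
    using p e' by (simp add: distrib_left ennreal_mult)
  also have "\<dots> \<le> ennreal p * emeasure lborel E + ennreal e"
  proof -
    have "p * e' \<le> e" using p e by (simp add: e'_def field_simps)
    then show ?thesis by (intro add_left_mono ennreal_leI)
  qed
  finally show "emeasure lborel (h -` E) \<le> ennreal p * emeasure lborel E + ennreal e" .
qed

text \<open>The points where the difference quotients oscillate across \<open>[p, q]\<close> as the step tends to 0.\<close>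

definition osc_set :: "(real \<Rightarrow> 'a \<Rightarrow> real) \<Rightarrow> real \<Rightarrow> real \<Rightarrow> 'a set" where
  "osc_set k p q = {x. (\<exists>\<^sub>F h in at 0. k h x < p) \<and> (\<exists>\<^sub>F h in at 0. k h x > q)}"

text \<open>Continuity in the point makes the condition open for each single step, so the union over all steps below a
given bound is open, and only the bound has to run through a sequence.\<close>

lemma osc_set_borel:
  fixes k :: "real \<Rightarrow> 'a::topological_space \<Rightarrow> real"
  assumes "\<And>h. h \<noteq> 0 \<Longrightarrow> continuous_on UNIV (k h)"
  shows "osc_set k p q \<in> sets borel"
proof -
  have op: "open {x. k h x < p}" "open {x. q < k h x}" if "h \<noteq> 0" for h
    using assms[OF that] by (auto intro!: open_Collect_less continuous_intros)
  have eq: "(\<exists>\<^sub>F h in at (0::real). P h) \<longleftrightarrow> (\<forall>n::nat. \<exists>h. h \<noteq> 0 \<and> \<bar>h\<bar> < inverse (Suc n) \<and> P h)"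
    (is "_ \<longleftrightarrow> ?R") for P
  proof
    assume "\<exists>\<^sub>F h in at (0::real). P h"
    then show ?R unfolding frequently_at by (auto simp: dist_real_def)
  next
    assume R: ?R
    show "\<exists>\<^sub>F h in at (0::real). P h" unfolding frequently_at
    proof (intro allI impI)
      fix d :: real assume "0 < d"
      then obtain n where "inverse (Suc n) < d" using reals_Archimedean by blast
      then show "\<exists>x\<in>UNIV. x \<noteq> 0 \<and> dist x 0 < d \<and> P x"
        using R by (auto simp: dist_real_def) (meson less_trans)
    qed
  qed
  have "osc_set k p q = (\<Inter>n::nat. \<Union>h\<in>{h. h \<noteq> 0 \<and> \<bar>h\<bar> < inverse (Suc n)}. {x. k h x < p}) \<inter>
     (\<Inter>n::nat. \<Union>h\<in>{h. h \<noteq> 0 \<and> \<bar>h\<bar> < inverse (Suc n)}. {x. q < k h x})"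
    unfolding osc_set_def eq by auto
  moreover have "open (\<Union>h\<in>{h. h \<noteq> 0 \<and> \<bar>h\<bar> < inverse (Suc n)}. {x. k h x < p})"
     "open (\<Union>h\<in>{h. h \<noteq> 0 \<and> \<bar>h\<bar> < inverse (Suc n)}. {x. q < k h x})" for n :: nat
    using op by (auto intro!: open_UN)
  ultimately show ?thesis by (auto intro!: sets.Int sets.countable_INT' borel_open)
qed

text \<open>A bounded function has a cluster value at 0; if it did not converge to that value, it would cross a
rational interval infinitely often.\<close>

lemma no_osc_imp_lim:
  fixes k :: "real \<Rightarrow> real"
  assumes bd: "\<And>h. h \<noteq> 0 \<Longrightarrow> \<bar>k h\<bar> \<le> L"
    and no: "\<And>p q. p \<in> \<rat> \<Longrightarrow> q \<in> \<rat> \<Longrightarrow> p < q \<Longrightarrow>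
       \<not> ((\<exists>\<^sub>F h in at 0. k h < p) \<and> (\<exists>\<^sub>F h in at 0. k h > q))"
  shows "\<exists>l. (k \<longlongrightarrow> l) (at 0)"
proof -
  define s where "s = (\<lambda>n. k (inverse (Suc n)))"
  have "s n \<in> {-L..L}" for n using bd[of "inverse (Suc n)"] by (auto simp: s_def)
  then obtain l r where r: "strict_mono r" "(s \<circ> r) \<longlonglongrightarrow> l"
    using compact_Icc[of "-L" L] unfolding compact_def by metis
  have fr: "\<exists>\<^sub>F h in at 0. P (k h)" if "eventually P (nhds l)" for P
  proof -
    have "\<forall>\<^sub>F n in sequentially. P ((s \<circ> r) n)"
      by (rule eventually_compose_filterlim[OF that r(2)])
    then have ev: "\<forall>\<^sub>F n in sequentially. P (k (inverse (Suc (r n))))" by (simp add: s_def o_def)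
    have f: "filterlim (\<lambda>n. inverse (real (Suc (r n)))) (at 0) sequentially"
    proof -
      have "(\<lambda>n. inverse (real (Suc (r n)))) \<longlonglongrightarrow> 0"
        using LIMSEQ_subseq_LIMSEQ[OF LIMSEQ_inverse_real_of_nat r(1)] by (simp add: o_def)
      then show ?thesis by (auto simp: filterlim_at)
    qed
    show ?thesis
    proof (rule ccontr)
      assume "\<not> ?thesis"
      then have "\<forall>\<^sub>F h in at 0. \<not> P (k h)" by (simp add: not_frequently)
      then have "\<forall>\<^sub>F n in sequentially. \<not> P (k (inverse (Suc (r n))))"
        using f by (rule eventually_compose_filterlim)
      with ev have "\<forall>\<^sub>F n in sequentially. False" by eventually_elim simp
      then show False by simp
    qed
  qed
  have "(k \<longlongrightarrow> l) (at 0)"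
  proof (rule ccontr)
    assume "\<not> ?thesis"
    then obtain e where e: "0 < e" "\<not> (\<forall>\<^sub>F h in at 0. dist (k h) l < e)" by (auto simp: tendsto_iff)
    then have "\<exists>\<^sub>F h in at 0. k h > l + e / 2 \<or> k h < l - e / 2"
      by (auto simp: not_eventually elim!: frequently_elim1)
         (auto simp: dist_real_def abs_if split: if_splits)
    then consider "\<exists>\<^sub>F h in at 0. k h > l + e / 2" | "\<exists>\<^sub>F h in at 0. k h < l - e / 2"
      by (auto simp: frequently_disj_iff)
    then show False
    proof cases
      case 1
      obtain q where q: "q \<in> \<rat>" "l < q" "q < l + e / 2" using Rats_dense_in_real[of l "l + e/2"] e by auto
      obtain p where p: "p \<in> \<rat>" "l < p" "p < q" using Rats_dense_in_real[of l q] q by auto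
      have "\<exists>\<^sub>F h in at 0. k h < p" using p by (intro fr) (auto intro!: order_tendstoD(2)[OF tendsto_ident_at] simp: eventually_nhds intro: exI[of _ "{..<p}"])
      moreover have "\<exists>\<^sub>F h in at 0. k h > q" using 1 q by (auto elim!: frequently_elim1)
      ultimately show False using no p q by blast
    next
      case 2
      obtain p where p: "p \<in> \<rat>" "l - e / 2 < p" "p < l" using Rats_dense_in_real[of "l - e/2" l] e by auto
      obtain q where q: "q \<in> \<rat>" "p < q" "q < l" using Rats_dense_in_real[of p l] p by auto
      have "\<exists>\<^sub>F h in at 0. k h > q" using q by (intro fr) (auto simp: eventually_nhds intro: exI[of _ "{q<..}"])
      moreover have "\<exists>\<^sub>F h in at 0. k h < p" using 2 p by (auto elim!: frequently_elim1)
      ultimately show False using no p q by blast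
    qed
  qed
  then show ?thesis ..
qed

abbreviation dq :: "('a::real_vector \<Rightarrow> real) \<Rightarrow> 'a \<Rightarrow> real \<Rightarrow> 'a \<Rightarrow> real" where
  "dq f u h x \<equiv> (f (x + h *\<^sub>R u) - f x) / h"

lemma dq_bound:
  assumes "L-lipschitz_on UNIV f"
  shows "\<bar>dq f u h x\<bar> \<le> L * norm u"
proof -
  have "\<bar>f (x + h *\<^sub>R u) - f x\<bar> \<le> L * (\<bar>h\<bar> * norm u)"
    using lipschitz_onD[OF assms, of "x + h *\<^sub>R u" x] by (simp add: dist_norm)
  then show ?thesis using lipschitz_on_nonneg[OF assms] by (cases "h = 0") (simp_all add: field_simps)
qed

text \<open>Together with the Lipschitz bound on \<open>g\<close> that is available where this is used, the lower bound on
slopes makes \<open>g\<close> a bi-Lipschitz bijection of the line.\<close>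

lemma bilipschitz_inverse:
  fixes g :: "real \<Rightarrow> real"
  assumes cont: "continuous_on UNIV g" and exp: "\<And>x y. x \<le> y \<Longrightarrow> y - x \<le> g y - g x"
  shows "\<exists>h. (\<forall>y. g (h y) = y) \<and> (\<forall>x. h (g x) = x) \<and> 1-lipschitz_on UNIV h \<and> strict_mono h \<and> strict_mono g"
proof -
  have sm: "strict_mono g" unfolding strict_mono_def
  proof (intro allI impI)
    fix x y :: real assume "x < y" then show "g x < g y" using exp[of x y] by linarith
  qed
  have surj: "\<exists>x. g x = y" for y
  proof -
    define R where "R = \<bar>y - g 0\<bar>"
    have "g (-R) \<le> y" using exp[of "-R" 0] by (auto simp: R_def)
    moreover have "y \<le> g R" using exp[of 0 R] by (auto simp: R_def)
    moreover have "-R \<le> R" by (simp add: R_def)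
    ultimately show ?thesis using IVT'[of g "-R" y R] continuous_on_subset[OF cont] by auto
  qed
  then obtain h where h: "\<And>y. g (h y) = y" by metis
  have hg: "h (g x) = x" for x using h[of "g x"] sm by (metis strict_mono_eq)
  have lt: "h x < h y \<longleftrightarrow> x < y" for x y using strict_mono_less[OF sm, of "h x" "h y"] h by simp
  have "\<bar>h x - h y\<bar> \<le> \<bar>x - y\<bar>" for x y
    using exp[of "h x" "h y"] exp[of "h y" "h x"] h by (cases "h x \<le> h y") auto
  then have "1-lipschitz_on UNIV h" by (auto simp: lipschitz_on_def dist_real_def)
  moreover have "strict_mono h" using lt by (simp add: strict_mono_def)
  ultimately show ?thesis using h hg sm by blast
qed

lemma frequently_at_0D:
  assumes "\<exists>\<^sub>F h in at (0::real). P h" "0 < d"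
  obtains h where "h \<noteq> 0" "\<bar>h\<bar> < d" "P h"
  using assms unfolding frequently_at by (auto simp: dist_real_def)

text \<open>Lebesgue's argument for monotone functions, applied to \<open>g(x) = f(x) + (L + 1) x\<close>, whose slopes are all
at least 1.  On a bounded part \<open>E\<close> of the oscillation set \<open>g\<close> has short intervals of slope at most
\<open>P\<close> and short intervals of slope at least \<open>Q > P\<close>.  The slope lemma for \<open>g\<close> gives \<open>|g(E)| \<le> P |E|\<close>,
and for the inverse of \<open>g\<close> it gives \<open>|E| \<le> |g(E)| / Q\<close>; hence \<open>|E| \<le> (P / Q) |E|\<close>.\<close>

lemma null_osc_real:
  fixes f :: "real \<Rightarrow> real"
  assumes lip: "L-lipschitz_on UNIV f" and pq: "p < q"
  shows "emeasure lborel (osc_set (dq f 1) p q) = 0"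
proof -
  define E where "E = (\<lambda>n::nat. osc_set (dq f 1) p q \<inter> {-real n..real n})"
  have L: "0 \<le> L" using lip by (rule lipschitz_on_nonneg)
  have lipb: "\<bar>f y - f x\<bar> \<le> L * \<bar>y - x\<bar>" for x y
    using lipschitz_onD[OF lip, of y x] by (simp add: dist_real_def)
  have fc: "continuous_on UNIV f" using lipschitz_on_continuous_on[OF lip] .
  have osc: "osc_set (dq f 1) p q \<in> sets borel"
    by (rule osc_set_borel) (auto intro!: continuous_intros continuous_on_compose2[OF fc])
  define g where "g = (\<lambda>x. f x + (L + 1) * x)"
  have gexp: "y - x \<le> g y - g x" if "x \<le> y" for x y
    using lipb[of y x] that by (auto simp: g_def abs_if algebra_simps split: if_splits)
  have gc: "continuous_on UNIV g" unfolding g_def by (intro continuous_intros fc)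
  have glip: "(2 * L + 1)-lipschitz_on UNIV g"
  proof (rule lipschitz_onI)
    fix x y :: real
    have "\<bar>g x - g y\<bar> = \<bar>(f x - f y) + (L + 1) * (x - y)\<bar>" by (simp add: g_def algebra_simps)
    also have "\<dots> \<le> \<bar>f x - f y\<bar> + \<bar>(L + 1) * (x - y)\<bar>" by (rule abs_triangle_ineq)
    also have "\<dots> \<le> L * \<bar>x - y\<bar> + (L + 1) * \<bar>x - y\<bar>" using lipb[of x y] L by (simp add: abs_mult)
    finally show "dist (g x) (g y) \<le> (2 * L + 1) * dist x y"
      by (simp add: dist_real_def algebra_simps)
  qed (use L in simp)
  obtain h where h: "\<And>y. g (h y) = y" "\<And>x. h (g x) = x" "1-lipschitz_on UNIV h"
     "strict_mono h" "strict_mono g" using bilipschitz_inverse[OF gc gexp] by blast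
  have hm: "h \<in> borel_measurable borel"
    using lipschitz_on_continuous_on[OF h(3)] by (rule borel_measurable_continuous_onI)
  have "emeasure lborel (E n) = 0" for n
  proof (cases "E n = {}")
    case False
    define P where "P = p + L + 1"
    define Q where "Q = q + L + 1"
    have slope: "\<exists>a b. a \<le> x \<and> x \<le> b \<and> a < b \<and> b - a < d \<and> g b - g a = (k + L + 1) * (b - a)"
      if "e \<noteq> 0" "\<bar>e\<bar> < d" "dq f 1 e x = k" for x e d k
    proof -
      have gk: "g (x + e) - g x = (k + L + 1) * e" using that by (auto simp: g_def field_simps)
      show ?thesis
      proof (cases "0 < e")
        case True
        then show ?thesis using gk that by (intro exI[of _ x] exI[of _ "x + e"]) auto
      next
        case False
        then show ?thesis using gk that by (intro exI[of _ "x + e"] exI[of _ x]) (auto simp: algebra_simps)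
      qed
    qed
    have lo: "\<exists>a b. a \<le> x \<and> x \<le> b \<and> a < b \<and> b - a < d \<and> g b - g a \<le> P * (b - a)"
      if x: "x \<in> E n" and d: "0 < d" for x d
    proof -
      obtain e where e: "e \<noteq> 0" "\<bar>e\<bar> < d" "dq f 1 e x < p"
        using x d by (auto simp: E_def osc_set_def elim: frequently_at_0D)
      obtain a b where ab: "a \<le> x" "x \<le> b" "a < b" "b - a < d" "g b - g a = (dq f 1 e x + L + 1) * (b - a)"
        using slope[OF e(1,2) refl] by blast
      have "(dq f 1 e x + L + 1) * (b - a) \<le> P * (b - a)"
        using e ab by (intro mult_right_mono) (auto simp: P_def)
      then show ?thesis using ab by metis
    qed
    have hi: "\<exists>a b. a \<le> x \<and> x \<le> b \<and> a < b \<and> b - a < d \<and> Q * (b - a) \<le> g b - g a"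
      if x: "x \<in> E n" and d: "0 < d" for x d
    proof -
      obtain e where e: "e \<noteq> 0" "\<bar>e\<bar> < d" "dq f 1 e x > q"
        using x d by (auto simp: E_def osc_set_def elim: frequently_at_0D)
      obtain a b where ab: "a \<le> x" "x \<le> b" "a < b" "b - a < d" "g b - g a = (dq f 1 e x + L + 1) * (b - a)"
        using slope[OF e(1,2) refl] by blast
      have "Q * (b - a) \<le> (dq f 1 e x + L + 1) * (b - a)"
        using e ab by (intro mult_right_mono) (auto simp: Q_def)
      then show ?thesis using ab by metis
    qed
    obtain x0 where "x0 \<in> E n" using False by auto
    then obtain a b where ab: "a < b" "g b - g a \<le> P * (b - a)" using lo[of x0 1] by auto
    then have "b - a \<le> P * (b - a)" using gexp[of a b] by (meson less_imp_le order_trans)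
    then have "0 \<le> (P - 1) * (b - a)" by (simp add: algebra_simps)
    then have P1: "1 \<le> P" using ab by (simp add: zero_le_mult_iff)
    have PQ: "P < Q" using pq by (simp add: P_def Q_def)
    have Es: "E n \<in> sets borel" using osc by (auto simp: E_def)
    have Ef: "emeasure lborel (E n) < \<infinity>"
    proof -
      have "emeasure lborel (E n) \<le> emeasure lborel {-real n..real n}"
        by (intro emeasure_mono) (auto simp: E_def)
      also have "\<dots> < \<infinity>" by simp
      finally show ?thesis .
    qed
    have 1: "emeasure lborel (h -` E n) \<le> ennreal P * emeasure lborel (E n)"
      using P1 by (intro emeasure_vimage_le_slope[OF h(1,2,5) glip h(3) Es Ef _ lo]) auto
    have Fs: "h -` E n \<in> sets borel" using measurable_sets[OF hm Es] by simp
    have Ff: "emeasure lborel (h -` E n) < \<infinity>"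
      using 1 Ef by (auto intro: order_le_less_trans simp: ennreal_mult_less_top)
    have "emeasure lborel (g -` (h -` E n)) \<le> ennreal (1 / Q) * emeasure lborel (h -` E n)"
    proof (intro emeasure_vimage_le_slope[OF h(2,1,4,3) glip Fs Ff])
      fix y d :: real assume y: "y \<in> h -` E n" and d: "0 < d"
      obtain a b where ab: "a \<le> h y" "h y \<le> b" "a < b" "b - a < d / (2 * L + 1)" "Q * (b - a) \<le> g b - g a"
        using hi[of "h y" "d / (2 * L + 1)"] y d L by auto
      have "g b - g a \<le> (2 * L + 1) * (b - a)"
        using lipschitz_onD[OF glip, of b a] ab by (simp add: dist_real_def)
      also have "\<dots> < d" using ab(4) L by (simp add: field_simps)
      finally have "g b - g a < d" .
      moreover have "g a \<le> y" "y \<le> g b" "g a < g b"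
        using strict_mono_less_eq[OF h(5)] strict_mono_less[OF h(5)] ab h(1) by metis+
      moreover have "h (g b) - h (g a) \<le> 1 / Q * (g b - g a)"
        using ab P1 PQ h(2) by (simp add: field_simps)
      ultimately show "\<exists>a b. a \<le> y \<and> y \<le> b \<and> a < b \<and> b - a < d \<and> h b - h a \<le> 1 / Q * (b - a)"
        by blast
    qed (use P1 PQ in auto)
    also have "g -` (h -` E n) = E n" using h(2) by auto
    also have "ennreal (1 / Q) * emeasure lborel (h -` E n) \<le> ennreal (1 / Q) * (ennreal P * emeasure lborel (E n))"
      using 1 by (intro mult_left_mono) auto
    also have "\<dots> = ennreal (P / Q) * emeasure lborel (E n)"
      using P1 PQ by (simp add: ennreal_mult[symmetric] mult.assoc[symmetric])
    finally have le: "emeasure lborel (E n) \<le> ennreal (P / Q) * emeasure lborel (E n)" .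
    obtain m where m: "emeasure lborel (E n) = ennreal m" "0 \<le> m" using Ef by (cases "emeasure lborel (E n)") auto
    have "m \<le> P / Q * m" using le m P1 PQ by (simp add: ennreal_mult[symmetric])
    then have "m * (Q - P) \<le> 0" using P1 PQ by (simp add: field_simps)
    then have "m \<le> 0" using PQ by (simp add: mult_le_0_iff)
    then show ?thesis using m by simp
  qed simp
  then have "emeasure lborel (\<Union>n. E n) = 0"
    using osc by (intro emeasure_UN_eq_0) (auto simp: E_def)
  moreover have "(\<Union>n. E n) = osc_set (dq f 1) p q"
  proof -
    have "\<exists>n. x \<in> {-real n..real n}" for x :: real
      using real_arch_simple[of "\<bar>x\<bar>"] by (auto simp: abs_le_iff)
         (metis abs_le_iff minus_le_iff)
    then show ?thesis by (auto simp: E_def)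
  qed
  ultimately show ?thesis by simp
qed

text \<open>On every line in direction \<open>u\<close> the oscillation sets are null by the one-dimensional case.  Averaging the
translates of the oscillation set along \<open>u\<close> and exchanging the integrals turns this into a statement
about the whole space; this replaces a choice of coordinates adapted to \<open>u\<close>.\<close>

lemma AE_directional_derivative:
  fixes f :: "'a::euclidean_space \<Rightarrow> real"
  assumes lip: "L-lipschitz_on UNIV f"
  shows "AE x in lborel. \<exists>l. ((\<lambda>h. dq f u h x) \<longlongrightarrow> l) (at 0)"
proof -
  have L: "0 \<le> L" using lip by (rule lipschitz_on_nonneg)
  have fc: "continuous_on UNIV f" using lipschitz_on_continuous_on[OF lip] .
  have osc[measurable]: "osc_set (dq f u) p q \<in> sets borel" for p q
    by (rule osc_set_borel) (auto intro!: continuous_intros continuous_on_compose2[OF fc])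
  have null: "osc_set (dq f u) p q \<in> null_sets lborel" if pq: "p < q" for p q
  proof -
    let ?B = "osc_set (dq f u) p q"
    have line: "emeasure lborel {t. x + t *\<^sub>R u \<in> ?B} = 0" for x
    proof -
      define \<phi> where "\<phi> = (\<lambda>t. f (x + t *\<^sub>R u))"
      have "(L * norm u)-lipschitz_on UNIV \<phi>"
      proof (rule lipschitz_onI)
        fix s t :: real
        have "dist (\<phi> s) (\<phi> t) \<le> L * dist (x + s *\<^sub>R u) (x + t *\<^sub>R u)"
          unfolding \<phi>_def by (rule lipschitz_onD[OF lip]) auto
        also have "\<dots> = L * norm u * dist s t"
          by (simp add: dist_norm scaleR_diff_left[symmetric])
        finally show "dist (\<phi> s) (\<phi> t) \<le> L * norm u * dist s t" .
      qed (use L in simp)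
      from null_osc_real[OF this pq] have "emeasure lborel (osc_set (dq \<phi> 1) p q) = 0" .
      moreover have "osc_set (dq \<phi> 1) p q = {t. x + t *\<^sub>R u \<in> ?B}"
        by (auto simp: osc_set_def \<phi>_def algebra_simps)
      ultimately show ?thesis by simp
    qed
    have "emeasure lborel ?B = (\<integral>\<^sup>+t. indicator {0..1::real} t * emeasure lborel ?B \<partial>lborel)"
      by (simp add: nn_integral_multc)
    also have "\<dots> = (\<integral>\<^sup>+t. indicator {0..1::real} t * (\<integral>\<^sup>+x. indicator ?B (x + t *\<^sub>R u) \<partial>lborel) \<partial>lborel)"
    proof (intro nn_integral_cong)
      fix t :: real
      have "emeasure lborel ?B = (\<integral>\<^sup>+x. indicator ?B x \<partial>distr lborel borel ((+) (t *\<^sub>R u)))"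
        by (simp add: lborel_distr_plus)
      also have "\<dots> = (\<integral>\<^sup>+x. indicator ?B (x + t *\<^sub>R u) \<partial>lborel)"
        by (subst nn_integral_distr) (auto simp: add.commute)
      finally show "indicator {0..1} t * emeasure lborel ?B =
        indicator {0..1} t * (\<integral>\<^sup>+x. indicator ?B (x + t *\<^sub>R u) \<partial>lborel)" by simp
    qed
    also have "\<dots> = (\<integral>\<^sup>+t. (\<integral>\<^sup>+x. indicator {0..1::real} t * indicator ?B (x + t *\<^sub>R u) \<partial>lborel) \<partial>lborel)"
      by (intro nn_integral_cong nn_integral_cmult[symmetric]) measurable
    also have "\<dots> = (\<integral>\<^sup>+x. (\<integral>\<^sup>+t. indicator {0..1::real} t * indicator ?B (x + t *\<^sub>R u) \<partial>lborel) \<partial>lborel)"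
      by (rule lborel_pair.Fubini') measurable
    also have "\<dots> \<le> (\<integral>\<^sup>+(x::'a). 0 \<partial>lborel)"
    proof (intro nn_integral_mono)
      fix x
      have m: "{t. x + t *\<^sub>R u \<in> ?B} \<in> sets lborel" by measurable
      have "(\<integral>\<^sup>+t. indicator {0..1::real} t * indicator ?B (x + t *\<^sub>R u) \<partial>lborel)
        \<le> (\<integral>\<^sup>+t. indicator {t. x + t *\<^sub>R u \<in> ?B} t \<partial>lborel)"
        by (intro nn_integral_mono) (auto split: split_indicator)
      also have "\<dots> = 0" using line[of x] m by simp
      finally show "(\<integral>\<^sup>+t. indicator {0..1::real} t * indicator ?B (x + t *\<^sub>R u) \<partial>lborel) \<le> 0" .
    qed
    finally show ?thesis using osc by (auto simp: null_sets_def)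
  qed
  have "AE x in lborel. \<forall>pq\<in>{(p, q). p \<in> \<rat> \<and> q \<in> \<rat> \<and> p < q}. x \<notin> osc_set (dq f u) (fst pq) (snd pq)"
  proof (subst AE_ball_countable)
    show "countable {(p, q). p \<in> \<rat> \<and> q \<in> \<rat> \<and> p < (q::real)}"
      by (rule countable_subset[OF _ countable_SIGMA[OF countable_rat, of "\<lambda>_. \<rat>"]]) (auto simp: countable_rat)
  qed (use null in \<open>auto intro!: AE_not_in\<close>)
  then show ?thesis
  proof eventually_elim
    case (elim x)
    show ?case
      using elim dq_bound[OF lip] by (intro no_osc_imp_lim[where L="L * norm u"]) (auto simp: osc_set_def)
  qed
qed

text \<open>The limit is taken along a sequence to make measurability in the point immediate.\<close>

definition dird :: "('a::real_vector \<Rightarrow> real) \<Rightarrow> 'a \<Rightarrow> 'a \<Rightarrow> real" where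
  "dird f u x = lim (\<lambda>n. dq f u (inverse (Suc n)) x)"

lemma LIMSEQ_dird:
  assumes "((\<lambda>h. dq f u h x) \<longlongrightarrow> l) (at 0)"
  shows "(\<lambda>n. dq f u (inverse (Suc n)) x) \<longlonglongrightarrow> l" "dird f u x = l"
proof -
  have "filterlim (\<lambda>n. inverse (real (Suc n))) (at 0) sequentially"
    using LIMSEQ_inverse_real_of_nat by (auto simp: filterlim_at)
  from filterlim_compose[OF assms this]
  show 1: "(\<lambda>n. dq f u (inverse (Suc n)) x) \<longlonglongrightarrow> l" .
  show "dird f u x = l" unfolding dird_def by (rule limI[OF 1])
qed

lemma lborel_translate:
  fixes F :: "'a::euclidean_space \<Rightarrow> real"
  assumes [measurable]: "F \<in> borel_measurable borel"
  shows "integrable lborel (\<lambda>x. F (x + c)) \<longleftrightarrow> integrable lborel F"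
    and "(\<integral>x. F (x + c) \<partial>lborel) = (\<integral>x. F x \<partial>lborel)"
proof -
  have "integrable lborel F \<longleftrightarrow> integrable (distr lborel borel ((+) c)) F"
    by (simp add: lborel_distr_plus)
  also have "\<dots> \<longleftrightarrow> integrable lborel (\<lambda>x. F (x + c))"
    by (subst integrable_distr_eq) (auto simp: add.commute)
  finally show "integrable lborel (\<lambda>x. F (x + c)) \<longleftrightarrow> integrable lborel F" ..
  have "(\<integral>x. F x \<partial>lborel) = (\<integral>x. F x \<partial>(distr lborel borel ((+) c)))"
    by (simp add: lborel_distr_plus)
  also have "\<dots> = (\<integral>x. F (x + c) \<partial>lborel)"
    by (subst integral_distr) (auto simp: add.commute)
  finally show "(\<integral>x. F (x + c) \<partial>lborel) = (\<integral>x. F x \<partial>lborel)" ..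
qed

text \<open>The difference has integral 0, so its absolute value integrates to twice its positive part.  The
positive part tends to 0 pointwise because the complement of \<open>K\<close> is open.\<close>

lemma LIMSEQ_indicator_translate:
  fixes K :: "'a::euclidean_space set" and a :: "nat \<Rightarrow> 'a"
  assumes K: "compact K" and a: "a \<longlonglongrightarrow> 0"
  shows "(\<lambda>n. \<integral>x. \<bar>indicator K (x + a n) - indicator K x\<bar> \<partial>lborel) \<longlonglongrightarrow> (0::real)"
proof -
  have Km[measurable]: "K \<in> sets borel" using K by (simp add: compact_imp_closed borel_closed)
  have fin: "emeasure lborel K < \<infinity>" using emeasure_bounded_finite[OF compact_imp_bounded[OF K]] .
  have int: "integrable lborel (\<lambda>x. indicator K x :: real)" using fin by simp
  have tr: "integrable lborel (\<lambda>x. indicator K (x + c) :: real)"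
       "(\<integral>x. indicator K (x + c) \<partial>lborel) = (\<integral>x. indicator K x \<partial>lborel :: real)" for c
    using lborel_translate[of "indicator K" c] int by auto
  define s where "s = (\<lambda>n x. indicator K (x + a n) - indicator K x :: real)"
  have si: "integrable lborel (s n)" "(\<integral>x. s n x \<partial>lborel) = 0" for n
    using tr[of "a n"] int by (simp_all add: s_def)
  obtain R where R: "\<And>x. x \<in> K \<Longrightarrow> norm x \<le> R" using compact_imp_bounded[OF K] by (auto simp: bounded_iff)
  obtain S where S: "\<And>n. norm (a n) \<le> S" using convergent_imp_Bseq[of a] a by (auto simp: Bseq_def convergent_def)
  have lim: "(\<lambda>n. \<integral>x. max 0 (s n x) \<partial>lborel) \<longlonglongrightarrow> (\<integral>(x::'a). 0 \<partial>lborel)"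
  proof (rule integral_dominated_convergence[where w="\<lambda>x. indicator (cball (0::'a) (R + S)) x"])
    show "integrable lborel (\<lambda>x. indicator (cball (0::'a) (R + S)) x :: real)"
      using emeasure_bounded_finite[OF bounded_cball, of "0::'a" "R + S"]
      by (intro integrable_real_indicator) auto
    show "AE x in lborel. (\<lambda>n. max 0 (s n x)) \<longlonglongrightarrow> 0"
    proof (rule AE_I2)
      fix x :: 'a
      show "(\<lambda>n. max 0 (s n x)) \<longlonglongrightarrow> 0"
      proof (cases "x \<in> K")
        case True
        then have "max 0 (s n x) = 0" for n by (auto simp: s_def split: split_indicator)
        then show ?thesis by simp
      next
        case False
        have "(\<lambda>n. x + a n) \<longlonglongrightarrow> x" using a by (auto intro!: tendsto_eq_intros)
        moreover have "open (- K)" using K by (simp add: compact_imp_closed open_Compl)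
        ultimately have "\<forall>\<^sub>F n in sequentially. x + a n \<in> - K" using False by (auto dest: topological_tendstoD)
        then have "\<forall>\<^sub>F n in sequentially. max 0 (s n x) = 0"
          by eventually_elim (use False in \<open>auto simp: s_def\<close>)
        then show ?thesis by (rule tendsto_eventually)
      qed
    qed
    show "AE x in lborel. norm (max 0 (s n x)) \<le> indicator (cball (0::'a) (R + S)) x" for n
    proof (rule AE_I2)
      fix x :: 'a
      have "x + a n \<in> K \<Longrightarrow> norm x \<le> R + S"
        using R[of "x + a n"] S[of n] norm_triangle_ineq4[of "x + a n" "a n"] by simp
      then show "norm (max 0 (s n x)) \<le> indicator (cball (0::'a) (R + S)) x"
        by (auto simp: s_def split: split_indicator)
    qed
  qed (auto simp: s_def)
  have "(\<integral>x. \<bar>s n x\<bar> \<partial>lborel) = 2 * (\<integral>x. max 0 (s n x) \<partial>lborel)" for n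
  proof -
    have mi: "integrable lborel (\<lambda>x. max 0 (s n x))" using si(1)[of n] by auto
    have "(\<integral>x. \<bar>s n x\<bar> \<partial>lborel) = (\<integral>x. 2 * max 0 (s n x) - s n x \<partial>lborel)"
      by (intro Bochner_Integration.integral_cong) (auto simp: max_def)
    also have "\<dots> = 2 * (\<integral>x. max 0 (s n x) \<partial>lborel)" using mi si[of n] by simp
    finally show ?thesis .
  qed
  with tendsto_mult[OF tendsto_const[of 2] lim] show ?thesis by (simp add: s_def)
qed

text \<open>The defect of additivity \<open>D\<close> is the limit of \<open>w\<^sub>n(x + e\<^sub>n u) - w\<^sub>n(x)\<close>, where \<open>w\<^sub>n\<close> is the difference
quotient in direction \<open>v\<close>: the defect is a translation difference of uniformly bounded functions.  Over
a compact set its integral is moved to the indicator function by translation invariance and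
vanishes in the limit.  Inner regularity then shows that \<open>D\<close> is neither positive nor negative on a set
of positive measure.\<close>

lemma AE_dird_add:
  fixes f :: "'a::euclidean_space \<Rightarrow> real"
  assumes lip: "L-lipschitz_on UNIV f"
  shows "AE x in lborel. dird f (u + v) x = dird f u x + dird f v x"
proof -
  have L: "0 \<le> L" using lip by (rule lipschitz_on_nonneg)
  have fc: "continuous_on UNIV f" using lipschitz_on_continuous_on[OF lip] .
  have dqm[measurable]: "(\<lambda>x. dq f w h x) \<in> borel_measurable borel" for w h
    by (intro borel_measurable_continuous_onI)
       (cases "h = 0"; auto intro!: continuous_intros continuous_on_compose2[OF fc])
  have dm[measurable]: "dird f w \<in> borel_measurable borel" for w
    unfolding dird_def by (intro borel_measurable_lim_metric dqm)
  define D where "D = (\<lambda>x. dird f (u + v) x - dird f u x - dird f v x)"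
  have Dm[measurable]: "D \<in> borel_measurable borel" unfolding D_def by measurable
  define e where "e = (\<lambda>n. inverse (real (Suc n)))"
  define k where "k = (\<lambda>n x. dq f (u + v) (e n) x - dq f u (e n) x - dq f v (e n) x)"
  define w where "w = (\<lambda>n x. dq f v (e n) x)"
  have km[measurable]: "k n \<in> borel_measurable borel" and wm[measurable]: "w n \<in> borel_measurable borel" for n
    unfolding k_def w_def by measurable
  define M where "M = L * norm v"
  have wb: "\<bar>w n x\<bar> \<le> M" for n x unfolding w_def M_def by (rule dq_bound[OF lip])
  have kw: "k n x = w n (x + e n *\<^sub>R u) - w n x" for n x
    by (simp add: k_def w_def diff_divide_distrib add.assoc scaleR_add_right)
  have e0: "e \<longlonglongrightarrow> 0" unfolding e_def by (rule LIMSEQ_inverse_real_of_nat)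
  have klim: "AE x in lborel. (\<lambda>n. k n x) \<longlonglongrightarrow> D x"
    using AE_directional_derivative[OF lip, of "u + v"] AE_directional_derivative[OF lip, of u]
      AE_directional_derivative[OF lip, of v]
  proof eventually_elim
    case (elim x)
    then obtain a b c where abc: "((\<lambda>h. dq f (u + v) h x) \<longlongrightarrow> a) (at 0)"
      "((\<lambda>h. dq f u h x) \<longlongrightarrow> b) (at 0)" "((\<lambda>h. dq f v h x) \<longlongrightarrow> c) (at 0)" by blast
    have "(\<lambda>n. k n x) \<longlonglongrightarrow> a - b - c"
      unfolding k_def e_def by (intro tendsto_diff LIMSEQ_dird(1) abc)
    then show ?case using LIMSEQ_dird(2)[OF abc(1)] LIMSEQ_dird(2)[OF abc(2)] LIMSEQ_dird(2)[OF abc(3)]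
      by (simp add: D_def)
  qed
  have intK: "integrable lborel (\<lambda>x. indicator K x * D x) \<and> (\<integral>x. indicator K x * D x \<partial>lborel) = 0"
    if K: "compact K" for K
  proof -
    have Km[measurable]: "K \<in> sets borel" using K by (simp add: compact_imp_closed borel_closed)
    have fin: "emeasure lborel K < \<infinity>" using emeasure_bounded_finite[OF compact_imp_bounded[OF K]] .
    have int: "integrable lborel (\<lambda>x. indicator K x :: real)" using fin by simp
    have intt: "integrable lborel (\<lambda>x. indicator K (x + c) :: real)" for c
      using lborel_translate(1)[of "indicator K" c] int by simp
    have iw: "integrable lborel (\<lambda>x. indicator K (x + c) * w n x)" for c n
      by (rule Bochner_Integration.integrable_bound[OF integrable_mult_left[OF intt[of c], of M]])
         (use wb[of n] in \<open>auto split: split_indicator intro!: order_trans[OF wb]\<close>)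
    note dct = integrable_dominated_convergence[where s="\<lambda>n x. indicator K x * k n x" and f="\<lambda>x. indicator K x * D x"
        and w="\<lambda>x. indicator K x * (2 * M)" and M=lborel]
      and dct2 = integral_dominated_convergence[where s="\<lambda>n x. indicator K x * k n x" and f="\<lambda>x. indicator K x * D x"
        and w="\<lambda>x. indicator K x * (2 * M)" and M=lborel]
    have kb: "AE x in lborel. norm (indicator K x * k n x) \<le> indicator K x * (2 * M)" for n
    proof (rule AE_I2)
      fix x show "norm (indicator K x * k n x) \<le> indicator K x * (2 * M)"
        using wb[of n x] wb[of n "x + e n *\<^sub>R u"] by (auto simp: kw split: split_indicator)
    qed
    have kl: "AE x in lborel. (\<lambda>n. indicator K x * k n x) \<longlonglongrightarrow> indicator K x * D x"
      using klim by eventually_elim (intro tendsto_mult tendsto_const)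
    have iM: "integrable lborel (\<lambda>x. indicator K x * (2 * M))" using int by simp
    have iD: "integrable lborel (\<lambda>x. indicator K x * D x)"
      by (rule dct[OF _ _ iM kl kb]) measurable
    have lim: "(\<lambda>n. \<integral>x. indicator K x * k n x \<partial>lborel) \<longlonglongrightarrow> (\<integral>x. indicator K x * D x \<partial>lborel)"
      by (rule dct2[OF _ _ iM kl kb]) measurable
    have le: "norm (\<integral>x. indicator K x * k n x \<partial>lborel)
       \<le> M * (\<integral>x. \<bar>indicator K (x + - (e n *\<^sub>R u)) - indicator K x\<bar> \<partial>lborel)" for n
    proof -
      define c where "c = - (e n *\<^sub>R u)"
      let ?F = "\<lambda>x. indicator K (x + c) * w n x"
      have Fm: "?F \<in> borel_measurable borel" by measurable
      have F: "?F (x + e n *\<^sub>R u) = indicator K x * w n (x + e n *\<^sub>R u)" for x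
        by (simp add: c_def)
      have iF: "integrable lborel (\<lambda>x. indicator K x * w n (x + e n *\<^sub>R u))"
        using lborel_translate(1)[OF Fm, of "e n *\<^sub>R u"] iw[of c n] by (simp only: F)
      have iw0: "integrable lborel (\<lambda>x. indicator K x * w n x)" using iw[of 0 n] by simp
      have "(\<integral>x. indicator K x * k n x \<partial>lborel) =
         (\<integral>x. indicator K x * w n (x + e n *\<^sub>R u) - indicator K x * w n x \<partial>lborel)"
        by (simp add: kw right_diff_distrib)
      also have "\<dots> = (\<integral>x. ?F (x + e n *\<^sub>R u) \<partial>lborel) - (\<integral>x. indicator K x * w n x \<partial>lborel)"
        using iF iw0 by (simp only: F Bochner_Integration.integral_diff)
      also have "(\<integral>x. ?F (x + e n *\<^sub>R u) \<partial>lborel) = (\<integral>x. ?F x \<partial>lborel)"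
        by (rule lborel_translate(2)[OF Fm])
      also have "\<dots> - (\<integral>x. indicator K x * w n x \<partial>lborel) =
         (\<integral>x. (indicator K (x + c) - indicator K x) * w n x \<partial>lborel)"
        using iw[of c n] iw0 by (simp add: left_diff_distrib)
      finally have "\<bar>\<integral>x. indicator K x * k n x \<partial>lborel\<bar> =
         norm (\<integral>x. (indicator K (x + c) - indicator K x) * w n x \<partial>lborel)" by simp
      also have "\<dots> \<le> (\<integral>x. M * \<bar>indicator K (x + c) - indicator K x\<bar> \<partial>lborel)"
      proof (rule Bochner_Integration.integral_norm_bound_integral)
        show "integrable lborel (\<lambda>x. (indicator K (x + c) - indicator K x) * w n x)"
          using iw[of c n] iw0 by (simp add: left_diff_distrib)
        show "integrable lborel (\<lambda>x. M * \<bar>indicator K (x + c) - indicator K x\<bar>)"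
          using intt[of c] int by (intro integrable_mult_right integrable_abs Bochner_Integration.integrable_diff)
        fix x :: 'a
        define i :: real where "i = indicator K (x + c) - indicator K x"
        have "norm (i * w n x) \<le> M * \<bar>i\<bar>"
          using mult_left_mono[OF wb[of n x], of "\<bar>i\<bar>"] by (simp add: abs_mult mult.commute[of M])
        then show "norm ((indicator K (x + c) - indicator K x) * w n x) \<le> M * \<bar>indicator K (x + c) - indicator K x\<bar>"
          by (simp only: i_def)
      qed
      finally show ?thesis unfolding c_def real_norm_def by (simp only: integral_mult_right_zero)
    qed
    have "(\<lambda>n. M * (\<integral>x. \<bar>indicator K (x + - (e n *\<^sub>R u)) - indicator K x\<bar> \<partial>lborel)) \<longlonglongrightarrow> M * 0"
    proof (intro tendsto_mult tendsto_const LIMSEQ_indicator_translate[OF K])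
      have "(\<lambda>n. - (e n *\<^sub>R u)) \<longlonglongrightarrow> - (0 *\<^sub>R u)" by (intro tendsto_intros e0)
      then show "(\<lambda>n. - (e n *\<^sub>R u)) \<longlonglongrightarrow> 0" by simp
    qed
    then have "(\<lambda>n. M * (\<integral>x. \<bar>indicator K (x + - (e n *\<^sub>R u)) - indicator K x\<bar> \<partial>lborel)) \<longlonglongrightarrow> 0"
      by (simp only: mult_zero_right)
    then have "(\<lambda>n. \<integral>x. indicator K x * k n x \<partial>lborel) \<longlonglongrightarrow> 0"
      by (rule Lim_null_comparison[OF always_eventually[OF allI[OF le]]])
    then have "(\<integral>x. indicator K x * D x \<partial>lborel) = 0" by (rule LIMSEQ_unique[OF lim])
    then show ?thesis using iD by simp
  qed
  \<comment> \<open>The signs \<open>s = 1\<close> and \<open>s = -1\<close> treat the two parts of \<open>{x. D x \<noteq> 0}\<close> at once.\<close>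
  have pos: "negligible {x. 0 < s * D x}" if s: "s \<noteq> 0" for s :: real
  proof -
    have "{x. 0 < s * D x} \<in> sets borel" by measurable
    then have "{x. 0 < s * D x} \<in> sets lebesgue" by simp
    then obtain Z C where C: "negligible Z" "\<And>n::nat. compact (C n)" "{x. 0 < s * D x} = (\<Union>n. C n) \<union> Z"
      using lebesgue_regular_inner by metis
    have "negligible (C n)" for n
    proof -
      have Cm[measurable]: "C n \<in> sets borel" using C(2) by (simp add: compact_imp_closed borel_closed)
      have Cp: "0 < s * D x" if "x \<in> C n" for x using C(3) that by blast
      have nn: "0 \<le> s * (indicator (C n) x * D x)" for x
        using Cp[of x] by (auto split: split_indicator)
      have "(\<integral>x. s * (indicator (C n) x * D x) \<partial>lborel) = 0" using intK[OF C(2), of n] by simp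
      then have "AE x in lborel. s * (indicator (C n) x * D x) = 0"
        using integral_nonneg_eq_0_iff_AE[of lborel "\<lambda>x. s * (indicator (C n) x * D x)"] intK[OF C(2), of n] nn by auto
      then have "AE x in lborel. x \<notin> C n"
      proof eventually_elim
        case (elim x)
        then show ?case using Cp[of x] by (auto split: split_indicator_asm)
      qed
      then have "C n \<in> null_sets lborel" using Cm by (simp add: AE_iff_null_sets)
      then show ?thesis by (simp add: negligible_iff_null_sets null_sets_completionI)
    qed
    then show ?thesis unfolding C(3) using C(1) by (intro negligible_Un negligible_countable_Union) auto
  qed
  have "negligible ({x. 0 < 1 * D x} \<union> {x. 0 < (-1) * D x})"
    using pos[of 1] pos[of "-1"] by (intro negligible_Un) auto
  moreover have "{x. 0 < 1 * D x} \<union> {x. 0 < (-1) * D x} = {x. D x \<noteq> 0}" by auto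
  ultimately have "{x. D x \<noteq> 0} \<in> null_sets lebesgue" by (simp add: negligible_iff_null_sets)
  then have "AE x in lebesgue. D x = 0" by (auto dest: AE_not_in)
  then have "AE x in lborel. D x = 0" by (simp add: AE_completion_iff)
  then show ?thesis by eventually_elim (simp add: D_def)
qed

lemma dird_scale:
  assumes "((\<lambda>h. dq f u h x) \<longlongrightarrow> l) (at 0)"
  shows "((\<lambda>h. dq f (r *\<^sub>R u) h x) \<longlongrightarrow> r * l) (at 0)"
proof (cases "r = 0")
  case False
  have "((\<lambda>h. r * h) \<longlongrightarrow> 0) (at 0)" by (auto intro!: tendsto_eq_intros)
  then have "filterlim (\<lambda>h. r * h) (at 0) (at 0)"
    using False by (auto simp: filterlim_at eventually_at intro!: exI[of _ 1])
  from tendsto_mult[OF tendsto_const[of r] filterlim_compose[OF assms this]] show ?thesis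
    using False by (simp add: mult.commute)
qed simp

lemma AE_dird_sum:
  fixes f :: "'a::euclidean_space \<Rightarrow> real"
  assumes lip: "L-lipschitz_on UNIV f" and B: "finite B"
  shows "AE x in lborel. dird f (\<Sum>b\<in>B. r b *\<^sub>R b) x = (\<Sum>b\<in>B. r b * dird f b x)"
  using B
proof induction
  case empty
  show ?case by (auto simp: dird_def)
next
  case (insert b B)
  show ?case
    using insert.IH AE_dird_add[OF lip, of "r b *\<^sub>R b" "\<Sum>b\<in>B. r b *\<^sub>R b"] AE_directional_derivative[OF lip, of b]
  proof eventually_elim
    case (elim x)
    then obtain l where l: "((\<lambda>h. dq f b h x) \<longlongrightarrow> l) (at 0)" by blast
    have "dird f (r b *\<^sub>R b) x = r b * dird f b x"
      using LIMSEQ_dird(2)[OF l] LIMSEQ_dird(2)[OF dird_scale[OF l, of "r b"]] by simp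
    then show ?case using elim insert.hyps by simp
  qed
qed

text \<open>At almost every point all directional derivatives along a countable dense set of directions exist and
depend linearly on the direction.  The Lipschitz bound makes the convergence uniform over the compact
unit sphere, which is differentiability.\<close>

theorem rademacher_real:
  fixes f :: "'a::euclidean_space \<Rightarrow> real"
  assumes lip: "L-lipschitz_on UNIV f"
  shows "AE x in lborel. f differentiable (at x)"
proof -
  have L: "0 \<le> L" using lip by (rule lipschitz_on_nonneg)
  obtain D :: "'a set" where D: "countable D" "D \<subseteq> UNIV" "(UNIV :: 'a set) \<subseteq> closure D"
    by (rule separable)
  have der: "AE x in lborel. ((\<lambda>h. dq f u h x) \<longlongrightarrow> (\<Sum>b\<in>Basis. (u \<bullet> b) * dird f b x)) (at 0)" for u
    using AE_dird_sum[OF lip finite_Basis, of "\<lambda>b. u \<bullet> b"] AE_directional_derivative[OF lip, of u]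
  proof eventually_elim
    case (elim x)
    from elim(2) obtain l where l: "((\<lambda>h. dq f u h x) \<longlongrightarrow> l) (at 0)" ..
    have "dird f u x = (\<Sum>b\<in>Basis. (u \<bullet> b) * dird f b x)"
      using elim(1) by (simp only: euclidean_representation)
    then show ?case using l LIMSEQ_dird(2)[OF l] by (simp only:)
  qed
  have "AE x in lborel. \<forall>u\<in>D. ((\<lambda>h. dq f u h x) \<longlongrightarrow> (\<Sum>b\<in>Basis. (u \<bullet> b) * dird f b x)) (at 0)"
    by (rule iffD2[OF AE_ball_countable[OF D(1)]]) (rule ballI, rule der)
  then show ?thesis
  proof eventually_elim
    case (elim x)
    define A where "A = (\<lambda>w. \<Sum>b\<in>Basis. (w \<bullet> b) * dird f b x)"
    have A: "bounded_linear A" unfolding A_def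
      by (intro bounded_linear_sum bounded_linear_mult_const bounded_linear_inner_left)
    obtain N where N: "0 < N" "\<And>w. norm (A w) \<le> norm w * N" using bounded_linear.pos_bounded[OF A] by blast
    have "(f has_derivative A) (at x)" unfolding has_derivative_at_alt
    proof (intro conjI A allI impI)
      fix e :: real assume e: "0 < e"
      define \<eta> where "\<eta> = e / (2 * (L + N))"
      have \<eta>: "0 < \<eta>" "(L + N) * \<eta> = e / 2" using e N L by (auto simp: \<eta>_def field_simps)
      have "sphere 0 1 \<subseteq> (\<Union>u\<in>D. ball u \<eta>)"
      proof
        fix w :: 'a
        have "w \<in> closure D" using D(3) by blast
        then obtain d where "d \<in> D" "dist d w < \<eta>" using \<eta>(1) closure_approachable[of w D] by blast
        then show "w \<in> (\<Union>u\<in>D. ball u \<eta>)" by auto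
      qed
      then obtain D0 where D0: "D0 \<subseteq> D" "finite D0" "sphere 0 1 \<subseteq> (\<Union>u\<in>D0. ball u \<eta>)"
        using compactE_image[OF compact_sphere, of D "\<lambda>u. ball u \<eta>" 0 1] by (metis open_ball)
      have "\<forall>\<^sub>F h in at 0. dist (dq f u h x) (A u) < e / 2" if "u \<in> D0" for u
      proof -
        have "((\<lambda>h. dq f u h x) \<longlongrightarrow> A u) (at 0)" using elim D0(1) that by (auto simp: A_def)
        from tendstoD[OF this, of "e / 2"] show ?thesis using e by simp
      qed
      then have "\<forall>\<^sub>F h in at 0. \<forall>u\<in>D0. dist (dq f u h x) (A u) < e / 2"
        using D0(2) by (simp add: eventually_ball_finite)
      then obtain d where d: "0 < d" "\<And>h u. h \<noteq> 0 \<Longrightarrow> \<bar>h\<bar> < d \<Longrightarrow> u \<in> D0 \<Longrightarrow> dist (dq f u h x) (A u) < e / 2"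
        unfolding eventually_at by (auto simp: dist_real_def)
      show "\<exists>d>0. \<forall>y. norm (y - x) < d \<longrightarrow> norm (f y - f x - A (y - x)) \<le> e * norm (y - x)"
      proof (intro exI[of _ d] conjI allI impI d(1))
        fix y assume y: "norm (y - x) < d"
        show "norm (f y - f x - A (y - x)) \<le> e * norm (y - x)"
        proof (cases "y = x")
          case True
          then show ?thesis using linear_0[OF bounded_linear.linear[OF A]] by simp
        next
          case False
          define h where "h = norm (y - x)"
          have h: "0 < h" "h < d" using False y by (auto simp: h_def)
          define w where "w = (1 / h) *\<^sub>R (y - x)"
          have w: "norm w = 1" "y = x + h *\<^sub>R w" using h by (auto simp: w_def h_def)
          then obtain u where u: "u \<in> D0" "norm (u - w) < \<eta>" using D0(3) by (force simp: dist_norm)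
          have 1: "\<bar>f y - f (x + h *\<^sub>R u)\<bar> \<le> L * (h * \<eta>)"
          proof -
            have "\<bar>f y - f (x + h *\<^sub>R u)\<bar> \<le> L * norm (y - (x + h *\<^sub>R u))"
              using lipschitz_onD[OF lip, of y "x + h *\<^sub>R u"] by (simp add: dist_norm)
            also have "y - (x + h *\<^sub>R u) = - (h *\<^sub>R (u - w))" using w by (simp add: algebra_simps)
            also have "norm \<dots> = h * norm (u - w)" using h by simp
            also have "L * \<dots> \<le> L * (h * \<eta>)" using u h L by (intro mult_left_mono) auto
            finally show ?thesis .
          qed
          have 2: "\<bar>f (x + h *\<^sub>R u) - f x - h * A u\<bar> \<le> h * (e / 2)"
          proof -
            have "\<bar>dq f u h x - A u\<bar> < e / 2" using d(2)[of h u] h u by (simp add: dist_real_def)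
            then have "h * \<bar>dq f u h x - A u\<bar> \<le> h * (e / 2)" using h by (intro mult_left_mono) auto
            also have "h * \<bar>dq f u h x - A u\<bar> = \<bar>h * (dq f u h x - A u)\<bar>" using h by (simp add: abs_mult)
            also have "h * (dq f u h x - A u) = f (x + h *\<^sub>R u) - f x - h * A u"
              using h by (simp add: field_simps)
            finally show ?thesis .
          qed
          have 3: "\<bar>h * A u - A (y - x)\<bar> \<le> h * (\<eta> * N)"
          proof -
            have "h * A u - A (y - x) = A (h *\<^sub>R (u - w))"
              using w linear_cmul[OF bounded_linear.linear[OF A]] linear_diff[OF bounded_linear.linear[OF A]]
              by (simp add: right_diff_distrib scaleR_diff_right)
            moreover have "norm (A (h *\<^sub>R (u - w))) \<le> h * norm (u - w) * N" using N(2)[of "h *\<^sub>R (u - w)"] h by simp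
            moreover have "\<dots> \<le> h * \<eta> * N" using u h N \<eta>(1) by (intro mult_mono) auto
            ultimately show ?thesis by simp
          qed
          have "\<bar>f y - f x - A (y - x)\<bar> \<le> L * (h * \<eta>) + h * (e / 2) + h * (\<eta> * N)"
            using 1 2 3 by linarith
          also have "\<dots> = h * ((L + N) * \<eta>) + h * (e / 2)" by (simp add: algebra_simps)
          also have "\<dots> = e * h" by (simp add: \<eta>(2))
          finally show ?thesis by (simp add: h_def)
        qed
      qed
    qed
    then show ?case by (auto simp: differentiable_def)
  qed
qed

text \<open>Near a point the map is extended to the whole space without losing the Lipschitz constant by composing
with the nearest-point projection onto a small closed ball.\<close>

theorem rademacher_local:
  fixes f :: "'a::euclidean_space \<Rightarrow> 'b::euclidean_space"
  assumes U: "open U" and lip: "\<And>x. x \<in> U \<Longrightarrow> \<exists>r>0. \<exists>K. K-lipschitz_on (ball x r \<inter> U) f"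
  shows "negligible {x \<in> U. \<not> f differentiable (at x)}" (is "negligible ?S")
proof (subst locally_negligible_alt, intro ballI)
  fix x assume "x \<in> ?S"
  then have x: "x \<in> U" by simp
  obtain r K where r: "0 < r" "K-lipschitz_on (ball x r \<inter> U) f" using lip[OF x] by blast
  obtain s where s: "0 < s" "cball x s \<subseteq> U" using U x by (meson open_contains_cball)
  define t where "t = min (r / 2) s"
  have t: "0 < t" "cball x t \<subseteq> ball x r \<inter> U" using r s by (auto simp: t_def)
  define F where "F = f \<circ> closest_point (cball x t)"
  have lF: "K-lipschitz_on UNIV F"
  proof (rule lipschitz_onI)
    show K: "0 \<le> K" using r(2) by (rule lipschitz_on_nonneg)
    fix y z
    have c: "closest_point (cball x t) w \<in> cball x t" for w using t by (intro closest_point_in_set) auto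
    have "dist (F y) (F z) \<le> K * dist (closest_point (cball x t) y) (closest_point (cball x t) z)"
      unfolding F_def o_def by (rule lipschitz_onD[OF r(2)]) (use c t in blast)+
    also have "\<dots> \<le> K * dist y z" using t K by (intro mult_left_mono closest_point_lipschitz) auto
    finally show "dist (F y) (F z) \<le> K * dist y z" .
  qed
  have "AE y in lborel. (\<lambda>y. F y \<bullet> i) differentiable (at y)" for i
  proof (rule rademacher_real)
    show "(K * norm i)-lipschitz_on UNIV (\<lambda>y. F y \<bullet> i)"
    proof (rule lipschitz_onI)
      fix y z
      have "\<bar>(F y - F z) \<bullet> i\<bar> \<le> norm (F y - F z) * norm i" by (rule Cauchy_Schwarz_ineq2)
      also have "\<dots> \<le> (K * dist y z) * norm i"
        using lipschitz_onD[OF lF, of y z] by (intro mult_right_mono) (auto simp: dist_norm)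
      finally show "dist (F y \<bullet> i) (F z \<bullet> i) \<le> K * norm i * dist y z"
        by (simp add: dist_real_def inner_diff_left mult_ac)
    qed (use lipschitz_on_nonneg[OF lF] in simp)
  qed
  then have "AE y in lborel. \<forall>i\<in>Basis. (\<lambda>y. F y \<bullet> i) differentiable (at y)"
    by (subst AE_ball_countable) (auto intro: countable_finite)
  then have "AE y in lborel. F differentiable (at y)"
    by eventually_elim (simp add: differentiable_componentwise_within[of F _ UNIV, simplified])
  then have "AE y in lebesgue. F differentiable (at y)" by (rule AE_completion)
  then obtain Z where "Z \<in> null_sets lebesgue" "{y. \<not> F differentiable (at y)} \<subseteq> Z"
    by (auto simp: eventually_ae_filter)
  then have neg: "negligible {y. \<not> F differentiable (at y)}"
    by (metis negligible_iff_null_sets negligible_subset)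
  show "\<exists>V. openin (top_of_set ?S) V \<and> x \<in> V \<and> negligible V"
  proof (intro exI conjI)
    show "openin (top_of_set ?S) (?S \<inter> ball x t)" by (auto simp: openin_open)
    show "x \<in> ?S \<inter> ball x t" using \<open>x \<in> ?S\<close> t by simp
    have "?S \<inter> ball x t \<subseteq> {y. \<not> F differentiable (at y)}"
    proof clarify
      fix y assume y: "\<not> f differentiable (at y)" "y \<in> ball x t" and "F differentiable (at y)"
      then obtain F' where "(F has_derivative F') (at y)" by (auto simp: differentiable_def)
      then have "(f has_derivative F') (at y)"
        by (rule has_derivative_transform_within_open[OF _ open_ball y(2)])
           (auto simp: F_def closest_point_self)
      then show False using y by (auto simp: differentiable_def)
    qed
    then show "negligible (?S \<inter> ball x t)" using neg negligible_subset by blast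
  qed
qed

section \<open>Propagation along intervals and Gronwall's inequality\<close>

text \<open>Compactness of the interval in a form that suits properties stated in varying charts: near each time
\<open>t0\<close> the property is carried forward between any two times, although it need not be known at \<open>t0\<close>.\<close>

lemma interval_propagate:
  fixes P :: "real \<Rightarrow> bool"
  assumes a: "P a"
    and step: "\<And>t0. t0 \<in> {a..b} \<Longrightarrow> \<exists>\<eta>>0. \<forall>t1\<in>{a..b}. \<forall>t2\<in>{a..b}.
       \<bar>t1 - t0\<bar> < \<eta> \<longrightarrow> \<bar>t2 - t0\<bar> < \<eta> \<longrightarrow> t1 \<le> t2 \<longrightarrow> P t1 \<longrightarrow> P t2"
    and t: "t \<in> {a..b}"
  shows "P t"
proof -
  define S where "S = {s \<in> {a..t}. P s}"
  have aS: "a \<in> S" using a t by (auto simp: S_def)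
  have bdd: "bdd_above S" by (auto simp: S_def)
  define t0 where "t0 = Sup S"
  have t0a: "a \<le> t0" unfolding t0_def by (rule cSup_upper[OF aS bdd])
  have t0b: "t0 \<le> t" unfolding t0_def by (rule cSup_least) (use aS in \<open>auto simp: S_def\<close>)
  note t0 = t0a t0b
  have t0ab: "t0 \<in> {a..b}" using t0 t by auto
  obtain \<eta> where \<eta>1: "0 < \<eta>" and \<eta>2: "\<forall>t1\<in>{a..b}. \<forall>t2\<in>{a..b}.
       \<bar>t1 - t0\<bar> < \<eta> \<longrightarrow> \<bar>t2 - t0\<bar> < \<eta> \<longrightarrow> t1 \<le> t2 \<longrightarrow> P t1 \<longrightarrow> P t2"
    using step[OF t0ab] by blast
  note \<eta> = \<eta>1 \<eta>2[rule_format]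
  have "t0 - \<eta> < Sup S" using \<eta>1 by (simp add: t0_def)
  then obtain t1 where t1: "t1 \<in> S" "t0 - \<eta> < t1" by (rule less_cSupE) (use aS in auto)
  have t1': "t1 \<le> t0" using cSup_upper[OF t1(1) bdd] by (simp add: t0_def)
  define t2 where "t2 = min t (t0 + \<eta> / 2)"
  have "P t2" using \<eta>(1) t1 t1' t t0 by (intro \<eta>(2)[of t1 t2]) (auto simp: S_def t2_def)
  then have "t2 \<in> S" using t0 \<eta>(1) by (auto simp: S_def t2_def)
  then have "t2 \<le> t0" using cSup_upper[OF _ bdd] by (simp add: t0_def)
  then have "t2 = t" using \<eta>(1) by (auto simp: t2_def min_def split: if_splits)
  then show ?thesis using \<open>P t2\<close> by simp
qed

text \<open>The square of the norm is differentiable where the norm is not, and the inhomogeneity \<open>e\<close> is absorbed by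
\<open>2 |u| e \<le> |u|^2 + e^2\<close>; this makes \<open>|u|^2 + e^2\<close>, damped with the rate \<open>2 K + 1\<close>, non-increasing.\<close>

lemma gronwall:
  fixes u :: "real \<Rightarrow> 'a::real_inner"
  assumes ab: "t \<in> {a..b}"
    and der: "\<And>s. s \<in> {a..b} \<Longrightarrow> (u has_vector_derivative u' s) (at s within {a..b})"
    and bd: "\<And>s. s \<in> {a..b} \<Longrightarrow> norm (u' s) \<le> K * norm (u s) + e"
    and K: "0 \<le> K" and e: "0 \<le> e"
  shows "norm (u t) \<le> exp ((2 * K + 1) * (b - a)) * (norm (u a) + e)"
proof -
  define c where "c = 2 * K + 1"
  define w where "w = (\<lambda>s. exp (- c * (s - a)) * (u s \<bullet> u s + e\<^sup>2))"
  have dw: "(w has_real_derivative exp (- c * (s - a)) * (2 * (u s \<bullet> u' s) - c * (u s \<bullet> u s + e\<^sup>2))) (at s within {a..b})"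
    if "s \<in> {a..b}" for s
  proof -
    have "((\<lambda>s. u s \<bullet> u s) has_real_derivative u s \<bullet> u' s + u' s \<bullet> u s) (at s within {a..b})"
      using has_derivative_inner[OF der[OF that, unfolded has_vector_derivative_def] der[OF that, unfolded has_vector_derivative_def]]
      by (simp add: has_field_derivative_def inner_commute algebra_simps)
         (erule has_derivative_eq_rhs, auto simp: algebra_simps)
    then show ?thesis unfolding w_def
      by (auto intro!: derivative_eq_intros simp: algebra_simps inner_commute)
  qed
  have le: "2 * (u s \<bullet> u' s) - c * (u s \<bullet> u s + e\<^sup>2) \<le> 0" if s: "s \<in> {a..b}" for s
  proof -
    have "u s \<bullet> u' s \<le> norm (u s) * norm (u' s)" by (rule norm_cauchy_schwarz)
    also have "\<dots> \<le> norm (u s) * (K * norm (u s) + e)" using bd[OF s] by (intro mult_left_mono) auto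
    finally have "2 * (u s \<bullet> u' s) \<le> 2 * K * (norm (u s))\<^sup>2 + 2 * norm (u s) * e"
      by (simp add: algebra_simps power2_eq_square)
    also have "\<dots> \<le> 2 * K * (norm (u s))\<^sup>2 + ((norm (u s))\<^sup>2 + e\<^sup>2)"
      using sum_squares_bound[of "norm (u s)" e] by simp
    also have "\<dots> \<le> c * (u s \<bullet> u s + e\<^sup>2)"
      using K by (simp add: c_def power2_norm_eq_inner algebra_simps)
    finally show ?thesis by simp
  qed
  have "w t \<le> w a"
  proof (rule DERIV_nonpos_imp_decreasing_open[of a t w])
    show "a \<le> t" using ab by simp
    show "continuous_on {a..t} w"
    proof (rule continuous_on_subset)
      show "continuous_on {a..b} w" using dw DERIV_continuous continuous_on_eq_continuous_within by blast
    qed (use ab in auto)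
    fix s assume s: "a < s" "s < t"
    then have i: "s \<in> {a..b}" using ab by auto
    have "at s within {a..b} = at s" using s ab by (intro at_within_interior) auto
    then show "\<exists>y. DERIV w s :> y \<and> y \<le> 0" using dw[OF i] le[OF i]
      by (intro exI conjI) (auto intro!: mult_nonneg_nonpos)
  qed
  then have 1: "exp (- c * (t - a)) * (u t \<bullet> u t + e\<^sup>2) \<le> u a \<bullet> u a + e\<^sup>2" by (simp add: w_def)
  have "exp (c * (t - a)) * (exp (- c * (t - a)) * (u t \<bullet> u t + e\<^sup>2)) \<le> exp (c * (t - a)) * (u a \<bullet> u a + e\<^sup>2)"
    using 1 by (intro mult_left_mono) auto
  then have 2: "u t \<bullet> u t + e\<^sup>2 \<le> exp (c * (t - a)) * (u a \<bullet> u a + e\<^sup>2)"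
    by (simp add: mult.assoc[symmetric] exp_add[symmetric])
  define E where "E = exp (c * (b - a))"
  have E1: "1 \<le> E" using K ab by (simp add: E_def c_def)
  have "exp (c * (t - a)) \<le> E" using ab K by (auto simp: E_def c_def intro!: mult_left_mono)
  then have "(norm (u t))\<^sup>2 \<le> E * (u a \<bullet> u a + e\<^sup>2)"
    using 2 mult_right_mono[of "exp (c * (t - a))" E "u a \<bullet> u a + e\<^sup>2"]
    by (simp add: power2_norm_eq_inner) (smt (verit) zero_le_power2 inner_ge_zero)
  also have "\<dots> \<le> E * (E * (norm (u a) + e)\<^sup>2)"
  proof (rule mult_left_mono)
    have "u a \<bullet> u a + e\<^sup>2 \<le> (norm (u a) + e)\<^sup>2" using e by (simp add: power2_sum power2_norm_eq_inner)
    also have "\<dots> \<le> E * (norm (u a) + e)\<^sup>2" using E1 mult_right_mono[OF E1, of "(norm (u a) + e)\<^sup>2"] by simp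
    finally show "u a \<bullet> u a + e\<^sup>2 \<le> E * (norm (u a) + e)\<^sup>2" .
  qed (use E1 in simp)
  also have "\<dots> = (E * (norm (u a) + e))\<^sup>2" by (simp add: power2_eq_square)
  finally have "norm (u t) \<le> E * (norm (u a) + e)"
    using E1 e by (intro power2_le_imp_le[of "norm (u t)"]) auto
  then show ?thesis by (simp add: E_def c_def)
qed

lemma ode_unique_zero:
  fixes u :: "real \<Rightarrow> 'a::real_inner"
  assumes t0: "t0 \<in> {a..b}" and t: "t \<in> {a..b}" and u0: "u t0 = 0"
    and der: "\<And>s. s \<in> {a..b} \<Longrightarrow> (u has_vector_derivative u' s) (at s)"
    and bd: "\<And>s. s \<in> {a..b} \<Longrightarrow> norm (u' s) \<le> K * norm (u s)" and K: "0 \<le> K"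
  shows "u t = 0"
proof (cases "t0 \<le> t")
  case True
  have "norm (u t) \<le> exp ((2 * K + 1) * (b - t0)) * (norm (u t0) + 0)"
    using True t t0 bd K by (intro gronwall[of t t0 b u u' K 0])
      (auto intro!: has_vector_derivative_at_within der)
  then show ?thesis using u0 by simp
next
  case False
  have "norm ((\<lambda>s. u (- s)) (- t)) \<le> exp ((2 * K + 1) * (- a - (- t0))) * (norm (u (- (- t0))) + 0)"
  proof (rule gronwall[of "-t" "-t0" "-a" "\<lambda>s. u (- s)" "\<lambda>s. - u' (- s)" K 0])
    fix s assume s: "s \<in> {- t0..- a}"
    have "((u \<circ> uminus) has_vector_derivative (-1) *\<^sub>R u' (- s)) (at s)"
      using der[of "- s"] s t0 by (intro vector_diff_chain_at) (auto intro!: derivative_eq_intros)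
    then show "((\<lambda>s. u (- s)) has_vector_derivative - u' (- s)) (at s within {- t0..- a})"
      by (auto simp: o_def intro: has_vector_derivative_at_within)
    show "norm (- u' (- s)) \<le> K * norm (u (- s)) + 0" using bd[of "- s"] s t0 by auto
  qed (use False t K in auto)
  then show ?thesis using u0 by simp
qed

section \<open>Locally Lipschitz maps\<close>

abbreviation LL :: "('a::metric_space \<Rightarrow> 'b::metric_space) \<Rightarrow> 'a set \<Rightarrow> bool" where
  "LL \<equiv> locally_lipschitz_on"

lemma LL_subset: "LL f S \<Longrightarrow> T \<subseteq> S \<Longrightarrow> LL f T"
  unfolding locally_lipschitz_on_def
proof
  fix x assume *: "\<forall>x\<in>S. \<exists>e>0. \<exists>K. K-lipschitz_on (ball x e \<inter> S) f" "T \<subseteq> S" "x \<in> T"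
  then obtain e K where e: "0 < e" "K-lipschitz_on (ball x e \<inter> S) f" by blast
  have "K-lipschitz_on (ball x e \<inter> T) f" using *(2) by (intro lipschitz_on_subset[OF e(2)]) auto
  then show "\<exists>e>0. \<exists>K. K-lipschitz_on (ball x e \<inter> T) f" using e(1) by blast
qed

lemma LL_cball:
  assumes "LL f S" "open S" "x \<in> S"
  obtains r K where "0 < r" "cball x r \<subseteq> S" "K-lipschitz_on (cball x r) f"
proof -
  obtain e K where e: "0 < e" "K-lipschitz_on (ball x e \<inter> S) f"
    using assms unfolding locally_lipschitz_on_def by blast
  obtain s where s: "0 < s" "cball x s \<subseteq> S" using assms by (meson open_contains_cball)
  define r where "r = min (e / 2) s"
  have "0 < r" "cball x r \<subseteq> S" "cball x r \<subseteq> ball x e \<inter> S" using e s by (auto simp: r_def)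
  then show ?thesis using that e(2) lipschitz_on_subset by blast
qed

lemma LL_I:
  assumes "\<And>x. x \<in> S \<Longrightarrow> \<exists>e>0. \<exists>K. \<forall>y\<in>ball x e \<inter> S. \<forall>z\<in>ball x e \<inter> S. dist (f y) (f z) \<le> K * dist y z"
  shows "LL f S"
  unfolding locally_lipschitz_on_def
proof
  fix x assume "x \<in> S"
  then obtain e K where e: "0 < e" "\<forall>y\<in>ball x e \<inter> S. \<forall>z\<in>ball x e \<inter> S. dist (f y) (f z) \<le> K * dist y z"
    using assms by blast
  have "\<bar>K\<bar>-lipschitz_on (ball x e \<inter> S) f"
  proof (rule lipschitz_onI)
    fix y z assume "y \<in> ball x e \<inter> S" "z \<in> ball x e \<inter> S"
    then have "dist (f y) (f z) \<le> K * dist y z" using e by blast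
    also have "\<dots> \<le> \<bar>K\<bar> * dist y z" by (intro mult_right_mono) auto
    finally show "dist (f y) (f z) \<le> \<bar>K\<bar> * dist y z" .
  qed simp
  then show "\<exists>e>0. \<exists>K. K-lipschitz_on (ball x e \<inter> S) f" using e by blast
qed

lemma LL_continuous_on: assumes "LL f S" shows "continuous_on S f"
  unfolding continuous_on_eq_continuous_within
proof
  fix x assume x: "x \<in> S"
  obtain e K where e: "0 < e" "K-lipschitz_on (ball x e \<inter> S) f"
    using assms x unfolding locally_lipschitz_on_def by blast
  have "continuous (at x within ball x e \<inter> S) f"
    using lipschitz_on_continuous_within[OF e(2)] e(1) x by simp
  moreover have "at x within ball x e \<inter> S = at x within S"
    using e(1) by (intro at_within_nhd[of x "ball x e"]) auto
  ultimately show "continuous (at x within S) f" by simp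
qed

lemma LL_const: "LL (\<lambda>x. c) S"
  by (rule LL_I) (intro exI[of _ "1::real"] conjI exI[of _ "0::real"], auto)

lemma LL_cong: "LL f S \<Longrightarrow> (\<And>x. x \<in> S \<Longrightarrow> f x = g x) \<Longrightarrow> LL g S"
  by (rule LL_I) (unfold locally_lipschitz_on_def lipschitz_on_def, metis Int_iff)

lemma LL_compose:
  assumes f: "LL f S" and g: "LL g T" and im: "f ` S \<subseteq> T"
  shows "LL (\<lambda>x. g (f x)) S"
proof (rule LL_I)
  fix x assume x: "x \<in> S"
  obtain e K where e: "0 < e" "K-lipschitz_on (ball x e \<inter> S) f"
    using f x unfolding locally_lipschitz_on_def by blast
  obtain d M where d: "0 < d" "M-lipschitz_on (ball (f x) d \<inter> T) g"
    using g x im unfolding locally_lipschitz_on_def by blast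
  have "continuous (at x within S) f" using LL_continuous_on[OF f] x
    by (simp add: continuous_on_eq_continuous_within)
  then obtain s where s: "0 < s" "\<And>y. y \<in> S \<Longrightarrow> dist y x < s \<Longrightarrow> dist (f y) (f x) < d"
    using d(1) unfolding continuous_within_eps_delta by metis
  have s2: "f y \<in> ball (f x) d \<inter> T" if "y \<in> ball x (min e s) \<inter> S" for y
    using s(2)[of y] that im by (auto simp: dist_commute)
  have "\<forall>y\<in>ball x (min e s) \<inter> S. \<forall>z\<in>ball x (min e s) \<inter> S. dist (g (f y)) (g (f z)) \<le> M * K * dist y z"
  proof (intro ballI)
    fix y z assume yz: "y \<in> ball x (min e s) \<inter> S" "z \<in> ball x (min e s) \<inter> S"
    have "dist (g (f y)) (g (f z)) \<le> M * dist (f y) (f z)"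
      using yz s2 by (intro lipschitz_onD[OF d(2)]) auto
    also have "\<dots> \<le> M * (K * dist y z)"
      using yz lipschitz_on_nonneg[OF d(2)] by (intro mult_left_mono lipschitz_onD[OF e(2)]) auto
    finally show "dist (g (f y)) (g (f z)) \<le> M * K * dist y z" by (simp add: mult.assoc)
  qed
  then show "\<exists>e>0. \<exists>K. \<forall>y\<in>ball x e \<inter> S. \<forall>z\<in>ball x e \<inter> S. dist (g (f y)) (g (f z)) \<le> K * dist y z"
    using e(1) s(1) by (intro exI[of _ "min e s"]) auto
qed

lemma LL_bounded_linear: assumes "bounded_linear f" shows "LL f S"
proof (rule LL_I)
  fix x
  obtain K where K: "\<And>x. norm (f x) \<le> norm x * K" using bounded_linear.bounded[OF assms] by blast
  have "dist (f y) (f z) \<le> K * dist y z" for y z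
    using K[of "y - z"] linear_diff[OF bounded_linear.linear[OF assms]] by (simp add: dist_norm mult.commute)
  then show "\<exists>e>0. \<exists>K. \<forall>y\<in>ball x e \<inter> S. \<forall>z\<in>ball x e \<inter> S. dist (f y) (f z) \<le> K * dist y z"
    by (intro exI[of _ 1] conjI exI[of _ K]) auto
qed

lemma LL_linear_compose: "bounded_linear h \<Longrightarrow> LL f S \<Longrightarrow> LL (\<lambda>x. h (f x)) S"
  by (rule LL_compose[OF _ LL_bounded_linear[of h UNIV]]) auto

lemma LL_Pair: assumes "LL f S" "LL g S" shows "LL (\<lambda>x. (f x, g x)) S"
  unfolding locally_lipschitz_on_def
proof
  fix x assume x: "x \<in> S"
  obtain e K where e: "0 < e" "K-lipschitz_on (ball x e \<inter> S) f"
    using assms(1) x unfolding locally_lipschitz_on_def by blast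
  obtain d M where d: "0 < d" "M-lipschitz_on (ball x d \<inter> S) g"
    using assms(2) x unfolding locally_lipschitz_on_def by blast
  have "(sqrt (K\<^sup>2 + M\<^sup>2))-lipschitz_on (ball x (min e d) \<inter> S) (\<lambda>x. (f x, g x))"
    by (intro lipschitz_on_Pair lipschitz_on_subset[OF e(2)] lipschitz_on_subset[OF d(2)]) auto
  then show "\<exists>e>0. \<exists>K. K-lipschitz_on (ball x e \<inter> S) (\<lambda>x. (f x, g x))"
    using e(1) d(1) by (intro exI[of _ "min e d"]) auto
qed

lemma LL_bounded_bilinear:
  fixes f :: "'a::real_normed_vector \<Rightarrow> 'b::real_normed_vector"
  assumes b: "bounded_bilinear b" and "LL f S" "LL g S"
  shows "LL (\<lambda>x. b (f x) (g x)) S"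
proof (rule LL_I)
  interpret bounded_bilinear b by fact
  fix x assume x: "x \<in> S"
  obtain e K where e: "0 < e" "K-lipschitz_on (ball x e \<inter> S) f"
    using assms(2) x unfolding locally_lipschitz_on_def by blast
  obtain d M where d: "0 < d" "M-lipschitz_on (ball x d \<inter> S) g"
    using assms(3) x unfolding locally_lipschitz_on_def by blast
  obtain B where B: "0 < B" "\<And>a c. norm (b a c) \<le> norm a * norm c * B" using pos_bounded by blast
  define s where "s = min 1 (min e d)"
  have nn: "0 \<le> K" "0 \<le> M" using e(2) d(2) lipschitz_on_nonneg by blast+
  define F where "F = norm (f x) + K" define G where "G = norm (g x) + M"
  have FG: "0 \<le> F" "0 \<le> G" using nn by (auto simp: F_def G_def)
  have xs: "x \<in> ball x e \<inter> S" "x \<in> ball x d \<inter> S" using x e d by auto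
  have bF: "norm (f y) \<le> F" if "y \<in> ball x s \<inter> S" for y
  proof -
    have "norm (f y - f x) \<le> K * norm (y - x)"
      using lipschitz_on_normD[OF e(2) _ xs(1)] that by (auto simp: s_def)
    also have "\<dots> \<le> K * 1" using that nn by (intro mult_left_mono) (auto simp: s_def dist_norm norm_minus_commute)
    finally show ?thesis using norm_triangle_sub[of "f y" "f x"] by (simp add: F_def)
  qed
  have bG: "norm (g y) \<le> G" if "y \<in> ball x s \<inter> S" for y
  proof -
    have "norm (g y - g x) \<le> M * norm (y - x)"
      using lipschitz_on_normD[OF d(2) _ xs(2)] that by (auto simp: s_def)
    also have "\<dots> \<le> M * 1" using that nn by (intro mult_left_mono) (auto simp: s_def dist_norm norm_minus_commute)
    finally show ?thesis using norm_triangle_sub[of "g y" "g x"] by (simp add: G_def)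
  qed
  have "dist (b (f y) (g y)) (b (f z) (g z)) \<le> (K * G + F * M) * B * dist y z"
    if y: "y \<in> ball x s \<inter> S" and z: "z \<in> ball x s \<inter> S" for y z
  proof -
    have f: "norm (f y - f z) \<le> K * norm (y - z)" using lipschitz_on_normD[OF e(2)] y z by (auto simp: s_def)
    have g: "norm (g y - g z) \<le> M * norm (y - z)" using lipschitz_on_normD[OF d(2)] y z by (auto simp: s_def)
    have "b (f y) (g y) - b (f z) (g z) = b (f y - f z) (g y) + b (f z) (g y - g z)"
      by (simp add: diff_left diff_right)
    then have "norm (b (f y) (g y) - b (f z) (g z)) \<le> norm (f y - f z) * norm (g y) * B + norm (f z) * norm (g y - g z) * B"
      using norm_triangle_mono[OF B(2) B(2)] by simp
    also have "\<dots> \<le> (K * norm (y - z)) * G * B + F * (M * norm (y - z)) * B"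
      using f g bF[OF z] bG[OF y] B(1) nn FG by (intro add_mono mult_mono) auto
    also have "\<dots> = (K * G + F * M) * B * dist y z" by (simp add: dist_norm algebra_simps)
    finally show ?thesis by (simp add: dist_norm)
  qed
  then show "\<exists>e>0. \<exists>K. \<forall>y\<in>ball x e \<inter> S. \<forall>z\<in>ball x e \<inter> S. dist (b (f y) (g y)) (b (f z) (g z)) \<le> K * dist y z"
    using e(1) d(1) by (intro exI[of _ s] conjI exI[of _ "(K * G + F * M) * B"]) (auto simp: s_def)
qed

lemma LL_add:
  fixes f g :: "'a::real_normed_vector \<Rightarrow> 'b::real_normed_vector"
  assumes "LL f S" "LL g S" shows "LL (\<lambda>x. f x + g x) S"
proof -
  have "bounded_linear (\<lambda>p :: 'b \<times> 'b. fst p + snd p)"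
    by (rule bounded_linear_add[OF bounded_linear_fst bounded_linear_snd])
  from LL_linear_compose[OF this LL_Pair[OF assms]] show ?thesis by simp
qed

lemma LL_minus:
  fixes f g :: "'a::real_normed_vector \<Rightarrow> 'b::real_normed_vector"
  assumes "LL f S" shows "LL (\<lambda>x. - f x) S"
  by (rule LL_linear_compose[OF bounded_linear_minus[OF bounded_linear_ident] assms])

lemma LL_sum:
  fixes f :: "'i \<Rightarrow> 'a::real_normed_vector \<Rightarrow> 'b::real_normed_vector"
  assumes "\<And>i. i \<in> I \<Longrightarrow> LL (f i) S" shows "LL (\<lambda>x. \<Sum>i\<in>I. f i x) S"
  using assms
proof (induction I rule: infinite_finite_induct)
  case (insert i I)
  have "LL (\<lambda>x. f i x + (\<Sum>i\<in>I. f i x)) S" by (rule LL_add) (use insert in auto)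
  then show ?case using insert by simp
qed (simp_all add: LL_const)

lemmas LL_mult = LL_bounded_bilinear[OF bounded_bilinear_mult]
lemmas LL_inner = LL_bounded_bilinear[OF bounded_bilinear_inner]
lemmas LL_scaleR = LL_bounded_bilinear[OF bounded_bilinear_scaleR]
lemmas LL_vec_nth = LL_linear_compose[OF bounded_linear_vec_nth]
lemmas LL_fst = LL_linear_compose[OF bounded_linear_fst]
lemmas LL_snd = LL_linear_compose[OF bounded_linear_snd]

lemma LL_vec:
  fixes f :: "'a::real_normed_vector \<Rightarrow> real ^ 'n"
  assumes "\<And>i. LL (\<lambda>x. f x $ i) S"
  shows "LL f S"
proof -
  have "LL (\<lambda>x. \<Sum>i\<in>UNIV. f x $ i *\<^sub>R axis i (1::real)) S"
    by (intro LL_sum LL_scaleR assms LL_const)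
  moreover have "(\<Sum>i\<in>UNIV. f x $ i *\<^sub>R axis i (1::real)) = f x" for x
    using basis_expansion[of "f x"] by (simp only: scalar_mult_eq_scaleR)
  ultimately show ?thesis by simp
qed

lemma LL_compact:
  assumes f: "LL f S" and C: "compact C" "C \<subseteq> S"
  obtains K where "K-lipschitz_on C f"
proof -
  have "local_lipschitz {0::real} C (\<lambda>_. f)"
  proof (rule local_lipschitzI)
    fix t :: real and x assume "x \<in> C"
    then obtain e K where e: "0 < e" "K-lipschitz_on (ball x e \<inter> S) f"
      using f C(2) unfolding locally_lipschitz_on_def by blast
    have "K-lipschitz_on (cball x (e / 2) \<inter> C) f"
      using e C(2) by (intro lipschitz_on_subset[OF e(2)]) auto
    then show "\<exists>u>0. \<exists>L. \<forall>t\<in>cball t u \<inter> {0}. L-lipschitz_on (cball x u \<inter> C) f"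
      using e by (intro exI[of _ "e / 2"]) auto
  qed
  from local_lipschitz_compact_implies_lipschitz[OF this C(1)] that show ?thesis by auto
qed

text \<open>Write \<open>f(x, v) = |v|^(k+1) f(x, v / |v|)\<close>.  On the compact unit sphere bundle \<open>f\<close> is Lipschitz and
bounded, and the only factor that is not Lipschitz near the zero section, \<open>v / |v|\<close>, is damped by one
power of \<open>|v|\<close>.  This extends the Lipschitz property of the spray and of the momentum across zero velocities.\<close>

lemma LL_homogeneous:
  fixes f :: "'a::euclidean_space \<times> 'b::euclidean_space \<Rightarrow> 'c::real_normed_vector"
  assumes X: "open X" and LL: "LL f (X \<times> (UNIV - {0}))"
    and hom: "\<And>x v s. x \<in> X \<Longrightarrow> v \<noteq> 0 \<Longrightarrow> 0 < s \<Longrightarrow> f (x, s *\<^sub>R v) = s ^ Suc k *\<^sub>R f (x, v)"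
    and f0: "\<And>x. f (x, 0) = 0"
  shows "LL f (X \<times> UNIV)"
proof (rule LL_I, clarify)
  fix x0 :: 'a and v0 :: 'b assume x0: "x0 \<in> X"
  obtain r where r: "0 < r" "cball x0 r \<subseteq> X" using X x0 by (meson open_contains_cball)
  define C where "C = cball x0 r \<times> sphere (0::'b) 1"
  have Cc: "compact C" and Cs: "C \<subseteq> X \<times> (UNIV - {0})" using r by (auto simp: C_def intro: compact_Times)
  obtain K where K: "K-lipschitz_on C f" using LL_compact[OF LL Cc Cs] .
  have K0: "0 \<le> K" using K by (rule lipschitz_on_nonneg)
  have "bounded (f ` C)" using Cc LL_continuous_on[OF LL] Cs
    by (intro compact_imp_bounded compact_continuous_image) (auto intro: continuous_on_subset)
  then obtain M where M: "\<And>z. z \<in> C \<Longrightarrow> norm (f z) \<le> M" by (auto simp: bounded_iff)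
  define R where "R = norm v0 + 1"
  have R: "1 \<le> R" by (simp add: R_def)
  define M' where "M' = \<bar>M\<bar>"
  have rep: "f (x, v) = norm v ^ Suc k *\<^sub>R f (x, (1 / norm v) *\<^sub>R v)" if "x \<in> X" "v \<noteq> 0" for x v
    using hom[of x "(1 / norm v) *\<^sub>R v" "norm v"] that by simp
  have inC: "(x, (1 / norm v) *\<^sub>R v) \<in> C" if "x \<in> cball x0 r" "v \<noteq> 0" for x v
    using that by (simp add: C_def)
  have pw: "\<bar>a ^ Suc k - b ^ Suc k\<bar> \<le> real (Suc k) * R ^ k * \<bar>a - b\<bar>"
    if "0 \<le> a" "a \<le> R" "0 \<le> b" "b \<le> R" for a b :: real
  proof -
    have "norm (a ^ Suc k - b ^ Suc k) \<le> (real (Suc k) * R ^ k) * norm (a - b)"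
    proof (rule field_differentiable_bound[of "{0..R}" "\<lambda>x. x ^ Suc k" "\<lambda>x. real (Suc k) * x ^ k"])
      fix x assume x: "x \<in> {0..R}"
      show "((\<lambda>x. x ^ Suc k) has_real_derivative real (Suc k) * x ^ k) (at x within {0..R})"
        using DERIV_pow[of "Suc k" x "{0..R}"] by simp
      show "norm (real (Suc k) * x ^ k) \<le> real (Suc k) * R ^ k"
        using x power_mono[of x R k] by (simp add: abs_mult mult_left_mono del: of_nat_Suc)
    qed (use that in auto)
    then show ?thesis by simp
  qed
  define A where "A = real (Suc k) * R ^ k * M' + R ^ k * K * (R + 2)"
  have A0: "0 \<le> A" using R K0 by (auto simp: A_def M'_def)
  have main: "norm (f (x, v) - f (y, w)) \<le> A * (norm (x - y) + norm (v - w))"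
    if xy: "x \<in> cball x0 r" "y \<in> cball x0 r" and vw: "norm w \<le> norm v" "norm v \<le> R" "v \<noteq> 0" for x y v w
  proof -
    define vh where "vh = (1 / norm v) *\<^sub>R v"
    have xX: "x \<in> X" "y \<in> X" using xy r by auto
    have Mv: "norm (f (x, vh)) \<le> M'" using M[OF inC[OF xy(1) vw(3)]] by (simp add: vh_def M'_def)
    have t1: "norm ((norm v ^ Suc k - norm w ^ Suc k) *\<^sub>R f (x, vh)) \<le> real (Suc k) * R ^ k * M' * norm (v - w)"
    proof -
      have "norm ((norm v ^ Suc k - norm w ^ Suc k) *\<^sub>R f (x, vh)) = \<bar>norm v ^ Suc k - norm w ^ Suc k\<bar> * norm (f (x, vh))" by simp
      also have "\<dots> \<le> (real (Suc k) * R ^ k * \<bar>norm v - norm w\<bar>) * M'"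
        using vw R Mv by (intro mult_mono pw) auto
      also have "\<dots> \<le> (real (Suc k) * R ^ k * norm (v - w)) * M'"
        using R norm_triangle_ineq3[of v w] by (intro mult_right_mono mult_left_mono) (auto simp: M'_def)
      finally show ?thesis by (simp add: mult_ac)
    qed
    show ?thesis
    proof (cases "w = 0")
      case True
      have "norm (f (x, v) - f (y, w)) = norm ((norm v ^ Suc k - norm w ^ Suc k) *\<^sub>R f (x, vh))"
        using True f0 rep[OF xX(1) vw(3)] by (simp add: vh_def)
      also have "\<dots> \<le> real (Suc k) * R ^ k * M' * norm (v - w)" by (rule t1)
      also have "\<dots> \<le> A * (norm (x - y) + norm (v - w))"
        using R K0 by (intro mult_mono) (auto simp: A_def M'_def)
      finally show ?thesis .
    next
      case False
      define wh where "wh = (1 / norm w) *\<^sub>R w"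
      \<comment> \<open>Multiplication by \<open>|w|\<close> tames the difference of the unit vectors.\<close>
      have d: "norm w * norm (vh - wh) \<le> 2 * norm (v - w)"
      proof -
        have "norm w *\<^sub>R (vh - wh) = (w \<bullet> w) *\<^sub>R 0 + ((norm w - norm v) *\<^sub>R vh + (v - w))"
          using False vw(3) by (simp add: vh_def wh_def algebra_simps)
        then have "norm w * norm (vh - wh) = norm ((norm w - norm v) *\<^sub>R vh + (v - w))"
          by (metis norm_scaleR abs_norm_cancel scaleR_zero_right add_0)
        also have "\<dots> \<le> \<bar>norm w - norm v\<bar> * norm vh + norm (v - w)"
          using norm_triangle_ineq[of "(norm w - norm v) *\<^sub>R vh" "v - w"] by simp
        also have "\<dots> \<le> norm (v - w) + norm (v - w)"
          using vw(3) norm_triangle_ineq3[of w v] by (simp add: vh_def norm_minus_commute)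
        finally show ?thesis by simp
      qed
      have "norm (f (x, vh) - f (y, wh)) \<le> K * norm ((x, vh) - (y, wh))"
        using lipschitz_on_normD[OF K inC[OF xy(1) vw(3)] inC[OF xy(2) False]] by (simp add: vh_def wh_def)
      also have "\<dots> \<le> K * (norm (x - y) + norm (vh - wh))"
        using K0 norm_Pair_le[of "x - y" "vh - wh"] by (intro mult_left_mono) auto
      finally have k: "norm (f (x, vh) - f (y, wh)) \<le> K * (norm (x - y) + norm (vh - wh))" .
      have wk: "norm w ^ k \<le> R ^ k" using vw by (intro power_mono) auto
      have "norm (norm w ^ Suc k *\<^sub>R (f (x, vh) - f (y, wh))) = norm w ^ k * (norm w * norm (f (x, vh) - f (y, wh)))"
        by simp
      also have "\<dots> \<le> norm w ^ k * (norm w * (K * (norm (x - y) + norm (vh - wh))))"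
        using k by (intro mult_left_mono) auto
      also have "\<dots> = norm w ^ k * (K * (norm w * norm (x - y) + norm w * norm (vh - wh)))" by (simp add: algebra_simps)
      also have "\<dots> \<le> R ^ k * (K * ((R + 2) * (norm (x - y) + norm (v - w))))"
      proof (intro mult_mono wk order_refl)
        have "norm w * norm (x - y) \<le> R * norm (x - y)" using vw by (intro mult_right_mono) auto
        moreover have "0 \<le> R * norm (v - w)" "0 \<le> 2 * norm (x - y)" using R by auto
        ultimately show "norm w * norm (x - y) + norm w * norm (vh - wh) \<le> (R + 2) * (norm (x - y) + norm (v - w))"
          using d unfolding distrib_left distrib_right by linarith
      qed (use R K0 in auto)
      finally have t2: "norm (norm w ^ Suc k *\<^sub>R (f (x, vh) - f (y, wh))) \<le> R ^ k * K * (R + 2) * (norm (x - y) + norm (v - w))"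
        by (simp only: mult.assoc)
      have "f (x, v) - f (y, w) = (norm v ^ Suc k - norm w ^ Suc k) *\<^sub>R f (x, vh) + norm w ^ Suc k *\<^sub>R (f (x, vh) - f (y, wh))"
        using rep[OF xX(1) vw(3)] rep[OF xX(2) False] by (simp add: vh_def wh_def algebra_simps del: power_Suc)
      then have "norm (f (x, v) - f (y, w)) \<le> real (Suc k) * R ^ k * M' * norm (v - w) + R ^ k * K * (R + 2) * (norm (x - y) + norm (v - w))"
        using norm_triangle_mono[OF t1 t2] by simp
      also have "\<dots> \<le> real (Suc k) * R ^ k * M' * (norm (x - y) + norm (v - w)) + R ^ k * K * (R + 2) * (norm (x - y) + norm (v - w))"
        using R K0 by (intro add_mono mult_left_mono) (auto simp: M'_def)
      also have "\<dots> = A * (norm (x - y) + norm (v - w))" unfolding A_def by (rule distrib_right[symmetric])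
      finally show ?thesis .
    qed
  qed
  have main': "norm (f (x, v) - f (y, w)) \<le> A * (norm (x - y) + norm (v - w))"
    if "x \<in> cball x0 r" "y \<in> cball x0 r" "norm v \<le> R" "norm w \<le> R" for x y v w
  proof (cases "norm w \<le> norm v")
    case True
    show ?thesis
    proof (cases "v = 0")
      case v: True
      then have "w = 0" using True by simp
      then show ?thesis using v f0 A0 by simp
    qed (use main that True in auto)
  next
    case False
    then have "norm (f (y, w) - f (x, v)) \<le> A * (norm (y - x) + norm (w - v))"
      using that by (intro main) auto
    then show ?thesis by (simp add: norm_minus_commute)
  qed
  have fin: "dist (f y) (f z) \<le> 2 * A * dist y z"
    if yz: "y \<in> ball (x0, v0) (min r 1)" "z \<in> ball (x0, v0) (min r 1)" for y z
  proof -
    have b: "fst y \<in> cball x0 r \<and> norm (snd y) \<le> R" if "y \<in> ball (x0, v0) (min r 1)" for y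
    proof -
      have "dist x0 (fst y) \<le> dist (x0, v0) y" "dist v0 (snd y) \<le> dist (x0, v0) y"
        using dist_fst_le[of "(x0, v0)" y] dist_snd_le[of "(x0, v0)" y] by simp_all
      then show ?thesis using that norm_triangle_sub[of "snd y" v0]
        by (auto simp: R_def dist_norm norm_minus_commute)
    qed
    have "norm (f (fst y, snd y) - f (fst z, snd z)) \<le> A * (norm (fst y - fst z) + norm (snd y - snd z))"
      using b yz by (intro main') auto
    also have "\<dots> \<le> A * (dist y z + dist y z)"
      using A0 dist_fst_le[of y z] dist_snd_le[of y z] by (intro mult_left_mono add_mono) (auto simp: dist_norm)
    finally show ?thesis by (simp add: dist_norm)
  qed
  show "\<exists>e>0. \<exists>K. \<forall>y\<in>ball (x0, v0) e \<inter> X \<times> UNIV. \<forall>z\<in>ball (x0, v0) e \<inter> X \<times> UNIV.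
       dist (f y) (f z) \<le> K * dist y z"
    using r(1) by (intro exI[of _ "min r 1"] conjI exI[of _ "2 * A"] ballI fin) auto
qed

section \<open>Taylor estimates and a criterion for differentiability\<close>

lemma onorm_diff_le_Basis:
  fixes f g :: "'a::euclidean_space \<Rightarrow> 'b::real_normed_vector"
  assumes "bounded_linear f" "bounded_linear g"
    and "\<And>b. b \<in> Basis \<Longrightarrow> norm (f b - g b) \<le> c"
  shows "onorm (f - g) \<le> real DIM('a) * c"
proof (rule onorm_bound)
  obtain b :: 'a where "b \<in> Basis" using nonempty_Basis by blast
  then have c: "0 \<le> c" using assms(3) norm_ge_zero order_trans by blast
  then show "0 \<le> real DIM('a) * c" by simp
  interpret h: bounded_linear "f - g" unfolding fun_diff_def by (rule bounded_linear_sub[OF assms(1,2)])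
  fix w :: 'a
  have "(f - g) w = (f - g) (\<Sum>b\<in>Basis. (w \<bullet> b) *\<^sub>R b)" by (simp add: euclidean_representation)
  also have "\<dots> = (\<Sum>b\<in>Basis. (w \<bullet> b) *\<^sub>R (f - g) b)" by (simp only: h.sum h.scaleR)
  also have "norm \<dots> \<le> (\<Sum>b\<in>(Basis::'a set). norm w * c)"
  proof (rule sum_norm_le)
    fix b :: 'a assume b: "b \<in> Basis"
    have "norm ((w \<bullet> b) *\<^sub>R (f - g) b) = \<bar>w \<bullet> b\<bar> * norm (f b - g b)" by simp
    also have "\<dots> \<le> norm w * c"
      using b assms(3) c Basis_le_norm[OF b, of w] by (intro mult_mono) auto
    finally show "norm ((w \<bullet> b) *\<^sub>R (f - g) b) \<le> norm w * c" .
  qed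
  also have "\<dots> = real DIM('a) * c * norm w" by simp
  finally show "norm ((f - g) w) \<le> real DIM('a) * c * norm w" .
qed

lemma linearization_bound:
  fixes f :: "'a::euclidean_space \<Rightarrow> 'b::real_normed_vector"
  assumes der: "\<And>z. z \<in> S \<Longrightarrow> (f has_derivative f' z) (at z)" and S: "convex S"
    and y: "y \<in> S" "y' \<in> S"
    and bd: "\<And>z b. z \<in> closed_segment y y' \<Longrightarrow> b \<in> Basis \<Longrightarrow> norm (f' z b - f' y b) \<le> c"
  shows "norm (f y' - f y - f' y (y' - y)) \<le> norm (y' - y) * (real DIM('a) * c)"
proof (rule differentiable_bound_linearization[where S="closed_segment y y'"])
  have sub: "closed_segment y y' \<subseteq> S" using S y by (rule closed_segment_subset[rotated 2])
  show "y + t *\<^sub>R (y' - y) \<in> closed_segment y y'" if "t \<in> {0..1}" for t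
    using that by (auto simp: closed_segment_def algebra_simps intro!: exI[of _ t])
  show "(f has_derivative f' z) (at z within closed_segment y y')" if "z \<in> closed_segment y y'" for z
    using der that sub by (meson has_derivative_at_withinI subsetD)
  show "onorm (f' z - f' y) \<le> real DIM('a) * c" if z: "z \<in> closed_segment y y'" for z
    by (rule onorm_diff_le_Basis[OF _ _ bd[OF z]])
       (use der z sub y in \<open>blast intro: has_derivative_bounded_linear\<close>)+
qed simp

text \<open>The Taylor estimate for \<open>C\<^sup>1\<^sup>,\<^sup>1\<close> maps with one constant for all pairs of points in a ball.  The
regularity is stated through directional derivatives, so an orthonormal basis serves to bound operator norms.\<close>

lemma quadratic_remainder:
  fixes f :: "'a::euclidean_space \<Rightarrow> 'b::real_normed_vector"
  assumes S: "open S" "x \<in> S"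
    and der: "\<And>z. z \<in> S \<Longrightarrow> (f has_derivative f' z) (at z)"
    and LL: "\<And>w. LL (\<lambda>z. f' z w) S"
  obtains r C where "0 < r" "0 \<le> C" "cball x r \<subseteq> S"
    "\<And>y y'. y \<in> cball x r \<Longrightarrow> y' \<in> cball x r \<Longrightarrow>
       norm (f y' - f y - f' y (y' - y)) \<le> C * (norm (y' - y))\<^sup>2"
proof -
  have "\<forall>b\<in>Basis. \<exists>r>0. \<exists>K\<ge>0. cball x r \<subseteq> S \<and> (\<forall>y\<in>cball x r. \<forall>z\<in>cball x r. norm (f' y b - f' z b) \<le> K * norm (y - z))"
  proof
    fix b :: 'a
    obtain r K where r: "0 < r" "cball x r \<subseteq> S" "K-lipschitz_on (cball x r) (\<lambda>z. f' z b)"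
      using LL_cball[OF LL S] .
    then show "\<exists>r>0. \<exists>K\<ge>0. cball x r \<subseteq> S \<and> (\<forall>y\<in>cball x r. \<forall>z\<in>cball x r. norm (f' y b - f' z b) \<le> K * norm (y - z))"
      using lipschitz_on_nonneg[OF r(3)] lipschitz_on_normD[OF r(3)] by blast
  qed
  then obtain r K where rK: "\<And>b. b \<in> Basis \<Longrightarrow> 0 < r b \<and> 0 \<le> K b \<and> cball x (r b) \<subseteq> S \<and>
      (\<forall>y\<in>cball x (r b). \<forall>z\<in>cball x (r b). norm (f' y b - f' z b) \<le> K b * norm (y - z))"
    by metis
  define R where "R = Min (r ` Basis)"
  define C where "C = (\<Sum>b\<in>Basis. K b)"
  have R: "0 < R" "\<And>b. b \<in> Basis \<Longrightarrow> R \<le> r b" using rK by (auto simp: R_def)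
  have C: "0 \<le> C" "\<And>b. b \<in> Basis \<Longrightarrow> K b \<le> C"
    using rK by (auto simp: C_def intro!: sum_nonneg member_le_sum)
  obtain b0 :: 'a where b0: "b0 \<in> Basis" using nonempty_Basis by blast
  have sub: "cball x R \<subseteq> S" using rK[OF b0] R(2)[OF b0] by (auto intro: order_trans)
  have "norm (f y' - f y - f' y (y' - y)) \<le> (real DIM('a) * C) * (norm (y' - y))\<^sup>2"
    if y: "y \<in> cball x R" "y' \<in> cball x R" for y y'
  proof -
    have "norm (f y' - f y - f' y (y' - y)) \<le> norm (y' - y) * (real DIM('a) * (C * norm (y' - y)))"
    proof (rule linearization_bound[where S="cball x R"])
      fix z b assume z: "z \<in> closed_segment y y'" and b: "b \<in> (Basis :: 'a set)"
      have "z \<in> cball x R" using z y closed_segment_subset[of y "cball x R" y'] by auto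
      then have zr: "z \<in> cball x (r b)" "y \<in> cball x (r b)" using R(2)[OF b] y by auto
      have "norm (f' z b - f' y b) \<le> K b * norm (z - y)" using rK[OF b] zr by blast
      also have "\<dots> \<le> C * norm (y' - y)"
        using C(2)[OF b] C(1) segment_bound(1)[OF z] by (intro mult_mono) auto
      finally show "norm (f' z b - f' y b) \<le> C * norm (y' - y)" .
    qed (use y der sub in auto)
    then show ?thesis by (simp add: power2_eq_square mult_ac)
  qed
  then show ?thesis using that[OF R(1) _ sub] C(1) by (meson mult_nonneg_nonneg of_nat_0_le_iff)
qed

lemma derivative_bounded:
  fixes f' :: "'a::euclidean_space \<Rightarrow> 'a \<Rightarrow> 'b::real_normed_vector"
  assumes S: "compact S" and cont: "\<And>w. continuous_on S (\<lambda>z. f' z w)" and lin: "\<And>z. z \<in> S \<Longrightarrow> linear (f' z)"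
  obtains B where "0 \<le> B" "\<And>z w. z \<in> S \<Longrightarrow> norm (f' z w) \<le> B * norm w"
proof -
  have "\<forall>b\<in>Basis. \<exists>M. \<forall>z\<in>S. norm (f' z b) \<le> M"
  proof
    fix b :: 'a
    have "bounded ((\<lambda>z. f' z b) ` S)"
      by (intro compact_imp_bounded compact_continuous_image cont S)
    then show "\<exists>M. \<forall>z\<in>S. norm (f' z b) \<le> M" by (auto simp: bounded_iff)
  qed
  then obtain M where M: "\<forall>b\<in>Basis. \<forall>z\<in>S. norm (f' z b) \<le> M b" by metis
  define B where "B = (\<Sum>b\<in>(Basis::'a set). \<bar>M b\<bar>)"
  have "norm (f' z w) \<le> B * norm w" if z: "z \<in> S" for z w
  proof -
    have "f' z w = f' z (\<Sum>b\<in>Basis. (w \<bullet> b) *\<^sub>R b)" by (simp add: euclidean_representation)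
    also have "\<dots> = (\<Sum>b\<in>Basis. (w \<bullet> b) *\<^sub>R f' z b)"
      by (simp only: linear_sum[OF lin[OF z]] linear_scale[OF lin[OF z]])
    also have "norm \<dots> \<le> (\<Sum>b\<in>Basis. norm w * \<bar>M b\<bar>)"
    proof (rule sum_norm_le)
      fix b :: 'a assume b: "b \<in> Basis"
      have "norm (f' z b) \<le> M b" using M b z by blast
      then have Mb: "norm (f' z b) \<le> \<bar>M b\<bar>" by simp
      have "norm ((w \<bullet> b) *\<^sub>R f' z b) = \<bar>w \<bullet> b\<bar> * norm (f' z b)" by simp
      also have "\<dots> \<le> norm w * \<bar>M b\<bar>"
        using Mb Basis_le_norm[OF b, of w] by (intro mult_mono) auto
      finally show "norm ((w \<bullet> b) *\<^sub>R f' z b) \<le> norm w * \<bar>M b\<bar>" .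
    qed
    also have "\<dots> = B * norm w" by (simp add: B_def sum_distrib_left mult.commute)
    finally show ?thesis .
  qed
  moreover have "0 \<le> B" by (simp add: B_def sum_nonneg)
  ultimately show ?thesis using that by blast
qed

lemma LL_differentiable:
  fixes f :: "'a::euclidean_space \<Rightarrow> 'b::real_normed_vector"
  assumes S: "open S"
    and der: "\<And>z. z \<in> S \<Longrightarrow> (f has_derivative f' z) (at z)"
    and LL: "\<And>w. LL (\<lambda>z. f' z w) S"
  shows "LL f S"
proof (rule LL_I)
  fix x assume x: "x \<in> S"
  obtain r C where r: "0 < r" "0 \<le> C" "cball x r \<subseteq> S"
    "\<And>y y'. y \<in> cball x r \<Longrightarrow> y' \<in> cball x r \<Longrightarrow> norm (f y' - f y - f' y (y' - y)) \<le> C * (norm (y' - y))\<^sup>2"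
    using quadratic_remainder[OF S x der LL] by blast
  have cont: "continuous_on (cball x r) (\<lambda>z. f' z w)" for w
    using continuous_on_subset[OF LL_continuous_on[OF LL] r(3)] .
  have lin: "linear (f' z)" if "z \<in> cball x r" for z
    using der r(3) that has_derivative_linear by blast
  obtain B where B: "0 \<le> B" "\<And>z w. z \<in> cball x r \<Longrightarrow> norm (f' z w) \<le> B * norm w"
    by (rule derivative_bounded[OF compact_cball cont lin]) blast+
  have "dist (f y') (f y) \<le> (C * (2 * r) + B) * dist y' y" if y: "y' \<in> ball x r \<inter> S" "y \<in> ball x r \<inter> S" for y y'
  proof -
    have yy: "y \<in> cball x r" "y' \<in> cball x r" using y by auto
    have d: "norm (y' - y) \<le> 2 * r"
      using yy dist_triangle[of y' y x] by (simp add: dist_norm norm_minus_commute)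
    have "norm (f y' - f y) \<le> norm (f y' - f y - f' y (y' - y)) + norm (f' y (y' - y))"
      by (metis norm_triangle_sub add.commute)
    also have "\<dots> \<le> C * (norm (y' - y))\<^sup>2 + B * norm (y' - y)"
      using r(4)[OF yy] B(2)[OF yy(1)] by (intro add_mono) auto
    also have "\<dots> \<le> C * (2 * r * norm (y' - y)) + B * norm (y' - y)"
      using r(2) mult_right_mono[OF d, of "norm (y' - y)"]
      by (intro add_mono mult_left_mono order_refl) (auto simp: power2_eq_square)
    also have "\<dots> = (C * (2 * r) + B) * dist y' y" by (simp add: dist_norm algebra_simps)
    finally show ?thesis by (simp add: dist_norm)
  qed
  then show "\<exists>e>0. \<exists>K. \<forall>y\<in>ball x e \<inter> S. \<forall>z\<in>ball x e \<inter> S. dist (f y) (f z) \<le> K * dist y z"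
    using r(1) by blast
qed

text \<open>Directional derivatives that are continuous on a compact ball are uniformly continuous there, so the
first-order remainder is small uniformly in the base point.\<close>

lemma uniform_linearization:
  fixes f :: "'a::euclidean_space \<Rightarrow> 'b::real_normed_vector"
  assumes der: "\<And>z. z \<in> cball x r \<Longrightarrow> (f has_derivative f' z) (at z)"
    and cont: "\<And>w. continuous_on (cball x r) (\<lambda>z. f' z w)" and e: "0 < e"
  obtains d where "0 < d" "\<And>y y'. y \<in> cball x r \<Longrightarrow> y' \<in> cball x r \<Longrightarrow> norm (y' - y) < d \<Longrightarrow>
       norm (f y' - f y - f' y (y' - y)) \<le> e * norm (y' - y)"
proof -
  define c where "c = e / real DIM('a)"
  have c: "0 < c" using e by (simp add: c_def)
  have "\<forall>b\<in>Basis. \<exists>d>0. \<forall>y\<in>cball x r. \<forall>z\<in>cball x r. dist z y < d \<longrightarrow> dist (f' z b) (f' y b) < c"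
    using compact_uniformly_continuous[OF cont compact_cball] c unfolding uniformly_continuous_on_def by blast
  then obtain D where D: "\<And>b. b \<in> Basis \<Longrightarrow> 0 < D b"
    "\<And>b y z. b \<in> Basis \<Longrightarrow> y \<in> cball x r \<Longrightarrow> z \<in> cball x r \<Longrightarrow> dist z y < D b \<Longrightarrow> dist (f' z b) (f' y b) < c"
    by metis
  define d where "d = Min (D ` Basis)"
  have d: "0 < d" "\<And>b. b \<in> Basis \<Longrightarrow> d \<le> D b" using D(1) by (auto simp: d_def)
  have "norm (f y' - f y - f' y (y' - y)) \<le> e * norm (y' - y)"
    if y: "y \<in> cball x r" "y' \<in> cball x r" "norm (y' - y) < d" for y y'
  proof -
    have "norm (f y' - f y - f' y (y' - y)) \<le> norm (y' - y) * (real DIM('a) * c)"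
    proof (rule linearization_bound[where S="cball x r"])
      fix z b assume z: "z \<in> closed_segment y y'" and b: "b \<in> (Basis :: 'a set)"
      have "z \<in> cball x r" using z y closed_segment_subset[of y "cball x r" y'] by auto
      moreover have "dist z y < D b"
        using segment_bound(1)[OF z] y(3) d(2)[OF b] by (simp add: dist_norm)
      ultimately show "norm (f' z b - f' y b) \<le> c" using D(2)[OF b y(1)] by (simp add: dist_norm less_imp_le)
    qed (use y der in auto)
    then show ?thesis by (simp add: c_def mult.commute)
  qed
  then show ?thesis using that d(1) by blast
qed

text \<open>Differentiability at 0 of a map vanishing at 0, expressed without the derivative.  The point is
that this condition is stable under flows: it passes through Gronwall's inequality, so differentiable
dependence on initial values needs no solution of the variational equation.\<close>

definition asymptotically_linear :: "('a::real_normed_vector \<Rightarrow> 'b::real_normed_vector) \<Rightarrow> bool" where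
  "asymptotically_linear \<phi> \<longleftrightarrow> (\<forall>e>0. \<exists>d>0. \<forall>a1 a2 h1 h2. norm h1 < d \<longrightarrow> norm h2 < d \<longrightarrow>
      norm (a1 *\<^sub>R h1) < d \<longrightarrow> norm (a2 *\<^sub>R h2) < d \<longrightarrow> norm (a1 *\<^sub>R h1 + a2 *\<^sub>R h2) < d \<longrightarrow>
      norm (\<phi> (a1 *\<^sub>R h1 + a2 *\<^sub>R h2) - a1 *\<^sub>R \<phi> h1 - a2 *\<^sub>R \<phi> h2) \<le> e * (norm (a1 *\<^sub>R h1) + norm (a2 *\<^sub>R h2)))"

lemma differentiable_imp_asymptotically_linear:
  assumes "f differentiable (at x)"
  shows "asymptotically_linear (\<lambda>h. f (x + h) - f x)"
  unfolding asymptotically_linear_def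
proof (intro allI impI)
  fix e :: real assume e: "0 < e"
  obtain D where D: "(f has_derivative D) (at x)" using assms by (auto simp: differentiable_def)
  interpret bounded_linear D using D by (rule has_derivative_bounded_linear)
  obtain d where d: "0 < d" "\<And>y. norm (y - x) < d \<Longrightarrow> norm (f y - f x - D (y - x)) \<le> e / 2 * norm (y - x)"
    using D e unfolding has_derivative_at_alt by (meson half_gt_zero)
  define R where "R = (\<lambda>h. f (x + h) - f x - D h)"
  have R: "norm (R h) \<le> e / 2 * norm h" if "norm h < d" for h using d(2)[of "x + h"] that by (simp add: R_def)
  show "\<exists>d>0. \<forall>a1 a2 h1 h2. norm h1 < d \<longrightarrow> norm h2 < d \<longrightarrow>
      norm (a1 *\<^sub>R h1) < d \<longrightarrow> norm (a2 *\<^sub>R h2) < d \<longrightarrow> norm (a1 *\<^sub>R h1 + a2 *\<^sub>R h2) < d \<longrightarrow>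
      norm ((f (x + (a1 *\<^sub>R h1 + a2 *\<^sub>R h2)) - f x) - a1 *\<^sub>R (f (x + h1) - f x) - a2 *\<^sub>R (f (x + h2) - f x))
        \<le> e * (norm (a1 *\<^sub>R h1) + norm (a2 *\<^sub>R h2))"
  proof (intro exI[of _ d] conjI allI impI d(1))
    fix a1 a2 :: real and h1 h2 :: 'a assume h: "norm h1 < d" "norm h2 < d" "norm (a1 *\<^sub>R h1 + a2 *\<^sub>R h2) < d"
    have "(f (x + (a1 *\<^sub>R h1 + a2 *\<^sub>R h2)) - f x) - a1 *\<^sub>R (f (x + h1) - f x) - a2 *\<^sub>R (f (x + h2) - f x)
       = R (a1 *\<^sub>R h1 + a2 *\<^sub>R h2) - a1 *\<^sub>R R h1 - a2 *\<^sub>R R h2"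
      by (simp add: R_def add scaleR algebra_simps)
    also have "norm \<dots> \<le> norm (R (a1 *\<^sub>R h1 + a2 *\<^sub>R h2)) + norm (a1 *\<^sub>R R h1) + norm (a2 *\<^sub>R R h2)"
      by (meson add_mono norm_triangle_ineq4 order_refl order_trans)
    also have "\<dots> \<le> e / 2 * (norm (a1 *\<^sub>R h1) + norm (a2 *\<^sub>R h2)) + e / 2 * norm (a1 *\<^sub>R h1) + e / 2 * norm (a2 *\<^sub>R h2)"
    proof (intro add_mono)
      show "norm (R (a1 *\<^sub>R h1 + a2 *\<^sub>R h2)) \<le> e / 2 * (norm (a1 *\<^sub>R h1) + norm (a2 *\<^sub>R h2))"
        using R[OF h(3)] e norm_triangle_ineq[of "a1 *\<^sub>R h1" "a2 *\<^sub>R h2"]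
        by (meson order_trans mult_left_mono half_gt_zero less_imp_le)
      have "norm (a *\<^sub>R R h) \<le> e / 2 * norm (a *\<^sub>R h)" if "norm h < d" for a h
        using mult_left_mono[OF R[OF that], of "\<bar>a\<bar>"] by (simp add: mult_ac)
      then show "norm (a1 *\<^sub>R R h1) \<le> e / 2 * norm (a1 *\<^sub>R h1)" "norm (a2 *\<^sub>R R h2) \<le> e / 2 * norm (a2 *\<^sub>R h2)"
        using h by auto
    qed
    also have "\<dots> = e * (norm (a1 *\<^sub>R h1) + norm (a2 *\<^sub>R h2))" by (simp add: field_simps)
    finally show "norm ((f (x + (a1 *\<^sub>R h1 + a2 *\<^sub>R h2)) - f x) - a1 *\<^sub>R (f (x + h1) - f x) - a2 *\<^sub>R (f (x + h2) - f x))
        \<le> e * (norm (a1 *\<^sub>R h1) + norm (a2 *\<^sub>R h2))" .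
  qed
qed

text \<open>The case \<open>h2 = 0\<close> makes the quotients \<open>\<phi>(s w) / s\<close> Cauchy as \<open>s\<close> decreases to 0; the limit is linear
in \<open>w\<close> by the full condition, and the same special case with \<open>a = 1 / s\<close> bounds the remainder.\<close>

lemma asymptotically_linear_imp_differentiable:
  fixes f :: "'a::euclidean_space \<Rightarrow> 'b::banach"
  assumes AL: "asymptotically_linear (\<lambda>h. f (x + h) - f x)"
  shows "f differentiable (at x)"
proof -
  define \<phi> where "\<phi> = (\<lambda>h. f (x + h) - f x)"
  have \<phi>: "\<exists>d>0. \<forall>a1 a2 h1 h2. norm h1 < d \<longrightarrow> norm h2 < d \<longrightarrow>
      norm (a1 *\<^sub>R h1) < d \<longrightarrow> norm (a2 *\<^sub>R h2) < d \<longrightarrow> norm (a1 *\<^sub>R h1 + a2 *\<^sub>R h2) < d \<longrightarrow>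
      norm (\<phi> (a1 *\<^sub>R h1 + a2 *\<^sub>R h2) - a1 *\<^sub>R \<phi> h1 - a2 *\<^sub>R \<phi> h2) \<le> e * (norm (a1 *\<^sub>R h1) + norm (a2 *\<^sub>R h2))"
    if "0 < e" for e using AL that unfolding asymptotically_linear_def \<phi>_def by blast
  have one: "\<exists>d>0. \<forall>a h. norm h < d \<longrightarrow> norm (a *\<^sub>R h) < d \<longrightarrow>
      norm (\<phi> (a *\<^sub>R h) - a *\<^sub>R \<phi> h) \<le> e * norm (a *\<^sub>R h)" if e: "0 < e" for e
  proof -
    obtain d where d: "0 < d" "\<forall>a1 a2 h1 h2. norm h1 < d \<longrightarrow> norm h2 < d \<longrightarrow>
      norm (a1 *\<^sub>R h1) < d \<longrightarrow> norm (a2 *\<^sub>R h2) < d \<longrightarrow> norm (a1 *\<^sub>R h1 + a2 *\<^sub>R h2) < d \<longrightarrow>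
      norm (\<phi> (a1 *\<^sub>R h1 + a2 *\<^sub>R h2) - a1 *\<^sub>R \<phi> h1 - a2 *\<^sub>R \<phi> h2) \<le> e * (norm (a1 *\<^sub>R h1) + norm (a2 *\<^sub>R h2))"
      using \<phi>[OF e] by blast
    have "norm (\<phi> (a *\<^sub>R h) - a *\<^sub>R \<phi> h) \<le> e * norm (a *\<^sub>R h)" if "norm h < d" "norm (a *\<^sub>R h) < d" for a h
      using d(2)[rule_format, of h 0 a 0] that d(1) by simp
    then show ?thesis using d(1) by blast
  qed
  define q where "q = (\<lambda>w s. (1 / s) *\<^sub>R \<phi> (s *\<^sub>R w))"
  have small: "\<forall>\<^sub>F s in at_right (0::real). norm (s *\<^sub>R w) < d" if "0 < d" for w :: 'a and d
  proof -
    have "((\<lambda>s. norm (s *\<^sub>R w)) \<longlongrightarrow> norm (0 *\<^sub>R w)) (at_right 0)" by (intro tendsto_intros)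
    then show ?thesis using that by (auto dest: order_tendstoD(2))
  qed
  have pos: "\<forall>\<^sub>F s in at_right (0::real). 0 < s" by (simp add: eventually_at_right_less)
  have qlim: "\<exists>l. (q w \<longlongrightarrow> l) (at_right 0)" for w
  proof -
    have "cauchy_filter (filtermap (q w) (at_right 0))"
      unfolding cauchy_filter_metric_filtermap
    proof (intro allI impI)
      fix e :: real assume e: "0 < e"
      define c where "c = e / (2 * (norm w + 1))"
      have n: "0 \<le> norm w" by simp
      have "norm w < 2 * (norm w + 1)" using n by (simp add: add_nonneg_pos)
      then have "e * norm w < e * (2 * (norm w + 1))" using e by simp
      moreover have P: "0 < 2 * (norm w + 1)" using n by (simp add: add_nonneg_pos)
      ultimately have "e * norm w / (2 * (norm w + 1)) < e" by (simp only: pos_divide_less_eq)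
      then have c: "0 < c" "c * norm w < e" using divide_pos_pos[OF e P] by (simp_all only: c_def times_divide_eq_left)
      obtain d where d: "0 < d" "\<forall>a h. norm h < d \<longrightarrow> norm (a *\<^sub>R h) < d \<longrightarrow>
        norm (\<phi> (a *\<^sub>R h) - a *\<^sub>R \<phi> h) \<le> c * norm (a *\<^sub>R h)" using one[OF c(1)] by blast
      show "\<exists>P. eventually P (at_right 0) \<and> (\<forall>s t. P s \<and> P t \<longrightarrow> dist (q w s) (q w t) < e)"
      proof (intro exI[of _ "\<lambda>s. norm (s *\<^sub>R w) < d \<and> 0 < s"] conjI allI impI)
        show "\<forall>\<^sub>F s in at_right 0. norm (s *\<^sub>R w) < d \<and> 0 < s"
          using small[OF d(1)] pos by eventually_elim simp
        fix s t assume st: "(norm (s *\<^sub>R w) < d \<and> 0 < s) \<and> (norm (t *\<^sub>R w) < d \<and> 0 < t)"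
        have "norm (\<phi> ((s / t) *\<^sub>R (t *\<^sub>R w)) - (s / t) *\<^sub>R \<phi> (t *\<^sub>R w)) \<le> c * norm ((s / t) *\<^sub>R (t *\<^sub>R w))"
          by (rule d(2)[rule_format]) (use st in auto)
        then have "norm (\<phi> (s *\<^sub>R w) - (s / t) *\<^sub>R \<phi> (t *\<^sub>R w)) \<le> c * (s * norm w)" using st by simp
        then have "(1 / s) * norm (\<phi> (s *\<^sub>R w) - (s / t) *\<^sub>R \<phi> (t *\<^sub>R w)) \<le> (1 / s) * (c * (s * norm w))"
          using st by (intro mult_left_mono) auto
        also have "\<dots> = c * norm w" using st by simp
        also have "(1 / s) * norm (\<phi> (s *\<^sub>R w) - (s / t) *\<^sub>R \<phi> (t *\<^sub>R w)) =
            norm ((1 / s) *\<^sub>R (\<phi> (s *\<^sub>R w) - (s / t) *\<^sub>R \<phi> (t *\<^sub>R w)))" using st by simp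
        also have "(1 / s) *\<^sub>R (\<phi> (s *\<^sub>R w) - (s / t) *\<^sub>R \<phi> (t *\<^sub>R w)) = q w s - q w t"
          using st by (simp add: q_def scaleR_diff_right)
        finally show "dist (q w s) (q w t) < e" using c(2) by (simp add: dist_norm)
      qed
    qed
    then show ?thesis
      using cauchy_filter_convergent[of "filtermap (q w) (at_right 0)"]
      by (auto simp: filterlim_def convergent_filter_iff)
  qed
  then obtain D where D: "\<And>w. (q w \<longlongrightarrow> D w) (at_right 0)" by metis
  have rem: "\<exists>d>0. \<forall>h. norm h < d \<longrightarrow> norm (\<phi> h - D h) \<le> e * norm h" if e: "0 < e" for e
  proof -
    obtain d where d: "0 < d" "\<forall>a h. norm h < d \<longrightarrow> norm (a *\<^sub>R h) < d \<longrightarrow>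
        norm (\<phi> (a *\<^sub>R h) - a *\<^sub>R \<phi> h) \<le> e * norm (a *\<^sub>R h)" using one[OF e] by blast
    have "norm (\<phi> h - D h) \<le> e * norm h" if h: "norm h < d" for h
    proof (rule tendsto_upperbound[OF tendsto_norm[OF tendsto_diff[OF tendsto_const D]]])
      show "\<forall>\<^sub>F s in at_right 0. norm (\<phi> h - q h s) \<le> e * norm h"
        using small[OF d(1), of h] pos
      proof eventually_elim
        case (elim s)
        have "norm (\<phi> ((1 / s) *\<^sub>R (s *\<^sub>R h)) - (1 / s) *\<^sub>R \<phi> (s *\<^sub>R h)) \<le> e * norm ((1 / s) *\<^sub>R (s *\<^sub>R h))"
          by (rule d(2)[rule_format]) (use elim h in auto)
        then show ?case using elim by (simp add: q_def)
      qed
    qed simp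
    then show ?thesis using d(1) by blast
  qed
  have lin2: "D (a1 *\<^sub>R w1 + a2 *\<^sub>R w2) = a1 *\<^sub>R D w1 + a2 *\<^sub>R D w2" for a1 a2 w1 w2
  proof -
    define W where "W = norm (a1 *\<^sub>R w1) + norm (a2 *\<^sub>R w2)"
    have "norm (D (a1 *\<^sub>R w1 + a2 *\<^sub>R w2) - a1 *\<^sub>R D w1 - a2 *\<^sub>R D w2) \<le> e * W" if e: "0 < e" for e
    proof -
      obtain d where d: "0 < d" "\<forall>a1 a2 h1 h2. norm h1 < d \<longrightarrow> norm h2 < d \<longrightarrow>
        norm (a1 *\<^sub>R h1) < d \<longrightarrow> norm (a2 *\<^sub>R h2) < d \<longrightarrow> norm (a1 *\<^sub>R h1 + a2 *\<^sub>R h2) < d \<longrightarrow>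
        norm (\<phi> (a1 *\<^sub>R h1 + a2 *\<^sub>R h2) - a1 *\<^sub>R \<phi> h1 - a2 *\<^sub>R \<phi> h2) \<le> e * (norm (a1 *\<^sub>R h1) + norm (a2 *\<^sub>R h2))"
        using \<phi>[OF e] by blast
      have "((\<lambda>s. norm (q (a1 *\<^sub>R w1 + a2 *\<^sub>R w2) s - a1 *\<^sub>R q w1 s - a2 *\<^sub>R q w2 s)) \<longlongrightarrow>
         norm (D (a1 *\<^sub>R w1 + a2 *\<^sub>R w2) - a1 *\<^sub>R D w1 - a2 *\<^sub>R D w2)) (at_right 0)"
        by (intro tendsto_intros D)
      then show ?thesis
      proof (rule tendsto_upperbound)
        show "\<forall>\<^sub>F s in at_right 0. norm (q (a1 *\<^sub>R w1 + a2 *\<^sub>R w2) s - a1 *\<^sub>R q w1 s - a2 *\<^sub>R q w2 s) \<le> e * W"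
          using small[OF d(1), of w1] small[OF d(1), of w2] small[OF d(1), of "a1 *\<^sub>R w1"]
            small[OF d(1), of "a2 *\<^sub>R w2"] small[OF d(1), of "a1 *\<^sub>R w1 + a2 *\<^sub>R w2"] pos
        proof eventually_elim
          case (elim s)
          have eq: "a1 *\<^sub>R (s *\<^sub>R w1) = s *\<^sub>R (a1 *\<^sub>R w1)" "a2 *\<^sub>R (s *\<^sub>R w2) = s *\<^sub>R (a2 *\<^sub>R w2)"
            "s *\<^sub>R (a1 *\<^sub>R w1) + s *\<^sub>R (a2 *\<^sub>R w2) = s *\<^sub>R (a1 *\<^sub>R w1 + a2 *\<^sub>R w2)"
            by (simp_all add: scaleR_add_right)
          have "norm (\<phi> (a1 *\<^sub>R (s *\<^sub>R w1) + a2 *\<^sub>R (s *\<^sub>R w2)) - a1 *\<^sub>R \<phi> (s *\<^sub>R w1) - a2 *\<^sub>R \<phi> (s *\<^sub>R w2))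
            \<le> e * (norm (a1 *\<^sub>R (s *\<^sub>R w1)) + norm (a2 *\<^sub>R (s *\<^sub>R w2)))"
            by (rule d(2)[rule_format]) (use elim in \<open>simp_all only: eq\<close>)
          also have "\<dots> = s * (e * W)" unfolding eq(1,2) using elim by (simp add: W_def abs_mult algebra_simps)
          finally have *: "norm (\<phi> (s *\<^sub>R (a1 *\<^sub>R w1 + a2 *\<^sub>R w2)) - a1 *\<^sub>R \<phi> (s *\<^sub>R w1) - a2 *\<^sub>R \<phi> (s *\<^sub>R w2)) \<le> s * (e * W)"
            unfolding eq(1,2) eq(3) .
          have "q (a1 *\<^sub>R w1 + a2 *\<^sub>R w2) s - a1 *\<^sub>R q w1 s - a2 *\<^sub>R q w2 s =
             (1 / s) *\<^sub>R (\<phi> (s *\<^sub>R (a1 *\<^sub>R w1 + a2 *\<^sub>R w2)) - a1 *\<^sub>R \<phi> (s *\<^sub>R w1) - a2 *\<^sub>R \<phi> (s *\<^sub>R w2))"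
            by (simp add: q_def scaleR_diff_right)
          then have "norm (q (a1 *\<^sub>R w1 + a2 *\<^sub>R w2) s - a1 *\<^sub>R q w1 s - a2 *\<^sub>R q w2 s) =
             (1 / s) * norm (\<phi> (s *\<^sub>R (a1 *\<^sub>R w1 + a2 *\<^sub>R w2)) - a1 *\<^sub>R \<phi> (s *\<^sub>R w1) - a2 *\<^sub>R \<phi> (s *\<^sub>R w2))"
            using elim by simp
          also have "\<dots> \<le> (1 / s) * (s * (e * W))" using elim by (intro mult_left_mono *) auto
          finally show ?case using elim by simp
        qed
      qed simp
    qed
    then have "norm (D (a1 *\<^sub>R w1 + a2 *\<^sub>R w2) - a1 *\<^sub>R D w1 - a2 *\<^sub>R D w2) \<le> 0 + e" if "0 < e" for e
    proof -
      define c where "c = e / (W + 1)"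
      have W: "0 \<le> W" by (simp add: W_def)
      have "0 < c" "c * W \<le> e" using that W by (auto simp: c_def field_simps)
      then show ?thesis using \<open>\<And>e. 0 < e \<Longrightarrow> norm (D (a1 *\<^sub>R w1 + a2 *\<^sub>R w2) - a1 *\<^sub>R D w1 - a2 *\<^sub>R D w2) \<le> e * W\<close>[of c] by simp
    qed
    then have "norm (D (a1 *\<^sub>R w1 + a2 *\<^sub>R w2) - a1 *\<^sub>R D w1 - a2 *\<^sub>R D w2) \<le> 0" by (rule field_le_epsilon)
    then show ?thesis by (simp add: algebra_simps)
  qed
  have "linear D"
  proof (rule linearI)
    show "D (x + y) = D x + D y" for x y using lin2[of 1 x 1 y] by simp
    show "D (r *\<^sub>R x) = r *\<^sub>R D x" for r x using lin2[of r x 0 x] by simp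
  qed
  then have bl: "bounded_linear D" by (simp add: linear_conv_bounded_linear)
  have "(f has_derivative D) (at x)" unfolding has_derivative_at_alt
  proof (intro conjI bl allI impI)
    fix e :: real assume "0 < e"
    then obtain d where d: "0 < d" "\<forall>h. norm h < d \<longrightarrow> norm (\<phi> h - D h) \<le> e * norm h" using rem by blast
    have "norm (f y - f x - D (y - x)) \<le> e * norm (y - x)" if "norm (y - x) < d" for y
      using d(2)[rule_format, OF that] by (simp add: \<phi>_def)
    then show "\<exists>d>0. \<forall>y. norm (y - x) < d \<longrightarrow> norm (f y - f x - D (y - x)) \<le> e * norm (y - x)"
      using d(1) by blast
  qed
  then show ?thesis by (auto simp: differentiable_def)
qed

section \<open>Linear systems with variable coefficients\<close>

lemma bounded_bilinear_matrix_vector_mult: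
  "bounded_bilinear (\<lambda>(A::real^'n^'m) (x::real^'n). A *v x)"
proof -
  have "bilinear (\<lambda>(A::real^'n^'m) (x::real^'n). A *v x)"
    unfolding bilinear_def
    by (auto intro!: linearI simp: matrix_vector_mult_add_rdistrib matrix_vector_right_distrib
        scaleR_matrix_vector_assoc matrix_vector_mult_scaleR)
  then show ?thesis by (simp add: bilinear_conv_bounded_bilinear)
qed

lemmas LL_matrix_vector = LL_bounded_bilinear[OF bounded_bilinear_matrix_vector_mult]

lemma matrix_inv_vector:
  fixes A :: "real^'n^'n"
  assumes "invertible A"
  shows "A *v (matrix_inv A *v b) = b" "matrix_inv A *v (A *v b) = b"
proof -
  have "A ** matrix_inv A = mat 1 \<and> matrix_inv A ** A = mat 1"
    using assms unfolding invertible_def matrix_inv_def by (rule someI_ex)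
  then show "A *v (matrix_inv A *v b) = b" "matrix_inv A *v (A *v b) = b"
    by (simp_all add: matrix_vector_mul_assoc)
qed

lemma matrix_lower_bound:
  fixes A :: "real^'n^'n"
  assumes "invertible A"
  obtains m where "0 < m" "\<And>x. m * norm x \<le> norm (A *v x)"
proof -
  obtain K where K: "0 < K" "\<And>x. norm (matrix_inv A *v x) \<le> norm x * K"
    using bounded_linear.pos_bounded[OF matrix_vector_mul_bounded_linear, of "matrix_inv A"] by blast
  show ?thesis
  proof (rule that[of "1 / K"])
    show "0 < 1 / K" using K by simp
    fix x show "1 / K * norm x \<le> norm (A *v x)"
      using K(2)[of "A *v x"] K(1) matrix_inv_vector(2)[OF assms] by (simp add: field_simps)
  qed
qed

lemma uniform_lower_bound:
  fixes G :: "'a::metric_space \<Rightarrow> real^'n^'n"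
  assumes cont: "continuous_on S G" and x: "x \<in> S" and inv: "invertible (G x)"
  obtains d m where "0 < d" "0 < m" "\<And>y w. y \<in> S \<Longrightarrow> dist y x < d \<Longrightarrow> m * norm w \<le> norm (G y *v w)"
proof -
  obtain m where m: "0 < m" "\<And>w. m * norm w \<le> norm (G x *v w)" using matrix_lower_bound[OF inv] by blast
  obtain K where K: "0 < K" "\<And>A w. norm ((A::real^'n^'n) *v w) \<le> norm A * norm w * K"
    using bounded_bilinear.pos_bounded[OF bounded_bilinear_matrix_vector_mult] by blast
  obtain d where d: "0 < d" "\<And>y. y \<in> S \<Longrightarrow> dist y x < d \<Longrightarrow> dist (G y) (G x) < m / (2 * K)"
    using cont x m K unfolding continuous_on_iff by (metis divide_pos_pos mult_pos_pos zero_less_numeral)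
  show ?thesis
  proof (rule that[of d "m / 2"])
    fix y w assume y: "y \<in> S" "dist y x < d"
    have "norm ((G y - G x) *v w) \<le> norm (G y - G x) * norm w * K" by (rule K(2))
    also have "\<dots> \<le> m / (2 * K) * norm w * K"
      using d(2)[OF y] K(1) by (intro mult_right_mono) (auto simp: dist_norm)
    also have "\<dots> = m / 2 * norm w" using K(1) by simp
    finally have 1: "norm ((G y - G x) *v w) \<le> m / 2 * norm w" .
    have "G x *v w = G y *v w - (G y - G x) *v w" by (simp add: matrix_vector_mult_diff_rdistrib)
    then have "norm (G x *v w) \<le> norm (G y *v w) + norm ((G y - G x) *v w)" by (metis norm_triangle_ineq4)
    then show "m / 2 * norm w \<le> norm (G y *v w)" using m(2)[of w] 1 by linarith
  qed (use d m in auto)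
qed

text \<open>For the solution \<open>H\<close> of \<open>G H = b\<close> one has \<open>G(y) (H(y) - H(z)) = b(y) - b(z) - (G(y) - G(z)) H(z)\<close>, and
\<open>G\<close> is uniformly bounded below near an invertible value.  Regularity of \<open>H\<close> thus follows from
that of \<open>G\<close> and \<open>b\<close> without any statement about the inverse matrix.\<close>

lemma solve_bounds:
  fixes G :: "'a::metric_space \<Rightarrow> real^'n^'n" and b :: "'a \<Rightarrow> real^'n"
  assumes G: "continuous_on S G" and b: "continuous_on S b"
    and inv: "\<And>z. z \<in> S \<Longrightarrow> invertible (G z)" and H: "\<And>z. z \<in> S \<Longrightarrow> G z *v H z = b z" and x: "x \<in> S"
  obtains d C where "0 < d" "0 < C"
    "\<And>y z. y \<in> S \<Longrightarrow> z \<in> S \<Longrightarrow> dist y x < d \<Longrightarrow> dist z x < d \<Longrightarrow>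
        norm (H y - H z) \<le> C * (norm (b y - b z) + norm (G y - G z))"
proof -
  obtain d0 m where d0: "0 < d0" "0 < m" "\<And>y w. y \<in> S \<Longrightarrow> dist y x < d0 \<Longrightarrow> m * norm w \<le> norm (G y *v w)"
    using uniform_lower_bound[OF G x inv[OF x]] by blast
  obtain K where K: "0 < K" "\<And>A w. norm ((A::real^'n^'n) *v w) \<le> norm A * norm w * K"
    using bounded_bilinear.pos_bounded[OF bounded_bilinear_matrix_vector_mult] by blast
  obtain d1 where d1: "0 < d1" "\<And>y. y \<in> S \<Longrightarrow> dist y x < d1 \<Longrightarrow> dist (b y) (b x) < 1"
    using b x unfolding continuous_on_iff by (meson zero_less_one)
  define B where "B = (norm (b x) + 1) / m"
  have B: "0 < B" using d0 by (auto simp: B_def add_nonneg_pos)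
  have Hb: "norm (H y) \<le> B" if y: "y \<in> S" "dist y x < min d0 d1" for y
  proof -
    have "norm (b y - b x) < 1" using d1(2)[OF y(1)] y(2) by (simp add: dist_norm)
    then have "norm (b y) \<le> norm (b x) + 1" using norm_triangle_sub[of "b y" "b x"] by linarith
    moreover have "m * norm (H y) \<le> norm (b y)" using d0(3)[OF y(1), of "H y"] H[OF y(1)] y(2) by simp
    ultimately have "m * norm (H y) \<le> norm (b x) + 1" by linarith
    then show ?thesis using d0(2) by (simp add: B_def field_simps)
  qed
  define C where "C = max 1 (B * K) / m"
  show ?thesis
  proof (rule that[of "min d0 d1" C])
    fix y z assume yz: "y \<in> S" "z \<in> S" "dist y x < min d0 d1" "dist z x < min d0 d1"
    have "G y *v (H y - H z) = (b y - b z) - (G y - G z) *v H z"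
      using H[OF yz(1)] H[OF yz(2)] by (simp add: matrix_vector_mult_diff_distrib matrix_vector_mult_diff_rdistrib)
    then have "norm (G y *v (H y - H z)) \<le> norm (b y - b z) + norm ((G y - G z) *v H z)"
      by (metis norm_triangle_ineq4)
    also have "\<dots> \<le> norm (b y - b z) + norm (G y - G z) * B * K"
      using K Hb[OF yz(2,4)] by (intro add_left_mono order_trans[OF K(2)] mult_right_mono mult_left_mono) auto
    also have "\<dots> \<le> max 1 (B * K) * norm (b y - b z) + max 1 (B * K) * norm (G y - G z)"
    proof (rule add_mono)
      show "norm (b y - b z) \<le> max 1 (B * K) * norm (b y - b z)"
        using mult_right_mono[of 1 "max 1 (B * K)" "norm (b y - b z)"] by simp
      show "norm (G y - G z) * B * K \<le> max 1 (B * K) * norm (G y - G z)"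
        using mult_right_mono[of "B * K" "max 1 (B * K)" "norm (G y - G z)"] by (simp add: mult_ac)
    qed
    finally have "m * norm (H y - H z) \<le> max 1 (B * K) * (norm (b y - b z) + norm (G y - G z))"
      using d0(3)[of y "H y - H z"] yz unfolding distrib_left by auto
    then show "norm (H y - H z) \<le> C * (norm (b y - b z) + norm (G y - G z))"
      using d0(2) by (simp add: C_def field_simps)
  qed (use d0 d1 in \<open>auto simp: C_def max_def\<close>)
qed

lemma LL_solve:
  fixes G :: "'a::metric_space \<Rightarrow> real^'n^'n" and b :: "'a \<Rightarrow> real^'n"
  assumes G: "LL G S" and b: "LL b S"
    and inv: "\<And>z. z \<in> S \<Longrightarrow> invertible (G z)" and H: "\<And>z. z \<in> S \<Longrightarrow> G z *v H z = b z"
  shows "LL H S"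
proof (rule LL_I)
  fix x assume x: "x \<in> S"
  obtain d C where d: "0 < d" "0 < C" "\<And>y z. y \<in> S \<Longrightarrow> z \<in> S \<Longrightarrow> dist y x < d \<Longrightarrow> dist z x < d \<Longrightarrow>
        norm (H y - H z) \<le> C * (norm (b y - b z) + norm (G y - G z))"
    using solve_bounds[OF LL_continuous_on[OF G] LL_continuous_on[OF b] inv H x] by blast
  obtain e1 K1 where 1: "0 < e1" "K1-lipschitz_on (ball x e1 \<inter> S) G"
    using G x unfolding locally_lipschitz_on_def by blast
  obtain e2 K2 where 2: "0 < e2" "K2-lipschitz_on (ball x e2 \<inter> S) b"
    using b x unfolding locally_lipschitz_on_def by blast
  define e where "e = min d (min e1 e2)"
  have fin: "dist (H y) (H z) \<le> C * (K2 + K1) * dist y z" if yz: "y \<in> ball x e \<inter> S" "z \<in> ball x e \<inter> S" for y z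
  proof -
    have "dist (b y) (b z) \<le> K2 * dist y z" using yz by (intro lipschitz_onD[OF 2(2)]) (auto simp: e_def)
    moreover have "dist (G y) (G z) \<le> K1 * dist y z" using yz by (intro lipschitz_onD[OF 1(2)]) (auto simp: e_def)
    ultimately have "C * (norm (b y - b z) + norm (G y - G z)) \<le> C * (K2 * dist y z + K1 * dist y z)"
      using d(2) by (intro mult_left_mono add_mono) (auto simp: dist_norm)
    moreover have "norm (H y - H z) \<le> C * (norm (b y - b z) + norm (G y - G z))"
      using yz by (intro d(3)) (auto simp: e_def dist_commute)
    ultimately show ?thesis by (simp add: dist_norm algebra_simps)
  qed
  show "\<exists>e>0. \<exists>K. \<forall>y\<in>ball x e \<inter> S. \<forall>z\<in>ball x e \<inter> S. dist (H y) (H z) \<le> K * dist y z"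
    using d(1) 1(1) 2(1) by (intro exI[of _ e] conjI exI[of _ "C * (K2 + K1)"] ballI fin) (auto simp: e_def)
qed

lemma continuous_on_solve:
  fixes G :: "'a::metric_space \<Rightarrow> real^'n^'n" and b :: "'a \<Rightarrow> real^'n"
  assumes G: "continuous_on S G" and b: "continuous_on S b"
    and inv: "\<And>z. z \<in> S \<Longrightarrow> invertible (G z)" and H: "\<And>z. z \<in> S \<Longrightarrow> G z *v H z = b z"
  shows "continuous_on S H"
  unfolding continuous_on_def
proof
  fix x assume x: "x \<in> S"
  obtain d C where d: "0 < d" "0 < C" "\<And>y z. y \<in> S \<Longrightarrow> z \<in> S \<Longrightarrow> dist y x < d \<Longrightarrow> dist z x < d \<Longrightarrow>
        norm (H y - H z) \<le> C * (norm (b y - b z) + norm (G y - G z))"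
    using solve_bounds[OF G b inv H x] by blast
  have "((\<lambda>y. C * (norm (b y - b x) + norm (G y - G x))) \<longlongrightarrow> C * (norm (b x - b x) + norm (G x - G x))) (at x within S)"
    using G b x unfolding continuous_on_def by (intro tendsto_intros) auto
  then have lim: "((\<lambda>y. C * (norm (b y - b x) + norm (G y - G x))) \<longlongrightarrow> 0) (at x within S)" by simp
  have "((\<lambda>y. H y - H x) \<longlongrightarrow> 0) (at x within S)"
  proof (rule Lim_null_comparison[OF _ lim])
    show "\<forall>\<^sub>F y in at x within S. norm (H y - H x) \<le> C * (norm (b y - b x) + norm (G y - G x))"
      unfolding eventually_at using d x by (intro exI[of _ d]) auto
  qed
  then show "(H \<longlongrightarrow> H x) (at x within S)" by (simp add: LIM_zero_iff)
qed

section \<open>Continuously differentiable maps\<close>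

text \<open>Continuity of the derivative is asked for in each fixed direction only, which in finite dimension is the
same as continuity in operator norm.\<close>

definition C1_on :: "('a::real_normed_vector \<Rightarrow> 'b::real_normed_vector) \<Rightarrow> 'a set \<Rightarrow> bool" where
  "C1_on f S \<longleftrightarrow> (\<exists>f'. (\<forall>z\<in>S. (f has_derivative f' z) (at z)) \<and> (\<forall>w. continuous_on S (\<lambda>z. f' z w)))"

lemma C1_onI:
  "(\<And>z. z \<in> S \<Longrightarrow> (f has_derivative f' z) (at z)) \<Longrightarrow> (\<And>w. continuous_on S (\<lambda>z. f' z w)) \<Longrightarrow> C1_on f S"
  unfolding C1_on_def by blast

lemma C1_on_continuous: "C1_on f S \<Longrightarrow> continuous_on S f"
  unfolding C1_on_def by (metis continuous_at_imp_continuous_on has_derivative_continuous)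

lemma C1_on_bounded_linear: assumes "bounded_linear h" shows "C1_on h S"
  by (rule C1_onI[where f'="\<lambda>z. h"]) (auto intro: bounded_linear_imp_has_derivative assms continuous_on_const)

lemma C1_on_const: "C1_on (\<lambda>z. c) S"
  by (rule C1_onI[where f'="\<lambda>z w. 0"]) auto

lemma C1_on_linear_compose:
  assumes h: "bounded_linear h" and f: "C1_on f S" shows "C1_on (\<lambda>z. h (f z)) S"
proof -
  obtain f' where f': "\<forall>z\<in>S. (f has_derivative f' z) (at z)" "\<forall>w. continuous_on S (\<lambda>z. f' z w)"
    using f unfolding C1_on_def by blast
  show ?thesis
  proof (rule C1_onI)
    fix z assume "z \<in> S"
    then show "((\<lambda>z. h (f z)) has_derivative (\<lambda>w. h (f' z w))) (at z)"
      using f' by (intro bounded_linear.has_derivative[OF h]) auto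
  next
    fix w show "continuous_on S (\<lambda>z. h (f' z w))"
      using f' by (intro bounded_linear.continuous_on[OF h]) auto
  qed
qed

lemma C1_on_add: assumes "C1_on f S" "C1_on g S" shows "C1_on (\<lambda>z. f z + g z) S"
proof -
  obtain f' where f': "\<forall>z\<in>S. (f has_derivative f' z) (at z)" "\<forall>w. continuous_on S (\<lambda>z. f' z w)"
    using assms unfolding C1_on_def by blast
  obtain g' where g': "\<forall>z\<in>S. (g has_derivative g' z) (at z)" "\<forall>w. continuous_on S (\<lambda>z. g' z w)"
    using assms unfolding C1_on_def by blast
  show ?thesis
    by (rule C1_onI[where f'="\<lambda>z w. f' z w + g' z w"])
       (use f' g' in \<open>auto intro!: has_derivative_add continuous_on_add\<close>)
qed

lemma C1_on_sum: "(\<And>i. i \<in> I \<Longrightarrow> C1_on (f i) S) \<Longrightarrow> C1_on (\<lambda>z. \<Sum>i\<in>I. f i z) S"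
proof (induction I rule: infinite_finite_induct)
  case (insert i I)
  have "C1_on (\<lambda>z. f i z + (\<Sum>i\<in>I. f i z)) S" by (rule C1_on_add) (use insert in auto)
  then show ?case using insert by simp
qed (simp_all add: C1_on_const)

lemma C1_on_bounded_bilinear:
  assumes b: "bounded_bilinear b" and f: "C1_on f S" and g: "C1_on g S"
  shows "C1_on (\<lambda>z. b (f z) (g z)) S"
proof -
  interpret bounded_bilinear b by fact
  obtain f' where f': "\<forall>z\<in>S. (f has_derivative f' z) (at z)" "\<forall>w. continuous_on S (\<lambda>z. f' z w)"
    using f unfolding C1_on_def by blast
  obtain g' where g': "\<forall>z\<in>S. (g has_derivative g' z) (at z)" "\<forall>w. continuous_on S (\<lambda>z. g' z w)"
    using g unfolding C1_on_def by blast
  show ?thesis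
  proof (rule C1_onI)
    fix z assume "z \<in> S"
    then show "((\<lambda>z. b (f z) (g z)) has_derivative (\<lambda>w. b (f z) (g' z w) + b (f' z w) (g z))) (at z)"
      using f' g' by (intro FDERIV) auto
  next
    fix w show "continuous_on S (\<lambda>z. b (f z) (g' z w) + b (f' z w) (g z))"
      using f' g' C1_on_continuous[OF f] C1_on_continuous[OF g] by (intro continuous_on_add continuous_on) auto
  qed
qed

lemmas C1_on_mult = C1_on_bounded_bilinear[OF bounded_bilinear_mult]
lemmas C1_on_scaleR = C1_on_bounded_bilinear[OF bounded_bilinear_scaleR]

lemma C1_on_vec:
  fixes f :: "'a::real_normed_vector \<Rightarrow> real ^ 'n"
  assumes "\<And>i. C1_on (\<lambda>x. f x $ i) S"
  shows "C1_on f S"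
proof -
  have "C1_on (\<lambda>x. \<Sum>i\<in>UNIV. f x $ i *\<^sub>R axis i (1::real)) S"
    by (intro C1_on_sum C1_on_scaleR assms C1_on_const)
  moreover have "(\<Sum>i\<in>UNIV. f x $ i *\<^sub>R axis i (1::real)) = f x" for x
    using basis_expansion[of "f x"] by (simp only: scalar_mult_eq_scaleR)
  ultimately show ?thesis by simp
qed

lemma C1_on_Pair: assumes "C1_on f S" "C1_on g S" shows "C1_on (\<lambda>z. (f z, g z)) S"
proof -
  obtain f' where f': "\<forall>z\<in>S. (f has_derivative f' z) (at z)" "\<forall>w. continuous_on S (\<lambda>z. f' z w)"
    using assms unfolding C1_on_def by blast
  obtain g' where g': "\<forall>z\<in>S. (g has_derivative g' z) (at z)" "\<forall>w. continuous_on S (\<lambda>z. g' z w)"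
    using assms unfolding C1_on_def by blast
  show ?thesis
    by (rule C1_onI[where f'="\<lambda>z w. (f' z w, g' z w)"])
       (use f' g' in \<open>auto intro!: has_derivative_Pair continuous_on_Pair\<close>)
qed

text \<open>Differentiating \<open>G H = b\<close> gives \<open>G H' = b' - G' H\<close>.  The product \<open>(G(y) - G(z)) (H(y) - H(z))\<close> of an
increment of order \<open>|y - z|\<close> with one that tends to 0 is negligible, which makes \<open>H\<close> differentiable.\<close>

lemma C1_on_solve:
  fixes G :: "'a::real_normed_vector \<Rightarrow> real^'n^'n" and b :: "'a \<Rightarrow> real^'n"
  assumes S: "open S" and G: "C1_on G S" and b: "C1_on b S"
    and inv: "\<And>z. z \<in> S \<Longrightarrow> invertible (G z)" and H: "\<And>z. z \<in> S \<Longrightarrow> G z *v H z = b z"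
  shows "C1_on H S"
proof -
  obtain G' where G': "\<forall>z\<in>S. (G has_derivative G' z) (at z)" "\<forall>w. continuous_on S (\<lambda>z. G' z w)"
    using G unfolding C1_on_def by blast
  obtain b' where b': "\<forall>z\<in>S. (b has_derivative b' z) (at z)" "\<forall>w. continuous_on S (\<lambda>z. b' z w)"
    using b unfolding C1_on_def by blast
  have Gc: "continuous_on S G" and bc: "continuous_on S b" using G b by (auto intro: C1_on_continuous)
  have Hc: "continuous_on S H" by (rule continuous_on_solve[OF Gc bc inv H])
  interpret bb: bounded_bilinear "\<lambda>(A::real^'n^'n) (x::real^'n). A *v x"
    by (rule bounded_bilinear_matrix_vector_mult)
  define H' where "H' = (\<lambda>z w. matrix_inv (G z) *v (b' z w - G' z w *v H z))"
  show ?thesis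
  proof (rule C1_onI)
    fix z assume z: "z \<in> S"
    have d1: "((\<lambda>y. (G y - G z) *v (H y - H z)) has_derivative (\<lambda>w. 0)) (at z)"
    proof -
      obtain K where K: "0 < K" "\<And>A w. norm ((A::real^'n^'n) *v w) \<le> norm A * norm w * K"
        using bb.pos_bounded by blast
      obtain D where D: "0 < D" "\<And>w. norm (G' z w) \<le> norm w * D"
        using bounded_linear.pos_bounded[OF has_derivative_bounded_linear[OF bspec[OF G'(1) z]]] by blast
      have "isCont H z" using Hc S z continuous_on_eq_continuous_at by blast
      then have Hlim: "(H \<longlongrightarrow> H z) (at z)" by (simp only: isCont_def)
      show ?thesis unfolding has_derivative_at_alt
      proof (intro conjI allI impI)
        fix e :: real assume e: "0 < e"
        define c where "c = e / ((1 + D) * K)"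
        have DK: "0 < (1 + D) * K" using K(1) D(1) by simp
        have c: "0 < c" unfolding c_def by (rule divide_pos_pos[OF e DK])
        have "x \<noteq> 0 \<Longrightarrow> e / x * x = e" for x by simp
        then have ce: "c * ((1 + D) * K) = e" unfolding c_def using DK by (metis less_irrefl)
        obtain d1 where d1: "0 < d1" "\<forall>y. norm (y - z) < d1 \<longrightarrow> norm (G y - G z - G' z (y - z)) \<le> 1 * norm (y - z)"
          using G'(1) z unfolding has_derivative_at_alt by (meson zero_less_one)
        have "\<forall>\<^sub>F y in at z. dist (H y) (H z) < c" using Hlim c by (rule tendstoD)
        then obtain d2 where d2: "0 < d2" "\<And>y. y \<noteq> z \<Longrightarrow> dist y z < d2 \<Longrightarrow> dist (H y) (H z) < c"
          unfolding eventually_at by auto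
        have "norm ((G y - G z) *v (H y - H z) - (G z - G z) *v (H z - H z) - 0) \<le> e * norm (y - z)"
          if y: "norm (y - z) < min d1 d2" for y
        proof -
          have "norm (G y - G z) \<le> norm (G y - G z - G' z (y - z)) + norm (G' z (y - z))"
            by (metis norm_triangle_sub add.commute)
          also have "\<dots> \<le> (1 + D) * norm (y - z)" using d1(2)[rule_format, of y] y D(2)[of "y - z"] by (simp add: distrib_right mult.commute[of D])
          finally have g: "norm (G y - G z) \<le> (1 + D) * norm (y - z)" .
          have h: "norm (H y - H z) \<le> c" using d2(2)[of y] y c by (cases "y = z") (auto simp: dist_norm less_imp_le)
          have "norm ((G y - G z) *v (H y - H z)) \<le> norm (G y - G z) * norm (H y - H z) * K" by (rule K(2))
          also have "\<dots> \<le> ((1 + D) * norm (y - z)) * c * K"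
            using g h K(1) c D(1) by (intro mult_right_mono mult_mono) auto
          also have "\<dots> = (c * ((1 + D) * K)) * norm (y - z)" by (simp only: mult_ac)
          also have "\<dots> = e * norm (y - z)" by (simp only: ce)
          finally show ?thesis by (simp add: bb.zero_left)
        qed
        then show "\<exists>d>0. \<forall>y. norm (y - z) < d \<longrightarrow>
            norm ((G y - G z) *v (H y - H z) - (G z - G z) *v (H z - H z) - 0) \<le> e * norm (y - z)"
          using d1(1) d2(1) by (intro exI[of _ "min d1 d2"]) auto
      qed simp
    qed
    have "((\<lambda>y. G y - G z) has_derivative (\<lambda>w. G' z w - 0)) (at z)"
      by (rule has_derivative_diff[OF bspec[OF G'(1) z] has_derivative_const])
    from bounded_linear.has_derivative[OF bb.bounded_linear_left this, of "H z"]
    have "((\<lambda>y. (G y - G z) *v H z) has_derivative (\<lambda>w. G' z w *v H z)) (at z)" by simp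
    note d2 = has_derivative_diff[OF bspec[OF b'(1) z] this]
    have "((\<lambda>y. matrix_inv (G z) *v ((b y - (G y - G z) *v H z) - (G y - G z) *v (H y - H z)))
        has_derivative (\<lambda>w. matrix_inv (G z) *v ((b' z w - G' z w *v H z) - 0))) (at z)"
      by (rule bounded_linear.has_derivative[OF matrix_vector_mul_bounded_linear has_derivative_diff[OF d2 d1]])
    then have "((\<lambda>y. matrix_inv (G z) *v ((b y - (G y - G z) *v H z) - (G y - G z) *v (H y - H z)))
        has_derivative H' z) (at z)" by (simp add: H'_def)
    then show "(H has_derivative H' z) (at z)"
    proof (rule has_derivative_transform_within_open[OF _ S z])
      fix y assume y: "y \<in> S"
      have "(b y - (G y - G z) *v H z) - (G y - G z) *v (H y - H z) = G z *v H y"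
        using H[OF y] by (simp add: matrix_vector_mult_diff_distrib matrix_vector_mult_diff_rdistrib)
      then show "matrix_inv (G z) *v ((b y - (G y - G z) *v H z) - (G y - G z) *v (H y - H z)) = H y"
        using matrix_inv_vector(2)[OF inv[OF z]] by simp
    qed
  next
    fix w
    show "continuous_on S (\<lambda>z. H' z w)"
    proof (rule continuous_on_solve[OF Gc _ inv])
      show "continuous_on S (\<lambda>z. b' z w - G' z w *v H z)"
        using b'(2) G'(2) Hc by (intro continuous_on_diff bb.continuous_on) auto
      show "G z *v H' z w = b' z w - G' z w *v H z" if "z \<in> S" for z
        unfolding H'_def using matrix_inv_vector(1)[OF inv[OF that]] .
    qed
  qed
qed

section \<open>Charts, transition maps and tangent vectors\<close>

lemma linear_axis:
  fixes f :: "real^'k \<Rightarrow> 'b::real_normed_vector"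
  assumes "linear f" shows "f w = (\<Sum>i\<in>UNIV. w $ i *\<^sub>R f (axis i 1))"
proof -
  have "f w = f (\<Sum>i\<in>UNIV. w $ i *\<^sub>R axis i 1)"
    using basis_expansion[of w] by (simp only: scalar_mult_eq_scaleR)
  also have "\<dots> = (\<Sum>i\<in>UNIV. w $ i *\<^sub>R f (axis i 1))"
    by (simp only: linear_sum[OF assms] linear_scale[OF assms])
  finally show ?thesis .
qed

definition overlap :: "('m, 'n) chart \<Rightarrow> ('m, 'n) chart \<Rightarrow> (real ^ 'n) set" where
  "overlap c d = snd c ` (fst c \<inter> fst d)"

definition tmap :: "('m, 'n) chart \<Rightarrow> ('m, 'n) chart \<Rightarrow> real ^ 'n \<Rightarrow> real ^ 'n" where
  "tmap c d = snd d \<circ> chart_inv c"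

definition Dt :: "('m, 'n::finite) chart \<Rightarrow> ('m, 'n) chart \<Rightarrow> real ^ 'n \<Rightarrow> real ^ 'n \<Rightarrow> real ^ 'n" where
  "Dt c d x = frechet_derivative (tmap c d) (at x)"

text \<open>The transition map of the tangent bundle.\<close>

definition ttrans :: "('m, 'n::finite) chart \<Rightarrow> ('m, 'n) chart \<Rightarrow>
    (real ^ 'n) \<times> (real ^ 'n) \<Rightarrow> (real ^ 'n) \<times> (real ^ 'n)" where
  "ttrans c d = (\<lambda>(x, w). (tmap c d x, Dt c d x w))"

locale c21 =
  fixes A :: "('m::t2_space, 'n::finite) chart set"
  assumes atlas: "C21_atlas A"
begin

lemma chart_cover: obtains c where "c \<in> A" "q \<in> fst c"
  using atlas unfolding C21_atlas_def by blast

lemma chart_open: "c \<in> A \<Longrightarrow> open (fst c)" and chart_image_open: "c \<in> A \<Longrightarrow> open (snd c ` fst c)"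
  and chart_homeo: "c \<in> A \<Longrightarrow> homeomorphism (fst c) (snd c ` fst c) (snd c) (chart_inv c)"
  using atlas unfolding C21_atlas_def by blast+

lemma chart_inv_chart [simp]: "c \<in> A \<Longrightarrow> q \<in> fst c \<Longrightarrow> chart_inv c (snd c q) = q"
  using homeomorphism_apply1[OF chart_homeo] by blast

lemma chart_inv_in: "c \<in> A \<Longrightarrow> x \<in> snd c ` fst c \<Longrightarrow> chart_inv c x \<in> fst c"
  using chart_inv_chart by auto

lemma chart_inv_cont: "c \<in> A \<Longrightarrow> continuous_on (snd c ` fst c) (chart_inv c)"
  using homeomorphism_cont2[OF chart_homeo] .

lemma open_chart_image:
  assumes c: "c \<in> A" and U: "open U"
  shows "open (snd c ` (U \<inter> fst c))"
proof -
  have "snd c ` (U \<inter> fst c) = snd c ` fst c \<inter> chart_inv c -` U"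
    using c by (auto simp: image_iff)
  then show ?thesis
    using continuous_open_preimage[OF chart_inv_cont[OF c] chart_image_open[OF c] U] by simp
qed

lemma overlap_open: "c \<in> A \<Longrightarrow> d \<in> A \<Longrightarrow> open (overlap c d)"
  unfolding overlap_def using open_chart_image[of c "fst d"] chart_open by (simp add: Int_commute)

lemma overlapI: "q \<in> fst c \<Longrightarrow> q \<in> fst d \<Longrightarrow> snd c q \<in> overlap c d"
  unfolding overlap_def by blast

lemma tmap_apply: "c \<in> A \<Longrightarrow> q \<in> fst c \<Longrightarrow> tmap c d (snd c q) = snd d q"
  by (simp add: tmap_def)

lemma trans_Ck: "c \<in> A \<Longrightarrow> d \<in> A \<Longrightarrow> Ck1_on 2 (tmap c d) (overlap c d)"
  using atlas unfolding C21_atlas_def tmap_def overlap_def by blast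

lemma trans_der:
  assumes "c \<in> A" "d \<in> A" "x \<in> overlap c d"
  shows "(tmap c d has_derivative Dt c d x) (at x)"
  using trans_Ck[OF assms(1,2)] assms(3) unfolding numeral_2_eq_2 Dt_def
  by (simp add: frechet_derivative_works)

lemma Dt_bl: "c \<in> A \<Longrightarrow> d \<in> A \<Longrightarrow> x \<in> overlap c d \<Longrightarrow> bounded_linear (Dt c d x)"
  by (rule has_derivative_bounded_linear[OF trans_der])

lemma Dt_der:
  assumes c: "c \<in> A" "d \<in> A"
  shows "\<exists>E. (\<forall>x\<in>overlap c d. ((\<lambda>x. Dt c d x w) has_derivative E x) (at x)) \<and> (\<forall>w'. LL (\<lambda>x. E x w') (overlap c d))"
proof -
  have 1: "Ck1_on (Suc 0) (\<lambda>x. Dt c d x w) (overlap c d)"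
    using trans_Ck[OF c] unfolding numeral_2_eq_2 Dt_def by simp
  show ?thesis
    by (rule exI[of _ "\<lambda>x. frechet_derivative (\<lambda>x. Dt c d x w) (at x)"])
       (use 1 in \<open>auto simp: frechet_derivative_works[symmetric]\<close>)
qed

lemma Dt_LL: assumes c: "c \<in> A" "d \<in> A" shows "LL (\<lambda>x. Dt c d x w) (overlap c d)"
proof -
  obtain E where E: "\<forall>x\<in>overlap c d. ((\<lambda>x. Dt c d x w) has_derivative E x) (at x)"
    "\<forall>w'. LL (\<lambda>x. E x w') (overlap c d)" using Dt_der[OF c] by blast
  show ?thesis by (rule LL_differentiable[OF overlap_open[OF c]]) (use E in auto)
qed

lemma trans_LL: "c \<in> A \<Longrightarrow> d \<in> A \<Longrightarrow> LL (tmap c d) (overlap c d)"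
  by (rule LL_differentiable[OF overlap_open trans_der Dt_LL])

lemma Dt_axis:
  assumes "c \<in> A" "d \<in> A" "x \<in> overlap c d"
  shows "Dt c d x w = (\<Sum>i\<in>UNIV. w $ i *\<^sub>R Dt c d x (axis i 1))"
  by (rule linear_axis[OF bounded_linear.linear[OF Dt_bl[OF assms]]])

lemma ttrans_LL: assumes c: "c \<in> A" "d \<in> A" shows "LL (ttrans c d) (overlap c d \<times> UNIV)"
proof -
  have f: "LL (\<lambda>z. h (fst z)) (overlap c d \<times> (UNIV :: (real^'n) set))" if "LL h (overlap c d)"
    for h :: "real^'n \<Rightarrow> real^'n"
    by (rule LL_compose[OF LL_bounded_linear[OF bounded_linear_fst] that]) auto
  have "LL (\<lambda>z. \<Sum>i\<in>UNIV. snd z $ i *\<^sub>R Dt c d (fst z) (axis i 1)) (overlap c d \<times> UNIV)"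
    by (intro LL_sum LL_scaleR LL_vec_nth LL_bounded_linear[OF bounded_linear_snd] f Dt_LL c)
  then have "LL (\<lambda>z. Dt c d (fst z) (snd z)) (overlap c d \<times> UNIV)"
    by (rule LL_cong) (auto simp: Dt_axis[OF c, symmetric])
  then have "LL (\<lambda>z. (tmap c d (fst z), Dt c d (fst z) (snd z))) (overlap c d \<times> UNIV)"
    by (intro LL_Pair f trans_LL c)
  then show ?thesis by (simp add: ttrans_def case_prod_unfold)
qed

lemma ttrans_differentiable:
  assumes c: "c \<in> A" "d \<in> A" and x: "x \<in> overlap c d"
  shows "ttrans c d differentiable (at (x, w))"
proof -
  have f: "(\<lambda>z. h (fst z)) differentiable (at (x, w))" if h: "h differentiable (at x)"
    for h :: "real^'n \<Rightarrow> real^'n"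
  proof -
    have "(h \<circ> fst) differentiable (at (x, w))"
      by (rule differentiable_chain_at) (use h in \<open>auto simp: bounded_linear_imp_differentiable[OF bounded_linear_fst]\<close>)
    then show ?thesis by (simp add: o_def)
  qed
  have sn: "(\<lambda>z. snd z $ i) differentiable (at (x, w))" for i
    using bounded_linear_imp_differentiable[OF bounded_linear_compose[OF bounded_linear_vec_nth bounded_linear_snd]] .
  have d: "(\<lambda>x. Dt c d x v) differentiable (at x)" for v
    using Dt_der[OF c, of v] x by (auto simp: differentiable_def)
  have "(\<lambda>z. \<Sum>i\<in>UNIV. snd z $ i *\<^sub>R Dt c d (fst z) (axis i 1)) differentiable (at (x, w))"
    by (intro differentiable_sum ballI differentiable_scaleR f sn d) auto
  then obtain E where E: "((\<lambda>z. \<Sum>i\<in>UNIV. snd z $ i *\<^sub>R Dt c d (fst z) (axis i 1)) has_derivative E) (at (x, w))"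
    by (auto simp: differentiable_def)
  have "((\<lambda>z. Dt c d (fst z) (snd z)) has_derivative E) (at (x, w))"
    by (rule has_derivative_transform_within_open[OF E, of "overlap c d \<times> UNIV"])
       (use x in \<open>auto simp: Dt_axis[OF c, symmetric] intro!: open_Times overlap_open c\<close>)
  note 1 = this
  have "(\<lambda>z. tmap c d (fst z)) differentiable (at (x, w))"
    using trans_der[OF c x] by (intro f) (auto simp: differentiable_def)
  then obtain F where F: "((\<lambda>z. tmap c d (fst z)) has_derivative F) (at (x, w))"
    by (auto simp: differentiable_def)
  have "(\<lambda>z. (tmap c d (fst z), Dt c d (fst z) (snd z))) differentiable (at (x, w))"
    unfolding differentiable_def by (rule exI, rule has_derivative_Pair[OF F 1])
  then show ?thesis by (simp add: ttrans_def case_prod_unfold)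
qed

lemma Dt_chain:
  assumes c: "c \<in> A" "d \<in> A" "e \<in> A" and q: "q \<in> fst c" "q \<in> fst d" "q \<in> fst e"
  shows "Dt c e (snd c q) w = Dt d e (snd d q) (Dt c d (snd c q) w)"
proof -
  define U where "U = snd c ` ((fst d \<inter> fst e) \<inter> fst c)"
  have U: "open U" unfolding U_def by (rule open_chart_image[OF c(1) open_Int[OF chart_open[OF c(2)] chart_open[OF c(3)]]])
  have qU: "snd c q \<in> U" using q by (auto simp: U_def)
  have 1: "(tmap c d has_derivative Dt c d (snd c q)) (at (snd c q))"
    using q c by (intro trans_der overlapI)
  have 2: "(tmap d e has_derivative Dt d e (snd d q)) (at (tmap c d (snd c q)))"
    using q c by (simp add: tmap_apply) (intro trans_der overlapI)
  have "((\<lambda>x. tmap d e (tmap c d x)) has_derivative (\<lambda>w. Dt d e (snd d q) (Dt c d (snd c q) w))) (at (snd c q))"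
    using has_derivative_compose[OF 1 2] .
  then have "(tmap c e has_derivative (\<lambda>w. Dt d e (snd d q) (Dt c d (snd c q) w))) (at (snd c q))"
    by (rule has_derivative_transform_within_open[OF _ U qU]) (use c in \<open>auto simp: U_def tmap_apply\<close>)
  from has_derivative_unique[OF this trans_der[OF c(1,3) overlapI[OF q(1,3)]]] show ?thesis
    by (metis)
qed

lemma Dt_self:
  assumes c: "c \<in> A" "q \<in> fst c" shows "Dt c c (snd c q) w = w"
proof -
  have "((\<lambda>x. x) has_derivative (\<lambda>w. w)) (at (snd c q))" by (rule has_derivative_ident)
  then have "(tmap c c has_derivative (\<lambda>w. w)) (at (snd c q))"
    by (rule has_derivative_transform_within_open[OF _ chart_image_open[OF c(1)]]) (use c in \<open>auto simp: tmap_apply\<close>)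
  from has_derivative_unique[OF this trans_der[OF c(1,1) overlapI[OF c(2,2)]]] show ?thesis by metis
qed

lemma tvec_of_apply:
  "tvec_of A c q w d = (if d \<in> A \<and> q \<in> fst d then Dt c d (snd c q) w else 0)"
  by (simp add: tvec_of_def Dt_def tmap_def)

lemma tvec_of_self: "c \<in> A \<Longrightarrow> q \<in> fst c \<Longrightarrow> tvec_of A c q w c = w"
  by (simp add: tvec_of_apply Dt_self)

lemma tangent_space_eq:
  "tangent_space A q = {v. (\<forall>c\<in>A. \<forall>d\<in>A. q \<in> fst c \<longrightarrow> q \<in> fst d \<longrightarrow> v d = Dt c d (snd c q) (v c)) \<and>
         (\<forall>c. c \<notin> A \<or> q \<notin> fst c \<longrightarrow> v c = 0)}"
  by (simp add: tangent_space_def Dt_def tmap_def)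

lemma tangentD: "v \<in> tangent_space A q \<Longrightarrow> c \<in> A \<Longrightarrow> d \<in> A \<Longrightarrow> q \<in> fst c \<Longrightarrow> q \<in> fst d \<Longrightarrow>
    v d = Dt c d (snd c q) (v c)"
  unfolding tangent_space_eq by blast

lemma tangent_outside: "v \<in> tangent_space A q \<Longrightarrow> c \<notin> A \<or> q \<notin> fst c \<Longrightarrow> v c = 0"
  unfolding tangent_space_eq by blast

lemma tvec_of_in: assumes c: "c \<in> A" "q \<in> fst c" shows "tvec_of A c q w \<in> tangent_space A q"
  unfolding tangent_space_eq
proof (intro CollectI conjI ballI allI impI)
  fix d e assume "d \<in> A" "e \<in> A" "q \<in> fst d" "q \<in> fst e"
  then show "tvec_of A c q w e = Dt d e (snd d q) (tvec_of A c q w d)"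
    by (simp add: tvec_of_apply) (rule Dt_chain[OF c(1) _ _ c(2)])
qed (auto simp: tvec_of_apply)

lemma tvec_of_chart:
  assumes v: "v \<in> tangent_space A q" and c: "c \<in> A" "q \<in> fst c"
  shows "tvec_of A c q (v c) = v"
proof
  fix d show "tvec_of A c q (v c) d = v d"
  proof (cases "d \<in> A \<and> q \<in> fst d")
    case True
    then have "v d = Dt c d (snd c q) (v c)" using tangentD[OF v c(1) _ c(2)] by blast
    then show ?thesis using True by (simp only: tvec_of_apply if_True simp_thms)
  next
    case False
    then have "v d = 0" using tangent_outside[OF v, of d] by blast
    then show ?thesis using False by (simp only: tvec_of_apply if_False)
  qed
qed

lemma tangent_eqI:
  assumes "v \<in> tangent_space A q" "w \<in> tangent_space A q" "c \<in> A" "q \<in> fst c" "v c = w c"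
  shows "v = w"
  using tvec_of_chart[OF assms(1,3,4)] tvec_of_chart[OF assms(2,3,4)] assms(5) by metis

lemma tvec_of_change:
  assumes "c \<in> A" "q \<in> fst c" "d \<in> A" "q \<in> fst d"
  shows "tvec_of A d q (Dt c d (snd c q) w) = tvec_of A c q w"
proof -
  have "tvec_of A c q w d = Dt c d (snd c q) w" using assms(3,4) by (simp add: tvec_of_apply)
  then show ?thesis using tvec_of_chart[OF tvec_of_in[OF assms(1,2), of w] assms(3,4)] by metis
qed

lemma tvec_of_add:
  assumes c: "c \<in> A" "q \<in> fst c" shows "tvec_of A c q (w + w') = tadd (tvec_of A c q w) (tvec_of A c q w')"
proof
  fix d show "tvec_of A c q (w + w') d = tadd (tvec_of A c q w) (tvec_of A c q w') d"
    using linear_add[OF bounded_linear.linear[OF Dt_bl[OF c(1) _ overlapI[OF c(2)]]]]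
    by (auto simp: tvec_of_apply tadd_def)
qed

lemma tvec_of_scale:
  assumes c: "c \<in> A" "q \<in> fst c" shows "tvec_of A c q (s *\<^sub>R w) = tscale s (tvec_of A c q w)"
proof
  fix d show "tvec_of A c q (s *\<^sub>R w) d = tscale s (tvec_of A c q w) d"
    using linear_scale[OF bounded_linear.linear[OF Dt_bl[OF c(1) _ overlapI[OF c(2)]]]]
    by (auto simp: tvec_of_apply tscale_def)
qed

lemma tvec_of_0: "c \<in> A \<Longrightarrow> q \<in> fst c \<Longrightarrow> tvec_of A c q 0 = tzero"
  using tvec_of_scale[of c q 0 0] by (simp add: tscale_def tzero_def)

lemma tvec_eq_tzero_iff:
  assumes "v \<in> tangent_space A q" "c \<in> A" "q \<in> fst c"
  shows "v = tzero \<longleftrightarrow> v c = 0"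
proof
  assume "v c = 0"
  then show "v = tzero" using tvec_of_chart[OF assms] tvec_of_0[OF assms(2,3)] by metis
qed (simp add: tzero_def)

lemma tvec_of_eq_tzero_iff: "c \<in> A \<Longrightarrow> q \<in> fst c \<Longrightarrow> tvec_of A c q w = tzero \<longleftrightarrow> w = 0"
  using tvec_eq_tzero_iff[OF tvec_of_in] by (simp add: tvec_of_self)

lemma tscale_in: assumes "v \<in> tangent_space A q" shows "tscale s v \<in> tangent_space A q"
proof -
  obtain c where c: "c \<in> A" "q \<in> fst c" by (rule chart_cover)
  have "tscale s v = tvec_of A c q (s *\<^sub>R v c)" by (simp only: tvec_of_scale[OF c] tvec_of_chart[OF assms c])
  then show ?thesis by (simp only: tvec_of_in[OF c])
qed

lemma tzero_in: "tzero \<in> tangent_space A q"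
proof -
  obtain c where c: "c \<in> A" "q \<in> fst c" by (rule chart_cover)
  show ?thesis using tvec_of_in[OF c, of 0] unfolding tvec_of_0[OF c] .
qed

lemma tvec_of_cont: assumes c: "c \<in> A" "q \<in> fst c" shows "continuous_on S (tvec_of A c q)"
proof (rule continuous_on_coordinatewise_then_product)
  fix d show "continuous_on S (\<lambda>w. tvec_of A c q w d)"
  proof (cases "d \<in> A \<and> q \<in> fst d")
    case True
    then have "bounded_linear (Dt c d (snd c q))" by (intro Dt_bl overlapI c) auto
    then show ?thesis using True by (simp add: tvec_of_apply linear_continuous_on)
  next
    case False
    then have "tvec_of A c q w d = 0" for w by (auto simp: tvec_of_apply)
    then show ?thesis by simp
  qed
qed

lemma component_cont: "continuous_on S (\<lambda>v :: ('m, 'n) tvec. v c)"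
  by (rule continuous_on_subset[OF continuous_on_product_coordinates]) simp

text \<open>Tangent vectors carry the components in all charts at once; reading off the components in one chart
identifies the tangent space with Euclidean space also topologically.\<close>

lemma tangent_open_image:
  assumes c: "c \<in> A" "q \<in> fst c" and N: "openin (top_of_set (tangent_space A q)) N"
  shows "open ((\<lambda>v. v c) ` N)" and "(\<lambda>v. v c) ` N = {y. tvec_of A c q y \<in> N}"
proof -
  have sub: "N \<subseteq> tangent_space A q" using N by (rule openin_imp_subset)
  show eq: "(\<lambda>v. v c) ` N = {y. tvec_of A c q y \<in> N}"
  proof (intro set_eqI iffI)
    fix y assume "y \<in> (\<lambda>v. v c) ` N"
    then show "y \<in> {y. tvec_of A c q y \<in> N}" using tvec_of_chart[OF _ c] sub by (auto dest!: subsetD)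
  next
    fix y assume "y \<in> {y. tvec_of A c q y \<in> N}"
    then have "tvec_of A c q y \<in> N" by simp
    then show "y \<in> (\<lambda>v. v c) ` N" by (rule image_eqI[rotated]) (simp add: tvec_of_self[OF c])
  qed
  obtain U where U: "open U" "N = tangent_space A q \<inter> U" using N by (auto simp: openin_open)
  have "{y. tvec_of A c q y \<in> N} = tvec_of A c q -` U" using U tvec_of_in[OF c] by auto
  then show "open ((\<lambda>v. v c) ` N)" unfolding eq using open_vimage[OF U(1) tvec_of_cont[OF c]] by simp
qed

end

section \<open>Pseudo-Finsler metrics in coordinates\<close>

text \<open>The representation of a pseudo-Finsler metric in one chart.  The two homogeneity conditions say that the
Cartan tensor \<open>\<partial>g\<^sub>\<mu>\<^sub>\<nu>/\<partial>v\<^sup>\<alpha>\<close> is annihilated by \<open>v\<close>; the first of them makes \<open>g\<^sub>v v\<close> the \<open>v\<close>-gradient of the Lagrangian.\<close>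

locale coord_metric =
  fixes X :: "(real^'n) set" and G :: "(real^'n) \<times> (real^'n) \<Rightarrow> real^'n^'n"
  assumes X: "open X" and CG: "Ck1_on 1 G (X \<times> (UNIV - {0}))"
    and sym: "\<And>z. z \<in> X \<times> (UNIV - {0}) \<Longrightarrow> transpose (G z) = G z"
    and inv: "\<And>z. z \<in> X \<times> (UNIV - {0}) \<Longrightarrow> invertible (G z)"
    and hv1: "\<And>x v \<mu> \<alpha>. x \<in> X \<Longrightarrow> v \<noteq> 0 \<Longrightarrow>
       (\<Sum>\<nu>\<in>UNIV. frechet_derivative G (at (x, v)) (0, axis \<alpha> 1) $ \<mu> $ \<nu> * v $ \<nu>) = 0"
    and hv2: "\<And>x v \<mu> \<nu>. x \<in> X \<Longrightarrow> v \<noteq> 0 \<Longrightarrow>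
       (\<Sum>\<alpha>\<in>UNIV. frechet_derivative G (at (x, v)) (0, axis \<alpha> 1) $ \<mu> $ \<nu> * v $ \<alpha>) = 0"
begin

abbreviation W where "W \<equiv> X \<times> (UNIV - {0 :: real^'n})"
abbreviation DG where "DG z \<equiv> frechet_derivative G (at z)"

lemma W_open: "open W"
  using X by (intro open_Times) (auto simp: open_Diff)

lemma CG': "\<forall>z\<in>W. G differentiable (at z)" "\<forall>w. LL (\<lambda>z. DG z w) W"
  using CG unfolding One_nat_def Ck1_on.simps by blast+

lemma DG: "z \<in> W \<Longrightarrow> (G has_derivative DG z) (at z)"
  using CG'(1) frechet_derivative_works by blast

lemma DG_LL: "LL (\<lambda>z. DG z w) W"
  using CG'(2) by blast

lemma DG_bl: "z \<in> W \<Longrightarrow> bounded_linear (DG z)"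
  by (rule has_derivative_bounded_linear[OF DG])

lemma G_LL: "LL G W"
  by (rule LL_differentiable[OF W_open DG DG_LL])

lemma DG_v_axis:
  assumes z: "z \<in> W" shows "DG z (0, w) = (\<Sum>\<alpha>\<in>UNIV. w $ \<alpha> *\<^sub>R DG z (0, axis \<alpha> 1))"
proof -
  have "bounded_linear (\<lambda>w. DG z (0, w))"
    by (rule bounded_linear_compose[OF DG_bl[OF z]]) (intro bounded_linear_Pair bounded_linear_zero bounded_linear_ident)
  from linear_axis[OF bounded_linear.linear[OF this]] show ?thesis .
qed

lemma DG_x_axis:
  assumes z: "z \<in> W" shows "DG z (w, 0) = (\<Sum>\<alpha>\<in>UNIV. w $ \<alpha> *\<^sub>R DG z (axis \<alpha> 1, 0))"
proof -
  have "bounded_linear (\<lambda>w. DG z (w, 0))"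
    by (rule bounded_linear_compose[OF DG_bl[OF z]]) (intro bounded_linear_Pair bounded_linear_zero bounded_linear_ident)
  from linear_axis[OF bounded_linear.linear[OF this]] show ?thesis .
qed

lemma DG_split: assumes z: "z \<in> W" shows "DG z (a, w) = DG z (a, 0) + DG z (0, w)"
  using linear_add[OF bounded_linear.linear[OF DG_bl[OF z]], of "(a, 0)" "(0, w)"] by simp

lemma DG_v_vector:
  assumes "(x, v) \<in> W" shows "DG (x, v) (0, w) *v v = 0"
proof (rule vec_eq_iff[THEN iffD2], rule allI)
  fix \<mu>
  have xv: "x \<in> X" "v \<noteq> 0" using assms by auto
  have "(DG (x, v) (0, w) *v v) $ \<mu> = (\<Sum>\<nu>\<in>UNIV. (\<Sum>\<alpha>\<in>UNIV. w $ \<alpha> * DG (x, v) (0, axis \<alpha> 1) $ \<mu> $ \<nu>) * v $ \<nu>)"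
    by (subst DG_v_axis[OF assms]) (simp add: matrix_vector_mult_def)
  also have "\<dots> = (\<Sum>\<alpha>\<in>UNIV. w $ \<alpha> * (\<Sum>\<nu>\<in>UNIV. DG (x, v) (0, axis \<alpha> 1) $ \<mu> $ \<nu> * v $ \<nu>))"
    unfolding sum_distrib_right sum_distrib_left by (subst sum.swap) (simp add: mult.assoc)
  also have "\<dots> = 0" by (simp add: hv1[OF xv])
  finally show "(DG (x, v) (0, w) *v v) $ \<mu> = 0 $ \<mu>" by simp
qed

lemma DG_v_self:
  assumes "(x, v) \<in> W" shows "DG (x, v) (0, v) = 0"
proof -
  have xv: "x \<in> X" "v \<noteq> 0" using assms by auto
  have "DG (x, v) (0, v) $ \<mu> $ \<nu> = 0" for \<mu> \<nu>
    by (subst DG_v_axis[OF assms]) (use hv2[OF xv, of \<mu> \<nu>] in \<open>simp add: mult.commute\<close>)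
  then show ?thesis by (simp add: vec_eq_iff)
qed

text \<open>By the second homogeneity condition the derivative of \<open>G\<close> along the ray through \<open>v\<close> vanishes.\<close>

lemma G_scale:
  assumes x: "x \<in> X" and v: "v \<noteq> 0" and s: "0 < s"
  shows "G (x, s *\<^sub>R v) = G (x, v)"
proof -
  have "\<exists>c. \<forall>s\<in>{0<..}. G (x, s *\<^sub>R v) = c"
  proof (rule has_derivative_zero_constant)
    fix s :: real assume s: "s \<in> {0<..}"
    then have w: "(x, s *\<^sub>R v) \<in> W" using x v by auto
    have "((\<lambda>s. (x, s *\<^sub>R v)) has_derivative (\<lambda>h. (0, h *\<^sub>R v))) (at s)"
      by (auto intro!: derivative_eq_intros)
    from has_derivative_compose[OF this DG[OF w]]
    have 1: "((\<lambda>s. G (x, s *\<^sub>R v)) has_derivative (\<lambda>h. DG (x, s *\<^sub>R v) (0, h *\<^sub>R v))) (at s)" .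
    have "DG (x, s *\<^sub>R v) (0, h *\<^sub>R v) = 0" for h
    proof -
      have "(0, h *\<^sub>R v) = (h / s) *\<^sub>R (0 :: real^'n, s *\<^sub>R v)" using s by simp
      then have "DG (x, s *\<^sub>R v) (0, h *\<^sub>R v) = (h / s) *\<^sub>R DG (x, s *\<^sub>R v) (0, s *\<^sub>R v)"
        using linear_scale[OF bounded_linear.linear[OF DG_bl[OF w]]] by metis
      then show ?thesis by (simp add: DG_v_self[OF w])
    qed
    then show "((\<lambda>s. G (x, s *\<^sub>R v)) has_derivative (\<lambda>h. 0)) (at s within {0<..})"
      using 1 by (simp add: has_derivative_at_withinI)
  qed simp
  then obtain c where c: "\<forall>s\<in>{0<..}. G (x, s *\<^sub>R v) = c" by blast
  show ?thesis using c[rule_format, of s] c[rule_format, of 1] s by simp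
qed

lemma DG_scale:
  assumes x: "x \<in> X" and v: "v \<noteq> 0" and s: "0 < s"
  shows "DG (x, s *\<^sub>R v) (a, 0) = DG (x, v) (a, 0)"
proof -
  have der: "((\<lambda>y. G (y, w)) has_derivative (\<lambda>a. DG (x, w) (a, 0))) (at x)" if "w \<noteq> 0" for w
  proof -
    have "((\<lambda>y. (y, w)) has_derivative (\<lambda>a. (a, 0))) (at x)"
      by (auto intro!: derivative_eq_intros)
    from has_derivative_compose[OF this DG] show ?thesis using x that by auto
  qed
  have "((\<lambda>y. G (y, v)) has_derivative (\<lambda>a. DG (x, s *\<^sub>R v) (a, 0))) (at x)"
    by (rule has_derivative_transform_within_open[OF der X x]) (use v s in \<open>auto simp: G_scale\<close>)
  from has_derivative_unique[OF this der[OF v]] show ?thesis by metis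
qed

text \<open>In coordinates, \<open>force\<close> collects the derivatives in the geodesic equation, \<open>spr\<close> is the spray, \<open>mom\<close> and
\<open>lag\<close> are momentum and Lagrangian, \<open>grad\<close> is twice the \<open>x\<close>-gradient of the Lagrangian, and \<open>dlag\<close> is its
differential: by the first homogeneity condition the \<open>v\<close>-derivative of \<open>G\<close> drops out.\<close>

definition force :: "(real^'n) \<times> (real^'n) \<Rightarrow> real^'n" where
  "force z = (\<chi> \<nu>. \<Sum>\<alpha>\<in>UNIV. \<Sum>\<beta>\<in>UNIV.
     (DG z (axis \<beta> 1, 0) $ \<nu> $ \<alpha> + DG z (axis \<alpha> 1, 0) $ \<nu> $ \<beta> - DG z (axis \<nu> 1, 0) $ \<alpha> $ \<beta>) * snd z $ \<alpha> * snd z $ \<beta>)"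

definition spr :: "(real^'n) \<times> (real^'n) \<Rightarrow> real^'n" where
  "spr z = (if snd z = 0 then 0 else matrix_inv (G z) *v ((- 1 / 2) *\<^sub>R force z))"

definition grad :: "(real^'n) \<times> (real^'n) \<Rightarrow> real^'n" where
  "grad z = (\<chi> \<nu>. snd z \<bullet> (DG z (axis \<nu> 1, 0) *v snd z))"

definition mom :: "(real^'n) \<times> (real^'n) \<Rightarrow> real^'n" where "mom z = G z *v snd z"
definition lag :: "(real^'n) \<times> (real^'n) \<Rightarrow> real" where "lag z = 1 / 2 * (snd z \<bullet> mom z)"
definition dlag :: "(real^'n) \<times> (real^'n) \<Rightarrow> (real^'n) \<times> (real^'n) \<Rightarrow> real" where
  "dlag z w = snd w \<bullet> mom z + 1 / 2 * (snd z \<bullet> (DG z (fst w, 0) *v snd z))"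

lemma force_eq:
  assumes z: "z \<in> W"
  shows "force z = 2 *\<^sub>R (DG z (snd z, 0) *v snd z) - grad z"
proof (rule vec_eq_iff[THEN iffD2], rule allI)
  fix \<nu>
  define v where "v = snd z"
  have A: "(DG z (v, 0) *v v) $ \<nu> = (\<Sum>\<alpha>\<in>UNIV. \<Sum>\<beta>\<in>UNIV. DG z (axis \<beta> 1, 0) $ \<nu> $ \<alpha> * v $ \<alpha> * v $ \<beta>)"
    by (subst DG_x_axis[OF z]) (simp add: matrix_vector_mult_def sum_distrib_left sum_distrib_right mult_ac)
  have B: "(DG z (v, 0) *v v) $ \<nu> = (\<Sum>\<alpha>\<in>UNIV. \<Sum>\<beta>\<in>UNIV. DG z (axis \<alpha> 1, 0) $ \<nu> $ \<beta> * v $ \<alpha> * v $ \<beta>)"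
    unfolding A by (subst sum.swap) (simp add: mult_ac)
  have C: "grad z $ \<nu> = (\<Sum>\<alpha>\<in>UNIV. \<Sum>\<beta>\<in>UNIV. DG z (axis \<nu> 1, 0) $ \<alpha> $ \<beta> * v $ \<alpha> * v $ \<beta>)"
    by (simp add: grad_def v_def matrix_vector_mult_def inner_vec_def sum_distrib_left mult_ac)
  have "force z $ \<nu> = (DG z (v, 0) *v v) $ \<nu> + (DG z (v, 0) *v v) $ \<nu> - grad z $ \<nu>"
    unfolding C by (subst A, subst B) (simp add: force_def v_def[symmetric] algebra_simps sum.distrib sum_subtractf)
  then show "force z $ \<nu> = (2 *\<^sub>R (DG z (snd z, 0) *v snd z) - grad z) $ \<nu>" by (simp add: v_def)
qed

lemma G_spr:
  assumes z: "z \<in> W"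
  shows "G z *v spr z = (1 / 2) *\<^sub>R grad z - DG z (snd z, 0) *v snd z"
proof -
  have "snd z \<noteq> 0" using z by auto
  then have "G z *v spr z = (- 1 / 2) *\<^sub>R force z"
    using matrix_inv_vector(1)[OF inv[OF z]] by (simp add: spr_def)
  then show ?thesis by (simp add: force_eq[OF z] algebra_simps)
qed

lemma G_self_adjoint: "z \<in> W \<Longrightarrow> a \<bullet> (G z *v b) = (G z *v a) \<bullet> b"
  using sym by (metis dot_lmul_matrix inner_commute vector_transpose_matrix)

lemma snd_LL: "LL (\<lambda>z :: (real^'n) \<times> (real^'n). snd z) S"
  by (rule LL_bounded_linear[OF bounded_linear_snd])

lemma force_LL: "LL force W"
  by (rule LL_vec)
     (unfold force_def vec_lambda_beta diff_conv_add_uminus,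
      intro LL_sum LL_mult LL_add LL_minus LL_vec_nth DG_LL snd_LL)

lemma spr_LL_W: "LL spr W"
proof (rule LL_solve[OF G_LL _ inv])
  show "LL (\<lambda>z. (- 1 / 2) *\<^sub>R force z) W" by (intro LL_scaleR LL_const force_LL)
  show "G z *v spr z = (- 1 / 2) *\<^sub>R force z" if z: "z \<in> W" for z
  proof -
    have "snd z \<noteq> 0" using z by auto
    then show ?thesis using matrix_inv_vector(1)[OF inv[OF z]] by (simp add: spr_def)
  qed
qed

lemma spr_scale:
  assumes x: "x \<in> X" and v: "v \<noteq> 0" and s: "0 < s"
  shows "spr (x, s *\<^sub>R v) = s\<^sup>2 *\<^sub>R spr (x, v)"
proof -
  have "force (x, s *\<^sub>R v) = s\<^sup>2 *\<^sub>R force (x, v)"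
    by (simp add: force_def vec_eq_iff DG_scale[OF assms] sum_distrib_left power2_eq_square mult_ac)
  then have f: "(- 1 / 2) *\<^sub>R force (x, s *\<^sub>R v) = s\<^sup>2 *\<^sub>R ((- 1 / 2) *\<^sub>R force (x, v))" by simp
  have "s *\<^sub>R v \<noteq> 0" using v s by simp
  then show ?thesis using v unfolding spr_def snd_conv f G_scale[OF assms] by (simp only: if_False matrix_vector_mult_scaleR)
qed

lemma spr_0: "spr (x, 0) = 0" by (simp add: spr_def)

lemma spr_LL: "LL spr (X \<times> UNIV)"
  by (rule LL_homogeneous[where k=1, OF X spr_LL_W])
     (auto simp: spr_scale spr_0 power2_eq_square)

lemma mom_LL: "LL mom (X \<times> UNIV)"
proof (rule LL_homogeneous[where k=0, OF X])
  show "LL mom W" unfolding mom_def by (intro LL_matrix_vector G_LL snd_LL)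
  show "mom (x, s *\<^sub>R v) = s ^ Suc 0 *\<^sub>R mom (x, v)" if "x \<in> X" "v \<noteq> 0" "0 < s" for x v s
    using G_scale[OF that] by (simp add: mom_def matrix_vector_mult_scaleR)
qed (simp add: mom_def)

lemma lag_der:
  assumes z: "z \<in> W" shows "(lag has_derivative dlag z) (at z)"
proof -
  interpret bb: bounded_bilinear "\<lambda>(A::real^'n^'n) (x::real^'n). A *v x"
    by (rule bounded_bilinear_matrix_vector_mult)
  obtain x v where xv: "z = (x, v)" by (cases z)
  have s: "(snd has_derivative snd) (at z)" by (rule bounded_linear_imp_has_derivative[OF bounded_linear_snd])
  have m: "(mom has_derivative (\<lambda>w. G z *v snd w + DG z w *v snd z)) (at z)"
    unfolding mom_def[abs_def] by (rule bb.FDERIV[OF DG[OF z] s])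
  have "(lag has_derivative (\<lambda>w. 1 / 2 * (snd z \<bullet> (G z *v snd w + DG z w *v snd z) + snd w \<bullet> mom z))) (at z)"
    unfolding lag_def[abs_def] by (rule has_derivative_mult_right[OF has_derivative_inner[OF s m]])
  moreover have "1 / 2 * (snd z \<bullet> (G z *v snd w + DG z w *v snd z) + snd w \<bullet> mom z) = dlag z w" for w
  proof -
    have "DG z w *v v = DG z (fst w, 0) *v v"
      using DG_split[OF z, of "fst w" "snd w"] DG_v_vector[of x v "snd w"] z
      by (simp add: xv bb.add_left)
    moreover have "v \<bullet> (G z *v snd w) = snd w \<bullet> (G z *v v)"
      using sym[OF z] by (metis dot_lmul_matrix inner_commute vector_transpose_matrix)
    ultimately show ?thesis by (simp add: dlag_def mom_def xv inner_add_right)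
  qed
  ultimately show ?thesis by simp
qed

lemma dlag_LL: "LL (\<lambda>z. dlag z w) W"
  unfolding dlag_def mom_def
  by (intro LL_add LL_mult LL_inner LL_const LL_matrix_vector G_LL snd_LL DG_LL)

text \<open>The Euler-Lagrange equation.  The change of the metric due to the change of velocity is annihilated by the
velocity, and the spray was solved for exactly what remains.\<close>

lemma mom_curve:
  assumes zt: "z t \<in> W" and z: "(z has_vector_derivative (snd (z t), spr (z t))) (at t)"
  shows "((\<lambda>s. mom (z s)) has_vector_derivative (1 / 2) *\<^sub>R grad (z t)) (at t)"
proof -
  interpret bb: bounded_bilinear "\<lambda>(A::real^'n^'n) (x::real^'n). A *v x"
    by (rule bounded_bilinear_matrix_vector_mult)
  obtain x v where xv: "z t = (x, v)" by (cases "z t")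
  have s: "(snd has_derivative snd) (at (z t))" by (rule bounded_linear_imp_has_derivative[OF bounded_linear_snd])
  have m: "(mom has_derivative (\<lambda>w. G (z t) *v snd w + DG (z t) w *v snd (z t))) (at (z t))"
    unfolding mom_def[abs_def] by (rule bb.FDERIV[OF DG[OF zt] s])
  have "((\<lambda>s. mom (z s)) has_derivative (\<lambda>h. G (z t) *v snd (h *\<^sub>R (snd (z t), spr (z t))) + DG (z t) (h *\<^sub>R (snd (z t), spr (z t))) *v snd (z t))) (at t)"
    using has_derivative_compose[OF z[unfolded has_vector_derivative_def] m] .
  moreover have "G (z t) *v snd (h *\<^sub>R (snd (z t), spr (z t))) + DG (z t) (h *\<^sub>R (snd (z t), spr (z t))) *v snd (z t)
     = h *\<^sub>R ((1 / 2) *\<^sub>R grad (z t))" for h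
  proof -
    have "DG (z t) (snd (z t), spr (z t)) *v snd (z t) = DG (z t) (snd (z t), 0) *v snd (z t)"
      using DG_split[OF zt, of "snd (z t)" "spr (z t)"] DG_v_vector[of x v "spr (z t)"] zt
      by (simp add: xv bb.add_left)
    moreover have "DG (z t) (h *\<^sub>R (snd (z t), spr (z t))) = h *\<^sub>R DG (z t) (snd (z t), spr (z t))"
      by (rule linear_scale[OF bounded_linear.linear[OF DG_bl[OF zt]]])
    moreover have "G (z t) *v snd (h *\<^sub>R (snd (z t), spr (z t))) = h *\<^sub>R (G (z t) *v spr (z t))"
      by (simp add: bb.scaleR_right)
    ultimately show ?thesis
      by (simp only: bb.scaleR_left G_spr[OF zt]) (simp add: algebra_simps)
  qed
  ultimately show ?thesis by (simp add: has_vector_derivative_def)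
qed

lemma grad_inner:
  assumes z: "z \<in> W" shows "w \<bullet> grad z = snd z \<bullet> (DG z (w, 0) *v snd z)"
proof -
  interpret bb: bounded_bilinear "\<lambda>(A::real^'n^'n) (x::real^'n). A *v x"
    by (rule bounded_bilinear_matrix_vector_mult)
  show ?thesis
    by (subst DG_x_axis[OF z])
       (simp add: bb.sum_left bb.scaleR_left inner_sum_right grad_def inner_vec_def[of w])
qed

text \<open>Conservation of energy: paired with the momentum, the spray contributes the negative of the \<open>x\<close>-part of
\<open>dlag\<close> along the velocity.\<close>

lemma lag_curve:
  assumes zt: "z t \<in> W" and z: "(z has_vector_derivative (snd (z t), spr (z t))) (at t)"
  shows "((\<lambda>s. lag (z s)) has_vector_derivative 0) (at t)"
proof -
  have "((\<lambda>s. lag (z s)) has_derivative (\<lambda>h. dlag (z t) (h *\<^sub>R (snd (z t), spr (z t))))) (at t)"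
    using has_derivative_compose[OF z[unfolded has_vector_derivative_def] lag_der[OF zt]] .
  moreover have "dlag (z t) (h *\<^sub>R (snd (z t), spr (z t))) = 0" for h
  proof -
    have "dlag (z t) (snd (z t), spr (z t)) = 0"
    proof -
      have "spr (z t) \<bullet> mom (z t) = snd (z t) \<bullet> (G (z t) *v spr (z t))"
        using sym[OF zt] unfolding mom_def by (metis dot_lmul_matrix inner_commute vector_transpose_matrix)
      also have "\<dots> = 1 / 2 * (snd (z t) \<bullet> grad (z t)) - snd (z t) \<bullet> (DG (z t) (snd (z t), 0) *v snd (z t))"
        by (simp add: G_spr[OF zt] inner_diff_right)
      finally show ?thesis by (simp add: dlag_def grad_inner[OF zt])
    qed
    moreover have "dlag (z t) (h *\<^sub>R (snd (z t), spr (z t))) = h *\<^sub>R dlag (z t) (snd (z t), spr (z t))"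
      by (rule linear_scale[OF has_derivative_linear[OF lag_der[OF zt]]])
    ultimately show ?thesis by simp
  qed
  ultimately show ?thesis by (simp add: has_vector_derivative_def)
qed

lemma spr_C1:
  assumes C2: "Ck_on 2 G W" shows "C1_on spr W"
proof (rule C1_on_solve[OF W_open _ _ inv])
  have C2': "(\<forall>z\<in>W. (\<lambda>z. DG z w) differentiable (at z)) \<and>
      (\<forall>w'. continuous_on W (\<lambda>z. frechet_derivative (\<lambda>z. DG z w) (at z) w'))" for w
    using C2 unfolding numeral_2_eq_2 Ck_on.simps by blast
  have D2: "C1_on (\<lambda>z. DG z w) W" for w
    by (rule C1_onI[where f'="\<lambda>z. frechet_derivative (\<lambda>z. DG z w) (at z)"])
       (use C2'[of w] frechet_derivative_works in blast)+
  show "C1_on G W"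
    by (rule C1_onI[where f'=DG]) (auto intro: DG LL_continuous_on[OF DG_LL])
  have sn: "C1_on (\<lambda>z :: (real^'n) \<times> (real^'n). snd z $ i) W" for i
    by (rule C1_on_bounded_linear[OF bounded_linear_compose[OF bounded_linear_vec_nth bounded_linear_snd]])
  have dn: "C1_on (\<lambda>z. DG z w $ i $ j) W" for w i j
    by (intro C1_on_linear_compose[OF bounded_linear_vec_nth] D2)
  have dm: "C1_on (\<lambda>z. - DG z w $ i $ j) W" for w i j
    by (rule C1_on_linear_compose[OF bounded_linear_minus[OF bounded_linear_ident] dn])
  have "C1_on force W"
    by (rule C1_on_vec)
       (unfold force_def vec_lambda_beta diff_conv_add_uminus, intro C1_on_sum C1_on_mult C1_on_add dn dm sn)
  then show "C1_on (\<lambda>z. (- 1 / 2) *\<^sub>R force z) W"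
    by (rule C1_on_linear_compose[OF bounded_linear_scaleR_right])
  show "G z *v spr z = (- 1 / 2) *\<^sub>R force z" if z: "z \<in> W" for z
  proof -
    have "snd z \<noteq> 0" using z by auto
    then show ?thesis using matrix_inv_vector(1)[OF inv[OF z]] by (simp add: spr_def)
  qed
qed

end

locale finsler = c21 A for A :: "('m::t2_space, 'n::finite) chart set" +
  fixes g :: "('m, 'n) metric"
  assumes metric: "pseudo_finsler_metric A g"
begin

abbreviation Xc where "Xc c \<equiv> snd c ` fst c"

lemma bil: "v \<in> tangent_space A q \<Longrightarrow> v \<noteq> tzero \<Longrightarrow> nondegenerate_symmetric_bilinear (tangent_space A q) (g q v)"
  using metric unfolding pseudo_finsler_metric_def by blast

text \<open>Bilinearity on the tangent space turns the values on coordinate vectors into a matrix.\<close>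

lemma g_coord:
  assumes c: "c \<in> A" "q \<in> fst c" and v: "v \<noteq> 0"
  shows "g q (tvec_of A c q v) (tvec_of A c q u) (tvec_of A c q w) = u \<bullet> (gcoord A g c (snd c q, v) *v w)"
proof -
  let ?T = "tvec_of A c q"
  let ?B = "\<lambda>u w. g q (?T v) (?T u) (?T w)"
  have nd: "nondegenerate_symmetric_bilinear (tangent_space A q) (g q (?T v))"
    using v by (intro bil tvec_of_in c) (simp add: tvec_of_eq_tzero_iff[OF c])
  have sym: "?B u w = ?B w u" for u w
    using nd tvec_of_in[OF c] unfolding nondegenerate_symmetric_bilinear_def by blast
  have lin1: "linear (\<lambda>u. ?B u w)" for w
  proof (rule linearI)
    fix a b
    show "?B (a + b) w = ?B a w + ?B b w"
      using nd tvec_of_in[OF c] unfolding tvec_of_add[OF c] nondegenerate_symmetric_bilinear_def by blast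
  next
    fix s a
    have "g q (?T v) (tscale s (?T a)) (?T w) = s * ?B a w"
      using nd tvec_of_in[OF c] unfolding nondegenerate_symmetric_bilinear_def by blast
    then show "?B (s *\<^sub>R a) w = s *\<^sub>R ?B a w" by (simp add: tvec_of_scale[OF c])
  qed
  have G: "gcoord A g c (snd c q, v) $ \<mu> $ \<nu> = ?B (axis \<mu> 1) (axis \<nu> 1)" for \<mu> \<nu>
    using c by (simp add: gcoord_def Let_def)
  have "?B u w = (\<Sum>\<mu>\<in>UNIV. u $ \<mu> * ?B (axis \<mu> 1) w)"
    using linear_axis[OF lin1[of w], of u] by simp
  also have "\<dots> = (\<Sum>\<mu>\<in>UNIV. u $ \<mu> * (\<Sum>\<nu>\<in>UNIV. w $ \<nu> * ?B (axis \<mu> 1) (axis \<nu> 1)))"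
  proof (intro sum.cong refl arg_cong2[where f="(*)"])
    fix \<mu>
    have "?B (axis \<mu> 1) w = ?B w (axis \<mu> 1)" by (rule sym)
    also have "\<dots> = (\<Sum>\<nu>\<in>UNIV. w $ \<nu> * ?B (axis \<nu> 1) (axis \<mu> 1))"
      using linear_axis[OF lin1[of "axis \<mu> 1"], of w] by simp
    finally show "?B (axis \<mu> 1) w = (\<Sum>\<nu>\<in>UNIV. w $ \<nu> * ?B (axis \<mu> 1) (axis \<nu> 1))"
      by (simp only: sym[of "axis \<mu> 1"])
  qed
  also have "\<dots> = u \<bullet> (gcoord A g c (snd c q, v) *v w)"
    by (simp add: inner_vec_def matrix_vector_mult_def G mult.commute)
  finally show ?thesis .
qed

lemma coord_metric_chart:
  assumes c: "c \<in> A" shows "coord_metric (Xc c) (gcoord A g c)"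
proof
  show "open (Xc c)" by (rule chart_image_open[OF c])
  show "Ck1_on 1 (gcoord A g c) (Xc c \<times> (UNIV - {0}))"
    using metric c unfolding pseudo_finsler_metric_def slit_domain_def by blast
  have sl: "(x, v) \<in> slit_domain c" if "x \<in> Xc c" "v \<noteq> 0" for x v
    using that by (simp add: slit_domain_def)
  have *: "\<forall>(x, v)\<in>slit_domain c.
           (\<forall>\<mu> \<alpha>. (\<Sum>\<nu>\<in>UNIV. dg_dv A g c (x, v) \<mu> \<nu> \<alpha> * v $ \<nu>) = 0) \<and>
           (\<forall>\<mu> \<nu>. (\<Sum>\<alpha>\<in>UNIV. dg_dv A g c (x, v) \<mu> \<nu> \<alpha> * v $ \<alpha>) = 0)"
    using metric c unfolding pseudo_finsler_metric_def by blast
  show "(\<Sum>\<nu>\<in>UNIV. frechet_derivative (gcoord A g c) (at (x, v)) (0, axis \<alpha> 1) $ \<mu> $ \<nu> * v $ \<nu>) = 0"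
    "(\<Sum>\<alpha>\<in>UNIV. frechet_derivative (gcoord A g c) (at (x, v)) (0, axis \<alpha> 1) $ \<mu> $ \<nu> * v $ \<alpha>) = 0"
    if "x \<in> Xc c" "v \<noteq> 0" for x v \<mu> \<alpha> \<nu>
    using bspec[OF * sl[OF that]] by (simp_all add: dg_dv_def)
  fix z assume "z \<in> Xc c \<times> (UNIV - {0 :: real^'n})"
  then obtain q v where z: "z = (snd c q, v)" "q \<in> fst c" "v \<noteq> 0" by auto
  let ?T = "tvec_of A c q"
  have nd: "nondegenerate_symmetric_bilinear (tangent_space A q) (g q (?T v))"
    using z by (intro bil tvec_of_in c) (auto simp: tvec_of_eq_tzero_iff[OF c])
  have sym: "g q (?T v) (?T a) (?T b) = g q (?T v) (?T b) (?T a)" for a b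
    using nd tvec_of_in[OF c z(2)] unfolding nondegenerate_symmetric_bilinear_def by blast
  have "gcoord A g c z $ i $ j = gcoord A g c z $ j $ i" for i j
    using sym[of "axis i 1" "axis j 1"] c z by (simp add: gcoord_def Let_def)
  then show "transpose (gcoord A g c z) = gcoord A g c z"
    by (simp add: vec_eq_iff transpose_def)
  show "invertible (gcoord A g c z)"
    unfolding invertible_left_inverse matrix_left_invertible_ker
  proof (intro allI impI)
    fix w assume w: "gcoord A g c z *v w = 0"
    have "g q (?T v) (?T w) u = 0" if u: "u \<in> tangent_space A q" for u
    proof -
      have "g q (?T v) (?T w) (?T (u c)) = g q (?T v) (?T (u c)) (?T w)" by (rule sym)
      also have "\<dots> = 0" using g_coord[OF c z(2,3)] w by (simp add: z(1))
      finally show ?thesis using tvec_of_chart[OF u c z(2)] by metis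
    qed
    then have "?T w = tzero" using nd tvec_of_in[OF c z(2)] unfolding nondegenerate_symmetric_bilinear_def by blast
    then show "w = 0" by (simp add: tvec_of_eq_tzero_iff[OF c z(2)])
  qed
qed

lemma spray_eq:
  assumes c: "c \<in> A" shows "spray A g c = coord_metric.spr (gcoord A g c)"
proof
  interpret coord_metric "Xc c" "gcoord A g c" by (rule coord_metric_chart[OF c])
  fix z :: "(real^'n) \<times> (real^'n)"
  obtain x v where z: "z = (x, v)" by (cases z)
  show "spray A g c z = spr z"
  proof (cases "v = 0")
    case False
    have "spray A g c z $ \<mu> = - 1 / 2 * (\<Sum>\<nu>\<in>UNIV. matrix_inv (gcoord A g c z) $ \<mu> $ \<nu> * force z $ \<nu>)" for \<mu>
      using False by (simp add: z spray_def force_def dg_dx_def sum_distrib_left mult.assoc)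
    then have "spray A g c z = (- 1 / 2) *\<^sub>R (matrix_inv (gcoord A g c z) *v force z)"
      by (simp add: vec_eq_iff matrix_vector_mult_def)
    also have "\<dots> = matrix_inv (gcoord A g c z) *v ((- 1 / 2) *\<^sub>R force z)"
      by (rule matrix_vector_mult_scaleR[symmetric])
    also have "\<dots> = spr z" using False by (simp add: spr_def z)
    finally show ?thesis .
  qed (simp add: z spray_def spr_def)
qed

definition momentum :: "('m, 'n) chart \<Rightarrow> (real^'n) \<times> (real^'n) \<Rightarrow> real^'n" where
  "momentum c z = gcoord A g c z *v snd z"

lemma gform_coord:
  assumes c: "c \<in> A" "q \<in> fst c" and v: "v \<in> tangent_space A q"
  shows "gform g q v v (tvec_of A c q w) = momentum c (snd c q, v c) \<bullet> w"
proof (cases "v c = 0")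
  case True
  then show ?thesis using tvec_eq_tzero_iff[OF v c] by (simp add: gform_def momentum_def)
next
  case False
  interpret coord_metric "Xc c" "gcoord A g c" by (rule coord_metric_chart[OF c(1)])
  have nz: "v \<noteq> tzero" using tvec_eq_tzero_iff[OF v c] False by simp
  have "g q (tvec_of A c q (v c)) (tvec_of A c q (v c)) (tvec_of A c q w) = v c \<bullet> (gcoord A g c (snd c q, v c) *v w)"
    by (rule g_coord[OF c False])
  also have "\<dots> = (gcoord A g c (snd c q, v c) *v v c) \<bullet> w"
    by (rule G_self_adjoint) (use False c(2) in auto)
  finally show ?thesis using tvec_of_chart[OF v c] nz by (simp add: gform_def momentum_def)
qed

lemma lagrangian_coord:
  assumes c: "c \<in> A" "q \<in> fst c" and v: "v \<in> tangent_space A q"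
  shows "lagrangian g q v = coord_metric.lag (gcoord A g c) (snd c q, v c)"
proof -
  interpret coord_metric "Xc c" "gcoord A g c" by (rule coord_metric_chart[OF c(1)])
  have "2 * lagrangian g q v = gform g q v v v" by (simp add: lagrangian_def gform_def)
  also have "\<dots> = momentum c (snd c q, v c) \<bullet> v c"
    using gform_coord[OF c v, of "v c"] tvec_of_chart[OF v c] by metis
  also have "\<dots> = 2 * lag (snd c q, v c)" by (simp add: lag_def mom_def momentum_def inner_commute)
  finally show ?thesis by simp
qed

end

section \<open>Uniqueness and scaling of geodesics\<close>

text \<open>Connectedness of an interval, with openness and closedness phrased relative to it through
neighborhoods of the line, as they arise from continuity of curves on open intervals.\<close>

lemma clopen_interval:
  fixes I :: "real set"
  assumes I: "connected I" and t0: "t0 \<in> I" "P t0" and t: "t \<in> I"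
    and op: "\<And>t. t \<in> I \<Longrightarrow> P t \<Longrightarrow> \<forall>\<^sub>F s in nhds t. s \<in> I \<longrightarrow> P s"
    and cl: "\<And>t. t \<in> I \<Longrightarrow> \<not> P t \<Longrightarrow> \<forall>\<^sub>F s in nhds t. s \<in> I \<longrightarrow> \<not> P s"
  shows "P t"
proof -
  have "openin (top_of_set I) {t \<in> I. Q t}"
    if Q: "\<And>t. t \<in> I \<Longrightarrow> Q t \<Longrightarrow> \<forall>\<^sub>F s in nhds t. s \<in> I \<longrightarrow> Q s" for Q
  proof (subst openin_subopen, intro ballI)
    fix t assume t: "t \<in> {t \<in> I. Q t}"
    then obtain U where U: "open U" "t \<in> U" "\<forall>s\<in>U. s \<in> I \<longrightarrow> Q s"
      using Q[of t] unfolding eventually_nhds by blast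
    show "\<exists>T. openin (top_of_set I) T \<and> t \<in> T \<and> T \<subseteq> {t \<in> I. Q t}"
      using U t by (intro exI[of _ "I \<inter> U"]) (auto simp: openin_open)
  qed
  note o = this
  have "openin (top_of_set I) {t \<in> I. P t}" by (rule o[OF op])
  moreover have "closedin (top_of_set I) {t \<in> I. P t}"
  proof -
    have "I - {t \<in> I. P t} = {t \<in> I. \<not> P t}" by auto
    then have "openin (top_of_set I) (I - {t \<in> I. P t})" using o[OF cl] by simp
    then show ?thesis by (simp add: closedin_def)
  qed
  ultimately have "{t \<in> I. P t} = {} \<or> {t \<in> I. P t} = I" using I unfolding connected_clopen by blast
  then show ?thesis using t0 t by blast
qed

context finsler begin

text \<open>The spray as a vector field on the tangent bundle in a chart, and the position and velocity of a curve
in a chart; solutions of the spray are integral curves of this field.\<close>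

definition field :: "('m, 'n) chart \<Rightarrow> (real^'n) \<times> (real^'n) \<Rightarrow> (real^'n) \<times> (real^'n)" where
  "field c z = (snd z, spray A g c z)"

definition coords :: "('m, 'n) chart \<Rightarrow> (real \<Rightarrow> 'm) \<Rightarrow> (real \<Rightarrow> ('m, 'n) tvec) \<Rightarrow> real \<Rightarrow> (real^'n) \<times> (real^'n)" where
  "coords c \<gamma> V t = (snd c (\<gamma> t), V t c)"

lemma field_LL: assumes c: "c \<in> A" shows "LL (field c) (Xc c \<times> UNIV)"
proof -
  interpret coord_metric "Xc c" "gcoord A g c" by (rule coord_metric_chart[OF c])
  show ?thesis unfolding field_def[abs_def] spray_eq[OF c] by (intro LL_Pair snd_LL spr_LL)
qed

lemma chart_eventually:
  assumes "isCont \<gamma> t" "c \<in> A" "\<gamma> t \<in> fst c"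
  shows "\<forall>\<^sub>F s in nhds t. \<gamma> s \<in> fst c"
proof -
  have "(\<gamma> \<longlongrightarrow> \<gamma> t) (nhds t)" using assms(1) by (simp add: tendsto_nhds_iff isCont_def)
  then show ?thesis using topological_tendstoD[OF _ chart_open[OF assms(2)] assms(3)] by blast
qed

lemma solution_velocity:
  assumes "spray_solution A g I \<gamma> V" "t \<in> I"
  shows "isCont \<gamma> t" "V t \<in> tangent_space A (\<gamma> t)" "has_velocity A \<gamma> t (V t)"
  using assms unfolding spray_solution_def has_velocity_def by blast+

lemma solution_coords:
  assumes sol: "spray_solution A g I \<gamma> V" and t: "t \<in> I" and c: "c \<in> A" "\<gamma> t \<in> fst c"
  shows "(coords c \<gamma> V has_vector_derivative field c (coords c \<gamma> V t)) (at t)"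
proof -
  have 1: "((\<lambda>s. snd c (\<gamma> s)) has_vector_derivative V t c) (at t)"
    using sol t c unfolding spray_solution_def has_velocity_def o_def by blast
  have 2: "((\<lambda>s. V s c) has_vector_derivative spray A g c (snd c (\<gamma> t), V t c)) (at t)"
    using sol t c unfolding spray_solution_def by blast
  have "((\<lambda>s. (snd c (\<gamma> s), V s c)) has_vector_derivative (V t c, spray A g c (snd c (\<gamma> t), V t c))) (at t)"
    by (rule has_vector_derivative_Pair[OF 1 2])
  then show ?thesis by (simp add: coords_def[abs_def] field_def)
qed

lemma solution_interval:
  assumes "spray_solution A g I \<gamma> V" shows "open I" "is_interval I" "connected I" "convex I"
  using assms unfolding spray_solution_def by (auto simp: is_interval_connected is_interval_convex)

text \<open>Agreement of position and velocity is an open condition by Gronwall's inequality, because the spray is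
Lipschitz even at zero velocity, and a closed one because the manifold is a Hausdorff space.\<close>

lemma solution_unique:
  assumes s1: "spray_solution A g I1 \<gamma>1 V1" and s2: "spray_solution A g I2 \<gamma>2 V2"
    and t0: "t0 \<in> I1" "t0 \<in> I2" "\<gamma>1 t0 = \<gamma>2 t0" "V1 t0 = V2 t0" and t: "t \<in> I1" "t \<in> I2"
  shows "\<gamma>1 t = \<gamma>2 t \<and> V1 t = V2 t"
proof (rule clopen_interval[where I="I1 \<inter> I2" and P="\<lambda>t. \<gamma>1 t = \<gamma>2 t \<and> V1 t = V2 t"])
  show "connected (I1 \<inter> I2)"
    using solution_interval(2)[OF s1] solution_interval(2)[OF s2] by (intro is_interval_connected is_interval_Int)
  fix t assume tt: "t \<in> I1 \<inter> I2"
  obtain c where c: "c \<in> A" "\<gamma>1 t \<in> fst c" by (rule chart_cover)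
  have cont: "isCont \<gamma>1 t" "isCont \<gamma>2 t"
    using solution_velocity(1)[OF s1] solution_velocity(1)[OF s2] tt by auto
  have Iop: "open (I1 \<inter> I2)" using solution_interval(1)[OF s1] solution_interval(1)[OF s2] by auto
  {
    assume eq: "\<gamma>1 t = \<gamma>2 t \<and> V1 t = V2 t"
    define z where "z = coords c \<gamma>1 V1 t"
    have z2: "coords c \<gamma>2 V2 t = z" using eq by (simp add: z_def coords_def)
    have zin: "z \<in> Xc c \<times> UNIV" using c by (auto simp: z_def coords_def)
    obtain r K where r: "0 < r" "K-lipschitz_on (cball z r) (field c)"
      using LL_cball[OF field_LL[OF c(1)] _ zin] chart_image_open[OF c(1)] by (metis open_Times open_UNIV)
    have d1: "(coords c \<gamma>1 V1 has_vector_derivative field c z) (at t)"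
      using solution_coords[OF s1 _ c] tt unfolding z_def by blast
    have d2: "(coords c \<gamma>2 V2 has_vector_derivative field c z) (at t)"
      using solution_coords[OF s2 _ c(1), of t] tt c(2) eq z2 by auto
    have e1: "\<forall>\<^sub>F s in nhds t. coords c \<gamma>1 V1 s \<in> ball z r"
      using has_vector_derivative_continuous[OF d1] r(1)
      by (intro topological_tendstoD[of _ z]) (auto simp: continuous_within tendsto_nhds_iff z_def)
    have e2: "\<forall>\<^sub>F s in nhds t. coords c \<gamma>2 V2 s \<in> ball z r"
      using has_vector_derivative_continuous[OF d2] r(1)
      by (intro topological_tendstoD[of _ z]) (auto simp: continuous_within tendsto_nhds_iff z2)
    have e3: "\<forall>\<^sub>F s in nhds t. s \<in> I1 \<inter> I2" using eventually_nhds_in_open[OF Iop tt] .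
    have "\<forall>\<^sub>F s in nhds t. s \<in> I1 \<inter> I2 \<and> \<gamma>1 s \<in> fst c \<and> \<gamma>2 s \<in> fst c \<and>
        coords c \<gamma>1 V1 s \<in> ball z r \<and> coords c \<gamma>2 V2 s \<in> ball z r"
      using e1 e2 e3 chart_eventually[OF cont(1) c] chart_eventually[OF cont(2) c(1)] c(2) eq
      by (auto simp: eventually_conj_iff)
    then obtain e where e: "0 < e" "\<And>s. dist s t < e \<Longrightarrow> s \<in> I1 \<inter> I2 \<and> \<gamma>1 s \<in> fst c \<and> \<gamma>2 s \<in> fst c \<and>
        coords c \<gamma>1 V1 s \<in> ball z r \<and> coords c \<gamma>2 V2 s \<in> ball z r"
      unfolding eventually_nhds_metric by blast
    define u where "u = (\<lambda>s. coords c \<gamma>1 V1 s - coords c \<gamma>2 V2 s)"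
    have "\<gamma>1 s = \<gamma>2 s \<and> V1 s = V2 s" if s: "dist s t < e / 2" for s
    proof -
      have se: "s \<in> {t - e / 2..t + e / 2}" using s by (auto simp: dist_real_def abs_if split: if_splits)
      have ne: "dist x t < e" if "x \<in> {t - e / 2..t + e / 2}" for x
        using that e(1) by (auto simp: dist_real_def abs_if)
      have "u s = 0"
      proof (rule ode_unique_zero[OF _ se])
        show "t \<in> {t - e / 2..t + e / 2}" using e(1) by simp
        show "u t = 0" using z2 by (simp add: u_def z_def)
        show "0 \<le> K" using r(2) by (rule lipschitz_on_nonneg)
        fix x assume x: "x \<in> {t - e / 2..t + e / 2}"
        note ex = e(2)[OF ne[OF x]]
        show "(u has_vector_derivative field c (coords c \<gamma>1 V1 x) - field c (coords c \<gamma>2 V2 x)) (at x)"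
          unfolding u_def using ex c(1)
          by (intro has_vector_derivative_diff solution_coords[OF s1] solution_coords[OF s2]) auto
        show "norm (field c (coords c \<gamma>1 V1 x) - field c (coords c \<gamma>2 V2 x)) \<le> K * norm (u x)"
          unfolding u_def using ex by (intro lipschitz_on_normD[OF r(2)]) auto
      qed
      then have eqs: "snd c (\<gamma>1 s) = snd c (\<gamma>2 s)" "V1 s c = V2 s c" by (auto simp: u_def coords_def zero_prod_def)
      note ex = e(2)[OF ne[OF se]]
      have g: "\<gamma>1 s = \<gamma>2 s" using eqs(1) ex chart_inv_chart[OF c(1)] by metis
      have "V1 s = V2 s"
        using solution_velocity(2)[OF s1, of s] solution_velocity(2)[OF s2, of s] ex g eqs(2)
        by (intro tangent_eqI[of "V1 s" "\<gamma>1 s" "V2 s" c]) (auto simp: c(1))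
      then show ?thesis using g by simp
    qed
    then show "\<forall>\<^sub>F s in nhds t. s \<in> I1 \<inter> I2 \<longrightarrow> \<gamma>1 s = \<gamma>2 s \<and> V1 s = V2 s"
      unfolding eventually_nhds_metric using e(1) by (intro exI[of _ "e / 2"]) auto
  }
  {
    assume neq: "\<not> (\<gamma>1 t = \<gamma>2 t \<and> V1 t = V2 t)"
    have lim1: "(\<gamma>1 \<longlongrightarrow> \<gamma>1 t) (nhds t)" and lim2: "(\<gamma>2 \<longlongrightarrow> \<gamma>2 t) (nhds t)"
      using cont by (simp_all add: tendsto_nhds_iff isCont_def)
    show "\<forall>\<^sub>F s in nhds t. s \<in> I1 \<inter> I2 \<longrightarrow> \<not> (\<gamma>1 s = \<gamma>2 s \<and> V1 s = V2 s)"
    proof (cases "\<gamma>1 t = \<gamma>2 t")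
      case False
      then obtain U U' where U: "open U" "open U'" "\<gamma>1 t \<in> U" "\<gamma>2 t \<in> U'" "U \<inter> U' = {}" using hausdorff[OF False] by blast
      have "\<forall>\<^sub>F s in nhds t. \<gamma>1 s \<in> U" using topological_tendstoD[OF lim1 U(1,3)] .
      moreover have "\<forall>\<^sub>F s in nhds t. \<gamma>2 s \<in> U'" using topological_tendstoD[OF lim2 U(2,4)] .
      ultimately show ?thesis by eventually_elim (use U(5) in auto)
    next
      case True
      then have "V1 t \<noteq> V2 t" using neq by simp
      then have ne: "coords c \<gamma>1 V1 t \<noteq> coords c \<gamma>2 V2 t"
        using tangent_eqI[of "V1 t" "\<gamma>1 t" "V2 t" c] solution_velocity(2)[OF s1, of t] solution_velocity(2)[OF s2, of t] tt c True
        by (auto simp: coords_def)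
      have d1: "(coords c \<gamma>1 V1 has_vector_derivative field c (coords c \<gamma>1 V1 t)) (at t)"
        using solution_coords[OF s1 _ c] tt by blast
      have d2: "(coords c \<gamma>2 V2 has_vector_derivative field c (coords c \<gamma>2 V2 t)) (at t)"
        using solution_coords[OF s2 _ c(1), of t] tt c(2) True by auto
      have l1: "(coords c \<gamma>1 V1 \<longlongrightarrow> coords c \<gamma>1 V1 t) (nhds t)" and l2: "(coords c \<gamma>2 V2 \<longlongrightarrow> coords c \<gamma>2 V2 t) (nhds t)"
        using has_vector_derivative_continuous[OF d1] has_vector_derivative_continuous[OF d2]
        by (simp_all add: continuous_within tendsto_nhds_iff)
      obtain U U' where U: "open U" "open U'" "coords c \<gamma>1 V1 t \<in> U" "coords c \<gamma>2 V2 t \<in> U'" "U \<inter> U' = {}"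
        using hausdorff[OF ne] by blast
      have "\<forall>\<^sub>F s in nhds t. coords c \<gamma>1 V1 s \<in> U" using topological_tendstoD[OF l1 U(1,3)] .
      moreover have "\<forall>\<^sub>F s in nhds t. coords c \<gamma>2 V2 s \<in> U'" using topological_tendstoD[OF l2 U(2,4)] .
      ultimately show ?thesis
      proof eventually_elim
        case (elim s)
        then have "coords c \<gamma>1 V1 s \<noteq> coords c \<gamma>2 V2 s" using U(5) by auto
        then show ?case by (auto simp: coords_def)
      qed
    qed
  }
qed (use t0 t in auto)

lemma geodesic_eq:
  assumes sol: "spray_solution A g I \<gamma> V" and I: "0 \<in> I" "t \<in> I" and init: "\<gamma> 0 = p" "V 0 = v"
  shows "geodesic A g p v t = \<gamma> t" "geodesic_velocity A g p v t = V t" "geodesic_defined A g p v t"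
proof -
  have r: "geodesic_reaches A g p v t (\<gamma> t, V t)"
    unfolding geodesic_reaches_def using sol I init by blast
  have "z = (\<gamma> t, V t)" if z: "geodesic_reaches A g p v t z" for z
  proof -
    obtain I' \<gamma>' V' where s': "spray_solution A g I' \<gamma>' V'" "0 \<in> I'" "t \<in> I'" "\<gamma>' 0 = p" "V' 0 = v" "z = (\<gamma>' t, V' t)"
      using z unfolding geodesic_reaches_def by blast
    have "\<gamma>' t = \<gamma> t \<and> V' t = V t"
      using s' I init by (intro solution_unique[OF s'(1) sol, of 0]) auto
    then show ?thesis using s'(6) by simp
  qed
  then have "(THE z. geodesic_reaches A g p v t z) = (\<gamma> t, V t)" using r by (intro the_equality)
  then show "geodesic A g p v t = \<gamma> t" "geodesic_velocity A g p v t = V t"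
    by (simp_all add: geodesic_def geodesic_velocity_def)
  show "geodesic_defined A g p v t" using r by (auto simp: geodesic_defined_def)
qed

lemma spray_scale:
  assumes c: "c \<in> A" and x: "x \<in> Xc c" and s: "0 < s"
  shows "spray A g c (x, s *\<^sub>R v) = s\<^sup>2 *\<^sub>R spray A g c (x, v)"
proof (cases "v = 0")
  case False
  interpret coord_metric "Xc c" "gcoord A g c" by (rule coord_metric_chart[OF c])
  show ?thesis unfolding spray_eq[OF c] by (rule spr_scale[OF x False s])
qed (simp add: spray_def)

text \<open>The spray is homogeneous of degree two in the velocity.\<close>

lemma solution_scale:
  assumes sol: "spray_solution A g I \<gamma> V" and s: "0 < s"
  shows "spray_solution A g {t. s * t \<in> I} (\<lambda>t. \<gamma> (s * t)) (\<lambda>t. tscale s (V (s * t)))"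
  unfolding spray_solution_def
proof (intro conjI ballI impI)
  have "open ((\<lambda>t. s * t) -` I)" using solution_interval(1)[OF sol] by (intro open_vimage continuous_intros)
  then show "open {t. s * t \<in> I}" by (simp add: vimage_def)
  have "convex ((\<lambda>t. s * t) -` I)" using solution_interval(4)[OF sol]
    by (intro convex_linear_vimage bounded_linear.linear[OF bounded_linear_mult_right])
  then show "is_interval {t. s * t \<in> I}" by (simp add: vimage_def is_interval_convex_1)
  fix t assume t: "t \<in> {t. s * t \<in> I}"
  then have tI: "s * t \<in> I" by simp
  have dm: "((\<lambda>t. s * t) has_vector_derivative s) (at t)"
    by (auto intro!: derivative_eq_intros simp: has_real_derivative_iff_has_vector_derivative[symmetric])
  show "has_velocity A (\<lambda>t. \<gamma> (s * t)) t (tscale s (V (s * t)))"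
    unfolding has_velocity_def
  proof (intro conjI ballI impI)
    have "isCont (\<lambda>t. s * t) t" by (intro continuous_intros)
    from isCont_o2[OF this solution_velocity(1)[OF sol tI]]
    show "isCont (\<lambda>t. \<gamma> (s * t)) t" .
    show "tscale s (V (s * t)) \<in> tangent_space A (\<gamma> (s * t))"
      by (rule tscale_in[OF solution_velocity(2)[OF sol tI]])
    fix c assume c: "c \<in> A" "\<gamma> (s * t) \<in> fst c"
    have "((snd c \<circ> \<gamma>) has_vector_derivative V (s * t) c) (at (s * t))"
      using sol tI c unfolding spray_solution_def has_velocity_def by blast
    from vector_diff_chain_at[OF dm this]
    show "((snd c \<circ> (\<lambda>t. \<gamma> (s * t))) has_vector_derivative tscale s (V (s * t)) c) (at t)"
      by (simp add: o_def tscale_def)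
  qed
  fix c assume c: "c \<in> A" "\<gamma> (s * t) \<in> fst c"
  have "((\<lambda>s. V s c) has_vector_derivative spray A g c (snd c (\<gamma> (s * t)), V (s * t) c)) (at (s * t))"
    using sol tI c unfolding spray_solution_def by blast
  from has_vector_derivative_scaleR[OF DERIV_const vector_diff_chain_at[OF dm this], of s]
  have "((\<lambda>t. s *\<^sub>R V (s * t) c) has_vector_derivative s *\<^sub>R (s *\<^sub>R spray A g c (snd c (\<gamma> (s * t)), V (s * t) c))) (at t)"
    by (simp add: o_def)
  moreover have "s *\<^sub>R (s *\<^sub>R spray A g c (snd c (\<gamma> (s * t)), V (s * t) c)) = spray A g c (snd c (\<gamma> (s * t)), s *\<^sub>R V (s * t) c)"
    using c by (subst spray_scale[OF c(1) _ s]) (auto simp: power2_eq_square)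
  ultimately show "((\<lambda>t. tscale s (V (s * t)) c) has_vector_derivative spray A g c (snd c (\<gamma> (s * t)), tscale s (V (s * t)) c)) (at t)"
    by (simp add: tscale_def)
qed

lemma solution_const: "spray_solution A g UNIV (\<lambda>_. q) (\<lambda>_. tzero)"
  unfolding spray_solution_def has_velocity_def
  by (auto simp: tzero_in o_def spray_def) (auto simp: tzero_def)

text \<open>A solution with zero velocity at one time is constant by uniqueness.  The metric is not defined at zero velocity, so
this is what allows differentiation along geodesics.\<close>

lemma solution_nonzero:
  assumes sol: "spray_solution A g I \<gamma> V" and t: "t \<in> I" "s \<in> I" and V: "V t \<noteq> tzero"
  shows "V s \<noteq> tzero"
  using solution_unique[OF sol solution_const[of "\<gamma> s"] t(2) UNIV_I refl _ t(1) UNIV_I] V by metis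

lemma lagrangian_constant:
  assumes sol: "spray_solution A g I \<gamma> V" and t: "t \<in> I" "s \<in> I"
  shows "lagrangian g (\<gamma> t) (V t) = lagrangian g (\<gamma> s) (V s)"
proof (cases "V t = tzero")
  case True
  then have "V s = tzero" using solution_nonzero[OF sol t(2,1)] by blast
  then show ?thesis using True by (simp add: lagrangian_def)
next
  case False
  have "\<exists>k. \<forall>x\<in>I. lagrangian g (\<gamma> x) (V x) = k"
  proof (rule has_derivative_zero_constant[OF solution_interval(4)[OF sol]])
    fix x assume x: "x \<in> I"
    obtain c where c: "c \<in> A" "\<gamma> x \<in> fst c" by (rule chart_cover)
    interpret coord_metric "Xc c" "gcoord A g c" by (rule coord_metric_chart[OF c(1)])
    have "V x c \<noteq> 0"
      using solution_nonzero[OF sol t(1) x False] tvec_eq_tzero_iff[OF solution_velocity(2)[OF sol x] c] by blast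
    then have zw: "coords c \<gamma> V x \<in> W" using c by (auto simp: coords_def)
    have "((\<lambda>s. lag (coords c \<gamma> V s)) has_vector_derivative 0) (at x)"
      using solution_coords[OF sol x c] unfolding field_def spray_eq[OF c(1)] by (intro lag_curve zw)
    then have d: "((\<lambda>s. lag (coords c \<gamma> V s)) has_derivative (\<lambda>h. 0)) (at x)" by (simp add: has_vector_derivative_def)
    have "\<forall>\<^sub>F s in nhds x. \<gamma> s \<in> fst c \<and> s \<in> I"
      using chart_eventually[OF solution_velocity(1)[OF sol x] c] eventually_nhds_in_open[OF solution_interval(1)[OF sol] x]
      by (rule eventually_conj)
    then obtain U where U: "open U" "x \<in> U" "\<forall>s\<in>U. \<gamma> s \<in> fst c \<and> s \<in> I" unfolding eventually_nhds by blast
    have "((\<lambda>s. lagrangian g (\<gamma> s) (V s)) has_derivative (\<lambda>h. 0)) (at x)"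
      by (rule has_derivative_transform_within_open[OF d U(1,2)])
         (use U(3) solution_velocity(2)[OF sol] lagrangian_coord[OF c(1)] in \<open>auto simp: coords_def\<close>)
    then show "((\<lambda>s. lagrangian g (\<gamma> s) (V s)) has_derivative (\<lambda>h. 0)) (at x within I)"
      by (rule has_derivative_at_withinI)
  qed
  then show ?thesis using t by metis
qed

end

section \<open>Lipschitz dependence on the initial velocity\<close>

lemma cancel_scaled_quotient: "(x::real) \<noteq> 0 \<Longrightarrow> x * (r / (k * x)) = r / k"
  by simp

lemma curve_bound:
  fixes u :: "real \<Rightarrow> 'a::real_normed_vector"
  assumes ab: "a \<le> b" and der: "\<And>s. s \<in> {a..b} \<Longrightarrow> (u has_vector_derivative u' s) (at s within {a..b})"
    and bd: "\<And>s. s \<in> {a..b} \<Longrightarrow> norm (u' s) \<le> B"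
  shows "norm (u b - u a) \<le> B * (b - a)"
proof -
  have "norm (u b - u a) \<le> B * norm (b - a)"
  proof (rule differentiable_bound[where S="{a..b}" and f'="\<lambda>s h. h *\<^sub>R u' s"])
    show "(u has_derivative (\<lambda>h. h *\<^sub>R u' s)) (at s within {a..b})" if "s \<in> {a..b}" for s
      using der[OF that] by (simp add: has_vector_derivative_def)
    show "onorm (\<lambda>h. h *\<^sub>R u' s) \<le> B" if "s \<in> {a..b}" for s
    proof (rule onorm_bound)
      show "0 \<le> B" using bd[OF that] norm_ge_zero order_trans by blast
      fix h show "norm (h *\<^sub>R u' s) \<le> B * norm h"
        using mult_left_mono[OF bd[OF that], of "\<bar>h\<bar>"] by (simp add: mult.commute)
    qed
  qed (use ab in auto)
  then show ?thesis using ab by simp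
qed

context finsler begin

lemma coords_continuous:
  assumes sol: "spray_solution A g I \<gamma> V" and t: "t \<in> I" and c: "c \<in> A" "\<gamma> t \<in> fst c"
  shows "(coords c \<gamma> V \<longlongrightarrow> coords c \<gamma> V t) (nhds t)"
  using has_vector_derivative_continuous[OF solution_coords[OF assms]]
  by (simp add: continuous_within tendsto_nhds_iff)

text \<open>A curve whose coordinates are outside a closed ball stays outside for a while; a curve outside the
domain of the chart does not come near the compact set of points with coordinates in the ball.  The
latter is closed because the manifold is a Hausdorff space.\<close>

lemma exit_open:
  assumes sol: "spray_solution A g I \<gamma> V" and t: "t \<in> I" and c: "c \<in> A"
    and B: "cball z r \<subseteq> Xc c \<times> UNIV"
    and out: "\<not> (\<gamma> t \<in> fst c \<and> coords c \<gamma> V t \<in> cball z r)"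
  shows "\<forall>\<^sub>F s in nhds t. \<not> (\<gamma> s \<in> fst c \<and> coords c \<gamma> V s \<in> cball z r)"
proof (cases "\<gamma> t \<in> fst c")
  case True
  then have "coords c \<gamma> V t \<in> - cball z r" using out by simp
  then have "\<forall>\<^sub>F s in nhds t. coords c \<gamma> V s \<in> - cball z r"
    by (rule topological_tendstoD[OF coords_continuous[OF sol t c True] open_Compl[OF closed_cball]])
  then show ?thesis by eventually_elim simp
next
  case False
  define K where "K = chart_inv c ` (fst ` cball z r)"
  have sub: "fst ` cball z r \<subseteq> Xc c" using B by auto
  have "compact (fst ` cball z r)"
    by (intro compact_continuous_image continuous_intros compact_cball)
  then have "compact K" unfolding K_def
    by (rule compact_continuous_image[OF continuous_on_subset[OF chart_inv_cont[OF c] sub]])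
  then have op: "open (- K)" by (simp add: compact_imp_closed open_Compl)
  have "K \<subseteq> fst c" using chart_inv_in[OF c] sub by (auto simp: K_def)
  then have "\<gamma> t \<in> - K" using False by blast
  moreover have "(\<gamma> \<longlongrightarrow> \<gamma> t) (nhds t)"
    using solution_velocity(1)[OF sol t] by (simp add: tendsto_nhds_iff isCont_def)
  ultimately have "\<forall>\<^sub>F s in nhds t. \<gamma> s \<in> - K" using topological_tendstoD op by blast
  then show ?thesis
  proof eventually_elim
    case (elim s)
    show ?case
    proof
      assume s: "\<gamma> s \<in> fst c \<and> coords c \<gamma> V s \<in> cball z r"
      have "chart_inv c (fst (coords c \<gamma> V s)) \<in> K" unfolding K_def using s by blast
      then have "\<gamma> s \<in> K" using s c by (simp add: coords_def)
      then show False using elim by blast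
    qed
  qed
qed

text \<open>The speed in the chart is at most \<open>M\<close> while the solution is in the ball, and the time is too short for
crossing the outer half of the radius at this speed.\<close>

lemma stay:
  assumes sol: "spray_solution A g I \<gamma> V" and I: "{t1..t2} \<subseteq> I" and c: "c \<in> A"
    and B: "cball z r \<subseteq> Xc c \<times> UNIV"
    and M: "\<And>w. w \<in> cball z r \<Longrightarrow> norm (field c w) \<le> M" and MT: "M * (t2 - t1) < r / 2"
    and init: "\<gamma> t1 \<in> fst c" "coords c \<gamma> V t1 \<in> cball z (r / 2)" and t: "t \<in> {t1..t2}"
  shows "\<gamma> t \<in> fst c \<and> coords c \<gamma> V t \<in> cball z r"
proof -
  define T where "T = (\<lambda>s. \<gamma> s \<in> fst c \<and> coords c \<gamma> V s \<in> cball z r)"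
  have r: "0 \<le> r" using init(2) by (metis cball_eq_empty divide_less_0_iff empty_iff not_less zero_less_numeral less_asym)
  have M0: "0 \<le> M" using M[of z] r norm_ge_zero order_trans by (metis centre_in_cball)
  have T1: "T t1" using init r by (auto simp: T_def)
  have "\<forall>s\<in>{t1..t}. T s"
  proof (rule clopen_interval[where I="{t1..t2}" and P="\<lambda>t. \<forall>s\<in>{t1..t}. T s" and ?t0.0=t1])
    show "\<forall>s\<in>{t1..t1}. T s" using T1 by simp
    show "t1 \<in> {t1..t2}" using t by simp
    fix x assume x: "x \<in> {t1..t2}"
    {
      assume Q: "\<forall>s\<in>{t1..x}. T s"
      have xI: "x \<in> I" and gx: "\<gamma> x \<in> fst c" using x I Q by (auto simp: T_def)
      have "norm (coords c \<gamma> V x - coords c \<gamma> V t1) \<le> M * (x - t1)"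
      proof (rule curve_bound)
        show "t1 \<le> x" using x by simp
        fix s assume s: "s \<in> {t1..x}"
        then have sI: "s \<in> I" using x I by auto
        have Ts: "\<gamma> s \<in> fst c" "coords c \<gamma> V s \<in> cball z r" using Q s by (auto simp: T_def)
        show "(coords c \<gamma> V has_vector_derivative field c (coords c \<gamma> V s)) (at s within {t1..x})"
          by (rule has_vector_derivative_at_within[OF solution_coords[OF sol sI c Ts(1)]])
        show "norm (field c (coords c \<gamma> V s)) \<le> M" by (rule M[OF Ts(2)])
      qed
      also have "\<dots> \<le> M * (t2 - t1)" using x M0 by (intro mult_left_mono) auto
      finally have "dist (coords c \<gamma> V t1) (coords c \<gamma> V x) < r / 2" using MT by (simp add: dist_norm norm_minus_commute)
      moreover have "dist z (coords c \<gamma> V t1) \<le> r / 2" using init(2) by simp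
      ultimately have inb: "coords c \<gamma> V x \<in> ball z r"
        using dist_triangle[of z "coords c \<gamma> V x" "coords c \<gamma> V t1"] by simp
      have "\<forall>\<^sub>F s in nhds x. \<gamma> s \<in> fst c \<and> coords c \<gamma> V s \<in> ball z r"
        using chart_eventually[OF solution_velocity(1)[OF sol xI] c gx]
          topological_tendstoD[OF coords_continuous[OF sol xI c gx] open_ball inb] by (rule eventually_conj)
      then obtain e where e: "0 < e" "\<And>s. dist s x < e \<Longrightarrow> \<gamma> s \<in> fst c \<and> coords c \<gamma> V s \<in> ball z r"
        unfolding eventually_nhds_metric by blast
      have "\<forall>s'\<in>{t1..s}. T s'" if "dist s x < e" for s
      proof
        fix s' assume s': "s' \<in> {t1..s}"
        show "T s'"
        proof (cases "s' \<le> x")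
          case True then show ?thesis using Q s' by auto
        next
          case False
          then have "dist s' x < e" using that s' by (auto simp: dist_real_def)
          then show ?thesis using e(2)[of s'] by (auto simp: T_def)
        qed
      qed
      then show "\<forall>\<^sub>F s in nhds x. s \<in> {t1..t2} \<longrightarrow> (\<forall>s\<in>{t1..s}. T s)"
        unfolding eventually_nhds_metric using e(1) by blast
    }
    {
      assume nQ: "\<not> (\<forall>s\<in>{t1..x}. T s)"
      then obtain s0 where s0: "s0 \<in> {t1..x}" "\<not> T s0" by blast
      show "\<forall>\<^sub>F s in nhds x. s \<in> {t1..t2} \<longrightarrow> \<not> (\<forall>s\<in>{t1..s}. T s)"
      proof (cases "s0 = x")
        case True
        have "\<forall>\<^sub>F s in nhds x. \<not> T s"
          unfolding T_def by (rule exit_open[OF sol _ c B]) (use x I s0 True in \<open>auto simp: T_def\<close>)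
        then show ?thesis by eventually_elim auto
      next
        case False
        then have "s0 < x" using s0 by simp
        then have "\<forall>\<^sub>F s in nhds x. s0 < s" using eventually_nhds_in_open[of "{s0<..}" x] by simp
        then show ?thesis
        proof eventually_elim
          case (elim s)
          then show ?case using s0 by (intro impI notI) (meson atLeastAtMost_iff bspec less_imp_le)
        qed
      qed
    }
  qed (use t in auto)
  then show ?thesis using t by (auto simp: T_def)
qed

end

text \<open>The geodesics from \<open>p\<close>, parametrized by the components \<open>y\<close> of the initial velocity in the chart \<open>c0\<close>.
They need not stay in one chart, so statements about them at time \<open>t\<close> refer to any chart around the
position at time \<open>t\<close>.\<close>

locale geodesic_family = finsler A g for A :: "('m::t2_space, 'n::finite) chart set" and g +
  fixes c0 :: "('m, 'n) chart" and p :: 'm and Y :: "(real^'n) set" and I :: "real^'n \<Rightarrow> real set"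
    and \<gamma> :: "real^'n \<Rightarrow> real \<Rightarrow> 'm" and V :: "real^'n \<Rightarrow> real \<Rightarrow> ('m, 'n) tvec"
  assumes c0: "c0 \<in> A" "p \<in> fst c0" and Y: "open Y"
    and sol: "\<And>y. y \<in> Y \<Longrightarrow> spray_solution A g (I y) (\<gamma> y) (V y)"
    and I01: "\<And>y. y \<in> Y \<Longrightarrow> {0..1} \<subseteq> I y"
    and init: "\<And>y. y \<in> Y \<Longrightarrow> \<gamma> y 0 = p" "\<And>y. y \<in> Y \<Longrightarrow> V y 0 = tvec_of A c0 p y"
begin

abbreviation Z where "Z d t y \<equiv> coords d (\<gamma> y) (V y) t"

lemma in_I: "y \<in> Y \<Longrightarrow> t \<in> {0..1} \<Longrightarrow> t \<in> I y" using I01 by blast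

lemma Z_change:
  assumes y: "y \<in> Y" and t: "t \<in> {0..1}" and d: "d \<in> A" "\<gamma> y t \<in> fst d" and e: "e \<in> A" "\<gamma> y t \<in> fst e"
  shows "Z e t y = ttrans d e (Z d t y)"
  using tangentD[OF solution_velocity(2)[OF sol[OF y] in_I[OF y t]] d(1) e(1) d(2) e(2)] d e
  by (simp add: coords_def ttrans_def tmap_apply)

text \<open>Near \<open>y0\<close> the state at time \<open>t\<close> is a Lipschitz function of the initial velocity, as seen in the chart \<open>d\<close>
or, for \<open>lip_time\<close>, in some chart.\<close>

definition lip_chart :: "real^'n \<Rightarrow> ('m, 'n) chart \<Rightarrow> real \<Rightarrow> bool" where
  "lip_chart y0 d t \<longleftrightarrow> (\<exists>\<delta>>0. \<exists>C\<ge>0. ball y0 \<delta> \<subseteq> Y \<and> (\<forall>y\<in>ball y0 \<delta>. \<gamma> y t \<in> fst d) \<and>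
     (\<forall>y\<in>ball y0 \<delta>. \<forall>y'\<in>ball y0 \<delta>. norm (Z d t y - Z d t y') \<le> C * norm (y - y')))"

definition lip_time :: "real^'n \<Rightarrow> real \<Rightarrow> bool" where "lip_time y0 t \<longleftrightarrow> (\<exists>d\<in>A. lip_chart y0 d t)"

lemma lip_chart_change:
  assumes d: "d \<in> A" and lip_time: "lip_chart y0 d t" and t: "t \<in> {0..1}" and e: "e \<in> A" "\<gamma> y0 t \<in> fst e"
  shows "lip_chart y0 e t"
proof -
  obtain \<delta> C where \<delta>: "0 < \<delta>" "0 \<le> C" "ball y0 \<delta> \<subseteq> Y" "\<forall>y\<in>ball y0 \<delta>. \<gamma> y t \<in> fst d"
    "\<forall>y\<in>ball y0 \<delta>. \<forall>y'\<in>ball y0 \<delta>. norm (Z d t y - Z d t y') \<le> C * norm (y - y')"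
    using lip_time unfolding lip_chart_def by blast
  have y0: "y0 \<in> ball y0 \<delta>" "y0 \<in> Y" using \<delta>(1,3) by auto
  have g0: "\<gamma> y0 t \<in> fst d" using \<delta>(4) y0 by blast
  have zin: "Z d t y0 \<in> overlap d e \<times> UNIV" using g0 e by (auto simp: coords_def overlap_def)
  have op: "open (overlap d e \<times> (UNIV :: (real^'n) set))" by (intro open_Times overlap_open d e) auto
  obtain r K where r: "0 < r" "cball (Z d t y0) r \<subseteq> overlap d e \<times> UNIV" "K-lipschitz_on (cball (Z d t y0) r) (ttrans d e)"
    using LL_cball[OF ttrans_LL[OF d e(1)] op zin] .
  have K: "0 \<le> K" using r(3) by (rule lipschitz_on_nonneg)
  define \<delta>' where "\<delta>' = min \<delta> (r / (C + 1))"
  have \<delta>': "0 < \<delta>'" "\<delta>' \<le> \<delta>" using \<delta>(1,2) r(1) by (auto simp: \<delta>'_def)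
  have inb: "Z d t y \<in> cball (Z d t y0) r" if y: "y \<in> ball y0 \<delta>'" for y
  proof -
    have yb: "y \<in> ball y0 \<delta>" using y \<delta>' by auto
    have "norm (Z d t y0 - Z d t y) \<le> C * norm (y0 - y)" using \<delta>(5) yb y0 by blast
    also have "\<dots> \<le> (C + 1) * (r / (C + 1))"
      using y \<delta>(2) by (intro mult_mono) (auto simp: \<delta>'_def dist_norm)
    also have "\<dots> = r" using \<delta>(2) by simp
    finally show ?thesis by (simp add: dist_norm)
  qed
  have ge: "\<gamma> y t \<in> fst d \<and> \<gamma> y t \<in> fst e" if y: "y \<in> ball y0 \<delta>'" for y
  proof -
    have gd: "\<gamma> y t \<in> fst d" using \<delta>(4) y \<delta>' by auto
    have "snd d (\<gamma> y t) \<in> overlap d e" using inb[OF y] r(2) by (auto simp: coords_def)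
    then obtain q where q: "q \<in> fst d" "q \<in> fst e" "snd d (\<gamma> y t) = snd d q" by (auto simp: overlap_def)
    then have "q = \<gamma> y t" using chart_inv_chart[OF d] gd by metis
    then show ?thesis using gd q by blast
  qed
  have Yin: "ball y0 \<delta>' \<subseteq> Y" using \<delta>(3) \<delta>'(2) by auto
  have fin: "norm (Z e t y - Z e t y') \<le> (K * C) * norm (y - y')"
    if y: "y \<in> ball y0 \<delta>'" "y' \<in> ball y0 \<delta>'" for y y'
  proof -
    have eq: "Z e t y = ttrans d e (Z d t y)" "Z e t y' = ttrans d e (Z d t y')"
      using y Yin ge by (auto intro!: Z_change t d e)
    have "norm (ttrans d e (Z d t y) - ttrans d e (Z d t y')) \<le> K * norm (Z d t y - Z d t y')"
      by (rule lipschitz_on_normD[OF r(3) inb[OF y(1)] inb[OF y(2)]])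
    also have "\<dots> \<le> K * (C * norm (y - y'))" using K \<delta>(5) y \<delta>'(2) by (intro mult_left_mono) auto
    finally show ?thesis by (simp add: eq mult.assoc)
  qed
  show ?thesis unfolding lip_chart_def
    using \<delta>'(1) Yin ge fin K \<delta>(2) by (intro exI[of _ \<delta>'] conjI exI[of _ "K * C"] ballI) auto
qed

lemma lip_time_0: assumes y0: "y0 \<in> Y" shows "lip_time y0 0"
  unfolding lip_time_def
proof (rule bexI[OF _ c0(1)])
  obtain \<delta> where \<delta>: "0 < \<delta>" "ball y0 \<delta> \<subseteq> Y" using Y y0 by (meson open_contains_ball)
  have Z: "Z c0 0 y = (snd c0 p, y)" if "y \<in> ball y0 \<delta>" for y
    using that \<delta>(2) init[of y] c0 by (auto simp: coords_def tvec_of_self)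
  have "norm (Z c0 0 y - Z c0 0 y') \<le> 1 * norm (y - y')" if "y \<in> ball y0 \<delta>" "y' \<in> ball y0 \<delta>" for y y'
    using that by (simp add: Z norm_Pair)
  moreover have "\<gamma> y 0 \<in> fst c0" if "y \<in> ball y0 \<delta>" for y using that \<delta>(2) init(1) c0 by auto
  ultimately show "lip_chart y0 c0 0" unfolding lip_chart_def using \<delta> zero_le_one by blast
qed

text \<open>Around a time \<open>t0\<close>, a whole bundle of neighboring geodesics that is Lipschitz at \<open>t1\<close> stays in one
coordinate ball until \<open>t2\<close>, where the spray has a Lipschitz constant; Gronwall's inequality then
bounds their mutual distances.\<close>

lemma tube_step:
  assumes y0: "y0 \<in> Y" and t0: "t0 \<in> {0..1}" and d: "d \<in> A" "\<gamma> y0 t0 \<in> fst d"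
    and r: "0 < r" "cball (Z d t0 y0) r \<subseteq> Xc d \<times> UNIV" and K: "K-lipschitz_on (cball (Z d t0 y0) r) (field d)"
  shows "\<exists>\<eta>>0. \<forall>t1\<in>{0..1}. \<forall>t2\<in>{0..1}. \<bar>t1 - t0\<bar> < \<eta> \<longrightarrow> \<bar>t2 - t0\<bar> < \<eta> \<longrightarrow> t1 \<le> t2 \<longrightarrow> lip_time y0 t1 \<longrightarrow>
    (\<exists>\<delta>>0. \<exists>C\<ge>0. ball y0 \<delta> \<subseteq> Y \<and> (\<forall>t\<in>{t1..t2}. \<forall>y\<in>ball y0 \<delta>. \<gamma> y t \<in> fst d \<and> Z d t y \<in> cball (Z d t0 y0) r \<and>
        (\<forall>y'\<in>ball y0 \<delta>. norm (Z d t y - Z d t y') \<le> C * norm (y - y'))))"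
proof -
  define z where "z = Z d t0 y0"
  have K0: "0 \<le> K" using K by (rule lipschitz_on_nonneg)
  have "bounded (field d ` cball z r)"
    using lipschitz_on_continuous_on[OF K] by (intro compact_imp_bounded compact_continuous_image) (auto simp: z_def)
  then obtain M0 where M0': "\<forall>w\<in>field d ` cball z r. norm w \<le> M0" unfolding bounded_iff by blast
  then have M0: "norm (field d w) \<le> M0" if "w \<in> cball z r" for w using that by blast
  define M where "M = \<bar>M0\<bar>"
  have M1: "0 \<le> M" by (simp add: M_def)
  have M2: "norm (field d w) \<le> M" if "w \<in> cball z r" for w
    using M0[OF that] abs_ge_self[of M0] unfolding M_def by linarith
  note M = M1 M2
  have t0I: "t0 \<in> I y0" by (rule in_I[OF y0 t0])
  have inb: "Z d t0 y0 \<in> ball z (r / 4)" using r(1) by (simp add: z_def)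
  have "\<forall>\<^sub>F s in nhds t0. \<gamma> y0 s \<in> fst d \<and> Z d s y0 \<in> ball z (r / 4)"
    using chart_eventually[OF solution_velocity(1)[OF sol[OF y0] t0I] d]
      topological_tendstoD[OF coords_continuous[OF sol[OF y0] t0I d] open_ball inb] by (rule eventually_conj)
  then obtain \<eta>0 where \<eta>0: "0 < \<eta>0" "\<And>s. dist s t0 < \<eta>0 \<Longrightarrow> \<gamma> y0 s \<in> fst d \<and> Z d s y0 \<in> ball z (r / 4)"
    unfolding eventually_nhds_metric by blast
  define \<eta> where "\<eta> = min \<eta>0 (r / (8 * (M + 1)))"
  have \<eta>: "0 < \<eta>" "\<eta> \<le> \<eta>0" using \<eta>0 r(1) M(1) by (auto simp: \<eta>_def)
  have M\<eta>: "M * (2 * \<eta>) < r / 2"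
  proof -
    have P: "0 < 8 * (M + 1)" using M(1) by simp
    have "\<eta> \<le> r / (8 * (M + 1))" unfolding \<eta>_def by (rule min.cobounded2)
    then have "\<eta> * (8 * (M + 1)) \<le> r" by (simp only: pos_le_divide_eq[OF P])
    then have "8 * (M * \<eta>) + 8 * \<eta> \<le> r" by (simp add: algebra_simps)
    then show ?thesis using \<eta>(1) mult_nonneg_nonneg[OF M(1), of \<eta>] by linarith
  qed
  have main: "\<exists>\<delta>>0. \<exists>C\<ge>0. ball y0 \<delta> \<subseteq> Y \<and> (\<forall>t\<in>{t1..t2}. \<forall>y\<in>ball y0 \<delta>. \<gamma> y t \<in> fst d \<and> Z d t y \<in> cball z r \<and>
        (\<forall>y'\<in>ball y0 \<delta>. norm (Z d t y - Z d t y') \<le> C * norm (y - y')))"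
    if t1: "t1 \<in> {0..1}" "\<bar>t1 - t0\<bar> < \<eta>" and t2: "t2 \<in> {0..1}" "\<bar>t2 - t0\<bar> < \<eta>" and t12: "t1 \<le> t2" and lip_time: "lip_time y0 t1" for t1 t2
  proof -
    have g1: "\<gamma> y0 t1 \<in> fst d" "Z d t1 y0 \<in> ball z (r / 4)" using \<eta>0(2)[of t1] t1(2) \<eta>(2) by (auto simp: dist_real_def)
    obtain d' where d': "d' \<in> A" "lip_chart y0 d' t1" using lip_time unfolding lip_time_def by blast
    obtain \<delta>0 C0 where \<delta>0: "0 < \<delta>0" "0 \<le> C0" "ball y0 \<delta>0 \<subseteq> Y" "\<forall>y\<in>ball y0 \<delta>0. \<gamma> y t1 \<in> fst d"
      "\<forall>y\<in>ball y0 \<delta>0. \<forall>y'\<in>ball y0 \<delta>0. norm (Z d t1 y - Z d t1 y') \<le> C0 * norm (y - y')"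
      using lip_chart_change[OF d' t1(1) d(1) g1(1)] unfolding lip_chart_def by blast
    define \<delta> where "\<delta> = min \<delta>0 (r / (4 * (C0 + 1)))"
    have \<delta>: "0 < \<delta>" "\<delta> \<le> \<delta>0" using \<delta>0(1,2) r(1) by (auto simp: \<delta>_def)
    have st: "\<gamma> y t \<in> fst d \<and> Z d t y \<in> cball z r" if y: "y \<in> ball y0 \<delta>" and t: "t \<in> {t1..t2}" for y t
    proof (rule stay[OF sol _ d(1) _ M(2) _ _ _ t])
      have yb: "y \<in> ball y0 \<delta>0" "y0 \<in> ball y0 \<delta>0" using y \<delta> by auto
      show yY: "y \<in> Y" using yb \<delta>0(3) by blast
      show "{t1..t2} \<subseteq> I y" using I01[OF yY] t1(1) t2(1) by auto
      show "cball z r \<subseteq> Xc d \<times> UNIV" using r(2) by (simp add: z_def)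
      have "t2 - t1 \<le> 2 * \<eta>" using t1(2) t2(2) by linarith
      then have "M * (t2 - t1) \<le> M * (2 * \<eta>)" using M(1) by (rule mult_left_mono)
      then show "M * (t2 - t1) < r / 2" using M\<eta> by linarith
      show "\<gamma> y t1 \<in> fst d" using \<delta>0(4) yb by blast
      have "norm (Z d t1 y0 - Z d t1 y) \<le> C0 * norm (y0 - y)" using \<delta>0(5) yb by blast
      also have "\<dots> \<le> (C0 + 1) * (r / (4 * (C0 + 1)))"
        using y \<delta>0(2) by (intro mult_mono) (auto simp: \<delta>_def dist_norm)
      also have "\<dots> = r / 4" by (rule cancel_scaled_quotient) (use \<delta>0(2) in linarith)
      finally have "dist (Z d t1 y0) (Z d t1 y) \<le> r / 4" by (simp add: dist_norm)
      then show "Z d t1 y \<in> cball z (r / 2)"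
        using g1(2) dist_triangle[of z "Z d t1 y" "Z d t1 y0"] by simp
    qed
    define C where "C = exp ((2 * K + 1) * (t2 - t1)) * C0"
    have C: "0 \<le> C" using \<delta>0(2) by (simp add: C_def)
    have lip: "norm (Z d t y - Z d t y') \<le> C * norm (y - y')"
      if y: "y \<in> ball y0 \<delta>" "y' \<in> ball y0 \<delta>" and t: "t \<in> {t1..t2}" for y y' t
    proof -
      have yY: "y \<in> Y" "y' \<in> Y" using y \<delta>(2) \<delta>0(3) by auto
      have "norm (Z d t y - Z d t y') \<le> exp ((2 * K + 1) * (t2 - t1)) * (norm (Z d t1 y - Z d t1 y') + 0)"
      proof (rule gronwall[OF t _ _ K0, where u="\<lambda>t. Z d t y - Z d t y'" and u'="\<lambda>s. field d (Z d s y) - field d (Z d s y')"])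
        fix s assume s: "s \<in> {t1..t2}"
        have s01: "s \<in> {0..1}" using s t1(1) t2(1) by auto
        note a = solution_coords[OF sol[OF yY(1)] in_I[OF yY(1) s01] d(1) conjunct1[OF st[OF y(1) s]]]
        note b = solution_coords[OF sol[OF yY(2)] in_I[OF yY(2) s01] d(1) conjunct1[OF st[OF y(2) s]]]
        show "((\<lambda>t. Z d t y - Z d t y') has_vector_derivative field d (Z d s y) - field d (Z d s y')) (at s within {t1..t2})"
          by (rule has_vector_derivative_at_within[OF has_vector_derivative_diff[OF a b]])
        show "norm (field d (Z d s y) - field d (Z d s y')) \<le> K * norm (Z d s y - Z d s y') + 0"
          using lipschitz_on_normD[OF K, of "Z d s y" "Z d s y'"] st[OF y(1) s] st[OF y(2) s] by (simp add: z_def)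
      qed simp
      also have "\<dots> \<le> exp ((2 * K + 1) * (t2 - t1)) * (C0 * norm (y - y'))"
        using \<delta>0(5) y \<delta>(2) by (intro mult_left_mono) auto
      finally show ?thesis by (simp add: C_def mult.assoc)
    qed
    show ?thesis
      using \<delta>(1) C \<delta>(2) \<delta>0(3) st lip by (intro exI[of _ \<delta>] exI[of _ C] conjI ballI) auto
  qed
  show ?thesis using main \<eta>(1) unfolding z_def by blast
qed

lemma field_cball:
  assumes "y0 \<in> Y" "d \<in> A" "\<gamma> y0 t0 \<in> fst d" and S: "open S" "Z d t0 y0 \<in> S"
  obtains r K where "0 < r" "cball (Z d t0 y0) r \<subseteq> S" "cball (Z d t0 y0) r \<subseteq> Xc d \<times> UNIV"
    "K-lipschitz_on (cball (Z d t0 y0) r) (field d)"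
proof -
  have 1: "Z d t0 y0 \<in> Xc d \<times> UNIV" using assms by (simp add: coords_def)
  have 2: "open (Xc d \<times> (UNIV :: (real^'n) set))" using chart_image_open[OF assms(2)] by (intro open_Times) auto
  obtain r K where r: "0 < r" "cball (Z d t0 y0) r \<subseteq> Xc d \<times> UNIV" "K-lipschitz_on (cball (Z d t0 y0) r) (field d)"
    by (rule LL_cball[OF field_LL[OF assms(2)] 2 1])
  obtain s where s: "0 < s" "cball (Z d t0 y0) s \<subseteq> S" using S by (meson open_contains_cball)
  show ?thesis
    by (rule that[of "min r s" K]) (use r s in \<open>auto intro: lipschitz_on_subset\<close>)
qed

lemma lip_time: assumes y0: "y0 \<in> Y" and t: "t \<in> {0..1}" shows "lip_time y0 t"
proof (rule interval_propagate[of "lip_time y0" 0 1, OF lip_time_0[OF y0] _ t])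
  fix t0 :: real assume t0: "t0 \<in> {0..1}"
  obtain d where d: "d \<in> A" "\<gamma> y0 t0 \<in> fst d" by (rule chart_cover)
  obtain r K where r: "0 < r" "cball (Z d t0 y0) r \<subseteq> Xc d \<times> UNIV" "K-lipschitz_on (cball (Z d t0 y0) r) (field d)"
    by (rule field_cball[OF y0 d open_UNIV UNIV_I])
  obtain \<eta> where \<eta>: "0 < \<eta>" "\<forall>t1\<in>{0..1}. \<forall>t2\<in>{0..1}. \<bar>t1 - t0\<bar> < \<eta> \<longrightarrow> \<bar>t2 - t0\<bar> < \<eta> \<longrightarrow> t1 \<le> t2 \<longrightarrow> lip_time y0 t1 \<longrightarrow>
    (\<exists>\<delta>>0. \<exists>C\<ge>0. ball y0 \<delta> \<subseteq> Y \<and> (\<forall>t\<in>{t1..t2}. \<forall>y\<in>ball y0 \<delta>. \<gamma> y t \<in> fst d \<and> Z d t y \<in> cball (Z d t0 y0) r \<and>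
        (\<forall>y'\<in>ball y0 \<delta>. norm (Z d t y - Z d t y') \<le> C * norm (y - y'))))"
    using tube_step[OF y0 t0 d r] by blast
  have "lip_time y0 t2" if t: "t1 \<in> {0..1}" "t2 \<in> {0..1}" "\<bar>t1 - t0\<bar> < \<eta>" "\<bar>t2 - t0\<bar> < \<eta>" "t1 \<le> t2" "lip_time y0 t1" for t1 t2
  proof -
    obtain \<delta> C where \<delta>: "\<delta> > 0" "C \<ge> 0" "ball y0 \<delta> \<subseteq> Y" "\<forall>t\<in>{t1..t2}. \<forall>y\<in>ball y0 \<delta>. \<gamma> y t \<in> fst d \<and> Z d t y \<in> cball (Z d t0 y0) r \<and>
        (\<forall>y'\<in>ball y0 \<delta>. norm (Z d t y - Z d t y') \<le> C * norm (y - y'))"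
      using \<eta>(2)[rule_format, OF t] by blast
    have "t2 \<in> {t1..t2}" using t by simp
    then have "lip_chart y0 d t2" unfolding lip_chart_def using \<delta>
      by (intro exI[of _ \<delta>] exI[of _ C] conjI ballI) blast+
    then show ?thesis using d(1) unfolding lip_time_def by blast
  qed
  then show "\<exists>\<eta>>0. \<forall>t1\<in>{0..1}. \<forall>t2\<in>{0..1}. \<bar>t1 - t0\<bar> < \<eta> \<longrightarrow> \<bar>t2 - t0\<bar> < \<eta> \<longrightarrow> t1 \<le> t2 \<longrightarrow> lip_time y0 t1 \<longrightarrow> lip_time y0 t2"
    using \<eta>(1) by blast
qed

lemma lip_time_chart: "y0 \<in> Y \<Longrightarrow> t \<in> {0..1} \<Longrightarrow> e \<in> A \<Longrightarrow> \<gamma> y0 t \<in> fst e \<Longrightarrow> lip_chart y0 e t"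
  using lip_time[of y0 t] lip_chart_change unfolding lip_time_def by blast

text \<open>Propagation from time 0 removes the hypothesis of \<open>tube_step\<close> on an earlier time.\<close>

lemma tube:
  assumes y0: "y0 \<in> Y" and t0: "t0 \<in> {0..1}" and d: "d \<in> A" "\<gamma> y0 t0 \<in> fst d"
    and r: "0 < r" "cball (Z d t0 y0) r \<subseteq> Xc d \<times> UNIV" and K: "K-lipschitz_on (cball (Z d t0 y0) r) (field d)"
  obtains \<eta> \<delta> C where "0 < \<eta>" "0 < \<delta>" "0 \<le> C" "ball y0 \<delta> \<subseteq> Y"
    "\<And>t y. t \<in> {0..1} \<Longrightarrow> \<bar>t - t0\<bar> < \<eta> \<Longrightarrow> y \<in> ball y0 \<delta> \<Longrightarrow> \<gamma> y t \<in> fst d \<and> Z d t y \<in> cball (Z d t0 y0) r"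
    "\<And>t y y'. t \<in> {0..1} \<Longrightarrow> \<bar>t - t0\<bar> < \<eta> \<Longrightarrow> y \<in> ball y0 \<delta> \<Longrightarrow> y' \<in> ball y0 \<delta> \<Longrightarrow>
        norm (Z d t y - Z d t y') \<le> C * norm (y - y')"
proof -
  obtain \<eta> where \<eta>: "0 < \<eta>" "\<forall>t1\<in>{0..1}. \<forall>t2\<in>{0..1}. \<bar>t1 - t0\<bar> < \<eta> \<longrightarrow> \<bar>t2 - t0\<bar> < \<eta> \<longrightarrow> t1 \<le> t2 \<longrightarrow> lip_time y0 t1 \<longrightarrow>
    (\<exists>\<delta>>0. \<exists>C\<ge>0. ball y0 \<delta> \<subseteq> Y \<and> (\<forall>t\<in>{t1..t2}. \<forall>y\<in>ball y0 \<delta>. \<gamma> y t \<in> fst d \<and> Z d t y \<in> cball (Z d t0 y0) r \<and>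
        (\<forall>y'\<in>ball y0 \<delta>. norm (Z d t y - Z d t y') \<le> C * norm (y - y'))))"
    using tube_step[OF y0 t0 d r K] by blast
  define t1 where "t1 = max 0 (t0 - \<eta> / 2)"
  define t2 where "t2 = min 1 (t0 + \<eta> / 2)"
  have t: "t1 \<in> {0..1}" "t2 \<in> {0..1}" "\<bar>t1 - t0\<bar> < \<eta>" "\<bar>t2 - t0\<bar> < \<eta>" "t1 \<le> t2"
    using t0 \<eta>(1) by (auto simp: t1_def t2_def)
  obtain \<delta> C where \<delta>: "\<delta> > 0" "C \<ge> 0" "ball y0 \<delta> \<subseteq> Y" "\<forall>t\<in>{t1..t2}. \<forall>y\<in>ball y0 \<delta>. \<gamma> y t \<in> fst d \<and> Z d t y \<in> cball (Z d t0 y0) r \<and>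
        (\<forall>y'\<in>ball y0 \<delta>. norm (Z d t y - Z d t y') \<le> C * norm (y - y'))"
    using \<eta>(2)[rule_format, OF t lip_time[OF y0 t(1)]] by blast
  have inn: "s \<in> {t1..t2}" if "s \<in> {0..1}" "\<bar>s - t0\<bar> < \<eta> / 2" for s
    using that unfolding t1_def t2_def abs_less_iff by auto
  show ?thesis
  proof (rule that[of "\<eta> / 2" \<delta> C])
    fix s y assume s: "s \<in> {0..1}" "\<bar>s - t0\<bar> < \<eta> / 2" and y: "y \<in> ball y0 \<delta>"
    show "\<gamma> y s \<in> fst d \<and> Z d s y \<in> cball (Z d t0 y0) r" using \<delta>(4) inn[OF s] y by blast
    fix y' assume "y' \<in> ball y0 \<delta>"
    then show "norm (Z d s y - Z d s y') \<le> C * norm (y - y')" using \<delta>(4) inn[OF s] y by blast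
  qed (use \<eta>(1) \<delta> in auto)
qed

end

section \<open>The pairing of momentum and displacement\<close>

context finsler begin

text \<open>The momentum is a covector.\<close>

lemma momentum_change:
  assumes d: "d \<in> A" "q \<in> fst d" and e: "e \<in> A" "q \<in> fst e" and v: "v \<in> tangent_space A q"
  shows "momentum e (snd e q, v e) \<bullet> Dt d e (snd d q) w = momentum d (snd d q, v d) \<bullet> w"
  using gform_coord[OF e v, of "Dt d e (snd d q) w"] gform_coord[OF d v, of w]
    tvec_of_change[OF d e, of w] by metis

lemma tmap_quadratic:
  assumes d: "d \<in> A" and e: "e \<in> A" and x: "x \<in> overlap d e"
  obtains r C where "0 < r" "0 \<le> C"
    "\<And>y. y \<in> cball x r \<Longrightarrow> norm (tmap d e y - tmap d e x - Dt d e x (y - x)) \<le> C * (norm (y - x))\<^sup>2"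
proof -
  obtain r C where r: "0 < r" "0 \<le> C" "cball x r \<subseteq> overlap d e"
    "\<And>y y'. y \<in> cball x r \<Longrightarrow> y' \<in> cball x r \<Longrightarrow>
       norm (tmap d e y' - tmap d e y - Dt d e y (y' - y)) \<le> C * (norm (y' - y))\<^sup>2"
    by (rule quadratic_remainder[OF overlap_open[OF d e] x trans_der[OF d e] Dt_LL[OF d e]]) blast+
  show ?thesis by (rule that[OF r(1,2)]) (use r(1,4) in auto)
qed

end

context geodesic_family begin

abbreviation "Lam y \<equiv> lagrangian g p (tvec_of A c0 p y)"

lemma lip_chartE:
  assumes y0: "y0 \<in> Y" and t: "t \<in> {0..1}" and d: "d \<in> A" "\<gamma> y0 t \<in> fst d"
  obtains \<delta> C where "0 < \<delta>" "0 \<le> C" "ball y0 \<delta> \<subseteq> Y" "\<And>y. y \<in> ball y0 \<delta> \<Longrightarrow> \<gamma> y t \<in> fst d"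
    "\<And>y y'. y \<in> ball y0 \<delta> \<Longrightarrow> y' \<in> ball y0 \<delta> \<Longrightarrow> norm (Z d t y - Z d t y') \<le> C * norm (y - y')"
proof -
  obtain \<delta> C where "0 < \<delta>" "0 \<le> C" "ball y0 \<delta> \<subseteq> Y" "\<forall>y\<in>ball y0 \<delta>. \<gamma> y t \<in> fst d"
    "\<forall>y\<in>ball y0 \<delta>. \<forall>y'\<in>ball y0 \<delta>. norm (Z d t y - Z d t y') \<le> C * norm (y - y')"
    using lip_time_chart[OF assms] unfolding lip_chart_def by blast
  then show ?thesis by (intro that[of \<delta> C]) blast+
qed

lemma fst_diff_le: "norm (fst a - fst b) \<le> norm (a - b)" for a b :: "'x::real_normed_vector \<times> 'y::real_normed_vector"
  using norm_fst_le[of "fst a - fst b" "snd a - snd b"] by (cases a, cases b) simp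

text \<open>Both sides of the estimate vanish at \<open>t = 0\<close>, and the factor \<open>t\<close> in front of \<open>L(y) - L(y0)\<close> is the integral
of the constant derivative found in \<open>pairing_time_step\<close>.\<close>

definition pairing_chart :: "real^'n \<Rightarrow> ('m, 'n) chart \<Rightarrow> real \<Rightarrow> bool" where
  "pairing_chart y0 d t \<longleftrightarrow> (\<exists>\<delta>>0. \<exists>C\<ge>0. ball y0 \<delta> \<subseteq> Y \<and> (\<forall>y\<in>ball y0 \<delta>. \<gamma> y t \<in> fst d \<and>
     \<bar>momentum d (Z d t y0) \<bullet> (fst (Z d t y) - fst (Z d t y0)) - t * (Lam y - Lam y0)\<bar> \<le> C * (norm (y - y0))\<^sup>2))"

definition pairing_time :: "real^'n \<Rightarrow> real \<Rightarrow> bool" where "pairing_time y0 t \<longleftrightarrow> (\<exists>d\<in>A. pairing_chart y0 d t)"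

lemma pairing_chartE:
  assumes "pairing_chart y0 d t"
  obtains \<delta> C where "0 < \<delta>" "0 \<le> C" "ball y0 \<delta> \<subseteq> Y" "\<And>y. y \<in> ball y0 \<delta> \<Longrightarrow> \<gamma> y t \<in> fst d"
    "\<And>y. y \<in> ball y0 \<delta> \<Longrightarrow> \<bar>momentum d (Z d t y0) \<bullet> (fst (Z d t y) - fst (Z d t y0)) - t * (Lam y - Lam y0)\<bar> \<le> C * (norm (y - y0))\<^sup>2"
proof -
  obtain \<delta> C where "0 < \<delta>" "0 \<le> C" "ball y0 \<delta> \<subseteq> Y" "\<forall>y\<in>ball y0 \<delta>. \<gamma> y t \<in> fst d \<and>
     \<bar>momentum d (Z d t y0) \<bullet> (fst (Z d t y) - fst (Z d t y0)) - t * (Lam y - Lam y0)\<bar> \<le> C * (norm (y - y0))\<^sup>2"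
    using assms unfolding pairing_chart_def by blast
  then show ?thesis by (intro that[of \<delta> C]) blast+
qed

text \<open>A change of chart maps the displacement by its differential up to a quadratic error, the displacement is
of order \<open>|y - y0|\<close>, and the differential is absorbed by the transformation of the momentum.\<close>

lemma pairing_chart_change:
  assumes y0: "y0 \<in> Y" and d: "d \<in> A" and pairing_time: "pairing_chart y0 d t" and t: "t \<in> {0..1}" and e: "e \<in> A" "\<gamma> y0 t \<in> fst e"
  shows "pairing_chart y0 e t"
proof -
  obtain \<delta>1 C1 where 1: "0 < \<delta>1" "0 \<le> C1" "ball y0 \<delta>1 \<subseteq> Y" "\<And>y. y \<in> ball y0 \<delta>1 \<Longrightarrow> \<gamma> y t \<in> fst d"
    "\<And>y. y \<in> ball y0 \<delta>1 \<Longrightarrow> \<bar>momentum d (Z d t y0) \<bullet> (fst (Z d t y) - fst (Z d t y0)) - t * (Lam y - Lam y0)\<bar> \<le> C1 * (norm (y - y0))\<^sup>2"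
    by (rule pairing_chartE[OF pairing_time]) blast
  have d0: "\<gamma> y0 t \<in> fst d" using 1(1,4) by simp
  obtain \<delta>2 C2 where 2: "0 < \<delta>2" "0 \<le> C2" "ball y0 \<delta>2 \<subseteq> Y" "\<And>y. y \<in> ball y0 \<delta>2 \<Longrightarrow> \<gamma> y t \<in> fst d"
    "\<And>y y'. y \<in> ball y0 \<delta>2 \<Longrightarrow> y' \<in> ball y0 \<delta>2 \<Longrightarrow> norm (Z d t y - Z d t y') \<le> C2 * norm (y - y')"
    by (rule lip_chartE[OF y0 t d d0]) blast
  obtain \<delta>3 and C3 :: real where 3: "0 < \<delta>3" "0 \<le> C3" "ball y0 \<delta>3 \<subseteq> Y" "\<And>y. y \<in> ball y0 \<delta>3 \<Longrightarrow> \<gamma> y t \<in> fst e"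
    by (rule lip_chartE[OF y0 t e]) blast
  define x where "x = (\<lambda>y. fst (Z d t y))"
  have xo: "x y0 \<in> overlap d e" using d0 e by (auto simp: x_def coords_def overlap_def)
  obtain r C4 where 4: "0 < r" "0 \<le> C4"
    "\<And>y. y \<in> cball (x y0) r \<Longrightarrow> norm (tmap d e y - tmap d e (x y0) - Dt d e (x y0) (y - x y0)) \<le> C4 * (norm (y - x y0))\<^sup>2"
    by (rule tmap_quadratic[OF d e(1) xo]) blast
  define P where "P = momentum e (Z e t y0)"
  define \<delta> where "\<delta> = min (min \<delta>1 \<delta>2) (min \<delta>3 (r / (C2 + 1)))"
  have \<delta>: "0 < \<delta>" "\<delta> \<le> \<delta>1" "\<delta> \<le> \<delta>2" "\<delta> \<le> \<delta>3" "\<delta> \<le> r / (C2 + 1)" using 1(1) 2(1,2) 3(1) 4(1) by (auto simp: \<delta>_def)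
  define C where "C = C1 + norm P * (C4 * C2\<^sup>2)"
  have C: "0 \<le> C" using 1(2) 4(2) by (simp add: C_def)
  have Yin: "ball y0 \<delta> \<subseteq> Y" using 1(3) \<delta>(2) by auto
  have fin: "\<bar>P \<bullet> (fst (Z e t y) - fst (Z e t y0)) - t * (Lam y - Lam y0)\<bar> \<le> C * (norm (y - y0))\<^sup>2"
    if y: "y \<in> ball y0 \<delta>" for y
  proof -
    have yy: "y \<in> ball y0 \<delta>1" "y \<in> ball y0 \<delta>2" "y \<in> ball y0 \<delta>3" "y0 \<in> ball y0 \<delta>2" using y \<delta> 2(1) by auto
    have xl: "norm (x y - x y0) \<le> C2 * norm (y - y0)"
      using order_trans[OF fst_diff_le 2(5)[OF yy(2,4)]] by (simp add: x_def)
    have xr: "x y \<in> cball (x y0) r"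
    proof -
      have "norm (x y - x y0) \<le> C2 * norm (y - y0)" by (rule xl)
      also have "\<dots> \<le> (C2 + 1) * (r / (C2 + 1))"
        using y \<delta>(5) 2(2) by (intro mult_mono) (auto simp: dist_norm norm_minus_commute)
      also have "\<dots> = r" using 2(2) by simp
      finally show ?thesis by (simp add: dist_norm norm_minus_commute)
    qed
    define R where "R = tmap d e (x y) - tmap d e (x y0) - Dt d e (x y0) (x y - x y0)"
    have R: "norm R \<le> C4 * C2\<^sup>2 * (norm (y - y0))\<^sup>2"
    proof -
      have "norm R \<le> C4 * (norm (x y - x y0))\<^sup>2" unfolding R_def by (rule 4(3)[OF xr])
      also have "\<dots> \<le> C4 * (C2 * norm (y - y0))\<^sup>2" using xl 4(2) by (intro mult_left_mono power_mono) auto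
      finally show ?thesis by (simp add: power_mult_distrib mult.assoc)
    qed
    have ty: "fst (Z e t y) = tmap d e (x y)" "fst (Z e t y0) = tmap d e (x y0)"
      using 1(4)[OF yy(1)] d0 d by (auto simp: coords_def x_def tmap_apply)
    have yY: "y0 \<in> Y" by (rule y0)
    have mc: "P \<bullet> Dt d e (x y0) w = momentum d (Z d t y0) \<bullet> w" for w
      using momentum_change[OF d d0 e solution_velocity(2)[OF sol[OF y0] in_I[OF y0 t]], of w]
      by (simp add: P_def coords_def x_def)
    have "P \<bullet> (fst (Z e t y) - fst (Z e t y0)) = P \<bullet> (Dt d e (x y0) (x y - x y0) + R)" by (simp add: ty R_def)
    also have "\<dots> = momentum d (Z d t y0) \<bullet> (x y - x y0) + P \<bullet> R" by (simp add: inner_add_right mc)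
    finally have "\<bar>P \<bullet> (fst (Z e t y) - fst (Z e t y0)) - t * (Lam y - Lam y0)\<bar>
       \<le> \<bar>momentum d (Z d t y0) \<bullet> (x y - x y0) - t * (Lam y - Lam y0)\<bar> + \<bar>P \<bullet> R\<bar>" by linarith
    also have "\<dots> \<le> C1 * (norm (y - y0))\<^sup>2 + norm P * norm R"
      using 1(5)[OF yy(1)] Cauchy_Schwarz_ineq2[of P R] unfolding x_def by linarith
    also have "\<dots> \<le> C1 * (norm (y - y0))\<^sup>2 + norm P * (C4 * C2\<^sup>2 * (norm (y - y0))\<^sup>2)"
      by (intro add_left_mono mult_left_mono R) simp
    also have "\<dots> = C * (norm (y - y0))\<^sup>2" by (simp add: C_def distrib_right mult.assoc)
    finally show ?thesis .
  qed
  show ?thesis unfolding pairing_chart_def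
    using \<delta>(1) C Yin 3(4) \<delta>(4) fin unfolding P_def by (intro exI[of _ \<delta>] exI[of _ C] conjI ballI) auto
qed

lemma pairing_time_0: assumes y0: "y0 \<in> Y" shows "pairing_time y0 0"
  unfolding pairing_time_def
proof (rule bexI[OF _ c0(1)])
  obtain \<delta> where \<delta>: "0 < \<delta>" "ball y0 \<delta> \<subseteq> Y" using Y y0 by (meson open_contains_ball)
  have "fst (Z c0 0 y) = snd c0 p" "\<gamma> y 0 \<in> fst c0" if "y \<in> Y" for y
    using that init[of y] c0 by (auto simp: coords_def)
  then have "\<forall>y\<in>ball y0 \<delta>. \<gamma> y 0 \<in> fst c0 \<and>
     \<bar>momentum c0 (Z c0 0 y0) \<bullet> (fst (Z c0 0 y) - fst (Z c0 0 y0)) - 0 * (Lam y - Lam y0)\<bar> \<le> 0 * (norm (y - y0))\<^sup>2"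
    using \<delta>(2) y0 by auto
  then show "pairing_chart y0 c0 0" unfolding pairing_chart_def using \<delta> by blast
qed

lemma V_nonzero:
  assumes y0: "y0 \<in> Y" "y0 \<noteq> 0" and t: "t \<in> {0..1}" shows "V y0 t \<noteq> tzero"
proof -
  have "V y0 0 \<noteq> tzero" using init(2)[OF y0(1)] y0(2) tvec_of_eq_tzero_iff[OF c0] by simp
  moreover have "(0::real) \<in> {0..1}" by simp
  ultimately show ?thesis
    using solution_nonzero[OF sol[OF y0(1)] in_I[OF y0(1)] in_I[OF y0(1) t]] by blast
qed

lemma Z_slit:
  assumes y0: "y0 \<in> Y" "y0 \<noteq> 0" and t: "t \<in> {0..1}" and d: "d \<in> A" "\<gamma> y0 t \<in> fst d"
  shows "Z d t y0 \<in> Xc d \<times> (UNIV - {0})"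
proof -
  have "V y0 t d \<noteq> 0"
    using V_nonzero[OF y0 t] tvec_eq_tzero_iff[OF solution_velocity(2)[OF sol[OF y0(1)] in_I[OF y0(1) t]] d] by blast
  then show ?thesis using d by (auto simp: coords_def)
qed

lemma Lam_eq:
  assumes y: "y \<in> Y" and t: "t \<in> {0..1}" and d: "d \<in> A" "\<gamma> y t \<in> fst d"
  shows "coord_metric.lag (gcoord A g d) (Z d t y) = Lam y"
proof -
  have t0: "(0::real) \<in> {0..1}" by simp
  have "coord_metric.lag (gcoord A g d) (Z d t y) = lagrangian g (\<gamma> y t) (V y t)"
    using lagrangian_coord[OF d solution_velocity(2)[OF sol[OF y] in_I[OF y t]]] by (simp add: coords_def)
  also have "\<dots> = lagrangian g (\<gamma> y 0) (V y 0)"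
    by (rule lagrangian_constant[OF sol[OF y] in_I[OF y t] in_I[OF y t0]])
  finally show ?thesis by (simp add: init[OF y])
qed

text \<open>The Euler-Lagrange equation turns the derivative of the pairing into the differential of the Lagrangian
at \<open>z\<^sub>y\<^sub>0\<close>, applied to \<open>z\<^sub>y - z\<^sub>y\<^sub>0\<close>.  By the Taylor estimate this is the difference of the values of the
Lagrangian up to a quadratic error, and these values do not depend on time.\<close>

lemma pairing_time_step:
  assumes y0: "y0 \<in> Y" "y0 \<noteq> 0" and t0: "t0 \<in> {0..1}"
  shows "\<exists>\<eta>>0. \<forall>t1\<in>{0..1}. \<forall>t2\<in>{0..1}. \<bar>t1 - t0\<bar> < \<eta> \<longrightarrow> \<bar>t2 - t0\<bar> < \<eta> \<longrightarrow> t1 \<le> t2 \<longrightarrow> pairing_time y0 t1 \<longrightarrow> pairing_time y0 t2"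
proof -
  obtain d where d: "d \<in> A" "\<gamma> y0 t0 \<in> fst d" by (rule chart_cover)
  interpret coord_metric "Xc d" "gcoord A g d" by (rule coord_metric_chart[OF d(1)])
  obtain r1 C1 where 1: "0 < r1" "0 \<le> C1" "cball (Z d t0 y0) r1 \<subseteq> W"
    "\<And>y y'. y \<in> cball (Z d t0 y0) r1 \<Longrightarrow> y' \<in> cball (Z d t0 y0) r1 \<Longrightarrow>
       norm (lag y' - lag y - dlag y (y' - y)) \<le> C1 * (norm (y' - y))\<^sup>2"
    by (rule quadratic_remainder[OF W_open Z_slit[OF y0 t0 d] lag_der dlag_LL]) blast+
  have zb: "Z d t0 y0 \<in> ball (Z d t0 y0) r1" using 1(1) by simp
  obtain r K where r: "0 < r" "cball (Z d t0 y0) r \<subseteq> ball (Z d t0 y0) r1" "cball (Z d t0 y0) r \<subseteq> Xc d \<times> UNIV"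
    "K-lipschitz_on (cball (Z d t0 y0) r) (field d)"
    by (rule field_cball[OF y0(1) d open_ball zb])
  obtain \<eta> \<delta>2 C2 where 2: "0 < \<eta>" "0 < \<delta>2" "0 \<le> C2" "ball y0 \<delta>2 \<subseteq> Y"
    "\<And>t y. t \<in> {0..1} \<Longrightarrow> \<bar>t - t0\<bar> < \<eta> \<Longrightarrow> y \<in> ball y0 \<delta>2 \<Longrightarrow> \<gamma> y t \<in> fst d \<and> Z d t y \<in> cball (Z d t0 y0) r"
    "\<And>t y y'. t \<in> {0..1} \<Longrightarrow> \<bar>t - t0\<bar> < \<eta> \<Longrightarrow> y \<in> ball y0 \<delta>2 \<Longrightarrow> y' \<in> ball y0 \<delta>2 \<Longrightarrow>
        norm (Z d t y - Z d t y') \<le> C2 * norm (y - y')"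
    by (rule tube[OF y0(1) t0 d r(1,3,4)]) blast
  have "pairing_time y0 t2" if t1: "t1 \<in> {0..1}" "\<bar>t1 - t0\<bar> < \<eta>" and t2: "t2 \<in> {0..1}" "\<bar>t2 - t0\<bar> < \<eta>" and t12: "t1 \<le> t2" and pairing_time: "pairing_time y0 t1" for t1 t2
  proof -
    have y02: "y0 \<in> ball y0 \<delta>2" using 2(2) by simp
    obtain d' where d': "d' \<in> A" "pairing_chart y0 d' t1" using pairing_time unfolding pairing_time_def by blast
    have "pairing_chart y0 d t1" using pairing_chart_change[OF y0(1) d' t1(1) d(1)] 2(5)[OF t1 y02] by blast
    then obtain \<delta>3 C3 where 3: "0 < \<delta>3" "0 \<le> C3" "ball y0 \<delta>3 \<subseteq> Y" "\<And>y. y \<in> ball y0 \<delta>3 \<Longrightarrow> \<gamma> y t1 \<in> fst d"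
      "\<And>y. y \<in> ball y0 \<delta>3 \<Longrightarrow> \<bar>momentum d (Z d t1 y0) \<bullet> (fst (Z d t1 y) - fst (Z d t1 y0)) - t1 * (Lam y - Lam y0)\<bar> \<le> C3 * (norm (y - y0))\<^sup>2"
      by (rule pairing_chartE) blast
    define \<delta> where "\<delta> = min \<delta>2 \<delta>3"
    define C where "C = C3 + C1 * C2\<^sup>2"
    have fin: "\<gamma> y t2 \<in> fst d \<and> \<bar>momentum d (Z d t2 y0) \<bullet> (fst (Z d t2 y) - fst (Z d t2 y0)) - t2 * (Lam y - Lam y0)\<bar> \<le> C * (norm (y - y0))\<^sup>2"
      if y: "y \<in> ball y0 \<delta>" for y
    proof -
      have yb: "y \<in> ball y0 \<delta>2" "y \<in> ball y0 \<delta>3" using y by (auto simp: \<delta>_def)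
      have yY: "y \<in> Y" using yb(1) 2(4) by blast
      define f where "f = (\<lambda>t. momentum d (Z d t y0) \<bullet> (fst (Z d t y) - fst (Z d t y0)) - t * (Lam y - Lam y0))"
      define c where "c = C1 * C2\<^sup>2 * (norm (y - y0))\<^sup>2"
      have c0': "0 \<le> c" using 1(2) by (simp add: c_def)
      have "norm (f t2 - f t1) \<le> c * (t2 - t1)"
      proof (rule curve_bound[OF t12])
        fix s assume s: "s \<in> {t1..t2}"
        have s01: "s \<in> {0..1}" and s\<eta>: "\<bar>s - t0\<bar> < \<eta>" using s t1 t2 by auto
        note in1 = 2(5)[OF s01 s\<eta> yb(1)] and in0 = 2(5)[OF s01 s\<eta> y02]
        have w0: "Z d s y0 \<in> cball (Z d t0 y0) r1" "Z d s y \<in> cball (Z d t0 y0) r1"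
          using in0 in1 r(2) by auto
        have d0: "((\<lambda>s. Z d s y0) has_vector_derivative field d (Z d s y0)) (at s)"
          by (rule solution_coords[OF sol[OF y0(1)] in_I[OF y0(1) s01] d(1) conjunct1[OF in0]])
        have d1: "((\<lambda>s. Z d s y) has_vector_derivative field d (Z d s y)) (at s)"
          by (rule solution_coords[OF sol[OF yY] in_I[OF yY s01] d(1) conjunct1[OF in1]])
        have m: "((\<lambda>s. mom (Z d s y0)) has_vector_derivative (1 / 2) *\<^sub>R grad (Z d s y0)) (at s)"
          using d0 unfolding field_def spray_eq[OF d(1)] by (intro mom_curve) (use w0 1(3) in blast)
        have fd: "((\<lambda>s. fst (Z d s y) - fst (Z d s y0)) has_vector_derivative (snd (Z d s y) - snd (Z d s y0))) (at s)"
          using bounded_linear.has_vector_derivative[OF bounded_linear_fst d1]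
            bounded_linear.has_vector_derivative[OF bounded_linear_fst d0]
          by (simp add: field_def has_vector_derivative_diff)
        have ld: "((\<lambda>t. t * (Lam y - Lam y0)) has_vector_derivative (Lam y - Lam y0)) (at s)"
          unfolding has_real_derivative_iff_has_vector_derivative[symmetric] by (auto intro!: derivative_eq_intros)
        have "(f has_vector_derivative (mom (Z d s y0) \<bullet> (snd (Z d s y) - snd (Z d s y0))
            + ((1 / 2) *\<^sub>R grad (Z d s y0)) \<bullet> (fst (Z d s y) - fst (Z d s y0))) - (Lam y - Lam y0)) (at s)"
          using has_vector_derivative_diff[OF bounded_bilinear.has_vector_derivative[OF bounded_bilinear_inner m fd] ld]
          by (simp add: f_def[abs_def] momentum_def[abs_def] mom_def[abs_def])
        moreover have "mom (Z d s y0) \<bullet> (snd (Z d s y) - snd (Z d s y0))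
            + ((1 / 2) *\<^sub>R grad (Z d s y0)) \<bullet> (fst (Z d s y) - fst (Z d s y0)) = dlag (Z d s y0) (Z d s y - Z d s y0)"
        proof -
          have w: "Z d s y0 \<in> W" using w0 1(3) by blast
          show ?thesis unfolding dlag_def grad_inner[OF w, symmetric] by (simp add: inner_commute)
        qed
        ultimately show "(f has_vector_derivative (dlag (Z d s y0) (Z d s y - Z d s y0) - (Lam y - Lam y0))) (at s within {t1..t2})"
          by (simp add: has_vector_derivative_at_within)
        have "norm (lag (Z d s y) - lag (Z d s y0) - dlag (Z d s y0) (Z d s y - Z d s y0)) \<le> C1 * (norm (Z d s y - Z d s y0))\<^sup>2"
          by (rule 1(4)[OF w0])
        also have "\<dots> \<le> C1 * (C2 * norm (y - y0))\<^sup>2"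
          using 2(6)[OF s01 s\<eta> yb(1) y02] 1(2) by (intro mult_left_mono power_mono) auto
        also have "\<dots> = c" by (simp add: c_def power_mult_distrib mult.assoc)
        finally have "norm (Lam y - Lam y0 - dlag (Z d s y0) (Z d s y - Z d s y0)) \<le> c"
          using Lam_eq[OF yY s01 d(1) conjunct1[OF in1]] Lam_eq[OF y0(1) s01 d(1) conjunct1[OF in0]] by simp
        then show "norm (dlag (Z d s y0) (Z d s y - Z d s y0) - (Lam y - Lam y0)) \<le> c"
          by (simp add: norm_minus_commute)
      qed
      also have "\<dots> \<le> c * 1" using c0' t1 t2 by (intro mult_left_mono) auto
      finally have "\<bar>f t2 - f t1\<bar> \<le> c" by simp
      moreover have "\<bar>f t1\<bar> \<le> C3 * (norm (y - y0))\<^sup>2" using 3(5)[OF yb(2)] by (simp add: f_def)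
      ultimately have "\<bar>f t2\<bar> \<le> C3 * (norm (y - y0))\<^sup>2 + c" by linarith
      then have "\<bar>f t2\<bar> \<le> C * (norm (y - y0))\<^sup>2" by (simp add: C_def c_def distrib_right)
      then show ?thesis using 2(5)[OF t2 yb(1)] by (simp add: f_def)
    qed
    have "0 < \<delta>" "ball y0 \<delta> \<subseteq> Y" "0 \<le> C" using 2(2,4) 3(1,2) 1(2) by (auto simp: \<delta>_def C_def)
    then have "pairing_chart y0 d t2" unfolding pairing_chart_def using fin by blast
    then show ?thesis using d(1) unfolding pairing_time_def by blast
  qed
  then show ?thesis using 2(1) by blast
qed

lemma second_order:
  assumes y0: "y0 \<in> Y" "y0 \<noteq> 0" and d: "d \<in> A" "\<gamma> y0 1 \<in> fst d"
  obtains \<delta> C where "0 < \<delta>" "0 \<le> C" "ball y0 \<delta> \<subseteq> Y"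
    "\<And>y. y \<in> ball y0 \<delta> \<Longrightarrow> \<bar>momentum d (Z d 1 y0) \<bullet> (fst (Z d 1 y) - fst (Z d 1 y0)) - (Lam y - Lam y0)\<bar> \<le> C * (norm (y - y0))\<^sup>2"
proof -
  have i: "(1::real) \<in> {0..1}" by simp
  have "pairing_time y0 1" by (rule interval_propagate[of "pairing_time y0" 0 1, OF pairing_time_0[OF y0(1)] pairing_time_step[OF y0] i])
  then obtain d' where d': "d' \<in> A" "pairing_chart y0 d' 1" unfolding pairing_time_def by blast
  have "pairing_chart y0 d 1" by (rule pairing_chart_change[OF y0(1) d' i d])
  then obtain \<delta> C where "0 < \<delta>" "0 \<le> C" "ball y0 \<delta> \<subseteq> Y"
     "\<And>y. y \<in> ball y0 \<delta> \<Longrightarrow> \<bar>momentum d (Z d 1 y0) \<bullet> (fst (Z d 1 y) - fst (Z d 1 y0)) - 1 * (Lam y - Lam y0)\<bar> \<le> C * (norm (y - y0))\<^sup>2"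
    by (rule pairing_chartE) blast
  then show ?thesis by (intro that[of \<delta> C]) auto
qed

section \<open>Differentiable dependence for twice differentiable metrics\<close>

definition diff_time :: "real^'n \<Rightarrow> real \<Rightarrow> bool" where
  "diff_time y0 t \<longleftrightarrow> (\<exists>d\<in>A. \<gamma> y0 t \<in> fst d \<and> (\<lambda>y. Z d t y) differentiable (at y0))"

lemma diff_time_change:
  assumes y0: "y0 \<in> Y" and t: "t \<in> {0..1}" and diff_time: "diff_time y0 t" and e: "e \<in> A" "\<gamma> y0 t \<in> fst e"
  shows "(\<lambda>y. Z e t y) differentiable (at y0)"
proof -
  obtain d where d: "d \<in> A" "\<gamma> y0 t \<in> fst d" "(\<lambda>y. Z d t y) differentiable (at y0)" using diff_time unfolding diff_time_def by blast
  obtain \<delta>1 and C1 :: real where 1: "0 < \<delta>1" "0 \<le> C1" "ball y0 \<delta>1 \<subseteq> Y" "\<And>y. y \<in> ball y0 \<delta>1 \<Longrightarrow> \<gamma> y t \<in> fst d"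
    by (rule lip_chartE[OF y0 t d(1,2)]) blast
  obtain \<delta>2 and C2 :: real where 2: "0 < \<delta>2" "0 \<le> C2" "ball y0 \<delta>2 \<subseteq> Y" "\<And>y. y \<in> ball y0 \<delta>2 \<Longrightarrow> \<gamma> y t \<in> fst e"
    by (rule lip_chartE[OF y0 t e]) blast
  have "ttrans d e differentiable (at (Z d t y0))"
    unfolding coords_def by (rule ttrans_differentiable[OF d(1) e(1) overlapI[OF d(2) e(2)]])
  then have "(ttrans d e \<circ> (\<lambda>y. Z d t y)) differentiable (at y0)" using d(3) by (intro differentiable_chain_at)
  then obtain D where D: "((ttrans d e \<circ> (\<lambda>y. Z d t y)) has_derivative D) (at y0)" by (auto simp: differentiable_def)
  have "((\<lambda>y. Z e t y) has_derivative D) (at y0)"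
  proof (rule has_derivative_transform_within_open[OF D, of "ball y0 (min \<delta>1 \<delta>2)"])
    fix y assume y: "y \<in> ball y0 (min \<delta>1 \<delta>2)"
    have "Z e t y = ttrans d e (Z d t y)"
      by (rule Z_change[OF _ t d(1) 1(4) e(1) 2(4)]) (use y 1(3) in auto)
    then show "(ttrans d e \<circ> (\<lambda>y. Z d t y)) y = Z e t y" by simp
  qed (use 1(1) 2(1) in auto)
  then show ?thesis by (auto simp: differentiable_def)
qed

lemma diff_time_0: assumes y0: "y0 \<in> Y" shows "diff_time y0 0"
proof -
  have "((\<lambda>y. (snd c0 p, y)) has_derivative (\<lambda>w. (0, w))) (at y0)" by (auto intro!: derivative_eq_intros)
  then have "((\<lambda>y. Z c0 0 y) has_derivative (\<lambda>w. (0, w))) (at y0)"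
    by (rule has_derivative_transform_within_open[OF _ Y y0]) (auto simp: coords_def init tvec_of_self c0)
  then show ?thesis unfolding diff_time_def differentiable_def using c0 init(1)[OF y0] by auto
qed

text \<open>The defect of linearity \<open>u\<close> of the displacement between geodesics satisfies the linearized equation up
to an error that is \<open>o(|a1 h1| + |a2 h2|)\<close>, since the field is uniformly differentiable on a ball and
displacements are Lipschitz in \<open>h\<close>.  Gronwall's inequality carries its smallness from \<open>t1\<close> to \<open>t2\<close>.\<close>

lemma diff_time_step:
  assumes C2: "C2_metric A g" and y0: "y0 \<in> Y" "y0 \<noteq> 0" and t0: "t0 \<in> {0..1}"
  shows "\<exists>\<eta>>0. \<forall>t1\<in>{0..1}. \<forall>t2\<in>{0..1}. \<bar>t1 - t0\<bar> < \<eta> \<longrightarrow> \<bar>t2 - t0\<bar> < \<eta> \<longrightarrow> t1 \<le> t2 \<longrightarrow> diff_time y0 t1 \<longrightarrow> diff_time y0 t2"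
proof -
  obtain d where d: "d \<in> A" "\<gamma> y0 t0 \<in> fst d" and Ck: "Ck_on 2 (gcoord A g d) (slit_domain d)"
    using C2 unfolding C2_metric_def by blast
  interpret coord_metric "Xc d" "gcoord A g d" by (rule coord_metric_chart[OF d(1)])
  have "C1_on spr W" using Ck unfolding slit_domain_def by (rule spr_C1)
  then have "C1_on (field d) W"
    unfolding field_def[abs_def] spray_eq[OF d(1)]
    by (intro C1_on_Pair C1_on_bounded_linear[OF bounded_linear_snd])
  then obtain F' where F': "\<forall>z\<in>W. (field d has_derivative F' z) (at z)" "\<forall>w. continuous_on W (\<lambda>z. F' z w)"
    unfolding C1_on_def by blast
  obtain r K where r: "0 < r" "cball (Z d t0 y0) r \<subseteq> W" "cball (Z d t0 y0) r \<subseteq> Xc d \<times> UNIV"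
    "K-lipschitz_on (cball (Z d t0 y0) r) (field d)"
    by (rule field_cball[OF y0(1) d W_open Z_slit[OF y0 t0 d]])
  define z where "z = Z d t0 y0"
  have rz: "cball z r \<subseteq> W" using r(2) by (simp add: z_def)
  have Fd: "\<And>x. x \<in> cball z r \<Longrightarrow> (field d has_derivative F' x) (at x)" using F'(1) rz by blast
  have Fc: "\<And>w. continuous_on (cball z r) (\<lambda>x. F' x w)" using F'(2) continuous_on_subset[OF _ rz] by blast
  obtain B where B: "0 \<le> B" "\<And>x w. x \<in> cball z r \<Longrightarrow> norm (F' x w) \<le> B * norm w"
    by (rule derivative_bounded[OF compact_cball Fc has_derivative_linear[OF Fd]]) blast+
  obtain \<eta> \<delta>2 C where 2: "0 < \<eta>" "0 < \<delta>2" "0 \<le> C" "ball y0 \<delta>2 \<subseteq> Y"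
    "\<And>t y. t \<in> {0..1} \<Longrightarrow> \<bar>t - t0\<bar> < \<eta> \<Longrightarrow> y \<in> ball y0 \<delta>2 \<Longrightarrow> \<gamma> y t \<in> fst d \<and> Z d t y \<in> cball (Z d t0 y0) r"
    "\<And>t y y'. t \<in> {0..1} \<Longrightarrow> \<bar>t - t0\<bar> < \<eta> \<Longrightarrow> y \<in> ball y0 \<delta>2 \<Longrightarrow> y' \<in> ball y0 \<delta>2 \<Longrightarrow>
        norm (Z d t y - Z d t y') \<le> C * norm (y - y')"
    by (rule tube[OF y0(1) t0 d r(1,3,4)]) blast
  have "diff_time y0 t2" if t1: "t1 \<in> {0..1}" "\<bar>t1 - t0\<bar> < \<eta>" and t2: "t2 \<in> {0..1}" "\<bar>t2 - t0\<bar> < \<eta>" and t12: "t1 \<le> t2" and diff_time: "diff_time y0 t1" for t1 t2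
  proof -
    have y02: "y0 \<in> ball y0 \<delta>2" using 2(2) by simp
    define \<zeta> where "\<zeta> = (\<lambda>t h. Z d t (y0 + h) - Z d t y0)"
    have "(\<lambda>y. Z d t1 y) differentiable (at y0)" using diff_time_change[OF y0(1) t1(1) diff_time d(1)] 2(5)[OF t1 y02] by blast
    then have AL: "asymptotically_linear (\<zeta> t1)"
      unfolding \<zeta>_def by (rule differentiable_imp_asymptotically_linear)
    define E where "E = exp ((2 * B + 1) * (t2 - t1))"
    have E: "0 < E" by (simp add: E_def)
    have "asymptotically_linear (\<zeta> t2)"
      unfolding asymptotically_linear_def
    proof (intro allI impI)
      fix e :: real assume e: "0 < e"
      \<comment> \<open>Half of \<open>e\<close> is spent on the defect at \<open>t1\<close>, half on the linearization error; \<open>E\<close> is the growth factor.\<close>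
      define e1 where "e1 = e / (2 * E)"
      define e2 where "e2 = e / (4 * E * (C + 1))"
      have e12: "0 < e1" "0 < e2" using e E 2(3) by (auto simp: e1_def e2_def)
      obtain \<delta>1 where \<delta>1: "0 < \<delta>1" "\<forall>a1 a2 h1 h2. norm h1 < \<delta>1 \<longrightarrow> norm h2 < \<delta>1 \<longrightarrow>
          norm (a1 *\<^sub>R h1) < \<delta>1 \<longrightarrow> norm (a2 *\<^sub>R h2) < \<delta>1 \<longrightarrow> norm (a1 *\<^sub>R h1 + a2 *\<^sub>R h2) < \<delta>1 \<longrightarrow>
          norm (\<zeta> t1 (a1 *\<^sub>R h1 + a2 *\<^sub>R h2) - a1 *\<^sub>R \<zeta> t1 h1 - a2 *\<^sub>R \<zeta> t1 h2) \<le> e1 * (norm (a1 *\<^sub>R h1) + norm (a2 *\<^sub>R h2))"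
        using AL e12(1) unfolding asymptotically_linear_def by blast
      obtain \<rho> where \<rho>: "0 < \<rho>" "\<And>y y'. y \<in> cball z r \<Longrightarrow> y' \<in> cball z r \<Longrightarrow> norm (y' - y) < \<rho> \<Longrightarrow>
          norm (field d y' - field d y - F' y (y' - y)) \<le> e2 * norm (y' - y)"
        by (rule uniform_linearization[OF Fd Fc e12(2)]) blast+
      define \<delta> where "\<delta> = min \<delta>1 (min \<delta>2 (\<rho> / (C + 1)))"
      have \<delta>: "0 < \<delta>" "\<delta> \<le> \<delta>1" "\<delta> \<le> \<delta>2" "\<delta> \<le> \<rho> / (C + 1)" using \<delta>1(1) 2(2,3) \<rho>(1) by (auto simp: \<delta>_def)
      have small: "norm (field d (Z d s (y0 + h)) - field d (Z d s y0) - F' (Z d s y0) (\<zeta> s h)) \<le> e2 * (C * norm h)"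
        "Z d s (y0 + h) \<in> cball z r" "Z d s y0 \<in> cball z r" "\<gamma> (y0 + h) s \<in> fst d" "y0 + h \<in> Y"
        if s: "s \<in> {t1..t2}" and h: "norm h < \<delta>" for s h
      proof -
        have s01: "s \<in> {0..1}" and s\<eta>: "\<bar>s - t0\<bar> < \<eta>" using s t1 t2 by auto
        have hb: "y0 + h \<in> ball y0 \<delta>2" using h \<delta>(3) by (simp add: dist_norm)
        show zz: "Z d s (y0 + h) \<in> cball z r" "Z d s y0 \<in> cball z r" "\<gamma> (y0 + h) s \<in> fst d"
          using 2(5)[OF s01 s\<eta> hb] 2(5)[OF s01 s\<eta> y02] by (auto simp: z_def)
        show "y0 + h \<in> Y" using hb 2(4) by blast
        have l: "norm (\<zeta> s h) \<le> C * norm h" using 2(6)[OF s01 s\<eta> hb y02] by (simp add: \<zeta>_def)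
        have "norm (\<zeta> s h) < \<rho>"
        proof -
          have "C * norm h \<le> (C + 1) * norm h" by (simp add: distrib_right)
          also have "\<dots> < (C + 1) * (\<rho> / (C + 1))" using h \<delta>(4) 2(3) by (intro mult_strict_left_mono) auto
          also have "\<dots> = \<rho>" using 2(3) by simp
          finally show ?thesis using l by linarith
        qed
        then have "norm (field d (Z d s (y0 + h)) - field d (Z d s y0) - F' (Z d s y0) (\<zeta> s h)) \<le> e2 * norm (\<zeta> s h)"
          unfolding \<zeta>_def by (rule \<rho>(2)[OF zz(2,1)])
        also have "\<dots> \<le> e2 * (C * norm h)" using l e12(2) by (intro mult_left_mono) auto
        finally show "norm (field d (Z d s (y0 + h)) - field d (Z d s y0) - F' (Z d s y0) (\<zeta> s h)) \<le> e2 * (C * norm h)" .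
      qed
      have "norm (\<zeta> t2 (a1 *\<^sub>R h1 + a2 *\<^sub>R h2) - a1 *\<^sub>R \<zeta> t2 h1 - a2 *\<^sub>R \<zeta> t2 h2) \<le> e * (norm (a1 *\<^sub>R h1) + norm (a2 *\<^sub>R h2))"
        if h: "norm h1 < \<delta>" "norm h2 < \<delta>" "norm (a1 *\<^sub>R h1) < \<delta>" "norm (a2 *\<^sub>R h2) < \<delta>" "norm (a1 *\<^sub>R h1 + a2 *\<^sub>R h2) < \<delta>"
        for a1 a2 h1 h2
      proof -
        define h3 where "h3 = a1 *\<^sub>R h1 + a2 *\<^sub>R h2"
        define s where "s = norm (a1 *\<^sub>R h1) + norm (a2 *\<^sub>R h2)"
        have h3a: "norm h3 < \<delta>" using h(5) by (simp only: h3_def)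
        have h3b: "norm h3 \<le> s" unfolding h3_def s_def by (rule norm_triangle_ineq)
        note h3 = h3a h3b
        define u where "u = (\<lambda>t. \<zeta> t h3 - a1 *\<^sub>R \<zeta> t h1 - a2 *\<^sub>R \<zeta> t h2)"
        define D where "D = (\<lambda>t h. field d (Z d t (y0 + h)) - field d (Z d t y0))"
        define R where "R = (\<lambda>t h. D t h - F' (Z d t y0) (\<zeta> t h))"
        have "norm (u t2) \<le> exp ((2 * B + 1) * (t2 - t1)) * (norm (u t1) + 2 * e2 * C * s)"
        proof (rule gronwall[where u'="\<lambda>t. D t h3 - a1 *\<^sub>R D t h1 - a2 *\<^sub>R D t h2"])
          fix t assume t: "t \<in> {t1..t2}"
          have t01: "t \<in> {0..1}" and t\<eta>: "\<bar>t - t0\<bar> < \<eta>" using t t1 t2 by auto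
          have dz: "((\<lambda>t. \<zeta> t h) has_vector_derivative D t h) (at t)" if "norm h < \<delta>" for h
            unfolding \<zeta>_def D_def
            by (rule has_vector_derivative_diff[OF solution_coords[OF sol[OF small(5)[OF t that]] in_I[OF small(5)[OF t that] t01] d(1) small(4)[OF t that]]
                solution_coords[OF sol[OF y0(1)] in_I[OF y0(1) t01] d(1) conjunct1[OF 2(5)[OF t01 t\<eta> y02]]]])
          show "(u has_vector_derivative D t h3 - a1 *\<^sub>R D t h1 - a2 *\<^sub>R D t h2) (at t within {t1..t2})"
            unfolding u_def
            by (rule has_vector_derivative_at_within[OF has_vector_derivative_diff[OF has_vector_derivative_diff[OF dz[OF h3(1)]
               bounded_linear.has_vector_derivative[OF bounded_linear_scaleR_right dz[OF h(1)]]]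
               bounded_linear.has_vector_derivative[OF bounded_linear_scaleR_right dz[OF h(2)]]]])
          have zz: "Z d t y0 \<in> cball z r" by (rule small(3)[OF t h(1)])
          have lin: "linear (F' (Z d t y0))" by (rule has_derivative_linear[OF Fd[OF zz]])
          have eq: "D t h3 - a1 *\<^sub>R D t h1 - a2 *\<^sub>R D t h2 = F' (Z d t y0) (u t) + (R t h3 - a1 *\<^sub>R R t h1 - a2 *\<^sub>R R t h2)"
            unfolding u_def R_def linear_diff[OF lin] linear_scale[OF lin] by (simp add: algebra_simps)
          have R: "norm (R t h) \<le> e2 * (C * norm h)" if "norm h < \<delta>" for h
            using small(1)[OF t that] by (simp add: R_def D_def)
          have R2: "norm (a *\<^sub>R R t h) \<le> e2 * C * norm (a *\<^sub>R h)" if "norm h < \<delta>" for a h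
            using mult_left_mono[OF R[OF that], of "\<bar>a\<bar>"] by (simp add: mult_ac)
          have "norm (D t h3 - a1 *\<^sub>R D t h1 - a2 *\<^sub>R D t h2) \<le> norm (F' (Z d t y0) (u t)) + norm (R t h3 - a1 *\<^sub>R R t h1 - a2 *\<^sub>R R t h2)"
            unfolding eq by (rule norm_triangle_ineq)
          moreover have "norm (R t h3 - a1 *\<^sub>R R t h1 - a2 *\<^sub>R R t h2) \<le> norm (R t h3) + norm (a1 *\<^sub>R R t h1) + norm (a2 *\<^sub>R R t h2)"
            using norm_triangle_ineq4[of "R t h3 - a1 *\<^sub>R R t h1" "a2 *\<^sub>R R t h2"] norm_triangle_ineq4[of "R t h3" "a1 *\<^sub>R R t h1"] by linarith
          moreover have "norm (R t h3) \<le> e2 * C * s"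
          proof -
            have "e2 * C * norm h3 \<le> e2 * C * s" using h3(2) e12(2) 2(3) by (intro mult_left_mono) auto
            then show ?thesis using R[OF h3(1)] by (simp add: mult.assoc)
          qed
          moreover have "norm (a1 *\<^sub>R R t h1) + norm (a2 *\<^sub>R R t h2) \<le> e2 * C * s"
            using R2[OF h(1), of a1] R2[OF h(2), of a2] unfolding s_def distrib_left by linarith
          moreover have "norm (F' (Z d t y0) (u t)) \<le> B * norm (u t)" by (rule B(2)[OF zz])
          ultimately show "norm (D t h3 - a1 *\<^sub>R D t h1 - a2 *\<^sub>R D t h2) \<le> B * norm (u t) + 2 * e2 * C * s" by simp
        qed (use t12 B(1) e12(2) 2(3) in \<open>auto simp: s_def\<close>)
        also have "\<dots> = E * (norm (u t1) + 2 * e2 * C * s)" by (simp add: E_def)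
        also have "\<dots> \<le> E * (e1 * s + 2 * e2 * (C + 1) * s)"
        proof (intro mult_left_mono add_mono)
          show "norm (u t1) \<le> e1 * s"
            unfolding u_def h3_def s_def by (rule \<delta>1(2)[rule_format]) (use h \<delta>(2) in auto)
          show "2 * e2 * C * s \<le> 2 * e2 * (C + 1) * s"
            using e12(2) by (intro mult_right_mono mult_left_mono) (auto simp: s_def)
        qed (use E in auto)
        also have "\<dots> = (E * e1) * s + (E * (2 * e2 * (C + 1))) * s" by (simp add: algebra_simps)
        also have "E * e1 = e / 2" using E by (simp add: e1_def)
        also have "E * (2 * e2 * (C + 1)) = e / 2"
        proof -
          define c where "c = C + 1"
          have "c \<noteq> 0" using 2(3) by (simp add: c_def)
          then have "E * (2 * (e / (4 * E * c)) * c) = e / 2" using E by simp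
          then show ?thesis by (simp add: e2_def c_def)
        qed
        also have "e / 2 * s + e / 2 * s = e * s" by simp
        finally show ?thesis by (simp only: u_def h3_def s_def)
      qed
      then show "\<exists>\<delta>>0. \<forall>a1 a2 h1 h2. norm h1 < \<delta> \<longrightarrow> norm h2 < \<delta> \<longrightarrow>
          norm (a1 *\<^sub>R h1) < \<delta> \<longrightarrow> norm (a2 *\<^sub>R h2) < \<delta> \<longrightarrow> norm (a1 *\<^sub>R h1 + a2 *\<^sub>R h2) < \<delta> \<longrightarrow>
          norm (\<zeta> t2 (a1 *\<^sub>R h1 + a2 *\<^sub>R h2) - a1 *\<^sub>R \<zeta> t2 h1 - a2 *\<^sub>R \<zeta> t2 h2) \<le> e * (norm (a1 *\<^sub>R h1) + norm (a2 *\<^sub>R h2))"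
        using \<delta>(1) by blast
    qed
    then have "(\<lambda>y. Z d t2 y) differentiable (at y0)"
      unfolding \<zeta>_def by (rule asymptotically_linear_imp_differentiable)
    then show ?thesis unfolding diff_time_def using d(1) 2(5)[OF t2 y02] by blast
  qed
  then show ?thesis using 2(1) by blast
qed

lemma C2_differentiable:
  assumes C2: "C2_metric A g" and y0: "y0 \<in> Y" "y0 \<noteq> 0" and d: "d \<in> A" "\<gamma> y0 1 \<in> fst d"
  shows "(\<lambda>y. Z d 1 y) differentiable (at y0)"
proof -
  have i: "(1::real) \<in> {0..1}" by simp
  have "diff_time y0 1" by (rule interval_propagate[of "diff_time y0" 0 1, OF diff_time_0[OF y0(1)] diff_time_step[OF C2 y0] i])
  then show ?thesis by (rule diff_time_change[OF y0(1) i _ d])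
qed

end

section \<open>Normal neighborhoods and the differential of the squared distance\<close>

lemma has_derivative_quadratic:
  fixes f :: "'a::real_normed_vector \<Rightarrow> 'b::real_normed_vector"
  assumes L: "bounded_linear L" and d: "0 < d" and C: "0 \<le> C"
    and bd: "\<And>x. x \<in> ball x0 d \<Longrightarrow> norm (f x - f x0 - L (x - x0)) \<le> C * (norm (x - x0))\<^sup>2"
  shows "(f has_derivative L) (at x0)"
  unfolding has_derivative_at_alt
proof (intro conjI L allI impI)
  fix e :: real assume e: "0 < e"
  define s where "s = min d (e / (C + 1))"
  have s: "0 < s" using d e C by (simp add: s_def)
  have "norm (f x - f x0 - L (x - x0)) \<le> e * norm (x - x0)" if x: "norm (x - x0) < s" for x
  proof -
    have "norm (f x - f x0 - L (x - x0)) \<le> C * (norm (x - x0))\<^sup>2"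
      using x by (intro bd) (simp add: s_def dist_norm norm_minus_commute)
    also have "\<dots> = (C * norm (x - x0)) * norm (x - x0)" by (simp add: power2_eq_square)
    also have "\<dots> \<le> e * norm (x - x0)"
    proof (rule mult_right_mono)
      have "C * norm (x - x0) \<le> (C + 1) * (e / (C + 1))"
        using x C by (intro mult_mono) (auto simp: s_def)
      then show "C * norm (x - x0) \<le> e" using C by simp
    qed simp
    finally show ?thesis .
  qed
  then show "\<exists>d>0. \<forall>y. norm (y - x0) < d \<longrightarrow> norm (f y - f x0 - L (y - x0)) \<le> e * norm (y - x0)"
    using s by blast
qed

context coord_metric begin

lemma lag_scale: "x \<in> X \<Longrightarrow> 0 < s \<Longrightarrow> lag (x, s *\<^sub>R v) = s\<^sup>2 * lag (x, v)"
  using G_scale[of x v s]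
  by (cases "v = 0") (simp_all add: lag_def mom_def matrix_vector_mult_scaleR power2_eq_square)

text \<open>Homogeneity of degree two and compactness of the unit sphere.\<close>

lemma lag_small:
  assumes x: "x \<in> X" shows "\<exists>d>0. \<exists>C\<ge>0. \<forall>v\<in>ball 0 d. \<bar>lag (x, v)\<bar> \<le> C * (norm v)\<^sup>2"
proof -
  obtain r K where r: "0 < r" "K-lipschitz_on (cball (x, 0) r) mom"
    by (rule LL_cball[OF mom_LL, of "(x, 0)"]) (use X x in \<open>auto intro: open_Times\<close>)
  have K: "0 \<le> K" using r(2) by (rule lipschitz_on_nonneg)
  have "\<bar>lag (x, v)\<bar> \<le> K * (norm v)\<^sup>2" if v: "v \<in> ball 0 r" for v
  proof -
    have "norm (mom (x, v) - mom (x, 0)) \<le> K * norm ((x, v) - (x, 0))"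
      using v r(1) by (intro lipschitz_on_normD[OF r(2)]) (auto simp: dist_Pair_Pair)
    then have m: "norm (mom (x, v)) \<le> K * norm v" by (simp add: mom_def norm_Pair)
    have "\<bar>v \<bullet> mom (x, v)\<bar> \<le> norm v * norm (mom (x, v))" by (rule Cauchy_Schwarz_ineq2)
    also have "\<dots> \<le> norm v * (K * norm v)" using m by (intro mult_left_mono) auto
    finally have "\<bar>v \<bullet> mom (x, v)\<bar> \<le> K * (norm v)\<^sup>2" by (simp add: power2_eq_square mult_ac)
    then show ?thesis by (simp add: lag_def)
  qed
  then show ?thesis using r(1) K by blast
qed

end

context c21 begin

lemma has_velocity_compose:
  assumes "has_velocity A \<gamma> (f t) v" and f: "(f has_real_derivative a) (at t)"
  shows "has_velocity A (\<lambda>t. \<gamma> (f t)) t (tscale a v)"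
  unfolding has_velocity_def
proof (intro conjI ballI impI)
  have h: "isCont \<gamma> (f t)" "v \<in> tangent_space A (\<gamma> (f t))"
    "\<And>c. c \<in> A \<Longrightarrow> \<gamma> (f t) \<in> fst c \<Longrightarrow> ((snd c \<circ> \<gamma>) has_vector_derivative v c) (at (f t))"
    using assms(1) unfolding has_velocity_def by blast+
  show "isCont (\<lambda>t. \<gamma> (f t)) t" using isCont_o2[OF DERIV_isCont[OF f] h(1)] .
  show "tscale a v \<in> tangent_space A (\<gamma> (f t))" by (rule tscale_in[OF h(2)])
  fix c assume "c \<in> A" "\<gamma> (f t) \<in> fst c"
  from vector_diff_chain_at[OF f[unfolded has_real_derivative_iff_has_vector_derivative] h(3)[OF this]]
  show "((snd c \<circ> (\<lambda>t. \<gamma> (f t))) has_vector_derivative tscale a v c) (at t)"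
    by (simp add: o_def tscale_def)
qed

lemma has_velocity_cong:
  assumes v: "has_velocity A \<gamma> t v" and U: "open U" "t \<in> U" "\<And>s. s \<in> U \<Longrightarrow> \<gamma> s = \<gamma>' s"
  shows "has_velocity A \<gamma>' t v"
  unfolding has_velocity_def
proof (intro conjI ballI impI)
  have h: "isCont \<gamma> t" "v \<in> tangent_space A (\<gamma> t)"
    "\<And>c. c \<in> A \<Longrightarrow> \<gamma> t \<in> fst c \<Longrightarrow> ((snd c \<circ> \<gamma>) has_vector_derivative v c) (at t)"
    using v unfolding has_velocity_def by blast+
  have eq: "\<gamma>' t = \<gamma> t" using U by simp
  have ev: "\<forall>\<^sub>F s in nhds t. \<gamma> s = \<gamma>' s" unfolding eventually_nhds using U by blast
  show "isCont \<gamma>' t" using h(1) isCont_cong[OF ev] by simp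
  show "v \<in> tangent_space A (\<gamma>' t)" using h(2) eq by simp
  fix c assume c: "c \<in> A" "\<gamma>' t \<in> fst c"
  have "((snd c \<circ> \<gamma>) has_vector_derivative v c) (at t)" using h(3) c eq by simp
  then show "((snd c \<circ> \<gamma>') has_vector_derivative v c) (at t)"
    by (rule has_vector_derivative_transform_within_open[OF _ U(1,2)]) (simp add: U(3))
qed

end

text \<open>Tangent vectors at \<open>p\<close> are represented by their components in a chart \<open>c0\<close> around \<open>p\<close>.  In these terms
\<open>Y\<close> is the star-shaped domain of the exponential map and \<open>psi\<close> its inverse.\<close>

locale normal = finsler A g for A :: "('m::t2_space, 'n::finite) chart set" and g +
  fixes p :: 'm and N :: "'m set" and Np :: "('m, 'n) tvec set" and c0 :: "('m, 'n) chart"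
  assumes nn: "normal_nbhd A g p N Np" and c0: "c0 \<in> A" "p \<in> fst c0"
begin

abbreviation E where "E \<equiv> exp_map A g p"
abbreviation Ei where "Ei \<equiv> exp_inv A g p Np"
abbreviation T where "T \<equiv> tvec_of A c0 p"
abbreviation TA where "TA \<equiv> tangent_atlas A p"
abbreviation "D \<equiv> D2 A g p Np"
abbreviation "P \<equiv> position_vector A g p Np"

definition Y where "Y = (\<lambda>v. v c0) ` Np"

lemma N_open: "open N" and pN: "p \<in> N" and Np_dom: "Np \<subseteq> exp_domain A g p"
  and Np_open: "openin (top_of_set (tangent_space A p)) Np"
  and Np_star: "v \<in> Np \<Longrightarrow> s \<in> {0..1} \<Longrightarrow> tscale s v \<in> Np"
  using nn unfolding normal_nbhd_def by blast+

lemma Np_tangent: "v \<in> Np \<Longrightarrow> v \<in> tangent_space A p"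
  using openin_imp_subset[OF Np_open] by blast

lemma homeo_ex: "\<exists>h. homeomorphism Np N E h \<and> loc_lipschitz_map TA A Np E \<and> loc_lipschitz_map A TA N h"
  using nn unfolding normal_nbhd_def lipeomorphism_def by blast

lemma Ei_eq:
  assumes h: "homeomorphism Np N E h" and q: "q \<in> N" shows "Ei q = h q"
proof -
  have hq: "h q \<in> Np" using homeomorphism_image2[OF h] q by blast
  have inj: "inj_on E Np" by (rule inj_on_inverseI[where g=h]) (rule homeomorphism_apply1[OF h])
  have "Ei (E (h q)) = h q" unfolding exp_inv_def by (rule inv_into_f_f[OF inj hq])
  then show ?thesis using homeomorphism_apply2[OF h q] by simp
qed

lemma homeo: "homeomorphism Np N E Ei"
proof -
  obtain h where h: "homeomorphism Np N E h" using homeo_ex by blast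
  show ?thesis by (rule homeomorphism_cong[OF h]) (auto simp: Ei_eq[OF h])
qed

lemma Ei_lip: "c \<in> A \<Longrightarrow> LL (\<lambda>x. Ei (chart_inv c x) c0) (snd c ` (N \<inter> fst c))"
proof -
  assume c: "c \<in> A"
  obtain h where h: "homeomorphism Np N E h" "loc_lipschitz_map A TA N h" using homeo_ex by blast
  have t: "(tangent_space A p, \<lambda>v. v c0) \<in> TA" unfolding tangent_atlas_def using c0 by blast
  have "LL (snd (tangent_space A p, \<lambda>v. v c0) \<circ> h \<circ> chart_inv c) (snd c ` {x \<in> N \<inter> fst c. h x \<in> fst (tangent_space A p, \<lambda>v :: ('m, 'n) tvec. v c0)})"
    using h(2) c t unfolding loc_lipschitz_map_def by blast
  moreover have "{x \<in> N \<inter> fst c. h x \<in> fst (tangent_space A p, \<lambda>v :: ('m, 'n) tvec. v c0)} = N \<inter> fst c"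
    using homeomorphism_image2[OF h(1)] Np_tangent by auto
  ultimately have "LL (\<lambda>x. h (chart_inv c x) c0) (snd c ` (N \<inter> fst c))" by (simp add: o_def)
  then show ?thesis by (rule LL_cong) (use c Ei_eq[OF h(1)] in auto)
qed

lemma E_N: "v \<in> Np \<Longrightarrow> E v \<in> N" using homeomorphism_image1[OF homeo] by blast
lemma Ei_Np: "q \<in> N \<Longrightarrow> Ei q \<in> Np" using homeomorphism_image2[OF homeo] by blast
lemma E_Ei: "q \<in> N \<Longrightarrow> E (Ei q) = q" by (rule homeomorphism_apply2[OF homeo])
lemma Ei_E: "v \<in> Np \<Longrightarrow> Ei (E v) = v" by (rule homeomorphism_apply1[OF homeo])

lemma Y_open: "open Y" unfolding Y_def by (rule tangent_open_image(1)[OF c0 Np_open])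
lemma Y_iff: "y \<in> Y \<longleftrightarrow> T y \<in> Np" unfolding Y_def tangent_open_image(2)[OF c0 Np_open] by simp

lemma T_comp: "v \<in> Np \<Longrightarrow> T (v c0) = v" using tvec_of_chart[OF Np_tangent c0] .
lemma comp_Y: "v \<in> Np \<Longrightarrow> v c0 \<in> Y" unfolding Y_def by blast
lemma T_self: "T y c0 = y" by (rule tvec_of_self[OF c0])

text \<open>Some solution on an open interval around \<open>[0,1]\<close>; by uniqueness the choice affects only the interval.
The components are the interval \<open>Iy\<close>, the geodesic \<open>gm\<close> and its velocity \<open>Vy\<close>.\<close>

definition fam :: "real^'n \<Rightarrow> real set \<times> (real \<Rightarrow> 'm) \<times> (real \<Rightarrow> ('m, 'n) tvec)" where
  "fam y = (SOME z. spray_solution A g (fst z) (fst (snd z)) (snd (snd z)) \<and> {0..1} \<subseteq> fst z \<and>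
     fst (snd z) 0 = p \<and> snd (snd z) 0 = T y)"
definition Iy where "Iy y = fst (fam y)"
definition gm where "gm y = fst (snd (fam y))"
definition Vy where "Vy y = snd (snd (fam y))"

lemma fam:
  assumes y: "y \<in> Y"
  shows "spray_solution A g (Iy y) (gm y) (Vy y)" "{0..1} \<subseteq> Iy y" "gm y 0 = p" "Vy y 0 = T y"
proof -
  have "T y \<in> exp_domain A g p" using y Y_iff Np_dom by blast
  then have "geodesic_defined A g p (T y) 1" by (simp add: exp_domain_def)
  then obtain J \<gamma> V where s: "spray_solution A g J \<gamma> V" "0 \<in> J" "1 \<in> J" "\<gamma> 0 = p" "V 0 = T y"
    unfolding geodesic_defined_def geodesic_reaches_def by blast
  have "{0..1} \<subseteq> J"
    using solution_interval(2)[OF s(1)] s(2,3) unfolding is_interval_1 by (meson atLeastAtMost_iff subsetI)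
  then have "\<exists>z. spray_solution A g (fst z) (fst (snd z)) (snd (snd z)) \<and> {0..1} \<subseteq> fst z \<and>
     fst (snd z) 0 = p \<and> snd (snd z) 0 = T y" using s by (intro exI[of _ "(J, \<gamma>, V)"]) simp
  from someI_ex[OF this] show "spray_solution A g (Iy y) (gm y) (Vy y)" "{0..1} \<subseteq> Iy y" "gm y 0 = p" "Vy y 0 = T y"
    unfolding Iy_def gm_def Vy_def fam_def by blast+
qed

sublocale geodesic_family A g c0 p Y Iy gm Vy
  by unfold_locales (use c0 Y_open fam in auto)

lemma one_I: "y \<in> Y \<Longrightarrow> 1 \<in> Iy y" using fam(2) by fastforce
lemma zero_I: "y \<in> Y \<Longrightarrow> 0 \<in> Iy y" using fam(2) by fastforce

lemma E_gm: "y \<in> Y \<Longrightarrow> E (T y) = gm y 1"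
  unfolding exp_map_def by (rule geodesic_eq(1)[OF fam(1) zero_I one_I fam(3,4)])

lemma vel_gm: "y \<in> Y \<Longrightarrow> geodesic_velocity A g p (T y) 1 = Vy y 1"
  by (rule geodesic_eq(2)[OF fam(1) zero_I one_I fam(3,4)])

definition psi where "psi q = Ei q c0"

lemma psi_Y: "q \<in> N \<Longrightarrow> psi q \<in> Y" unfolding psi_def by (rule comp_Y[OF Ei_Np])
lemma T_psi: "q \<in> N \<Longrightarrow> T (psi q) = Ei q" unfolding psi_def by (rule T_comp[OF Ei_Np])
lemma gm_psi: "q \<in> N \<Longrightarrow> gm (psi q) 1 = q" using E_gm[OF psi_Y] T_psi E_Ei by metis
lemma gm_N: "y \<in> Y \<Longrightarrow> gm y 1 \<in> N" using E_gm E_N Y_iff by metis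
lemma psi_gm: "y \<in> Y \<Longrightarrow> psi (gm y 1) = y"
  unfolding psi_def using E_gm Ei_E Y_iff T_self by metis
lemma P_psi: "q \<in> N \<Longrightarrow> P q = Vy (psi q) 1"
  unfolding position_vector_def using vel_gm[OF psi_Y] T_psi by metis
lemma D_psi: "q \<in> N \<Longrightarrow> D q = 2 * Lam (psi q)" unfolding D2_def by (simp add: T_psi)
lemma P_tangent: "q \<in> N \<Longrightarrow> P q \<in> tangent_space A q"
  using solution_velocity(2)[OF fam(1)[OF psi_Y] one_I[OF psi_Y]] by (simp add: P_psi gm_psi)

lemma psi_LL: "c \<in> A \<Longrightarrow> LL (\<lambda>x. psi (chart_inv c x)) (snd c ` (N \<inter> fst c))"
  unfolding psi_def by (rule Ei_lip)

lemma psi_cont: "continuous_on N psi"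
  unfolding psi_def
  by (rule continuous_on_compose2[OF component_cont homeomorphism_cont2[OF homeo] subset_UNIV])

lemma gm_cont: "continuous_on Y (\<lambda>y. gm y 1)"
proof -
  have "continuous_on Y (\<lambda>y. E (T y))"
    by (rule continuous_on_compose2[OF homeomorphism_cont1[OF homeo] tvec_of_cont[OF c0]]) (use Y_iff in blast)
  then show ?thesis using E_gm by (simp cong: continuous_on_cong)
qed

lemma Z_LL: assumes d: "d \<in> A" shows "LL (\<lambda>y. Z d 1 y) {y \<in> Y. gm y 1 \<in> fst d}"
proof (rule LL_I)
  fix y assume y: "y \<in> {y \<in> Y. gm y 1 \<in> fst d}"
  obtain \<delta> C where \<delta>: "0 < \<delta>" "0 \<le> C" "ball y \<delta> \<subseteq> Y" "\<And>y'. y' \<in> ball y \<delta> \<Longrightarrow> gm y' 1 \<in> fst d"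
    "\<And>y1 y2. y1 \<in> ball y \<delta> \<Longrightarrow> y2 \<in> ball y \<delta> \<Longrightarrow> norm (Z d 1 y1 - Z d 1 y2) \<le> C * norm (y1 - y2)"
    by (rule lip_chartE[of y 1 d]) (use y d in auto)
  show "\<exists>e>0. \<exists>K. \<forall>y1\<in>ball y e \<inter> {y \<in> Y. gm y 1 \<in> fst d}. \<forall>y2\<in>ball y e \<inter> {y \<in> Y. gm y 1 \<in> fst d}.
      dist (Z d 1 y1) (Z d 1 y2) \<le> K * dist y1 y2"
    using \<delta>(1,5) by (intro exI[of _ \<delta>] conjI exI[of _ C] ballI) (auto simp: dist_norm)
qed

lemma gm_dom_open: assumes d: "d \<in> A" shows "open {y \<in> Y. gm y 1 \<in> fst d}"
proof -
  have "open (Y \<inter> (\<lambda>y. gm y 1) -` fst d)"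
    by (rule continuous_open_preimage[OF gm_cont Y_open chart_open[OF d]])
  moreover have "Y \<inter> (\<lambda>y. gm y 1) -` fst d = {y \<in> Y. gm y 1 \<in> fst d}" by auto
  ultimately show ?thesis by simp
qed

lemma Np_ne: "tzero \<in> Np"
proof -
  have "tscale 0 (Ei p) \<in> Np" by (rule Np_star[OF Ei_Np[OF pN]]) simp
  then show ?thesis by (simp add: tscale_def tzero_def)
qed

lemma Vy_zero:
  assumes "0 \<in> Y" shows "gm 0 1 = p" "Vy 0 1 = tzero"
  using solution_unique[OF fam(1)[OF assms] solution_const[of p] zero_I[OF assms] UNIV_I _ _ one_I[OF assms] UNIV_I]
    fam(3,4)[OF assms] tvec_of_0[OF c0] by auto

text \<open>For \<open>q = p\<close> the initial velocity is 0 and the metric is not defined there, but then the momentum vanishes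
and the Lagrangian is quadratically small.\<close>

lemma expansion:
  assumes q: "q \<in> N" and d: "d \<in> A" "q \<in> fst d"
  obtains \<delta> C where "0 < \<delta>" "0 \<le> C" "ball (psi q) \<delta> \<subseteq> Y"
    "\<And>y. y \<in> ball (psi q) \<delta> \<Longrightarrow> gm y 1 \<in> fst d \<Longrightarrow>
       \<bar>momentum d (snd d q, P q d) \<bullet> (snd d (gm y 1) - snd d q) - (Lam y - Lam (psi q))\<bar> \<le> C * (norm (y - psi q))\<^sup>2"
proof (cases "psi q = 0")
  case False
  have gd: "gm (psi q) 1 \<in> fst d" using d(2) gm_psi[OF q] by simp
  obtain \<delta> C where \<delta>: "0 < \<delta>" "0 \<le> C" "ball (psi q) \<delta> \<subseteq> Y"
    "\<And>y. y \<in> ball (psi q) \<delta> \<Longrightarrow> \<bar>momentum d (Z d 1 (psi q)) \<bullet> (fst (Z d 1 y) - fst (Z d 1 (psi q))) - (Lam y - Lam (psi q))\<bar> \<le> C * (norm (y - psi q))\<^sup>2"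
    by (rule second_order[OF psi_Y[OF q] False d(1) gd]) blast
  have eq: "Z d 1 (psi q) = (snd d q, P q d)" by (simp add: coords_def gm_psi[OF q] P_psi[OF q])
  show ?thesis
  proof (rule that[OF \<delta>(1-3)])
    fix y assume "y \<in> ball (psi q) \<delta>"
    from \<delta>(4)[OF this] show "\<bar>momentum d (snd d q, P q d) \<bullet> (snd d (gm y 1) - snd d q) - (Lam y - Lam (psi q))\<bar> \<le> C * (norm (y - psi q))\<^sup>2"
      unfolding eq by (simp add: coords_def)
  qed
next
  case True
  have 0: "0 \<in> Y" using psi_Y[OF q] True by simp
  have Pq: "P q = tzero" using P_psi[OF q] True Vy_zero(2)[OF 0] by simp
  have m0: "momentum d (snd d q, P q d) = 0" by (simp add: Pq tzero_def momentum_def)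
  interpret coord_metric "Xc c0" "gcoord A g c0" by (rule coord_metric_chart[OF c0(1)])
  have L: "Lam y = lag (snd c0 p, y)" for y
    using lagrangian_coord[OF c0 tvec_of_in[OF c0], of y] T_self by simp
  have "snd c0 p \<in> Xc c0" using c0 by blast
  then obtain \<delta>1 C where 1: "0 < \<delta>1" "0 \<le> C" "\<forall>v\<in>ball 0 \<delta>1. \<bar>lag (snd c0 p, v)\<bar> \<le> C * (norm v)\<^sup>2"
    using lag_small by blast
  obtain \<delta>2 where 2: "0 < \<delta>2" "ball 0 \<delta>2 \<subseteq> Y" using Y_open 0 by (meson open_contains_ball)
  have L0: "Lam 0 = 0" by (simp add: L lag_def)
  show ?thesis
  proof (rule that[of "min \<delta>1 \<delta>2" C])
    show "0 < min \<delta>1 \<delta>2" "0 \<le> C" using 1 2 by auto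
    show "ball (psi q) (min \<delta>1 \<delta>2) \<subseteq> Y" unfolding True using 2(2) by auto
    fix y assume "y \<in> ball (psi q) (min \<delta>1 \<delta>2)"
    then have "y \<in> ball 0 \<delta>1" unfolding True by simp
    then have "\<bar>Lam y\<bar> \<le> C * (norm y)\<^sup>2" unfolding L using 1(3) by blast
    then show "\<bar>momentum d (snd d q, P q d) \<bullet> (snd d (gm y 1) - snd d q) - (Lam y - Lam (psi q))\<bar> \<le> C * (norm (y - psi q))\<^sup>2"
      unfolding m0 True L0 by simp
  qed
qed

text \<open>The expansion is linear in the displacement of the endpoint, and its error is quadratic in the initial
velocity, hence quadratic in the endpoint, since the inverse of the exponential map is Lipschitz.\<close>

lemma D_der:
  assumes q: "q \<in> N" and d: "d \<in> A" "q \<in> fst d"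
  shows "((D \<circ> chart_inv d) has_derivative (\<lambda>w. 2 * (momentum d (snd d q, P q d) \<bullet> w))) (at (snd d q))"
proof -
  define m where "m = momentum d (snd d q, P q d)"
  define S where "S = snd d ` (N \<inter> fst d)"
  define x0 where "x0 = snd d q"
  have S: "open S" unfolding S_def by (rule open_chart_image[OF d(1) N_open])
  have x0: "x0 \<in> S" using q d by (auto simp: S_def x0_def)
  obtain \<delta> C where \<delta>: "0 < \<delta>" "0 \<le> C" "ball (psi q) \<delta> \<subseteq> Y"
    "\<And>y. y \<in> ball (psi q) \<delta> \<Longrightarrow> gm y 1 \<in> fst d \<Longrightarrow>
       \<bar>m \<bullet> (snd d (gm y 1) - snd d q) - (Lam y - Lam (psi q))\<bar> \<le> C * (norm (y - psi q))\<^sup>2"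
    unfolding m_def by (rule expansion[OF q d]) blast
  obtain r K where r: "0 < r" "cball x0 r \<subseteq> S" "K-lipschitz_on (cball x0 r) (\<lambda>x. psi (chart_inv d x))"
    using LL_cball[OF psi_LL[OF d(1), folded S_def] S x0] .
  have K: "0 \<le> K" using r(3) by (rule lipschitz_on_nonneg)
  define s where "s = min r (\<delta> / (K + 1))"
  have s: "0 < s" using r(1) \<delta>(1) K by (simp add: s_def)
  have ciq: "chart_inv d x0 = q" using d by (simp add: x0_def)
  show ?thesis
    unfolding m_def[symmetric] unfolding x0_def[symmetric]
  proof (rule has_derivative_quadratic[of _ s "2 * (C * K\<^sup>2)"])
    show "bounded_linear (\<lambda>w. 2 * (m \<bullet> w))"
      by (intro bounded_linear_const_mult bounded_linear_inner_right)
    fix x assume x: "x \<in> ball x0 s"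
    then have xr: "x \<in> cball x0 r" by (simp add: s_def)
    then have "x \<in> S" using r(2) by blast
    then obtain q' where q': "q' \<in> N" "q' \<in> fst d" "x = snd d q'" by (auto simp: S_def)
    have cx: "chart_inv d x = q'" using q' d by simp
    define y where "y = psi q'"
    have yl: "norm (y - psi q) \<le> K * norm (x - x0)"
      using lipschitz_on_normD[OF r(3) xr, of x0] r(1) by (simp add: cx ciq y_def)
    also have "\<dots> < \<delta>"
    proof -
      have "K * norm (x - x0) \<le> K * s" using x K by (intro mult_left_mono) (auto simp: dist_norm norm_minus_commute)
      also have "\<dots> \<le> K * (\<delta> / (K + 1))" using K by (intro mult_left_mono) (auto simp: s_def)
      also have "\<dots> < (K + 1) * (\<delta> / (K + 1))" using K \<delta>(1) by (intro mult_strict_right_mono) auto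
      also have "\<dots> = \<delta>" using K by simp
      finally show ?thesis .
    qed
    finally have yb: "y \<in> ball (psi q) \<delta>" by (simp add: dist_norm norm_minus_commute)
    have gy: "gm y 1 = q'" unfolding y_def by (rule gm_psi[OF q'(1)])
    have "\<bar>m \<bullet> (x - x0) - (Lam y - Lam (psi q))\<bar> \<le> C * (norm (y - psi q))\<^sup>2"
      using \<delta>(4)[OF yb] gy q' by (simp add: x0_def)
    also have "\<dots> \<le> C * (K * norm (x - x0))\<^sup>2" using yl \<delta>(2) by (intro mult_left_mono power_mono) auto
    finally have *: "\<bar>m \<bullet> (x - x0) - (Lam y - Lam (psi q))\<bar> \<le> C * K\<^sup>2 * (norm (x - x0))\<^sup>2"
      by (simp add: power_mult_distrib mult.assoc)
    have "(D \<circ> chart_inv d) x - (D \<circ> chart_inv d) x0 - 2 * (m \<bullet> (x - x0)) = - 2 * (m \<bullet> (x - x0) - (Lam y - Lam (psi q)))"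
      using D_psi[OF q'(1)] D_psi[OF q] by (simp add: cx ciq y_def)
    then show "norm ((D \<circ> chart_inv d) x - (D \<circ> chart_inv d) x0 - 2 * (m \<bullet> (x - x0))) \<le> 2 * (C * K\<^sup>2) * (norm (x - x0))\<^sup>2"
      using * by (simp add: abs_mult)
  qed (use s \<delta>(2) in auto)
qed

lemma differential: "q \<in> N \<Longrightarrow> has_differential_scalar A D q (\<lambda>w. 2 * gform g q (P q) (P q) w)"
  unfolding has_differential_scalar_def using D_der gform_coord[OF _ _ P_tangent] by simp

lemma C11: "C11_scalar_on A N D"
  unfolding C11_scalar_on_def
proof
  fix d assume d: "d \<in> A"
  let ?S = "snd d ` (N \<inter> fst d)"
  define m where "m = (\<lambda>x. momentum d (Z d 1 (psi (chart_inv d x))))"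
  have der: "((D \<circ> chart_inv d) has_derivative (\<lambda>w. 2 * (m x \<bullet> w))) (at x)" if "x \<in> ?S" for x
  proof -
    obtain q where q: "q \<in> N" "q \<in> fst d" "x = snd d q" using \<open>x \<in> ?S\<close> by blast
    have "Z d 1 (psi q) = (snd d q, P q d)" by (simp add: coords_def gm_psi[OF q(1)] P_psi[OF q(1)])
    then show ?thesis using D_der[OF q(1) d q(2)] q d by (simp add: m_def)
  qed
  have LLm: "LL m ?S"
    unfolding m_def
  proof (rule LL_compose[where g="momentum d" and T="Xc d \<times> UNIV"])
    show "LL (\<lambda>x. Z d 1 (psi (chart_inv d x))) ?S"
      by (rule LL_compose[OF psi_LL[OF d] Z_LL[OF d]]) (use d psi_Y gm_psi in auto)
    interpret coord_metric "Xc d" "gcoord A g d" by (rule coord_metric_chart[OF d])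
    have "momentum d = mom" by (simp add: fun_eq_iff momentum_def mom_def)
    then show "LL (momentum d) (Xc d \<times> UNIV)" using mom_LL by simp
    show "(\<lambda>x. Z d 1 (psi (chart_inv d x))) ` ?S \<subseteq> Xc d \<times> UNIV"
      using d gm_psi by (auto simp: coords_def)
  qed
  have "LL (\<lambda>x. frechet_derivative (D \<circ> chart_inv d) (at x) w) ?S" for w
  proof (rule LL_cong)
    show "LL (\<lambda>x. 2 * (m x \<bullet> w)) ?S" by (intro LL_mult LL_inner LL_const LLm)
    fix x assume "x \<in> ?S"
    from frechet_derivative_at[OF der[OF this]]
    show "2 * (m x \<bullet> w) = frechet_derivative (D \<circ> chart_inv d) (at x) w" by metis
  qed
  moreover have "\<forall>x\<in>?S. (D \<circ> chart_inv d) differentiable (at x)" using der unfolding differentiable_def by blast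
  ultimately show "Ck1_on 1 (D \<circ> chart_inv d) ?S" unfolding One_nat_def Ck1_on.simps by blast
qed

section \<open>Radial geodesics and level sets\<close>

lemma gm_scale:
  assumes y: "y \<in> Y" and s: "0 < s" "s \<in> Iy y" and sy: "s *\<^sub>R y \<in> Y"
  shows "gm (s *\<^sub>R y) 1 = gm y s" "Vy (s *\<^sub>R y) 1 = tscale s (Vy y s)"
proof -
  have "gm (s *\<^sub>R y) 1 = gm y (s * 1) \<and> Vy (s *\<^sub>R y) 1 = tscale s (Vy y (s * 1))"
    by (rule solution_unique[OF fam(1)[OF sy] solution_scale[OF fam(1)[OF y] s(1)] zero_I[OF sy] _ _ _ one_I[OF sy]])
       (use s zero_I[OF y] fam(3,4)[OF sy] fam(3,4)[OF y] in \<open>auto simp: tvec_of_scale[OF c0]\<close>)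
  then show "gm (s *\<^sub>R y) 1 = gm y s" "Vy (s *\<^sub>R y) 1 = tscale s (Vy y s)" by auto
qed

lemma scale_Y: "y \<in> Y \<Longrightarrow> 0 \<le> s \<Longrightarrow> s \<le> 1 \<Longrightarrow> s *\<^sub>R y \<in> Y"
  using Np_star[of "T y" s] by (simp add: Y_iff tvec_of_scale[OF c0])

lemma Lam_scale: assumes "0 < s" shows "Lam (s *\<^sub>R y) = s\<^sup>2 * Lam y"
proof -
  interpret coord_metric "Xc c0" "gcoord A g c0" by (rule coord_metric_chart[OF c0(1)])
  have L: "Lam y = lag (snd c0 p, y)" for y
    using lagrangian_coord[OF c0 tvec_of_in[OF c0], of y] T_self by simp
  show ?thesis unfolding L by (rule lag_scale[OF _ assms]) (use c0 in blast)
qed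

text \<open>A radial geodesic that stays in \<open>N\<close> is the image of a segment in \<open>Y\<close>.  The set of times \<open>\<tau>\<close> with
\<open>\<tau> y \<in> Y\<close> is open since \<open>Y\<close> is.  It is closed too: at a time \<open>\<tau>\<close> outside, \<open>psi\<close> of the geodesic is a
point of \<open>Y\<close> and so different from \<open>\<tau> y\<close>, but it would be the limit of \<open>s y\<close> along times \<open>s\<close> of the set that
tend to \<open>\<tau>\<close>.\<close>

lemma ray_in_Y:
  assumes v: "v \<in> tangent_space A p" and t: "0 < t"
    and N: "\<And>\<tau>. \<tau> \<in> {0..t} \<Longrightarrow> geodesic_defined A g p v \<tau> \<and> geodesic A g p v \<tau> \<in> N"
  shows "t *\<^sub>R v c0 \<in> Y" "geodesic A g p v t = gm (t *\<^sub>R v c0) 1"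
    "Vy (t *\<^sub>R v c0) 1 = tscale t (geodesic_velocity A g p v t)"
proof -
  define y where "y = v c0"
  have Ty: "T y = v" unfolding y_def by (rule tvec_of_chart[OF v c0])
  obtain J \<gamma> V where s: "spray_solution A g J \<gamma> V" "0 \<in> J" "t \<in> J" "\<gamma> 0 = p" "V 0 = v"
    using N[of t] t unfolding geodesic_defined_def geodesic_reaches_def by auto
  have Jt: "{0..t} \<subseteq> J"
    using solution_interval(2)[OF s(1)] s(2,3) unfolding is_interval_1 by (meson atLeastAtMost_iff subsetI)
  have geo: "geodesic A g p v \<tau> = \<gamma> \<tau>" "geodesic_velocity A g p v \<tau> = V \<tau>" if "\<tau> \<in> {0..t}" for \<tau>
    using geodesic_eq[OF s(1,2) _ s(4,5), of \<tau>] that Jt by auto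
  have gN: "\<gamma> \<tau> \<in> N" if "\<tau> \<in> {0..t}" for \<tau> using N[OF that] geo(1)[OF that] by simp
  have eq: "gm (\<tau> *\<^sub>R y) 1 = \<gamma> \<tau> \<and> Vy (\<tau> *\<^sub>R y) 1 = tscale \<tau> (V \<tau>)"
    if \<tau>: "0 < \<tau>" "\<tau> \<in> {0..t}" "\<tau> *\<^sub>R y \<in> Y" for \<tau>
  proof -
    have "gm (\<tau> *\<^sub>R y) 1 = \<gamma> (\<tau> * 1) \<and> Vy (\<tau> *\<^sub>R y) 1 = tscale \<tau> (V (\<tau> * 1))"
      by (rule solution_unique[OF fam(1)[OF \<tau>(3)] solution_scale[OF s(1) \<tau>(1)] zero_I[OF \<tau>(3)] _ _ _ one_I[OF \<tau>(3)]])
         (use \<tau> Jt s fam(3,4)[OF \<tau>(3)] in \<open>auto simp: tvec_of_scale[OF c0] Ty\<close>)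
    then show ?thesis by simp
  qed
  have zY: "0 \<in> Y" using Np_ne by (simp add: Y_iff tvec_of_0[OF c0])
  have "t *\<^sub>R y \<in> Y"
  proof (rule clopen_interval[where I="{0..t}" and P="\<lambda>\<tau>. \<tau> *\<^sub>R y \<in> Y" and ?t0.0=0])
    show "0 *\<^sub>R y \<in> Y" using zY by simp
    fix \<tau> assume \<tau>: "\<tau> \<in> {0..t}"
    have lim: "((\<lambda>s. s *\<^sub>R y) \<longlongrightarrow> \<tau> *\<^sub>R y) (nhds \<tau>)"
      by (intro tendsto_intros) (simp add: filterlim_ident)
    {
      assume "\<tau> *\<^sub>R y \<in> Y"
      then have "\<forall>\<^sub>F s in nhds \<tau>. s *\<^sub>R y \<in> Y" by (rule topological_tendstoD[OF lim Y_open])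
      then show "\<forall>\<^sub>F s in nhds \<tau>. s \<in> {0..t} \<longrightarrow> s *\<^sub>R y \<in> Y" by eventually_elim simp
    }
    {
      assume n: "\<tau> *\<^sub>R y \<notin> Y"
      define u where "u = psi (\<gamma> \<tau>)"
      have \<tau>0: "0 < \<tau>" using \<tau> n zY by (cases "\<tau> = 0") auto
      have uY: "u \<in> Y" unfolding u_def by (rule psi_Y[OF gN[OF \<tau>]])
      have "u \<noteq> \<tau> *\<^sub>R y" using uY n by auto
      then obtain U U' where U: "open U" "open U'" "u \<in> U" "\<tau> *\<^sub>R y \<in> U'" "U \<inter> U' = {}" using hausdorff[of u "\<tau> *\<^sub>R y"] by blast
      have isC: "isCont psi (\<gamma> \<tau>)" using psi_cont N_open gN[OF \<tau>] continuous_on_eq_continuous_at by blast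
      have g: "isCont \<gamma> \<tau>" using solution_velocity(1)[OF s(1)] Jt \<tau> by blast
      have "isCont (\<lambda>s. psi (\<gamma> s)) \<tau>" by (rule isCont_o2[OF g isC])
      then have "((\<lambda>s. psi (\<gamma> s)) \<longlongrightarrow> u) (nhds \<tau>)" by (simp add: isCont_def tendsto_nhds_iff u_def)
      then have "\<forall>\<^sub>F s in nhds \<tau>. psi (\<gamma> s) \<in> U" by (rule topological_tendstoD[OF _ U(1,3)])
      moreover have "\<forall>\<^sub>F s in nhds \<tau>. s *\<^sub>R y \<in> U'" by (rule topological_tendstoD[OF lim U(2,4)])
      moreover have "\<forall>\<^sub>F s in nhds \<tau>. 0 < s" using eventually_nhds_in_open[of "{0<..}" \<tau>] \<tau>0 by simp
      ultimately show "\<forall>\<^sub>F s in nhds \<tau>. s \<in> {0..t} \<longrightarrow> s *\<^sub>R y \<notin> Y"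
      proof eventually_elim
        case (elim s)
        show ?case
        proof (intro impI notI)
          assume s: "s \<in> {0..t}" "s *\<^sub>R y \<in> Y"
          have "psi (\<gamma> s) = s *\<^sub>R y" using eq[OF elim(3) s] psi_gm[OF s(2)] by metis
          then show False using elim(1,2) U(5) by auto
        qed
      qed
    }
  qed (use t in auto)
  then show "t *\<^sub>R v c0 \<in> Y" by (simp add: y_def)
  have tt: "t \<in> {0..t}" using t by simp
  show "geodesic A g p v t = gm (t *\<^sub>R v c0) 1" "Vy (t *\<^sub>R v c0) 1 = tscale t (geodesic_velocity A g p v t)"
    using eq[OF t tt \<open>t *\<^sub>R y \<in> Y\<close>] geo[OF tt] by (auto simp: y_def)
qed

lemma gform_scale:
  assumes v: "v \<in> tangent_space A q" and w: "w \<in> tangent_space A q" and s: "0 < s"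
  shows "gform g q (tscale s v) (tscale s v) w = s * gform g q v v w"
proof -
  obtain c where c: "c \<in> A" "q \<in> fst c" by (rule chart_cover)
  interpret coord_metric "Xc c" "gcoord A g c" by (rule coord_metric_chart[OF c(1)])
  have qc: "snd c q \<in> Xc c" using c by blast
  have "momentum c (snd c q, s *\<^sub>R v c) = s *\<^sub>R momentum c (snd c q, v c)"
    using G_scale[OF qc _ s, of "v c"] by (cases "v c = 0") (simp_all add: momentum_def matrix_vector_mult_scaleR)
  then have "gform g q (tscale s v) (tscale s v) (tvec_of A c q (w c)) = s * gform g q v v (tvec_of A c q (w c))"
    unfolding gform_coord[OF c v] gform_coord[OF c tscale_in[OF v]] by (simp add: tscale_def)
  then show ?thesis by (simp only: tvec_of_chart[OF w c])
qed

text \<open>\<open>D\<^sup>2\<close> is constant along a curve in the level set, so its differential \<open>2 g\<^sub>P(P, \<sqdot>)\<close> annihilates the velocity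
of the curve; \<open>P\<close> is \<open>t\<close> times the velocity of the geodesic.\<close>

lemma orthogonal:
  assumes v: "v \<in> tangent_space A p" and t: "0 < t"
    and N: "\<And>\<tau>. \<tau> \<in> {0..t} \<Longrightarrow> geodesic_defined A g p v \<tau> \<and> geodesic A g p v \<tau> \<in> N"
    and w: "tangent_to_at A (level_set N D (D (geodesic A g p v t))) (geodesic A g p v t) w"
  shows "orthogonal_to g (geodesic A g p v t) (geodesic_velocity A g p v t) w"
proof -
  define y where "y = t *\<^sub>R v c0"
  define q where "q = geodesic A g p v t"
  note ray = ray_in_Y[OF v t N, folded y_def]
  have yY: "y \<in> Y" and qg: "q = gm y 1" and Vt: "Vy y 1 = tscale t (geodesic_velocity A g p v t)"
    using ray by (auto simp: q_def)
  have qN: "q \<in> N" unfolding qg by (rule gm_N[OF yY])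
  have psiq: "psi q = y" unfolding qg by (rule psi_gm[OF yY])
  have Pq: "P q = tscale t (geodesic_velocity A g p v t)" using P_psi[OF qN] psiq Vt by simp
  obtain d where d: "d \<in> A" "q \<in> fst d" by (rule chart_cover)
  obtain \<sigma> where \<sigma>: "\<sigma> 0 = q" "has_velocity A \<sigma> 0 w" "\<forall>\<^sub>F \<tau> in nhds 0. \<sigma> \<tau> \<in> level_set N D (D q)"
    using w unfolding tangent_to_at_def q_def by blast
  have wq: "w \<in> tangent_space A q" using \<sigma>(1,2) unfolding has_velocity_def by simp
  have s0: "isCont \<sigma> 0" using \<sigma>(2) unfolding has_velocity_def by blast
  have ds: "((snd d \<circ> \<sigma>) has_vector_derivative w d) (at 0)"
    using \<sigma>(1,2) d unfolding has_velocity_def by simp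
  have dD: "((D \<circ> chart_inv d) has_derivative (\<lambda>w. 2 * (momentum d (snd d q, P q d) \<bullet> w))) (at ((snd d \<circ> \<sigma>) 0))"
    using D_der[OF qN d] \<sigma>(1) by simp
  have "((\<lambda>s. (D \<circ> chart_inv d) ((snd d \<circ> \<sigma>) s)) has_derivative (\<lambda>h. 2 * (momentum d (snd d q, P q d) \<bullet> (h *\<^sub>R w d)))) (at 0)"
    by (rule has_derivative_compose[OF ds[unfolded has_vector_derivative_def] dD])
  moreover have "((\<lambda>s. (D \<circ> chart_inv d) ((snd d \<circ> \<sigma>) s)) has_derivative (\<lambda>h. 0)) (at 0)"
  proof -
    have "\<forall>\<^sub>F s in nhds 0. \<sigma> s \<in> fst d" using chart_eventually[OF s0 d(1)] \<sigma>(1) d(2) by simp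
    with \<sigma>(3) have "\<forall>\<^sub>F s in nhds 0. \<sigma> s \<in> fst d \<and> \<sigma> s \<in> level_set N D (D q)" by eventually_elim simp
    then obtain U where U: "open U" "0 \<in> U" "\<forall>s\<in>U. \<sigma> s \<in> fst d \<and> \<sigma> s \<in> level_set N D (D q)"
      unfolding eventually_nhds by blast
    show ?thesis
      by (rule has_derivative_transform_within_open[OF has_derivative_const[of "D q"] U(1,2)])
         (use U(3) d in \<open>auto simp: level_set_def\<close>)
  qed
  ultimately have "(\<lambda>h. 2 * (momentum d (snd d q, P q d) \<bullet> (h *\<^sub>R w d))) = (\<lambda>h. 0)" by (rule has_derivative_unique)
  then have "2 * (momentum d (snd d q, P q d) \<bullet> (1 *\<^sub>R w d)) = 0" by meson
  then have "gform g q (P q) (P q) (tvec_of A d q (w d)) = 0" using gform_coord[OF d P_tangent[OF qN]] by simp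
  then have 0: "gform g q (P q) (P q) w = 0" by (simp only: tvec_of_chart[OF wq d])
  have Vq: "geodesic_velocity A g p v t \<in> tangent_space A q"
  proof -
    have "tscale (1 / t) (P q) \<in> tangent_space A q" by (rule tscale_in[OF P_tangent[OF qN]])
    moreover have "tscale (1 / t) (P q) = geodesic_velocity A g p v t" unfolding Pq using t by (simp add: tscale_def)
    ultimately show ?thesis by simp
  qed
  have "t * gform g q (geodesic_velocity A g p v t) (geodesic_velocity A g p v t) w = 0"
    using 0 gform_scale[OF Vq wq t] unfolding Pq by simp
  then show ?thesis unfolding orthogonal_to_def q_def using t by simp
qed

section \<open>The flow of the position vector field\<close>

lemma P_LL: assumes d: "d \<in> A" shows "LL (\<lambda>x. P (chart_inv d x) d) (snd d ` (N \<inter> fst d))"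
proof -
  have "LL (\<lambda>x. Z d 1 (psi (chart_inv d x))) (snd d ` (N \<inter> fst d))"
    by (rule LL_compose[OF psi_LL[OF d] Z_LL[OF d]]) (use d psi_Y gm_psi in auto)
  then have "LL (\<lambda>x. snd (Z d 1 (psi (chart_inv d x)))) (snd d ` (N \<inter> fst d))" by (rule LL_snd)
  then show ?thesis by (rule LL_cong) (use d P_psi in \<open>auto simp: coords_def\<close>)
qed

text \<open>Integral curves of a locally Lipschitz field in a Hausdorff space are unique.\<close>

lemma flow_unique:
  assumes I1: "open I1" "is_interval I1" "0 \<in> I1" "t \<in> I1" and I2: "open I2" "is_interval I2" "0 \<in> I2" "t \<in> I2"
    and \<sigma>1: "\<And>\<tau>. \<tau> \<in> I1 \<Longrightarrow> \<sigma>1 \<tau> \<in> N \<and> has_velocity A \<sigma>1 \<tau> (P (\<sigma>1 \<tau>))"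
    and \<sigma>2: "\<And>\<tau>. \<tau> \<in> I2 \<Longrightarrow> \<sigma>2 \<tau> \<in> N \<and> has_velocity A \<sigma>2 \<tau> (P (\<sigma>2 \<tau>))"
    and init: "\<sigma>1 0 = \<sigma>2 0"
  shows "\<sigma>1 t = \<sigma>2 t"
proof (rule clopen_interval[where I="I1 \<inter> I2" and P="\<lambda>t. \<sigma>1 t = \<sigma>2 t" and ?t0.0=0])
  show "connected (I1 \<inter> I2)" using I1(2) I2(2) by (intro is_interval_connected is_interval_Int)
  fix x assume x: "x \<in> I1 \<inter> I2"
  have c1: "isCont \<sigma>1 x" and c2: "isCont \<sigma>2 x" using \<sigma>1[of x] \<sigma>2[of x] x unfolding has_velocity_def by auto
  have l1: "(\<sigma>1 \<longlongrightarrow> \<sigma>1 x) (nhds x)" and l2: "(\<sigma>2 \<longlongrightarrow> \<sigma>2 x) (nhds x)"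
    using c1 c2 by (simp_all add: tendsto_nhds_iff isCont_def)
  {
    assume "\<sigma>1 x \<noteq> \<sigma>2 x"
    from hausdorff[OF this] obtain U U' where U: "open U" "open U'" "\<sigma>1 x \<in> U" "\<sigma>2 x \<in> U'" "U \<inter> U' = {}" by blast
    have "\<forall>\<^sub>F s in nhds x. \<sigma>1 s \<in> U" by (rule topological_tendstoD[OF l1 U(1,3)])
    moreover have "\<forall>\<^sub>F s in nhds x. \<sigma>2 s \<in> U'" by (rule topological_tendstoD[OF l2 U(2,4)])
    ultimately show "\<forall>\<^sub>F s in nhds x. s \<in> I1 \<inter> I2 \<longrightarrow> \<sigma>1 s \<noteq> \<sigma>2 s"
      by eventually_elim (use U(5) in auto)
  }
  {
    assume eq: "\<sigma>1 x = \<sigma>2 x"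
    obtain d where d: "d \<in> A" "\<sigma>1 x \<in> fst d" by (rule chart_cover)
    have d2: "\<sigma>2 x \<in> fst d" using d eq by simp
    define S where "S = snd d ` (N \<inter> fst d)"
    have S: "open S" unfolding S_def by (rule open_chart_image[OF d(1) N_open])
    have xS: "snd d (\<sigma>1 x) \<in> S" using \<sigma>1[of x] x d by (auto simp: S_def)
    obtain r K where r: "0 < r" "cball (snd d (\<sigma>1 x)) r \<subseteq> S" "K-lipschitz_on (cball (snd d (\<sigma>1 x)) r) (\<lambda>x. P (chart_inv d x) d)"
      using LL_cball[OF P_LL[OF d(1), folded S_def] S xS] .
    have vel: "((snd d \<circ> \<sigma>1) has_vector_derivative P (\<sigma>1 s) d) (at s)" if "s \<in> I1" "\<sigma>1 s \<in> fst d" for s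
      using \<sigma>1[OF that(1)] that(2) d(1) unfolding has_velocity_def by blast
    have vel2: "((snd d \<circ> \<sigma>2) has_vector_derivative P (\<sigma>2 s) d) (at s)" if "s \<in> I2" "\<sigma>2 s \<in> fst d" for s
      using \<sigma>2[OF that(1)] that(2) d(1) unfolding has_velocity_def by blast
    have xb: "(snd d \<circ> \<sigma>1) x \<in> ball (snd d (\<sigma>1 x)) r" "(snd d \<circ> \<sigma>2) x \<in> ball (snd d (\<sigma>1 x)) r" using r(1) eq by auto
    have "((snd d \<circ> \<sigma>1) \<longlongrightarrow> (snd d \<circ> \<sigma>1) x) (nhds x)" "((snd d \<circ> \<sigma>2) \<longlongrightarrow> (snd d \<circ> \<sigma>2) x) (nhds x)"
      using has_vector_derivative_continuous[OF vel] has_vector_derivative_continuous[OF vel2] x d(2) d2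
      by (simp_all add: continuous_within tendsto_nhds_iff)
    note e12 = topological_tendstoD[OF this(1) open_ball xb(1)] topological_tendstoD[OF this(2) open_ball xb(2)]
    have "\<forall>\<^sub>F s in nhds x. s \<in> I1 \<inter> I2" by (rule eventually_nhds_in_open[OF open_Int[OF I1(1) I2(1)] x])
    with e12 chart_eventually[OF c1 d] chart_eventually[OF c2 d(1) d2]
    have "\<forall>\<^sub>F s in nhds x. s \<in> I1 \<inter> I2 \<and> \<sigma>1 s \<in> fst d \<and> \<sigma>2 s \<in> fst d \<and>
       snd d (\<sigma>1 s) \<in> ball (snd d (\<sigma>1 x)) r \<and> snd d (\<sigma>2 s) \<in> ball (snd d (\<sigma>1 x)) r"
      by eventually_elim simp
    then obtain e where e: "0 < e" "\<And>s. dist s x < e \<Longrightarrow> s \<in> I1 \<inter> I2 \<and> \<sigma>1 s \<in> fst d \<and> \<sigma>2 s \<in> fst d \<and>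
       snd d (\<sigma>1 s) \<in> ball (snd d (\<sigma>1 x)) r \<and> snd d (\<sigma>2 s) \<in> ball (snd d (\<sigma>1 x)) r"
      unfolding eventually_nhds_metric by blast
    define u where "u = (\<lambda>s. snd d (\<sigma>1 s) - snd d (\<sigma>2 s))"
    have "\<sigma>1 s = \<sigma>2 s" if s: "dist s x < e / 2" for s
    proof -
      have se: "s \<in> {x - e / 2..x + e / 2}" using s by (auto simp: dist_real_def abs_if split: if_splits)
      have ne: "dist y x < e" if "y \<in> {x - e / 2..x + e / 2}" for y
        using that e(1) by (auto simp: dist_real_def abs_if)
      have "u s = 0"
      proof (rule ode_unique_zero[OF _ se])
        show "x \<in> {x - e / 2..x + e / 2}" using e(1) by simp
        show "u x = 0" by (simp add: u_def eq)
        show "0 \<le> K" using r(3) by (rule lipschitz_on_nonneg)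
        fix y assume y: "y \<in> {x - e / 2..x + e / 2}"
        note ey = e(2)[OF ne[OF y]]
        have v1: "((\<lambda>s. snd d (\<sigma>1 s)) has_vector_derivative P (\<sigma>1 y) d) (at y)" using vel[of y] ey by (simp add: o_def)
        have v2: "((\<lambda>s. snd d (\<sigma>2 s)) has_vector_derivative P (\<sigma>2 y) d) (at y)" using vel2[of y] ey by (simp add: o_def)
        show "(u has_vector_derivative P (\<sigma>1 y) d - P (\<sigma>2 y) d) (at y)"
          unfolding u_def by (rule has_vector_derivative_diff[OF v1 v2])
        have "norm (P (chart_inv d (snd d (\<sigma>1 y))) d - P (chart_inv d (snd d (\<sigma>2 y))) d) \<le> K * norm (snd d (\<sigma>1 y) - snd d (\<sigma>2 y))"
          using ey by (intro lipschitz_on_normD[OF r(3)]) auto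
        then show "norm (P (\<sigma>1 y) d - P (\<sigma>2 y) d) \<le> K * norm (u y)" using ey d(1) by (simp add: u_def)
      qed
      then have "snd d (\<sigma>1 s) = snd d (\<sigma>2 s)" by (simp add: u_def)
      then show ?thesis using e(2)[OF ne[OF se]] chart_inv_chart[OF d(1)] by metis
    qed
    then show "\<forall>\<^sub>F s in nhds x. s \<in> I1 \<inter> I2 \<longrightarrow> \<sigma>1 s = \<sigma>2 s"
      unfolding eventually_nhds_metric using e(1) by (intro exI[of _ "e / 2"]) auto
  }
qed (use assms in auto)

text \<open>With \<open>z = e\<^sup>t y\<close>, the curve is \<open>s \<mapsto> gm z (e\<^sup>s\<^sup>-\<^sup>t)\<close>: a reparametrized geodesic through its position at time 1,
where the velocity is by definition the position vector.\<close>

lemma flow_curve: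
  assumes y: "y \<in> Y" and e: "\<And>s. s < e \<Longrightarrow> exp s *\<^sub>R y \<in> Y" and t: "t < e"
  shows "has_velocity A (\<lambda>s. gm (exp s *\<^sub>R y) 1) t (P (gm (exp t *\<^sub>R y) 1))"
proof -
  define z where "z = exp t *\<^sub>R y"
  have z: "z \<in> Y" unfolding z_def by (rule e[OF t])
  have d: "((\<lambda>s. exp (s - t)) has_real_derivative 1) (at t)" by (auto intro!: derivative_eq_intros)
  have v: "has_velocity A (gm z) (exp (t - t)) (Vy z 1)" using solution_velocity(3)[OF fam(1)[OF z] one_I[OF z]] by simp
  have h: "has_velocity A (\<lambda>s. gm z (exp (s - t))) t (tscale 1 (Vy z 1))" by (rule has_velocity_compose[OF v d])
  have "isCont (\<lambda>s. exp (s - t)) t" by (intro continuous_intros)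
  then have "((\<lambda>s. exp (s - t)) \<longlongrightarrow> 1) (nhds t)" by (simp add: isCont_def tendsto_nhds_iff)
  from topological_tendstoD[OF this solution_interval(1)[OF fam(1)[OF z]] one_I[OF z]]
  have "\<forall>\<^sub>F s in nhds t. exp (s - t) \<in> Iy z" .
  moreover have "\<forall>\<^sub>F s in nhds t. s < e" using eventually_nhds_in_open[of "{..<e}" t] t by simp
  ultimately have "\<forall>\<^sub>F s in nhds t. exp (s - t) \<in> Iy z \<and> s < e" by eventually_elim simp
  then obtain U where U: "open U" "t \<in> U" "\<forall>s\<in>U. exp (s - t) \<in> Iy z \<and> s < e" unfolding eventually_nhds by blast
  have "has_velocity A (\<lambda>s. gm (exp s *\<^sub>R y) 1) t (tscale 1 (Vy z 1))"
  proof (rule has_velocity_cong[OF h U(1,2)])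
    fix s assume s: "s \<in> U"
    have eq: "exp (s - t) *\<^sub>R z = exp s *\<^sub>R y" by (simp add: z_def exp_diff)
    have "gm (exp (s - t) *\<^sub>R z) 1 = gm z (exp (s - t))"
      by (rule gm_scale(1)[OF z]) (use U(3) s e in \<open>auto simp: eq\<close>)
    then show "gm z (exp (s - t)) = gm (exp s *\<^sub>R y) 1" by (simp add: eq)
  qed
  moreover have "tscale 1 (Vy z 1) = P (gm z 1)"
    using P_psi[OF gm_N[OF z]] psi_gm[OF z] by (simp add: tscale_def)
  ultimately show ?thesis by (simp add: z_def)
qed

text \<open>Backwards the dilation stays in \<open>Y\<close> for all times because \<open>Y\<close> is star-shaped, forwards for a short time
because \<open>Y\<close> is open.\<close>

lemma extend_Y: assumes y: "y \<in> Y" obtains e where "0 < e" "\<And>s. s < e \<Longrightarrow> exp s *\<^sub>R y \<in> Y"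
proof -
  have "isCont (\<lambda>s. exp s *\<^sub>R y) (0::real)" by (intro continuous_intros)
  then have "((\<lambda>s. exp s *\<^sub>R y) \<longlongrightarrow> y) (nhds (0::real))" by (simp add: isCont_def tendsto_nhds_iff)
  from topological_tendstoD[OF this Y_open y] obtain e where e: "0 < e" "\<And>s. dist s 0 < e \<Longrightarrow> exp s *\<^sub>R y \<in> Y"
    unfolding eventually_nhds_metric by blast
  have "exp s *\<^sub>R y \<in> Y" if "s < e" for s
  proof (cases "0 \<le> s")
    case True then show ?thesis using e(2)[of s] that by (simp add: dist_real_def)
  next
    case False then show ?thesis by (intro scale_Y[OF y]) auto
  qed
  then show ?thesis using that e(1) by blast
qed

text \<open>The flow of \<open>P\<close> is the dilation in the coordinates \<open>psi\<close>.\<close>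

lemma flow_reaches_iff:
  assumes q: "q \<in> N" and t: "0 < t"
  shows "flow_reaches A N P (- t) q q' \<longleftrightarrow> q' = gm (exp (- t) *\<^sub>R psi q) 1"
proof -
  define y where "y = psi q"
  have y: "y \<in> Y" unfolding y_def by (rule psi_Y[OF q])
  obtain e where e: "0 < e" "\<And>s. s < e \<Longrightarrow> exp s *\<^sub>R y \<in> Y" by (rule extend_Y[OF y]) blast
  define \<sigma> where "\<sigma> = (\<lambda>s. gm (exp s *\<^sub>R y) 1)"
  have \<sigma>0: "\<sigma> 0 = q" using gm_psi[OF q] by (simp add: \<sigma>_def y_def)
  have \<sigma>: "\<sigma> s \<in> N \<and> has_velocity A \<sigma> s (P (\<sigma> s))" if "s \<in> {..<e}" for s
    using gm_N[OF e(2)[of s]] flow_curve[OF y e(2), of e s] that unfolding \<sigma>_def by auto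
  have I: "open {..<e}" "is_interval {..<e}" "0 \<in> {..<e}" "- t \<in> {..<e}" using e(1) t by (auto simp: is_interval_1)
  have "flow_reaches A N P (- t) q (\<sigma> (- t))"
    unfolding flow_reaches_def using I \<sigma>0 \<sigma> by (intro exI[of _ "{..<e}"] exI[of _ \<sigma>]) auto
  moreover have "q' = \<sigma> (- t)" if "flow_reaches A N P (- t) q q'"
  proof -
    obtain J \<sigma>' where J: "open J" "is_interval J" "0 \<in> J" "- t \<in> J" "\<sigma>' 0 = q" "\<sigma>' (- t) = q'"
      "\<forall>\<tau>\<in>J. \<sigma>' \<tau> \<in> N \<and> has_velocity A \<sigma>' \<tau> (P (\<sigma>' \<tau>))"
      using \<open>flow_reaches A N P (- t) q q'\<close> unfolding flow_reaches_def by blast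
    have "\<sigma>' (- t) = \<sigma> (- t)"
      by (rule flow_unique[OF J(1-4) I _ \<sigma>]) (use J \<sigma>0 in auto)
    then show ?thesis using J(6) by simp
  qed
  ultimately show ?thesis unfolding \<sigma>_def y_def by blast
qed

lemma flow_map_eq: "q \<in> N \<Longrightarrow> 0 < t \<Longrightarrow> flow_map A N P (- t) q = gm (exp (- t) *\<^sub>R psi q) 1"
  unfolding flow_map_def by (rule the_equality) (use flow_reaches_iff in auto)

lemma scaled_lipschitz:
  assumes S: "S \<subseteq> N" and a: "\<And>q. q \<in> S \<Longrightarrow> a *\<^sub>R psi q \<in> Y" and F: "\<And>q. q \<in> S \<Longrightarrow> F q = gm (a *\<^sub>R psi q) 1"
  shows "loc_lipschitz_map A A S F"
  unfolding loc_lipschitz_map_def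
proof (intro conjI ballI)
  have "continuous_on S (\<lambda>q. gm (a *\<^sub>R psi q) 1)"
    by (rule continuous_on_compose2[OF gm_cont]) (use a in \<open>auto intro!: continuous_intros continuous_on_subset[OF psi_cont S]\<close>)
  then show "continuous_on S F" using F by (simp cong: continuous_on_cong)
  fix c d assume c: "c \<in> A" and d: "d \<in> A"
  let ?S = "snd c ` {x \<in> S \<inter> fst c. F x \<in> fst d}"
  have 1: "LL (\<lambda>x. psi (chart_inv c x)) ?S"
    by (rule LL_subset[OF psi_LL[OF c]]) (use S in auto)
  have 2: "LL (\<lambda>x. a *\<^sub>R psi (chart_inv c x)) ?S"
    by (rule LL_linear_compose[OF bounded_linear_scaleR_right 1])
  have 3: "LL (\<lambda>x. fst (Z d 1 (a *\<^sub>R psi (chart_inv c x)))) ?S"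
    by (rule LL_fst, rule LL_compose[OF 2 Z_LL[OF d]]) (use a F c in auto)
  show "LL (snd d \<circ> F \<circ> chart_inv c) ?S"
    by (rule LL_cong[OF 3]) (use F c in \<open>auto simp: coords_def\<close>)
qed

text \<open>The dilation by \<open>e\<^sup>t\<close> inverts the dilation by \<open>e\<^sup>-\<^sup>t\<close>, and both are conjugated by the Lipeomorphism \<open>exp\<^sub>p\<close>.\<close>

lemma flow_lipeomorphism:
  assumes S: "S \<subseteq> N" and t: "0 < t"
  shows "lipeomorphism A A S (flow_map A N P (- t) ` S) (flow_map A N P (- t))"
proof -
  define \<Phi> where "\<Phi> = flow_map A N P (- t)"
  define \<Psi> where "\<Psi> = (\<lambda>q. gm (exp t *\<^sub>R psi q) 1)"
  have F: "\<Phi> q = gm (exp (- t) *\<^sub>R psi q) 1" if "q \<in> S" for q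
    unfolding \<Phi>_def using S that by (intro flow_map_eq t) auto
  have a: "exp (- t) *\<^sub>R psi q \<in> Y" if "q \<in> S" for q
    using S that t by (intro scale_Y psi_Y) auto
  have ps: "psi (\<Phi> q) = exp (- t) *\<^sub>R psi q" if "q \<in> S" for q using F[OF that] psi_gm[OF a[OF that]] by simp
  have b: "exp t *\<^sub>R psi (\<Phi> q) = psi q" if "q \<in> S" for q
    by (simp add: ps[OF that] exp_minus)
  have \<Phi>N: "\<Phi> ` S \<subseteq> N" using F gm_N[OF a] by auto
  have l1: "loc_lipschitz_map A A S \<Phi>" by (rule scaled_lipschitz[OF S a F])
  have l2: "loc_lipschitz_map A A (\<Phi> ` S) \<Psi>"
    by (rule scaled_lipschitz[OF \<Phi>N, where a="exp t"]) (use b S psi_Y in \<open>auto simp: \<Psi>_def\<close>)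
  have inv: "\<Psi> (\<Phi> q) = q" if "q \<in> S" for q
    using b[OF that] gm_psi S that by (auto simp: \<Psi>_def)
  have "homeomorphism S (\<Phi> ` S) \<Phi> \<Psi>"
    by (rule homeomorphismI) (use l1 l2 inv in \<open>auto simp: loc_lipschitz_map_def\<close>)
  then show ?thesis unfolding lipeomorphism_def \<Phi>_def[symmetric] using l1 l2 by blast
qed

lemma flow_level:
  assumes q: "q \<in> level_set N D s" and t: "0 < t"
  shows "flow_map A N P (- t) q \<in> level_set N D (s * exp (- 2 * t))"
proof -
  have qN: "q \<in> N" and Dq: "D q = s" using q by (auto simp: level_set_def)
  have y: "exp (- t) *\<^sub>R psi q \<in> Y" using t by (intro scale_Y psi_Y[OF qN]) auto
  have "D (gm (exp (- t) *\<^sub>R psi q) 1) = 2 * ((exp (- t))\<^sup>2 * Lam (psi q))"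
    using D_psi[OF gm_N[OF y]] psi_gm[OF y] by (simp add: Lam_scale)
  also have "\<dots> = s * exp (- 2 * t)"
    using D_psi[OF qN] Dq by (simp add: power2_eq_square exp_add[symmetric])
  finally show ?thesis using gm_N[OF y] by (simp add: flow_map_eq[OF qN t] level_set_def)
qed

section \<open>The Gauss lemma\<close>

lemma Lam_der: assumes y: "y \<noteq> 0"
  shows "((\<lambda>y. Lam y) has_derivative (\<lambda>w. momentum c0 (snd c0 p, y) \<bullet> w)) (at y)"
proof -
  interpret coord_metric "Xc c0" "gcoord A g c0" by (rule coord_metric_chart[OF c0(1)])
  have L: "Lam y = lag (snd c0 p, y)" for y
    using lagrangian_coord[OF c0 tvec_of_in[OF c0], of y] T_self by simp
  have w: "(snd c0 p, y) \<in> W" using c0 y by auto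
  have "((\<lambda>y. (snd c0 p, y)) has_derivative (\<lambda>w. (0, w))) (at y)" by (auto intro!: derivative_eq_intros)
  from has_derivative_compose[OF this lag_der[OF w]]
  have "((\<lambda>y. lag (snd c0 p, y)) has_derivative (\<lambda>h. dlag (snd c0 p, y) (0, h))) (at y)" .
  moreover have "dlag (snd c0 p, y) (0, h) = momentum c0 (snd c0 p, y) \<bullet> h" for h
  proof -
    have "DG (snd c0 p, y) (0, 0) = 0"
      using linear_0[OF bounded_linear.linear[OF DG_bl[OF w]]] by (simp add: zero_prod_def)
    then show ?thesis by (simp add: dlag_def momentum_def mom_def inner_commute)
  qed
  ultimately show ?thesis unfolding L by simp
qed

text \<open>Differentiating \<open>\<gamma>\<^sub>v(s) = exp\<^sub>p(s v)\<close> at \<open>s = 1\<close> gives \<open>(d exp\<^sub>p)\<^sub>v v = P\<close>, and differentiating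
\<open>D\<^sup>2 \<circ> exp\<^sub>p = 2 L\<close> in the direction \<open>w\<close> gives \<open>2 g\<^sub>P(P, (d exp\<^sub>p)\<^sub>v w) = 2 g\<^sub>v(v, w)\<close>.\<close>

lemma gauss:
  assumes v: "v \<in> Np" "v \<noteq> tzero" and \<Lambda>: "has_differential_from_tangent A p E v \<Lambda>"
  shows "gauss_identity A g p v \<Lambda>"
proof -
  define y where "y = v c0"
  have vT: "v \<in> tangent_space A p" by (rule Np_tangent[OF v(1)])
  have yY: "y \<in> Y" unfolding y_def by (rule comp_Y[OF v(1)])
  have Ty: "T y = v" unfolding y_def by (rule T_comp[OF v(1)])
  have y0: "y \<noteq> 0" unfolding y_def using v(2) tvec_eq_tzero_iff[OF vT c0] by blast
  define q where "q = E v"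
  have qN: "q \<in> N" unfolding q_def by (rule E_N[OF v(1)])
  have qg: "gm y 1 = q" using E_gm[OF yY] Ty by (simp add: q_def)
  have psiq: "psi q = y" using psi_gm[OF yY] qg by simp
  have Pq: "P q = Vy y 1" using P_psi[OF qN] psiq by simp
  obtain d where d: "d \<in> A" "q \<in> fst d" by (rule chart_cover)
  define \<phi> where "\<phi> = (\<lambda>y. snd d (E (T y)))"
  have \<Lambda>T: "\<Lambda> w \<in> tangent_space A q" if "w \<in> tangent_space A p" for w
    using \<Lambda> that unfolding has_differential_from_tangent_def q_def by blast
  have d\<phi>: "(\<phi> has_derivative (\<lambda>w. \<Lambda> (T w) d)) (at y)"
    using \<Lambda> c0 d unfolding has_differential_from_tangent_def q_def \<phi>_def y_def by blast
  have yd: "y \<in> {y \<in> Y. gm y 1 \<in> fst d}" using yY qg d by simp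
  note op = gm_dom_open[OF d(1)]
  have \<phi>gm: "\<phi> x = snd d (gm x 1)" if "x \<in> Y" for x using E_gm[OF that] by (simp add: \<phi>_def)
  have \<Lambda>v: "\<Lambda> v = P q"
  proof (rule tangent_eqI[OF \<Lambda>T[OF vT] P_tangent[OF qN] d])
    have "((\<lambda>s. s *\<^sub>R y) has_derivative (\<lambda>h. h *\<^sub>R y)) (at (1::real))" by (auto intro!: derivative_eq_intros)
    moreover have "(\<phi> has_derivative (\<lambda>w. \<Lambda> (T w) d)) (at (1 *\<^sub>R y))" using d\<phi> by simp
    ultimately have 1: "((\<lambda>s. \<phi> (s *\<^sub>R y)) has_derivative (\<lambda>h. \<Lambda> (T (h *\<^sub>R y)) d)) (at 1)"
      by (rule has_derivative_compose)
    have "((snd d \<circ> gm y) has_vector_derivative Vy y 1 d) (at 1)"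
      using solution_velocity(3)[OF fam(1)[OF yY] one_I[OF yY]] d qg unfolding has_velocity_def by simp
    then have 2: "((\<lambda>s. snd d (gm y s)) has_derivative (\<lambda>h. h *\<^sub>R Vy y 1 d)) (at 1)"
      by (simp add: has_vector_derivative_def o_def)
    have "isCont (\<lambda>s. s *\<^sub>R y) (1::real)" by (intro continuous_intros)
    then have "((\<lambda>s. s *\<^sub>R y) \<longlongrightarrow> y) (nhds (1::real))" by (simp add: isCont_def tendsto_nhds_iff)
    then have e1: "\<forall>\<^sub>F s in nhds (1::real). s *\<^sub>R y \<in> Y" by (rule topological_tendstoD[OF _ Y_open yY])
    have e2: "\<forall>\<^sub>F s in nhds (1::real). s \<in> Iy y" by (rule eventually_nhds_in_open[OF solution_interval(1)[OF fam(1)[OF yY]] one_I[OF yY]])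
    have e3: "\<forall>\<^sub>F s in nhds (1::real). 0 < s" using eventually_nhds_in_open[of "{0<..}" "1::real"] by simp
    from e1 e2 e3 have "\<forall>\<^sub>F s in nhds (1::real). s *\<^sub>R y \<in> Y \<and> s \<in> Iy y \<and> 0 < s" by eventually_elim simp
    then obtain U where U: "open U" "1 \<in> U" "\<forall>s\<in>U. s *\<^sub>R y \<in> Y \<and> s \<in> Iy y \<and> 0 < s" unfolding eventually_nhds by blast
    have "((\<lambda>s. \<phi> (s *\<^sub>R y)) has_derivative (\<lambda>h. h *\<^sub>R Vy y 1 d)) (at 1)"
    proof (rule has_derivative_transform_within_open[OF 2 U(1,2)])
      fix s assume "s \<in> U"
      then have s: "s *\<^sub>R y \<in> Y" "s \<in> Iy y" "0 < s" using U(3) by auto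
      show "snd d (gm y s) = \<phi> (s *\<^sub>R y)" using gm_scale(1)[OF yY s(3,2,1)] \<phi>gm[OF s(1)] by simp
    qed
    from has_derivative_unique[OF 1 this] have "\<Lambda> (T (1 *\<^sub>R y)) d = 1 *\<^sub>R Vy y 1 d" by meson
    then show "\<Lambda> v d = P q d" by (simp add: Ty Pq)
  qed
  have Pnz: "P q \<noteq> tzero"
    unfolding Pq by (rule V_nonzero[OF yY y0]) simp
  have main: "gform g q (P q) (P q) (\<Lambda> w) = gform g p v v w" if w: "w \<in> tangent_space A p" for w
  proof -
    have \<phi>y: "\<phi> y = snd d q" using \<phi>gm[OF yY] qg by simp
    have "((D \<circ> chart_inv d) has_derivative (\<lambda>w. 2 * (momentum d (snd d q, P q d) \<bullet> w))) (at (\<phi> y))"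
      using D_der[OF qN d] by (simp add: \<phi>y)
    from has_derivative_compose[OF d\<phi> this]
    have 1: "((\<lambda>x. (D \<circ> chart_inv d) (\<phi> x)) has_derivative (\<lambda>h. 2 * (momentum d (snd d q, P q d) \<bullet> \<Lambda> (T h) d))) (at y)" .
    have "((\<lambda>x. 2 * Lam x) has_derivative (\<lambda>h. 2 * (momentum c0 (snd c0 p, y) \<bullet> h))) (at y)"
      by (rule has_derivative_mult_right[OF Lam_der[OF y0]])
    then have 2: "((\<lambda>x. (D \<circ> chart_inv d) (\<phi> x)) has_derivative (\<lambda>h. 2 * (momentum c0 (snd c0 p, y) \<bullet> h))) (at y)"
    proof (rule has_derivative_transform_within_open[OF _ op yd])
      fix x assume x: "x \<in> {y \<in> Y. gm y 1 \<in> fst d}"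
      then have "(D \<circ> chart_inv d) (\<phi> x) = D (gm x 1)" using \<phi>gm d by simp
      also have "\<dots> = 2 * Lam x" using x D_psi[OF gm_N] psi_gm by simp
      finally show "2 * Lam x = (D \<circ> chart_inv d) (\<phi> x)" ..
    qed
    from has_derivative_unique[OF 1 2]
    have "2 * (momentum d (snd d q, P q d) \<bullet> \<Lambda> (T (w c0)) d) = 2 * (momentum c0 (snd c0 p, y) \<bullet> w c0)" by meson
    then have "momentum d (snd d q, P q d) \<bullet> \<Lambda> w d = momentum c0 (snd c0 p, v c0) \<bullet> w c0"
      by (simp add: tvec_of_chart[OF w c0] y_def)
    then have "gform g q (P q) (P q) (tvec_of A d q (\<Lambda> w d)) = gform g p v v (tvec_of A c0 p (w c0))"
      unfolding gform_coord[OF d P_tangent[OF qN]] gform_coord[OF c0 vT] .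
    then show ?thesis by (simp only: tvec_of_chart[OF \<Lambda>T[OF w] d] tvec_of_chart[OF w c0])
  qed
  then show ?thesis
    unfolding gauss_identity_def q_def[symmetric] \<Lambda>v using Pnz v(2) by (simp add: gform_def)
qed

text \<open>Differentiability with respect to one pair of charts gives it for all pairs, and the differential for that
pair determines the values in the tangent space at the image point.\<close>

lemma differential_exists:
  assumes v: "v \<in> Np" and d: "d \<in> A" "E v \<in> fst d"
    and diff: "(\<lambda>y. snd d (gm y 1)) differentiable (at (v c0))"
  shows "\<exists>\<Lambda>. has_differential_from_tangent A p E v \<Lambda>"
proof -
  define q where "q = E v"
  define y where "y = v c0"
  have yY: "y \<in> Y" unfolding y_def by (rule comp_Y[OF v])
  have qg: "gm y 1 = q" using E_gm[OF yY] T_comp[OF v] by (simp add: q_def y_def)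
  have qd: "q \<in> fst d" using d by (simp add: q_def)
  obtain L where L: "((\<lambda>y. snd d (gm y 1)) has_derivative L) (at y)" using diff unfolding y_def differentiable_def by blast
  define \<Lambda> where "\<Lambda> = (\<lambda>w :: ('m, 'n) tvec. tvec_of A d q (L (w c0)))"
  have "has_differential_from_tangent A p E v \<Lambda>"
    unfolding has_differential_from_tangent_def
  proof (intro conjI ballI impI)
    have "(E \<longlongrightarrow> E v) (at v within Np)" using homeomorphism_cont1[OF homeo] v by (simp add: continuous_on_def)
    moreover have "at v within Np = at v within tangent_space A p"
    proof -
      obtain U where U: "open U" "Np = tangent_space A p \<inter> U" using Np_open by (auto simp: openin_open)
      show ?thesis using v U by (intro at_within_nhd[of v U]) auto
    qed
    ultimately show "(E \<longlongrightarrow> E v) (at v within tangent_space A p)" by simp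
    show "\<Lambda> w \<in> tangent_space A (E v)" for w unfolding \<Lambda>_def q_def[symmetric] by (rule tvec_of_in[OF d(1) qd])
    fix c d' assume c: "c \<in> A" and d': "d' \<in> A" and pc: "p \<in> fst c" and qd': "E v \<in> fst d'"
    have qd'': "q \<in> fst d'" using qd' by (simp add: q_def)
    define B where "B = Dt c c0 (snd c p)"
    have B: "bounded_linear B" unfolding B_def by (rule Dt_bl[OF c c0(1) overlapI[OF pc c0(2)]])
    have Tc: "tvec_of A c p x = T (B x)" for x unfolding B_def by (rule tvec_of_change[OF c pc c0, symmetric])
    have Bv: "B (v c) = y" unfolding B_def y_def using tangentD[OF Np_tangent[OF v] c c0(1) pc c0(2)] by simp
    have 1: "(B has_derivative B) (at (v c))" by (rule bounded_linear_imp_has_derivative[OF B])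
    have 2: "((\<lambda>y. snd d (gm y 1)) has_derivative L) (at (B (v c)))" using L by (simp add: Bv)
    have 3: "((\<lambda>x. snd d (gm (B x) 1)) has_derivative (\<lambda>x. L (B x))) (at (v c))"
      by (rule has_derivative_compose[OF 1 2])
    have 4: "(tmap d d' has_derivative Dt d d' (snd d q)) (at (snd d (gm (B (v c)) 1)))"
      using trans_der[OF d(1) d' overlapI[OF qd qd'']] by (simp add: Bv qg)
    have 5: "((\<lambda>x. tmap d d' (snd d (gm (B x) 1))) has_derivative (\<lambda>x. Dt d d' (snd d q) (L (B x)))) (at (v c))"
      by (rule has_derivative_compose[OF 3 4])
    define U where "U = B -` {y \<in> Y. gm y 1 \<in> fst d}"
    have U: "open U" unfolding U_def by (rule open_vimage[OF gm_dom_open[OF d(1)] linear_continuous_on[OF B]])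
    have vU: "v c \<in> U" using yY qg qd by (simp add: U_def Bv)
    have "((\<lambda>y. snd d' (E (tvec_of A c p y))) has_derivative (\<lambda>x. Dt d d' (snd d q) (L (B x)))) (at (v c))"
    proof (rule has_derivative_transform_within_open[OF 5 U vU])
      fix x assume "x \<in> U"
      then have x: "B x \<in> Y" "gm (B x) 1 \<in> fst d" by (auto simp: U_def)
      show "tmap d d' (snd d (gm (B x) 1)) = snd d' (E (tvec_of A c p x))"
        using x d by (simp add: Tc E_gm tmap_apply)
    qed
    moreover have "\<Lambda> (tvec_of A c p x) d' = Dt d d' (snd d q) (L (B x))" for x
      unfolding \<Lambda>_def Tc T_self using d' qd'' by (simp add: tvec_of_apply)
    ultimately show "((\<lambda>y. snd d' (E (tvec_of A c p y))) has_derivative (\<lambda>y. \<Lambda> (tvec_of A c p y) d')) (at (v c))" by simp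
  qed
  then show ?thesis by blast
qed

text \<open>Rademacher's theorem is applied on the open sets of vectors that are mapped into one chart; negligible sets may be
recognized locally.\<close>

lemma ae_gauss:
  "negligible ((\<lambda>v. v c0) ` {v \<in> Np - {tzero}. \<not> (\<exists>\<Lambda>. has_differential_from_tangent A p E v \<Lambda> \<and> gauss_identity A g p v \<Lambda>)})"
    (is "negligible ?S")
proof (subst locally_negligible_alt, intro ballI)
  fix y assume "y \<in> ?S"
  then have yY: "y \<in> Y" using comp_Y by auto
  obtain d where d: "d \<in> A" "gm y 1 \<in> fst d" by (rule chart_cover)
  define U where "U = {y \<in> Y. gm y 1 \<in> fst d}"
  have U: "open U" unfolding U_def by (rule gm_dom_open[OF d(1)])
  have "LL (\<lambda>y. fst (Z d 1 y)) U" unfolding U_def by (rule LL_fst[OF Z_LL[OF d(1)]])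
  then have "LL (\<lambda>y. snd d (gm y 1)) U" by (simp add: coords_def)
  then have neg: "negligible {y \<in> U. \<not> (\<lambda>y. snd d (gm y 1)) differentiable (at y)}"
    unfolding locally_lipschitz_on_def by (intro rademacher_local[OF U]) blast
  show "\<exists>V. openin (top_of_set ?S) V \<and> y \<in> V \<and> negligible V"
  proof (intro exI conjI)
    show "openin (top_of_set ?S) (?S \<inter> U)" using U by (auto simp: openin_open)
    show "y \<in> ?S \<inter> U" using \<open>y \<in> ?S\<close> yY d by (auto simp: U_def)
    have "?S \<inter> U \<subseteq> {y \<in> U. \<not> (\<lambda>y. snd d (gm y 1)) differentiable (at y)}"
    proof
      fix x assume x: "x \<in> ?S \<inter> U"
      then obtain v where v: "v \<in> Np" "v \<noteq> tzero" "x = v c0"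
        "\<not> (\<exists>\<Lambda>. has_differential_from_tangent A p E v \<Lambda> \<and> gauss_identity A g p v \<Lambda>)" by blast
      have xU: "x \<in> U" using x by blast
      have "E v = gm x 1" using E_gm[OF comp_Y[OF v(1)]] T_comp[OF v(1)] v(3) by simp
      then have Ed: "E v \<in> fst d" using xU by (simp add: U_def)
      have "\<not> (\<lambda>y. snd d (gm y 1)) differentiable (at x)"
        using differential_exists[OF v(1) d(1) Ed] gauss[OF v(1,2)] v(3,4) by blast
      then show "x \<in> {y \<in> U. \<not> (\<lambda>y. snd d (gm y 1)) differentiable (at y)}" using xU by blast
    qed
    then show "negligible (?S \<inter> U)" using neg negligible_subset by blast
  qed
qed

lemma C2_gauss:
  assumes C2: "C2_metric A g" and v: "v \<in> Np" "v \<noteq> tzero"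
  shows "\<exists>\<Lambda>. has_differential_from_tangent A p E v \<Lambda> \<and> gauss_identity A g p v \<Lambda>"
proof -
  define y where "y = v c0"
  have yY: "y \<in> Y" unfolding y_def by (rule comp_Y[OF v(1)])
  have y0: "y \<noteq> 0" unfolding y_def using v(2) tvec_eq_tzero_iff[OF Np_tangent[OF v(1)] c0] by blast
  have Eg: "E v = gm y 1" using E_gm[OF yY] T_comp[OF v(1)] by (simp add: y_def)
  obtain d where d: "d \<in> A" "gm y 1 \<in> fst d" by (rule chart_cover)
  have "(\<lambda>y. Z d 1 y) differentiable (at y)" by (rule C2_differentiable[OF C2 yY y0 d])
  then obtain L where L: "((\<lambda>y. Z d 1 y) has_derivative L) (at y)" by (auto simp: differentiable_def)
  have "((\<lambda>y. fst (Z d 1 y)) has_derivative (\<lambda>h. fst (L h))) (at y)"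
    by (rule bounded_linear.has_derivative[OF bounded_linear_fst L])
  then have "(\<lambda>y. snd d (gm y 1)) differentiable (at (v c0))"
    unfolding y_def[symmetric] differentiable_def by (auto simp: coords_def)
  then show ?thesis using differential_exists[OF v(1) d(1)] d(2) Eg gauss[OF v] by auto
qed

end

theorem theorem5:
  fixes A :: "('m::t2_space, 'n::finite) chart set"
    and g :: "('m, 'n) metric"
    and p :: 'm and N :: "'m set" and Np :: "('m, 'n) tvec set"
  assumes "pseudo_finsler_manifold A g"
    and "normal_nbhd A g p N Np"
  shows
    "(\<forall>q\<in>N. let v = exp_inv A g p Np q in D2 A g p Np q = gform g p v v v) \<and>
     C11_scalar_on A N (D2 A g p Np) \<and>
     (\<forall>q\<in>N. let P = position_vector A g p Np q in
        has_differential_scalar A (D2 A g p Np) q (\<lambda>w. 2 * gform g q P P w)) \<and>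
     (\<forall>v\<in>tangent_space A p - {tzero}. \<forall>t>0.
        (\<forall>\<tau>\<in>{0..t}. geodesic_defined A g p v \<tau> \<and> geodesic A g p v \<tau> \<in> N) \<longrightarrow>
        (let q = geodesic A g p v t in
         \<forall>w. tangent_to_at A (level_set N (D2 A g p Np) (D2 A g p Np q)) q w \<longrightarrow>
             orthogonal_to g q (geodesic_velocity A g p v t) w)) \<and>
     (\<forall>t>0. \<forall>s>0.
        let X = position_vector A g p Np;
            S = level_set N (D2 A g p Np) s;
            \<Phi> = flow_map A N X (- t)
        in (\<forall>q\<in>S. \<exists>!q'. flow_reaches A N X (- t) q q') \<and>
           \<Phi> ` S \<subseteq> level_set N (D2 A g p Np) (s * exp (- 2 * t)) \<and>
           lipeomorphism A A S (\<Phi> ` S) \<Phi>) \<and>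
     (\<forall>v\<in>Np - {tzero}. \<forall>\<Lambda>.
        has_differential_from_tangent A p (exp_map A g p) v \<Lambda> \<longrightarrow> gauss_identity A g p v \<Lambda>) \<and>
     (\<forall>c\<in>A. p \<in> fst c \<longrightarrow>
        negligible ((\<lambda>v. v c) ` {v \<in> Np - {tzero}.
          \<not> (\<exists>\<Lambda>. has_differential_from_tangent A p (exp_map A g p) v \<Lambda> \<and>
                 gauss_identity A g p v \<Lambda>)})) \<and>
     (C2_metric A g \<longrightarrow>
        (\<forall>v\<in>Np - {tzero}.
          \<exists>\<Lambda>. has_differential_from_tangent A p (exp_map A g p) v \<Lambda> \<and>
              gauss_identity A g p v \<Lambda>))"
proof -
  interpret finsler A g
    using assms(1) unfolding pseudo_finsler_manifold_def C21_manifold_def by unfold_locales auto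
  have normal: "normal A g p N Np c" if "c \<in> A" "p \<in> fst c" for c
    using assms(2) that by unfold_locales auto
  obtain c where c: "c \<in> A" "p \<in> fst c" by (rule chart_cover)
  interpret normal A g p N Np c by (rule normal[OF c])
  have ortho: "\<forall>v\<in>tangent_space A p - {tzero}. \<forall>t>0.
        (\<forall>\<tau>\<in>{0..t}. geodesic_defined A g p v \<tau> \<and> geodesic A g p v \<tau> \<in> N) \<longrightarrow>
        (let q = geodesic A g p v t in
         \<forall>w. tangent_to_at A (level_set N D (D q)) q w \<longrightarrow> orthogonal_to g q (geodesic_velocity A g p v t) w)"
    using orthogonal by (auto simp: Let_def)
  have flow: "\<forall>t>0. \<forall>s>0. let X = P; S = level_set N D s; \<Phi> = flow_map A N X (- t)
        in (\<forall>q\<in>S. \<exists>!q'. flow_reaches A N X (- t) q q') \<and>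
           \<Phi> ` S \<subseteq> level_set N D (s * exp (- 2 * t)) \<and> lipeomorphism A A S (\<Phi> ` S) \<Phi>"
    unfolding Let_def
  proof (intro allI impI conjI ballI)
    fix t s :: real assume t: "0 < t"
    have S: "level_set N D s \<subseteq> N" by (auto simp: level_set_def)
    show "\<exists>!q'. flow_reaches A N P (- t) q q'" if "q \<in> level_set N D s" for q
      using flow_reaches_iff[OF subsetD[OF S that] t] by simp
    show "flow_map A N P (- t) ` level_set N D s \<subseteq> level_set N D (s * exp (- 2 * t))"
      using flow_level[OF _ t] by blast
    show "lipeomorphism A A (level_set N D s) (flow_map A N P (- t) ` level_set N D s) (flow_map A N P (- t))"
      by (rule flow_lipeomorphism[OF S t])
  qed
  show ?thesis
    using C11 differential ortho flow gauss C2_gauss normal.ae_gauss[OF normal]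
    by (intro conjI) (auto simp: Let_def D2_def lagrangian_def gform_def)
qed

end
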